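(* Let $\mathcal{Q}=(\Delta,\sigma,\xi)$ be a Q-datum for $\mathfrak{g}$. (1) The map $\phi_{\mathcal{Q}}:\widehat\Delta^\sigma_0\to\widehat{\mathsf{R}}^+$ is a bijection. (2) We have $\phi_{\mathcal{Q}}^{-1}(\mathsf{R}^+\times\{0\})=(\Gamma_{\mathcal{Q}})_0$, and $\phi_{\mathcal{Q}}(\imath,p)=(\phi_{\mathcal{Q},0}(\imath,p),0)$ for each $(\imath,p)\in(\Gamma_{\mathcal{Q}})_0$, where $\phi_{\mathcal{Q},0}:(\Gamma_{\mathcal{Q}})_0\to\mathsf{R}^+$ is the underlying bijection of the isomorphism $\Gamma_{\mathcal{Q}}\cong\Upsilon_{[\mathcal{Q}]}$. In particular, $\phi_{\mathcal{Q},0}(\imath,p)=\tau_{\mathcal{Q}}^{(\xi_\imath-p)/2}(\gamma^{\mathcal{Q}}_\imath)$ for each $(\imath,p)\in(\Gamma_{\mathcal{Q}})_0$.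
   Context: Basic notation. Let $\mathsf{g}$ be a finite-dimensional complex simple Lie algebra of type ADE with Dynkin diagram $\Delta$ (vertex set $\Delta_0$; $\imath\sim\jmath$ means adjacent). $\mathsf{P}=\bigoplus_{\imath\in\Delta_0}\mathbb{Z}\varpi_\imath$ is the weight lattice, $\alpha_\imath$ the simple roots, $(\cdot,\cdot)$ the symmetric form on $\mathsf{P}$ with $(\varpi_\imath,\alpha_\jmath)=\delta_{\imath\jmath}$, $\mathsf{W}\subset\mathrm{Aut}(\mathsf{P})$ the Weyl group generated by $s_\imath(\lambda)=\lambda-(\lambda,\alpha_\imath)\alpha_\imath$, $\mathsf{R}=\mathsf{R}^+\sqcup\mathsf{R}^-$ the set of roots (positive, negative), $w_0$ the longest element, $N=\ell(w_0)=|\mathsf{R}^+|$, and $\imath\mapsto\imath^*$ the involution of $\Delta_0$ with $w_0(\alpha_\imath)=-\alpha_{\imath^*}$. Let $\sigma$ be an automorphism of $\Delta$ such that there is no $\imath$ with $\imath\sim\sigma(\imath)$, and let $r\in\{1,2,3\}$ be its order; $\sigma$ acts on $\mathsf{P}$ by $\sigma(\varpi_\imath)=\varpi_{\sigma(\imath)}$. Let $I$ be the set of $\sigma$-orbits in $\Delta_0$, $\imath\mapsto\bar\imath$ the quotient map, $d_i=|i|\in\{1,r\}$ for $i\in I$. Write $i\sim j$ in $I$ if some representatives are adjacent; put $c_{ii}=2$, $c_{ij}=-\lceil d_j/d_i\rceil$ if $i\sim j$, $c_{ij}=0$ otherwise. Then $(c_{ij})$ is the Cartan matrix of a complex simple Lie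 algebra $\mathfrak{g}$; every such $\mathfrak{g}$ arises so: $\sigma=\mathrm{id}$ and $\mathfrak{g}=\mathsf{g}$ if simply-laced, otherwise $(\mathsf{g},r,\mathfrak{g})=(A_{2n-1},2,B_n),(D_{n+1},2,C_n),(E_6,2,F_4),(D_4,3,G_2)$. The pair $(\Delta,\sigma)$ is fixed and $h^\vee$ is the dual Coxeter number of $\mathfrak{g}$. Q-data. A height function on $(\Delta,\sigma)$ is a function $\xi:\Delta_0\to\mathbb{Z}$, $\imath\mapsto\xi_\imath$, such that (a) $|\xi_\imath-\xi_\jmath|=d_{\bar\imath}$ whenever $\imath\sim\jmath$ and $d_{\bar\imath}=d_{\bar\jmath}$; (b) for $i,j\in I$ with $i\sim j$ and $d_i<d_j$ (so $d_i=1$, $d_j=r$, $i=\{\imath\}$), there is a unique $j^\circ\in j$ with $|\xi_\imath-\xi_{j^\circ}|=1$ and $\xi_{\sigma^l(j^\circ)}=\xi_{j^\circ}-2l$ for $0\le l<r$. A Q-datum for $\mathfrak{g}$ is a triple $\mathcal{Q}=(\Delta,\sigma,\xi)$ with $\xi$ a height function. Fix once and for all a $\sigma$-parity function: integers $\epsilon_\imath$, $0\le\epsilon_\imath<2d_{\bar\imath}$, with $\epsilon_{\imath}\equiv\epsilon_{\imath'}\pmod 2$ if $\bar\imath=\bar\imath'$; $\epsilon_{\sigma^l(\imath)}\equiv\epsilon_\imath-2l\pmod{2d_{\bar\imath}}$ for $l\in\mathbb{Z}$; and $\epsilon_\imath\equiv\epsilon_\jmath+\min(d_{\bar\imath},d_{\bar\jmath})\pmod{2\min(d_{\bar\imath},d_{\bar\jmath})}$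 if $\imath\sim\jmath$. All height functions are required to satisfy in addition (c) $\xi_\imath-\epsilon_\imath\in2d_{\bar\imath}\mathbb{Z}$ for all $\imath$ (achievable by adding a constant). A vertex $\imath$ is a source of $\mathcal{Q}$ if $\xi_\imath>\xi_\jmath$ for all $\jmath\sim\imath$; then $s_\imath\mathcal{Q}=(\Delta,\sigma,s_\imath\xi)$ with $(s_\imath\xi)_\jmath=\xi_\jmath-2d_{\bar\jmath}\delta_{\imath\jmath}$ is again a Q-datum. A sequence $(\imath_1,\dots,\imath_l)$ is adapted to $\mathcal{Q}$ if $\imath_k$ is a source of $s_{\imath_{k-1}}\cdots s_{\imath_1}\mathcal{Q}$ for all $k$. Repetition quiver. $\widehat\Delta^\sigma$ has vertex set $\widehat\Delta^\sigma_0=\{(\imath,p)\in\Delta_0\times\mathbb{Z}\mid p-\epsilon_\imath\in2d_{\bar\imath}\mathbb{Z}\}$ and an arrow $(\imath,p)\to(\jmath,s)$ whenever $\imath\sim\jmath$ and $s-p=\min(d_{\bar\imath},d_{\bar\jmath})$; $\pi(\imath,p)=\imath$. For a finite $X\subset\widehat\Delta^\sigma_0$, a compatible reading is a total ordering $(x_1,\dots,x_l)$ of $X$ with $k<k'$ whenever there is an arrow $x_{k'}\to x_k$; put $w[X]=s_{\pi(x_1)}\cdots s_{\pi(x_l)}\in\mathsf{W}$ (independent of the reading). The twisted AR quiver $\Gamma_{\mathcal{Q}}$ is the full subquiver of $\widehat\Delta^\sigma$ with vertex set $(\Gamma_{\mathcal{Q}})_0=\{(\imath,\xi_\imath-2d_{\bar\imath}k)\mid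 k\in\mathbb{Z},\ 0\le2d_{\bar\imath}k<rh^\vee+\xi_\imath-\xi_{\imath^*}\}$. Generalized twisted Coxeter element. For $i\in I$ let $i^\circ\in i$ be the unique element with $\xi_{i^\circ}=\max\{\xi_\imath\mid\imath\in i\}$. Put $X^\circ_{\mathcal{Q}}=\{(i^\circ,\xi_{i^\circ})\mid i\in I\}$, $\tau^\circ_{\mathcal{Q}}=w[X^\circ_{\mathcal{Q}}]\sigma$, $X'_{\mathcal{Q}}=\{(\sigma(i^\circ),p)\in\widehat\Delta^\sigma_0\mid i\in I,\ \xi_{\sigma(i^\circ)}<p\le\xi_{i^\circ}-2\}$, and $\tau_{\mathcal{Q}}=w[X'_{\mathcal{Q}}]^{-1}\,\tau^\circ_{\mathcal{Q}}\,w[X'_{\mathcal{Q}}]\in\mathsf{W}\sigma$. The map $\phi_{\mathcal{Q}}$. Put $\gamma^{\mathcal{Q}}_\imath=(1-\tau_{\mathcal{Q}}^{d_{\bar\imath}})\varpi_\imath$ (a positive root) and $\widehat{\mathsf{R}}^+=\mathsf{R}^+\times\mathbb{Z}$. $\phi_{\mathcal{Q}}$ is defined recursively by $\phi_{\mathcal{Q}}(\imath,\xi_\imath)=(\gamma^{\mathcal{Q}}_\imath,0)$ and, if $\phi_{\mathcal{Q}}(\imath,p)=(\beta,k)$, $\phi_{\mathcal{Q}}(\imath,p\pm2d_{\bar\imath})=(\tau_{\mathcal{Q}}^{\mp d_{\bar\imath}}\beta,k)$ if $\tau_{\mathcal{Q}}^{\mp d_{\bar\imath}}\beta\in\mathsf{R}^+$,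 and $=(-\tau_{\mathcal{Q}}^{\mp d_{\bar\imath}}\beta,k\pm1)$ if $\tau_{\mathcal{Q}}^{\mp d_{\bar\imath}}\beta\in\mathsf{R}^-$. The quiver $\Upsilon_{[\mathcal{Q}]}$. Two sequences are commutation equivalent if related by swaps of adjacent entries $(\imath,\jmath)$, $\imath\not\sim\jmath$. The set $[\mathcal{Q}]$ of reduced words of $w_0$ adapted to $\mathcal{Q}$ is a single commutation class. For $\boldsymbol i=(\imath_1,\dots,\imath_N)\in[\mathcal{Q}]$ put $\beta_k^{\boldsymbol i}=s_{\imath_1}\cdots s_{\imath_{k-1}}(\alpha_{\imath_k})$ and $\mathrm{res}^{[\mathcal{Q}]}(\beta_k^{\boldsymbol i})=\imath_k$. The quiver $\Upsilon_{[\mathcal{Q}]}$ has vertex set $\mathsf{R}^+$ and an arrow $\beta^{\boldsymbol i}_k\to\beta^{\boldsymbol i}_j$ iff $j<k$, $\imath_j\sim\imath_k$ and no $j<j'<k$ has $\imath_{j'}\in\{\imath_j,\imath_k\}$. (Residue and quiver do not depend on $\boldsymbol i\in[\mathcal{Q}]$.) There is a unique quiver isomorphism $\Gamma_{\mathcal{Q}}\cong\Upsilon_{[\mathcal{Q}]}$ intertwining $\pi$ and $\mathrm{res}^{[\mathcal{Q}]}$; $\phi_{\mathcal{Q},0}$ is its map on vertices. *)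

theory Defs
  imports Complex_Main "HOL-Library.FuncSet"
begin

section \<open>Auxiliary notions\<close>

text \<open>Integer powers of a bijection under composition.\<close>

definition fun_powi :: "('a \<Rightarrow> 'a) \<Rightarrow> int \<Rightarrow> 'a \<Rightarrow> 'a" where
  "fun_powi f k = (if 0 \<le> k then f ^^ nat k else inv f ^^ nat (- k))"

text \<open>
  Let \<open>c\<close> be a Cartan matrix of finite type with index set \<open>I\<close>, in the convention
  \<open>c i j = \<langle>\<alpha>\<^sup>\<or>\<^sub>i, \<alpha>\<^sub>j\<rangle>\<close>.  The elements of \<open>root_coroots I c\<close> are the pairs
  \<open>(\<beta>, \<beta>\<^sup>\<or>)\<close> with \<open>\<beta>\<close> a root, where \<open>\<beta>\<close> is given by its coefficients on the simple roots
  and \<open>\<beta>\<^sup>\<or>\<close> by its coefficients on the simple coroots.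
\<close>

inductive_set root_coroots :: "'i set \<Rightarrow> ('i \<Rightarrow> 'i \<Rightarrow> int) \<Rightarrow> (('i \<Rightarrow> int) \<times> ('i \<Rightarrow> int)) set"
  for I :: "'i set" and c :: "'i \<Rightarrow> 'i \<Rightarrow> int" where
  simple: "i \<in> I \<Longrightarrow> (\<lambda>j. of_bool (j = i), \<lambda>j. of_bool (j = i)) \<in> root_coroots I c"
| reflect: "\<lbrakk> (b, b') \<in> root_coroots I c; i \<in> I \<rbrakk> \<Longrightarrow>
    (b(i := b i - (\<Sum>j\<in>I. c i j * b j)), b'(i := b' i - (\<Sum>j\<in>I. b' j * c j i))) \<in> root_coroots I c"

text \<open>
  \<open>h\<^sup>\<or> = 1 + \<langle>\<rho>, \<theta>\<^sup>\<or>\<rangle>\<close>, i.e. one plus the height of the coroot \<open>\<theta>\<^sup>\<or>\<close>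
  of the highest root \<open>\<theta>\<close>.
\<close>

definition dual_coxeter_number :: "'i set \<Rightarrow> ('i \<Rightarrow> 'i \<Rightarrow> int) \<Rightarrow> int" where
  "dual_coxeter_number I c =
     1 + (THE m. \<exists>t t'. (t, t') \<in> root_coroots I c \<and>
                   (\<forall>(b, b') \<in> root_coroots I c. \<forall>i\<in>I. b i \<le> t i) \<and> m = (\<Sum>i\<in>I. t' i))"


section \<open>Dynkin diagrams of type ADE\<close>

datatype ADE_type = Type_A nat | Type_D nat | Type_E nat

fun ADE_rank :: "ADE_type \<Rightarrow> nat" where
  "ADE_rank (Type_A n) = n"
| "ADE_rank (Type_D n) = n"
| "ADE_rank (Type_E n) = n"

fun ADE_admissible :: "ADE_type \<Rightarrow> bool" where
  "ADE_admissible (Type_A n) \<longleftrightarrow> 1 \<le> n"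
| "ADE_admissible (Type_D n) \<longleftrightarrow> 4 \<le> n"
| "ADE_admissible (Type_E n) \<longleftrightarrow> n \<in> {6, 7, 8}"

text \<open>
  Edges, each listed in one direction only, in the Bourbaki labelling by \<open>{1..n}\<close>: for type D
  the chain \<open>1, \<dots>, n-1\<close> with \<open>n\<close> attached to \<open>n-2\<close>, and for type E
  the chain \<open>1, 3, 4, \<dots>, n\<close> with \<open>2\<close> attached to \<open>4\<close>.
\<close>

fun ADE_edge :: "ADE_type \<Rightarrow> nat \<Rightarrow> nat \<Rightarrow> bool" where
  "ADE_edge (Type_A n) a b \<longleftrightarrow> b = a + 1"
| "ADE_edge (Type_D n) a b \<longleftrightarrow> (b = a + 1 \<and> b < n) \<or> (a + 2 = n \<and> b = n)"
| "ADE_edge (Type_E n) a b \<longleftrightarrow> (b = a + 1 \<and> 3 \<le> a) \<or> (a = 1 \<and> b = 3) \<or> (a = 2 \<and> b = 4)"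

text \<open>
  The vertex set \<open>\<Delta>\<^sub>0\<close> is the whole (arbitrary) finite type \<open>'v\<close>.
  A weight \<open>\<Sum>\<^sub>\<iota> \<lambda>\<^sub>\<iota> \<varpi>\<^sub>\<iota>\<close> is represented by its coefficient function
  \<open>\<lambda> :: 'v \<Rightarrow> int\<close>, so that \<open>\<lambda> \<iota> = (\<lambda>, \<alpha>\<^sub>\<iota>)\<close> and the weight lattice
  is the whole type \<open>'v \<Rightarrow> int\<close>.
\<close>

locale ADE_diagram =
  fixes adj :: "'v::finite \<Rightarrow> 'v \<Rightarrow> bool"
  assumes ADE: "\<exists>X f. ADE_admissible X \<and> bij_betw f UNIV {1..ADE_rank X} \<and>
    (\<forall>\<iota> \<kappa>. adj \<iota> \<kappa> \<longleftrightarrow> ADE_edge X (f \<iota>) (f \<kappa>) \<or> ADE_edge X (f \<kappa>) (f \<iota>))"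
begin

definition fund_weight :: "'v \<Rightarrow> 'v \<Rightarrow> int" where
  "fund_weight \<iota> = (\<lambda>\<kappa>. of_bool (\<kappa> = \<iota>))"

definition simple_root :: "'v \<Rightarrow> 'v \<Rightarrow> int" where
  "simple_root \<iota> = (\<lambda>\<kappa>. if \<kappa> = \<iota> then 2 else if adj \<iota> \<kappa> then - 1 else 0)"

definition simple_refl :: "'v \<Rightarrow> ('v \<Rightarrow> int) \<Rightarrow> ('v \<Rightarrow> int)" where
  "simple_refl \<iota> l = (\<lambda>\<kappa>. l \<kappa> - l \<iota> * simple_root \<iota> \<kappa>)"

definition word_refl :: "'v list \<Rightarrow> ('v \<Rightarrow> int) \<Rightarrow> ('v \<Rightarrow> int)" where
  "word_refl is = foldr (\<lambda>\<iota> w. simple_refl \<iota> \<circ> w) is id"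

definition weyl :: "(('v \<Rightarrow> int) \<Rightarrow> ('v \<Rightarrow> int)) set" where
  "weyl = range word_refl"

definition weyl_length :: "(('v \<Rightarrow> int) \<Rightarrow> ('v \<Rightarrow> int)) \<Rightarrow> nat" where
  "weyl_length w = (LEAST n. \<exists>is. length is = n \<and> word_refl is = w)"

definition longest :: "('v \<Rightarrow> int) \<Rightarrow> ('v \<Rightarrow> int)" where
  "longest = (THE w. w \<in> weyl \<and> (\<forall>v\<in>weyl. weyl_length v \<le> weyl_length w))"

definition roots :: "('v \<Rightarrow> int) set" where
  "roots = {w (simple_root \<iota>) | w \<iota>. w \<in> weyl}"

definition pos_roots :: "('v \<Rightarrow> int) set" where
  "pos_roots = {b \<in> roots. \<exists>m :: 'v \<Rightarrow> nat. b = (\<lambda>\<kappa>. \<Sum>\<iota>\<in>UNIV. int (m \<iota>) * simple_root \<iota> \<kappa>)}"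

definition neg_roots :: "('v \<Rightarrow> int) set" where
  "neg_roots = uminus ` pos_roots"

text \<open>The involution \<open>\<iota> \<mapsto> \<iota>\<^sup>*\<close>.\<close>

definition star :: "'v \<Rightarrow> 'v" where
  "star \<iota> = (THE \<kappa>. longest (simple_root \<iota>) = - simple_root \<kappa>)"

definition reduced_words_longest :: "'v list set" where
  "reduced_words_longest = {is. word_refl is = longest \<and> length is = weyl_length longest}"

text \<open>For a word \<open>is\<close>, with positions numbered from \<open>0\<close>: the root \<open>\<beta>\<^sub>k\<close>, and the
  residue and the arrows of the associated combinatorial quiver.\<close>

definition word_root :: "'v list \<Rightarrow> nat \<Rightarrow> ('v \<Rightarrow> int)" where
  "word_root is k = word_refl (take k is) (simple_root (is ! k))"

definition word_res :: "'v list \<Rightarrow> ('v \<Rightarrow> int) \<Rightarrow> 'v" where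
  "word_res is b = (THE \<iota>. \<exists>k < length is. b = word_root is k \<and> \<iota> = is ! k)"

definition word_arrow :: "'v list \<Rightarrow> ('v \<Rightarrow> int) \<Rightarrow> ('v \<Rightarrow> int) \<Rightarrow> bool" where
  "word_arrow is b b' \<longleftrightarrow> (\<exists>j k. j < k \<and> k < length is \<and> b = word_root is k \<and> b' = word_root is j \<and>
     adj (is ! j) (is ! k) \<and> (\<forall>j'. j < j' \<and> j' < k \<longrightarrow> is ! j' \<notin> {is ! j, is ! k}))"

end


section \<open>Folding\<close>

locale folded_diagram = ADE_diagram adj
  for adj :: "'v::finite \<Rightarrow> 'v \<Rightarrow> bool" +
  fixes \<sigma> :: "'v \<Rightarrow> 'v"
  assumes bij_sigma: "bij \<sigma>"
    and adj_sigma: "adj (\<sigma> \<iota>) (\<sigma> \<kappa>) \<longleftrightarrow> adj \<iota> \<kappa>"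
    and not_adj_sigma: "\<not> adj \<iota> (\<sigma> \<iota>)"
begin

definition sigma_order :: nat where
  "sigma_order = (LEAST n. 0 < n \<and> \<sigma> ^^ n = id)"

definition sigma_act :: "('v \<Rightarrow> int) \<Rightarrow> ('v \<Rightarrow> int)" where
  "sigma_act l = l \<circ> inv \<sigma>"

definition orb :: "'v \<Rightarrow> 'v set" where
  "orb \<iota> = {(\<sigma> ^^ n) \<iota> | n. True}"

definition orbits :: "'v set set" where
  "orbits = range orb"

definition d :: "'v \<Rightarrow> int" where
  "d \<iota> = int (card (orb \<iota>))"

definition orb_adj :: "'v set \<Rightarrow> 'v set \<Rightarrow> bool" where
  "orb_adj i j \<longleftrightarrow> (\<exists>\<iota>\<in>i. \<exists>\<kappa>\<in>j. adj \<iota> \<kappa>)"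

definition cartan :: "'v set \<Rightarrow> 'v set \<Rightarrow> int" where
  "cartan i j = (if i = j then 2
                 else if orb_adj i j then - \<lceil>real (card j) / real (card i)\<rceil>
                 else 0)"

text \<open>The dual Coxeter number of the Lie algebra with Cartan matrix \<open>cartan\<close>.\<close>

definition hdual :: int where
  "hdual = dual_coxeter_number orbits cartan"

definition parity_function :: "('v \<Rightarrow> int) \<Rightarrow> bool" where
  "parity_function \<epsilon> \<longleftrightarrow>
     (\<forall>\<iota>. 0 \<le> \<epsilon> \<iota> \<and> \<epsilon> \<iota> < 2 * d \<iota>) \<and>
     (\<forall>\<iota> \<iota>'. orb \<iota> = orb \<iota>' \<longrightarrow> \<epsilon> \<iota> mod 2 = \<epsilon> \<iota>' mod 2) \<and>
     (\<forall>\<iota> l. \<epsilon> (fun_powi \<sigma> l \<iota>) mod (2 * d \<iota>) = (\<epsilon> \<iota> - 2 * l) mod (2 * d \<iota>)) \<and>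
     (\<forall>\<iota> \<kappa>. adj \<iota> \<kappa> \<longrightarrow>
        \<epsilon> \<iota> mod (2 * min (d \<iota>) (d \<kappa>)) = (\<epsilon> \<kappa> + min (d \<iota>) (d \<kappa>)) mod (2 * min (d \<iota>) (d \<kappa>)))"

text \<open>In the second condition, \<open>card (orb \<iota>) < card j\<close> forces \<open>orb \<iota> = {\<iota>}\<close>.\<close>

definition height_function :: "('v \<Rightarrow> int) \<Rightarrow> bool" where
  "height_function \<xi> \<longleftrightarrow>
     (\<forall>\<iota> \<kappa>. adj \<iota> \<kappa> \<and> d \<iota> = d \<kappa> \<longrightarrow> \<bar>\<xi> \<iota> - \<xi> \<kappa>\<bar> = d \<iota>) \<and>
     (\<forall>\<iota>. \<forall>j\<in>orbits. orb_adj (orb \<iota>) j \<and> card (orb \<iota>) < card j \<longrightarrow>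
        (\<exists>!\<kappa>. \<kappa> \<in> j \<and> \<bar>\<xi> \<iota> - \<xi> \<kappa>\<bar> = 1 \<and>
               (\<forall>l < sigma_order. \<xi> ((\<sigma> ^^ l) \<kappa>) = \<xi> \<kappa> - 2 * int l)))"

definition source :: "('v \<Rightarrow> int) \<Rightarrow> 'v \<Rightarrow> bool" where
  "source \<xi> \<iota> \<longleftrightarrow> (\<forall>\<kappa>. adj \<iota> \<kappa> \<longrightarrow> \<xi> \<kappa> < \<xi> \<iota>)"

fun adapted :: "('v \<Rightarrow> int) \<Rightarrow> 'v list \<Rightarrow> bool" where
  "adapted \<xi> [] \<longleftrightarrow> True"
| "adapted \<xi> (\<iota> # is) \<longleftrightarrow> source \<xi> \<iota> \<and> adapted (\<xi>(\<iota> := \<xi> \<iota> - 2 * d \<iota>)) is"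

end


section \<open>Q-data\<close>

locale Q_datum = folded_diagram adj \<sigma>
  for adj :: "'v::finite \<Rightarrow> 'v \<Rightarrow> bool" and \<sigma> :: "'v \<Rightarrow> 'v" +
  fixes \<epsilon> :: "'v \<Rightarrow> int" and \<xi> :: "'v \<Rightarrow> int"
  assumes parity: "parity_function \<epsilon>"
    and height: "height_function \<xi>"
    and height_parity: "2 * d \<iota> dvd \<xi> \<iota> - \<epsilon> \<iota>"
begin

definition rep_vertices :: "('v \<times> int) set" where
  "rep_vertices = {(\<iota>, p). 2 * d \<iota> dvd p - \<epsilon> \<iota>}"

definition rep_arrow :: "'v \<times> int \<Rightarrow> 'v \<times> int \<Rightarrow> bool" where
  "rep_arrow x y \<longleftrightarrow> x \<in> rep_vertices \<and> y \<in> rep_vertices \<and> adj (fst x) (fst y) \<and>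
     snd y - snd x = min (d (fst x)) (d (fst y))"

definition compatible_reading :: "('v \<times> int) set \<Rightarrow> ('v \<times> int) list \<Rightarrow> bool" where
  "compatible_reading X xs \<longleftrightarrow> distinct xs \<and> set xs = X \<and>
     (\<forall>k < length xs. \<forall>k' < length xs. rep_arrow (xs ! k') (xs ! k) \<longrightarrow> k < k')"

text \<open>\<open>w[X]\<close>, which does not depend on the chosen reading.\<close>

definition w_of :: "('v \<times> int) set \<Rightarrow> ('v \<Rightarrow> int) \<Rightarrow> ('v \<Rightarrow> int)" where
  "w_of X = word_refl (map fst (SOME xs. compatible_reading X xs))"

definition AR_vertices :: "('v \<times> int) set" where
  "AR_vertices = {(\<iota>, \<xi> \<iota> - 2 * d \<iota> * k) | \<iota> k.
     0 \<le> 2 * d \<iota> * k \<and> 2 * d \<iota> * k < int sigma_order * hdual + \<xi> \<iota> - \<xi> (star \<iota>)}"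

text \<open>\<open>i\<^sup>\<circ>\<close> for an orbit \<open>i\<close>.\<close>

definition top_vertex :: "'v set \<Rightarrow> 'v" where
  "top_vertex i = (THE \<iota>. \<iota> \<in> i \<and> \<xi> \<iota> = Max (\<xi> ` i))"

definition X_circ :: "('v \<times> int) set" where
  "X_circ = {(top_vertex i, \<xi> (top_vertex i)) | i. i \<in> orbits}"

definition X_prime :: "('v \<times> int) set" where
  "X_prime = {(\<sigma> (top_vertex i), p) | i p. i \<in> orbits \<and> (\<sigma> (top_vertex i), p) \<in> rep_vertices \<and>
     \<xi> (\<sigma> (top_vertex i)) < p \<and> p \<le> \<xi> (top_vertex i) - 2}"

definition tau_circ :: "('v \<Rightarrow> int) \<Rightarrow> ('v \<Rightarrow> int)" where
  "tau_circ = w_of X_circ \<circ> sigma_act"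

definition tau :: "('v \<Rightarrow> int) \<Rightarrow> ('v \<Rightarrow> int)" where
  "tau = inv (w_of X_prime) \<circ> tau_circ \<circ> w_of X_prime"

definition gamma :: "'v \<Rightarrow> ('v \<Rightarrow> int)" where
  "gamma \<iota> = fund_weight \<iota> - fun_powi tau (d \<iota>) (fund_weight \<iota>)"

text \<open>The graph of the map \<open>\<phi>\<^sub>Q\<close>.\<close>

inductive phi_graph :: "'v \<times> int \<Rightarrow> ('v \<Rightarrow> int) \<times> int \<Rightarrow> bool" where
  base: "phi_graph (\<iota>, \<xi> \<iota>) (gamma \<iota>, 0)"
| up_pos: "\<lbrakk> phi_graph (\<iota>, p) (b, k); fun_powi tau (- d \<iota>) b \<in> pos_roots \<rbrakk> \<Longrightarrow>
    phi_graph (\<iota>, p + 2 * d \<iota>) (fun_powi tau (- d \<iota>) b, k)"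
| up_neg: "\<lbrakk> phi_graph (\<iota>, p) (b, k); fun_powi tau (- d \<iota>) b \<in> neg_roots \<rbrakk> \<Longrightarrow>
    phi_graph (\<iota>, p + 2 * d \<iota>) (- fun_powi tau (- d \<iota>) b, k + 1)"
| down_pos: "\<lbrakk> phi_graph (\<iota>, p) (b, k); fun_powi tau (d \<iota>) b \<in> pos_roots \<rbrakk> \<Longrightarrow>
    phi_graph (\<iota>, p - 2 * d \<iota>) (fun_powi tau (d \<iota>) b, k)"
| down_neg: "\<lbrakk> phi_graph (\<iota>, p) (b, k); fun_powi tau (d \<iota>) b \<in> neg_roots \<rbrakk> \<Longrightarrow>
    phi_graph (\<iota>, p - 2 * d \<iota>) (- fun_powi tau (d \<iota>) b, k - 1)"

definition phi :: "'v \<times> int \<Rightarrow> ('v \<Rightarrow> int) \<times> int" where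
  "phi x = (THE y. phi_graph x y)"

text \<open>\<open>[Q]\<close>, and the residue and arrows of \<open>\<Upsilon>\<^bsub>[Q]\<^esub>\<close> (whose vertex set is
  \<open>pos_roots\<close>); the latter do not depend on the chosen word.\<close>

definition Q_class :: "'v list set" where
  "Q_class = {is \<in> reduced_words_longest. adapted \<xi> is}"

definition Upsilon_res :: "('v \<Rightarrow> int) \<Rightarrow> 'v" where
  "Upsilon_res = word_res (SOME is. is \<in> Q_class)"

definition Upsilon_arrow :: "('v \<Rightarrow> int) \<Rightarrow> ('v \<Rightarrow> int) \<Rightarrow> bool" where
  "Upsilon_arrow = word_arrow (SOME is. is \<in> Q_class)"

text \<open>The quivers have no multiple arrows, so an isomorphism is determined by its map on vertices;
  this map is made unique as a HOL function by extensionality.\<close>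

definition phi0 :: "'v \<times> int \<Rightarrow> ('v \<Rightarrow> int)" where
  "phi0 = (THE f. f \<in> extensional AR_vertices \<and> bij_betw f AR_vertices pos_roots \<and>
     (\<forall>x\<in>AR_vertices. \<forall>y\<in>AR_vertices. rep_arrow x y \<longleftrightarrow> Upsilon_arrow (f x) (f y)) \<and>
     (\<forall>x\<in>AR_vertices. Upsilon_res (f x) = fst x))"

end

end

theory Submission
  imports Defs "HOL-Analysis.Analysis"
begin

text \<open>
  Regard \<open>p\<close> as time. Sweeping the repetition quiver from time 0 to time \<open>t\<close>, and more generally to
  a height function \<open>\<eta>\<close>, gives Weyl group elements \<open>V\<^sub>t\<close> and \<open>U\<^sub>\<eta>\<close>; put
  \<open>\<beta>(\<iota>, p) = V\<^sub>p \<alpha>\<^sub>\<iota>\<close>. Firing a source multiplies \<open>U\<^sub>\<eta>\<close> by \<open>s\<^sub>\<iota>\<close> on the right, and the shift by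
  \<open>\<sigma>\<close> and two time units is left multiplication by \<open>P = V\<^sub>-\<^sub>2 \<sigma>\<close>. Hence \<open>\<tau>\<^sub>Q = U\<^sub>\<xi>\<inverse> P U\<^sub>\<xi>\<close>, and
  \<open>\<tau>\<^sub>Q\<close> acts along the rows through \<open>(\<iota>, p) \<mapsto> U\<^sub>\<xi>\<inverse> \<beta>(\<iota>, p)\<close>.

  By a Perron-Frobenius argument the mesh relations have a solution \<open>b\<^sub>\<iota> cos (\<theta> p)\<close> with \<open>b\<close> positive.
  It defines linear functionals rotating through the Weyl chambers which the frame \<open>V\<^sub>t\<close> follows, so
  after half a turn, in time \<open>H = \<pi> / \<theta>\<close>, the frame has been multiplied by \<open>w\<^sub>0\<close> and
  \<open>\<beta>(\<iota>\<^sup>*, p - H) = - \<beta>(\<iota>, p)\<close>. Counting the roots met gives \<open>2 N = H |I|\<close>, whereas the invariant form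
  on the \<open>\<sigma>\<close>-fixed part, computed by its trace and at the highest root, gives \<open>2 N = r h\<^sup>\<or> |I|\<close>; thus
  \<open>H = r h\<^sup>\<or>\<close>. So \<open>\<Gamma>\<^sub>Q\<close> is the region between \<open>\<xi>\<close> and its half turn, every adapted word of \<open>w\<^sub>0\<close> is a
  linear extension of it, and its successive half turns are the fibres of the second component of
  \<open>\<phi>\<^sub>Q\<close>.
\<close>

section \<open>Dynkin diagrams of type ADE\<close>

text \<open>In the code \<open>V_t\<close> is \<open>frame\<close>, \<open>U_\<eta>\<close> is
  \<open>place\<close>, \<open>P\<close> is \<open>cox\<close> and \<open>H\<close> is
  \<open>turn\<close>. Case checks by type are confined to irreflexivity, connectedness, a
  subadditive function (hence positive definiteness) and the automorphisms of the diagram; the rest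
  is uniform. Two obstacles shape the argument. Words adapted to different paths must be compared:
  the image of a fundamental weight changes only when its own row is fired, so it depends on a
  single vertex of the quiver, and \<open>place\<close> is defined from these images, which makes
  path independence automatic. Moreover nothing in the definitions says after how long a sweep
  reaches the longest element. The wave supplies a half period, a priori a real number; it is an
  integer because a jump of the frame at an integer time must be matched by a jump one half period
  earlier. Its value cannot be read off from the angle, which is only known to exist, so it is tied
  to the dual Coxeter number by evaluating one invariant form in two ways.\<close>

definition ADE_adj :: "ADE_type \<Rightarrow> nat \<Rightarrow> nat \<Rightarrow> bool" where
  "ADE_adj X a b \<longleftrightarrow> ADE_edge X a b \<or> ADE_edge X b a"

lemma ADE_adj_simps:
  "ADE_adj (Type_A n) a b \<longleftrightarrow> b = a + 1 \<or> a = b + 1"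
  "ADE_adj (Type_D n) a b \<longleftrightarrow>
     b = a + 1 \<and> b < n \<or> a = b + 1 \<and> a < n \<or> a + 2 = n \<and> b = n \<or> b + 2 = n \<and> a = n"
  "ADE_adj (Type_E n) a b \<longleftrightarrow>
     b = a + 1 \<and> 3 \<le> a \<or> a = b + 1 \<and> 3 \<le> b \<or> a = 1 \<and> b = 3 \<or> a = 3 \<and> b = 1 \<or>
     a = 2 \<and> b = 4 \<or> a = 4 \<and> b = 2"
  by (auto simp: ADE_adj_def)

lemma ADE_adj_irrefl: "ADE_admissible X \<Longrightarrow> \<not> ADE_adj X a a"
  by (cases X) (auto simp: ADE_adj_simps)

lemma ADE_connected:
  assumes "ADE_admissible X"
    and P: "\<And>a b. \<lbrakk>a \<in> {1..ADE_rank X}; b \<in> {1..ADE_rank X}; ADE_adj X a b\<rbrakk> \<Longrightarrow> P a \<longleftrightarrow> P b"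
    and a: "a \<in> {1..ADE_rank X}"
  shows "P a \<longleftrightarrow> P (1::nat)"
proof (cases X)
  case (Type_A n)
  have "Suc k \<le> n \<longrightarrow> P (Suc k) = P 1" for k
  proof (induction k)
    case (Suc k)
    then show ?case using P[of "Suc k" "Suc (Suc k)"] Type_A by (auto simp: ADE_adj_simps)
  qed simp
  from this[of "a - 1"] a Type_A show ?thesis by simp
next
  case (Type_D n)
  have n: "n \<ge> 4" using assms(1) Type_D by simp
  have *: "Suc k < n \<longrightarrow> P (Suc k) = P 1" for k
  proof (induction k)
    case (Suc k)
    then show ?case using P[of "Suc k" "Suc (Suc k)"] Type_D by (auto simp: ADE_adj_simps)
  qed simp
  show ?thesis
  proof (cases "a = n")
    case True
    have "P (n - 2) = P n" using P[of "n - 2" n] n Type_D by (force simp: ADE_adj_simps)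
    moreover have "Suc (n - 3) = n - 2" using n by simp
    ultimately show ?thesis using *[of "n - 3"] n True by simp
  next
    case False
    then show ?thesis using *[of "a - 1"] a Type_D by simp
  qed
next
  case (Type_E n)
  have n: "n \<ge> 6" using assms(1) Type_E by auto
  have *: "k + 3 \<le> n \<longrightarrow> P (k + 3) = P 3" for k
  proof (induction k)
    case (Suc k)
    then show ?case using P[of "k + 3" "Suc k + 3"] Type_E by (auto simp: ADE_adj_simps)
  qed simp
  have 13: "P 1 = P 3" using P[of 1 3] n Type_E by (simp add: ADE_adj_simps)
  have 24: "P 2 = P 4" using P[of 2 4] n Type_E by (simp add: ADE_adj_simps)
  consider "a = 1" | "a = 2" | "a \<ge> 3" using a by fastforce
  then show ?thesis
  proof cases
    case 2
    then show ?thesis using 13 24 *[of 1] n by simp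
  next
    case 3
    then show ?thesis using 13 *[of "a - 3"] a Type_E by simp
  qed simp
qed

lemma ADE_nbrs_sum_le:
  assumes "{b \<in> {1..ADE_rank X}. ADE_adj X a b} \<subseteq> B" "finite B" "\<And>b. b \<in> B \<Longrightarrow> 0 \<le> (u b :: int)"
  shows "(\<Sum>b | b \<in> {1..ADE_rank X} \<and> ADE_adj X a b. u b) \<le> sum u B"
  using assms by (intro sum_mono2) auto

text \<open>For type E the weights are the coefficients of the highest root of \<open>E\<^sub>8\<close>.\<close>

lemma ADE_subadditive:
  assumes "ADE_admissible X"
  shows "\<exists>u :: nat \<Rightarrow> int.
    (\<forall>a \<in> {1..ADE_rank X}. 0 < u a \<and> (\<Sum>b | b \<in> {1..ADE_rank X} \<and> ADE_adj X a b. u b) \<le> 2 * u a) \<and>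
    (\<exists>a \<in> {1..ADE_rank X}. (\<Sum>b | b \<in> {1..ADE_rank X} \<and> ADE_adj X a b. u b) < 2 * u a)"
proof (cases X)
  case (Type_A n)
  have n: "n \<ge> 1" using assms Type_A by simp
  have "(\<Sum>b | b \<in> {1..n} \<and> ADE_adj X a b. 1::int) \<le> 2" for a
  proof -
    have "(\<Sum>b | b \<in> {1..n} \<and> ADE_adj X a b. 1::int) \<le> sum (\<lambda>_. 1) {a - 1, a + 1}"
      using Type_A by (intro sum_mono2) (auto simp: ADE_adj_simps)
    also have "\<dots> \<le> 2" by simp
    finally show ?thesis .
  qed
  moreover have "(\<Sum>b | b \<in> {1..n} \<and> ADE_adj X 1 b. 1::int) < 2"
  proof -
    have "(\<Sum>b | b \<in> {1..n} \<and> ADE_adj X 1 b. 1::int) \<le> sum (\<lambda>_. 1) {2::nat}"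
      using Type_A by (intro sum_mono2) (auto simp: ADE_adj_simps)
    then show ?thesis by simp
  qed
  ultimately show ?thesis
    using n Type_A by (intro exI[of _ "\<lambda>_. 1"]) (auto intro!: bexI[of _ 1])
next
  case (Type_D n)
  have n: "n \<ge> 4" using assms Type_D by simp
  \<comment> \<open>The additive function of the infinite diagram with one fork: 1 at the two tips,
    2 along the chain. Cutting the chain off makes the inequality strict at the vertex 1.\<close>
  define u :: "nat \<Rightarrow> int" where "u = (\<lambda>b. if n \<le> b + 1 then 1 else 2)"
  have u0: "0 \<le> u b" for b by (simp add: u_def)
  have rk: "ADE_rank X = n" using Type_D by simp
  have bnd: "(\<Sum>b | b \<in> {1..n} \<and> ADE_adj X a b. u b) \<le> 2 * u a" if a: "a \<in> {1..n}" for a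
  proof -
    consider "a + 3 \<le> n" | "a + 2 = n" | "n \<le> a + 1" using a by fastforce
    then show ?thesis
    proof cases
      case 1
      then have "(\<Sum>b | b \<in> {1..n} \<and> ADE_adj X a b. u b) \<le> sum u {a - 1, a + 1}"
        by (intro order_trans[OF _ ADE_nbrs_sum_le[of X a "{a - 1, a + 1}" u]])
          (use u0 Type_D 1 in \<open>auto simp: ADE_adj_simps\<close>)
      also have "\<dots> \<le> 4" by (simp add: u_def)
      finally show ?thesis using 1 by (simp add: u_def)
    next
      case 2
      have "(\<Sum>b | b \<in> {1..n} \<and> ADE_adj X a b. u b) \<le> sum u {a - 1, a + 1, n}"
        by (rule order_trans[OF _ ADE_nbrs_sum_le[of X a "{a - 1, a + 1, n}" u]])
          (use u0 Type_D 2 in \<open>auto simp: ADE_adj_simps\<close>)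
      also have "{a - 1, a + 1, n} = {n - 3, n - 1, n}" using 2 by auto
      also have "sum u {n - 3, n - 1, n} = 4" 
      proof -
        have "n - 3 \<noteq> n - 1" "n - 3 \<noteq> n" "n - 1 \<noteq> n" using n by auto
        then show ?thesis using n by (simp add: u_def)
      qed
      finally show ?thesis using 2 by (simp add: u_def)
    next
      case 3
      have "(\<Sum>b | b \<in> {1..n} \<and> ADE_adj X a b. u b) \<le> sum u {n - 2}"
        by (rule order_trans[OF _ ADE_nbrs_sum_le[of X a "{n - 2}" u]])
          (use u0 Type_D 3 in \<open>auto simp: ADE_adj_simps\<close>)
      also have "\<dots> = 2" using n by (simp add: u_def)
      finally show ?thesis using 3 by (simp add: u_def)
    qed
  qed
  have "(\<Sum>b | b \<in> {1..n} \<and> ADE_adj X 1 b. u b) \<le> sum u {2}"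
    by (rule order_trans[OF _ ADE_nbrs_sum_le[of X 1 "{2}" u]])
      (use n u0 Type_D in \<open>auto simp: ADE_adj_simps\<close>)
  also have "\<dots> < 2 * u 1" using n by (simp add: u_def)
  finally show ?thesis
    using n bnd rk by (intro exI[of _ u]) (auto simp: u_def intro!: bexI[of _ 1])
next
  case (Type_E n)
  have n: "n \<in> {6,7,8}" using assms Type_E by simp
  define u :: "nat \<Rightarrow> int" where "u = (\<lambda>b. [0,2,3,4,6,5,4,3,2] ! b)"
  have rk: "ADE_rank X = n" using Type_E by simp
  have 8: "{1..n} \<subseteq> {1,2,3,4,5,6,7,8}" using n by auto
  have u0: "0 < u b" if "b \<in> {1,2,3,4,5,6,7,8}" for b using that by (auto simp: u_def)
  have uv: "u 1 = 2" "u 2 = 3" "u 3 = 4" "u 4 = 6" "u 5 = 5" "u 6 = 4" "u 7 = 3" "u 8 = 2"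
    "u (Suc 0) = 2"
    by (simp_all add: u_def)
  have le: "(\<Sum>b | b \<in> {1..n} \<and> ADE_adj X a b. u b) \<le> sum u B"
    if "{b \<in> {1,2,3,4,5,6,7,8}. ADE_adj X a b} \<subseteq> B" "B \<subseteq> {1,2,3,4,5,6,7,8}" for a B
  proof -
    have "{b \<in> {1..ADE_rank X}. ADE_adj X a b} \<subseteq> B"
      using that(1) 8 unfolding rk by blast
    moreover have "finite B" using that(2) by (rule finite_subset) simp
    moreover have "0 \<le> u b" if "b \<in> B" for b
      using u0[of b] that \<open>B \<subseteq> _\<close> by (meson less_imp_le subsetD)
    ultimately show ?thesis using ADE_nbrs_sum_le[of X a B u] rk by simp
  qed
  have "(\<Sum>b | b \<in> {1..n} \<and> ADE_adj X a b. u b) \<le> 2 * u a" if "a \<in> {1..n}" for a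
  proof -
    have "a \<in> {1,2,3,4,5,6,7,8}" using 8 that by blast
    then consider "a = 1" | "a = 2" | "a = 3" | "a = 4" | "a = 5" | "a = 6" | "a = 7" | "a = 8" by blast
    then show ?thesis
    proof cases
      case 1 show ?thesis unfolding 1
        by (rule order_trans[OF le[of _ "{3}"]]) (auto simp: Type_E ADE_adj_simps uv)
    next
      case 2 show ?thesis unfolding 2
        by (rule order_trans[OF le[of _ "{4}"]]) (auto simp: Type_E ADE_adj_simps uv)
    next
      case 3 show ?thesis unfolding 3
        by (rule order_trans[OF le[of _ "{1,4}"]]) (auto simp: Type_E ADE_adj_simps uv)
    next
      case 4 show ?thesis unfolding 4
        by (rule order_trans[OF le[of _ "{2,3,5}"]]) (auto simp: Type_E ADE_adj_simps uv)
    next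
      case 5 show ?thesis unfolding 5
        by (rule order_trans[OF le[of _ "{4,6}"]]) (auto simp: Type_E ADE_adj_simps uv)
    next
      case 6 show ?thesis unfolding 6
        by (rule order_trans[OF le[of _ "{5,7}"]]) (auto simp: Type_E ADE_adj_simps uv)
    next
      case 7 show ?thesis unfolding 7
        by (rule order_trans[OF le[of _ "{6,8}"]]) (auto simp: Type_E ADE_adj_simps uv)
    next
      case 8 show ?thesis unfolding 8
        by (rule order_trans[OF le[of _ "{7}"]]) (auto simp: Type_E ADE_adj_simps uv)
    qed
  qed
  \<comment> \<open>Cutting the long arm of \<open>E\<^sub>8\<close> at \<open>n\<close> leaves the
    end \<open>n\<close> with the single neighbour \<open>n - 1\<close>, whose weight is below
    \<open>2 * u n\<close>.\<close>
  moreover have "(\<Sum>b | b \<in> {1..n} \<and> ADE_adj X n b. u b) < 2 * u n"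
  proof -
    have n': "n = 6 \<or> n = 7 \<or> n = 8" using n by simp
    have "{b. b \<in> {1..n} \<and> ADE_adj X n b} = {n - 1}"
      using n' Type_E by (force simp: ADE_adj_simps)
    then have "(\<Sum>b | b \<in> {1..n} \<and> ADE_adj X n b. u b) = u (n - 1)" by simp
    also have "\<dots> < 2 * u n" using n' by (elim disjE) (simp_all add: u_def)
    finally show ?thesis .
  qed
  ultimately show ?thesis
    using 8 unfolding rk
  proof (intro exI[of _ u] conjI ballI bexI[of _ n])
    show "0 < u a" if "a \<in> {1..n}" for a using u0[of a] 8 that by blast
    show "n \<in> {1..n}" using n by auto
  qed auto
qed

text \<open>In types D and E the branch vertex is fixed because no other vertex has three
  neighbours; in type A the two ends are preserved. Fixedness then spreads along the arms. Only the
  3-cycles on the arms of \<open>D\<^sub>4\<close> escape the first alternative, and the fixed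
  neighbour in the second one is its centre.\<close>

lemma ADE_automorphism:
  fixes g :: "nat \<Rightarrow> nat"
  assumes adm: "ADE_admissible X"
    and bij: "bij_betw g {1..ADE_rank X} {1..ADE_rank X}"
    and hom: "\<And>a b. \<lbrakk>a \<in> {1..ADE_rank X}; b \<in> {1..ADE_rank X}\<rbrakk> \<Longrightarrow>
      ADE_adj X (g a) (g b) \<longleftrightarrow> ADE_adj X a b"
  shows "(\<forall>a \<in> {1..ADE_rank X}. g (g a) = a) \<or>
    (\<forall>a \<in> {1..ADE_rank X}. g (g (g a)) = a \<and>
       (g a \<noteq> a \<longrightarrow> (\<exists>c \<in> {1..ADE_rank X}. ADE_adj X a c \<and> g c = c)))"
proof -
  define V where "V = {1..ADE_rank X}"
  have gV: "g a \<in> V" if "a \<in> V" for a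
    using bij that unfolding V_def by (rule bij_betw_apply)
  have ginj: "a = b" if "g a = g b" "a \<in> V" "b \<in> V" for a b
    using bij that unfolding V_def bij_betw_def inj_on_def by blast
  have "g ` V = V" using bij by (simp add: V_def bij_betw_def)
  then have gsurj: "\<exists>a \<in> V. g a = b" if "b \<in> V" for b
    using that by (metis (no_types) image_iff)
  have hom': "ADE_adj X (g a) (g b) \<longleftrightarrow> ADE_adj X a b" if "a \<in> V" "b \<in> V" for a b
    using hom that by (simp add: V_def)
  \<comment> \<open>Propagation: if \<open>h\<close> fixes \<open>a\<close> and all neighbours of
    \<open>a\<close> except possibly \<open>b\<close>, injectivity leaves only \<open>b\<close> as
    image of \<open>b\<close>. It is applied to \<open>g\<close> and to the square of
    \<open>g\<close>.\<close>
  have fixd: "h b = b"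
    if inj: "inj_on h V" and V: "h ` V \<subseteq> V"
      and h: "\<forall>x\<in>V. \<forall>y\<in>V. ADE_adj X (h x) (h y) \<longleftrightarrow> ADE_adj X x y"
      and ab: "h a = a" "a \<in> V" "b \<in> V" "ADE_adj X a b"
      and nb: "\<And>x. \<lbrakk>x \<in> V; ADE_adj X a x\<rbrakk> \<Longrightarrow> x = b \<or> x \<in> V \<and> h x = x" for h a b
  proof -
    have hb: "h b \<in> V" using V ab(3) by auto
    have "ADE_adj X (h a) (h b)" using h ab(2-4) by blast
    then have "ADE_adj X a (h b)" by (simp add: ab(1))
    from nb[OF hb this] show ?thesis
      using inj_onD[OF inj, of "h b" b] ab(3) hb by blast
  qed
  have g: "inj_on g V" "g ` V \<subseteq> V"
    "\<forall>x\<in>V. \<forall>y\<in>V. ADE_adj X (g x) (g y) \<longleftrightarrow> ADE_adj X x y"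
    using bij hom by (auto simp: V_def bij_betw_def)
  have gg: "inj_on (\<lambda>x. g (g x)) V" "(\<lambda>x. g (g x)) ` V \<subseteq> V"
    "\<forall>x\<in>V. \<forall>y\<in>V. ADE_adj X (g (g x)) (g (g y)) \<longleftrightarrow> ADE_adj X x y"
    using ginj gV hom' by (auto simp: inj_on_def)
  note fixg = fixd[OF g]
  note fixgg = fixd[OF gg]
  have "(\<forall>a\<in>V. g (g a) = a) \<or>
    (\<forall>a\<in>V. g (g (g a)) = a \<and> (g a \<noteq> a \<longrightarrow> (\<exists>c\<in>V. ADE_adj X a c \<and> g c = c)))"
  proof (cases X)
    case (Type_A n)
    have V: "V = {1..n}" using Type_A by (simp add: V_def)
    have n: "n \<ge> 1" using adm Type_A by simp
    have leaf: "g e \<in> {1, n}" if e: "e \<in> {1, n}" for e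
    proof (rule ccontr)
      assume c: "g e \<notin> {1, n}"
      have eV: "e \<in> V" using e n V by auto
      then have c': "1 < g e" "g e < n" using gV[of e] c V by (auto simp: order_less_le)
      then have "g e - 1 \<in> V" "g e + 1 \<in> V" using V by auto
      from gsurj[OF this(1)] gsurj[OF this(2)]
      obtain x y where xy: "x \<in> V" "y \<in> V" "g x = g e - 1" "g y = g e + 1" by blast
      have "ADE_adj X (g e) (g x)" "ADE_adj X (g e) (g y)"
        using xy c' Type_A by (auto simp: ADE_adj_simps)
      then have "ADE_adj X e x" "ADE_adj X e y" using hom'[OF eV xy(1)] hom'[OF eV xy(2)] by blast+
      then have "x = y" using e Type_A xy V by (auto simp: ADE_adj_simps)
      then show False using xy by simp
    qed
    have "g (g 1) = 1"
    proof (cases "g 1 = 1")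
      case False
      then have "g 1 = n" "n \<noteq> 1" using leaf[of 1] n by auto
      then show ?thesis using leaf[of n] ginj[of n 1] n V by auto
    qed simp
    have "k + 1 \<in> V \<Longrightarrow> g (g (k + 1)) = k + 1" for k
    proof (induction k rule: less_induct)
      case (less k)
      show ?case
      proof (cases k)
        case 0
        then show ?thesis using \<open>g (g 1) = 1\<close> by simp
      next
        case (Suc j)
        have j: "j + 1 \<in> V" using less.prems Suc V by simp
        show ?thesis
        proof (rule fixgg[OF less.IH[of j] j less.prems])
          show "j < k" "j + 1 \<in> V" using Suc j by simp_all
          show "ADE_adj X (j + 1) (k + 1)" using Suc Type_A by (simp add: ADE_adj_simps)
          fix x assume x: "x \<in> V" "ADE_adj X (j + 1) x"
          then have "x = k + 1 \<or> x = j" using Suc Type_A by (auto simp: ADE_adj_simps)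
          moreover have "g (g x) = x" if "x = j"
            using less.IH[of "j - 1"] that x V Suc by (cases j) auto
          ultimately show "x = k + 1 \<or> x \<in> V \<and> g (g x) = x" using x by blast
        qed
      qed
    qed
    then have "g (g k) = k" if "k \<in> V" for k
      using that V by (cases k) auto
    then show ?thesis by blast
  next
    case (Type_D n)
    have V: "V = {1..n}" using Type_D by (simp add: V_def)
    have n: "n \<ge> 4" using adm Type_D by simp
    have nb: "ADE_adj X (n - 2) (n - 3)" "ADE_adj X (n - 2) (n - 1)" "ADE_adj X (n - 2) n"
      unfolding Type_D ADE_adj_simps using n by arith+
    have branch: "g (n - 2) = n - 2"
    proof (rule ccontr)
      assume c: "g (n - 2) \<noteq> n - 2"
      let ?c = "g (n - 2)"
      have mem: "n - 2 \<in> V" "n - 3 \<in> V" "n - 1 \<in> V" "n \<in> V" using n V by auto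
      have "ADE_adj X ?c (g (n - 3))" "ADE_adj X ?c (g (n - 1))" "ADE_adj X ?c (g n)"
        using nb hom'[OF mem(1,2)] hom'[OF mem(1,3)] hom'[OF mem(1,4)] by blast+
      moreover have "g (n - 3) \<noteq> g (n - 1)" "g (n - 3) \<noteq> g n" "g (n - 1) \<noteq> g n"
        using ginj[of "n - 3" "n - 1"] ginj[of "n - 3" n] ginj[of "n - 1" n] mem n by auto
      moreover have "x = (if ?c = n then n - 2 else ?c - 1) \<or> x = ?c + 1" if "ADE_adj X ?c x" for x
        using that c n unfolding Type_D ADE_adj_simps by (auto split: if_splits)
      ultimately show False by metis
    qed
    show ?thesis
    proof (cases "n = 4")
      case True
      have V4: "V = {1,2,3,4}" using V True by auto
      have g2: "g 2 = 2" using branch True by simp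
      have leaf: "g a = 1 \<or> g a = 3 \<or> g a = 4" if "a \<in> {1,3,4}" for a
      proof -
        have "a \<in> V" "a \<noteq> 2" "2 \<in> V" using that V4 by auto
        then show ?thesis using gV[of a] ginj[of a 2] g2 V4 by auto
      qed
      have "g 1 \<noteq> g 3" "g 1 \<noteq> g 4" "g 3 \<noteq> g 4"
        using ginj[of 1 3] ginj[of 1 4] ginj[of 3 4] V4 by auto
      moreover have "g 1 = 1 \<or> g 1 = 3 \<or> g 1 = 4" "g 3 = 1 \<or> g 3 = 3 \<or> g 3 = 4"
        "g 4 = 1 \<or> g 4 = 3 \<or> g 4 = 4"
        using leaf by simp_all
      ultimately have "g (g 1) = 1 \<and> g (g 3) = 3 \<and> g (g 4) = 4 \<or>
        g (g (g 1)) = 1 \<and> g (g (g 3)) = 3 \<and> g (g (g 4)) = 4"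
        by metis
      then have "(\<forall>a\<in>V. g (g a) = a) \<or> (\<forall>a\<in>V. g (g (g a)) = a)"
        unfolding V4 using g2 by (elim disjE) (simp_all del: One_nat_def)
      moreover have "\<exists>c\<in>V. ADE_adj X a c \<and> g c = c" if "a \<in> V" "g a \<noteq> a" for a
        using that V4 g2 True Type_D by (auto simp: ADE_adj_simps intro!: bexI[of _ 2])
      ultimately show ?thesis by blast
    next
      case False
      have mem: "n - 2 \<in> V" "n - 3 \<in> V" "n - 1 \<in> V" "n \<in> V" "n - 4 \<in> V" using n V False by auto
      \<comment> \<open>For \<open>n > 4\<close> the arm through \<open>n - 3\<close> has a further
        vertex \<open>n - 4\<close>, which distinguishes it from the two tips.\<close>
      have n3: "g (n - 3) = n - 3"
      proof -
        have "ADE_adj X (g (n - 2)) (g (n - 3))"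
          using hom'[OF mem(1,2)] nb by blast
        then have *: "g (n - 3) = n - 3 \<or> g (n - 3) = n - 1 \<or> g (n - 3) = n"
          unfolding branch Type_D ADE_adj_simps using n by linarith
        have "ADE_adj X (n - 3) (n - 4)"
          unfolding Type_D ADE_adj_simps using n False by arith
        then have "ADE_adj X (g (n - 3)) (g (n - 4))"
          using hom'[OF mem(2,5)] by blast
        then have "g (n - 4) = n - 2" if "g (n - 3) = n - 1 \<or> g (n - 3) = n"
          unfolding Type_D ADE_adj_simps using that n gV[OF mem(5)] V by auto
        moreover have "g (n - 4) \<noteq> n - 2"
          using ginj[of "n - 4" "n - 2"] branch mem n by auto
        ultimately show ?thesis using * by blast
      qed
      have down: "k + 2 \<le> n \<Longrightarrow> k \<ge> 1 \<Longrightarrow> g k = k" for k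
      proof (induction "n - k" arbitrary: k rule: less_induct)
        case less
        consider "k = n - 2" | "k = n - 3" | "k + 4 \<le> n" using less.prems by fastforce
        then show ?case
        proof cases
          case 3
          show ?thesis
          proof (rule fixg[of "k + 1" k])
            show "g (k + 1) = k + 1" using less 3 by simp
            show "k + 1 \<in> V" "k \<in> V" using V 3 less.prems by auto
            show "ADE_adj X (k + 1) k" using 3 by (simp add: Type_D ADE_adj_simps)
            fix x assume x: "x \<in> V" "ADE_adj X (k + 1) x"
            then have "x = k \<or> x = k + 2" using 3 by (auto simp: Type_D ADE_adj_simps)
            moreover have "g (k + 2) = k + 2" using less 3 by simp
            ultimately show "x = k \<or> x \<in> V \<and> g x = x" using x(1) by blast
          qed
        qed (use branch n3 in auto)
      qed
      have "g (n - 1) \<in> {n - 1, n}" "g n \<in> {n - 1, n}"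
      proof -
        have "g b \<in> {n - 1, n}" if b: "b \<in> V" "b + 2 > n" for b
        proof -
          have "\<not> g b + 2 \<le> n"
          proof
            assume le: "g b + 2 \<le> n"
            have "g b \<in> V" by (rule gV[OF b(1)])
            then have "g (g b) = g b" using down[OF le] V by simp
            then have "g b = b" using ginj[of "g b" b] b \<open>g b \<in> V\<close> by blast
            then show False using le b by simp
          qed
          then show ?thesis using gV[OF b(1)] V by auto
        qed
        from this[OF mem(3)] this[OF mem(4)] n
        show "g (n - 1) \<in> {n - 1, n}" "g n \<in> {n - 1, n}" by simp_all
      qed
      moreover have "g (n - 1) \<noteq> g n" using ginj[of "n - 1" n] mem n by auto
      ultimately have "g (g (n - 1)) = n - 1" "g (g n) = n" by auto
      moreover have "a + 2 \<le> n \<or> a = n - 1 \<or> a = n" if "a \<in> V" for a using that V by auto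
      ultimately have "g (g a) = a" if "a \<in> V" for a
        using down[of a] that V by fastforce
      then show ?thesis by blast
    qed
  next
    case (Type_E n)
    have V: "V = {1..n}" using Type_E by (simp add: V_def)
    have n: "n = 6 \<or> n = 7 \<or> n = 8" using adm Type_E by simp
    have mem: "1 \<in> V" "2 \<in> V" "3 \<in> V" "4 \<in> V" "5 \<in> V" "6 \<in> V" using n V by auto
    have g4: "g 4 = 4"
    proof (rule ccontr)
      assume c: "g 4 \<noteq> 4"
      have "ADE_adj X (g 4) (g 2)" "ADE_adj X (g 4) (g 3)" "ADE_adj X (g 4) (g 5)"
        using hom'[OF mem(4,2)] hom'[OF mem(4,3)] hom'[OF mem(4,5)] Type_E
        by (simp_all add: ADE_adj_simps)
      moreover have "g 2 \<noteq> g 3" "g 2 \<noteq> g 5" "g 3 \<noteq> g 5"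
        using ginj[of 2 3] ginj[of 2 5] ginj[of 3 5] mem by auto
      ultimately show False using c unfolding ADE_adj_simps Type_E by auto
    qed
    have nb4: "x = 2 \<or> x = 3 \<or> x = 5" if "ADE_adj X 4 x" for x
      using that Type_E by (auto simp: ADE_adj_simps)
    have "ADE_adj X 4 (g 2)" "ADE_adj X 4 (g 3)" "ADE_adj X 4 (g 5)"
      using hom'[of 4 2] hom'[of 4 3] hom'[of 4 5] mem g4 Type_E by (auto simp: ADE_adj_simps)
    then have im: "g 2 \<in> {2,3,5}" "g 3 \<in> {2,3,5}" "g 5 \<in> {2,3,5}" using nb4 by auto
    have "ADE_adj X (g 3) (g 1)" "ADE_adj X (g 5) (g 6)"
      using hom'[of 3 1] hom'[of 5 6] mem Type_E by (auto simp: ADE_adj_simps)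
    moreover have "g 1 \<noteq> 4" "g 6 \<noteq> 4" using ginj[of 1 4] ginj[of 6 4] g4 mem by auto
    ultimately have "g 3 \<noteq> 2" "g 5 \<noteq> 2" using Type_E by (auto simp: ADE_adj_simps)
    then have gg2: "g (g 2) = 2" and gg3: "g (g 3) = 3" and gg5: "g (g 5) = 5"
      using im ginj[of 3 5] ginj[of 2 3] ginj[of 2 5] mem by auto
    have gg4: "g (g 4) = 4" using g4 by simp
    have gg1: "g (g 1) = 1" if b: "1 \<in> V"
    proof (rule fixgg[of 3 1])
      show "3 \<in> V" using b V n by auto
      show "ADE_adj X 3 1" by (simp add: Type_E ADE_adj_simps)
      fix x assume x: "x \<in> V" "ADE_adj X 3 x"
      then have "x = 1 \<or> x = 4" by (auto simp: Type_E ADE_adj_simps)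
      then show "x = 1 \<or> x \<in> V \<and> g (g x) = x" using gg4 x(1) by blast
    qed (use gg3 b mem in auto)
    have gg6: "g (g 6) = 6" if b: "6 \<in> V"
    proof (rule fixgg[of 5 6])
      show "5 \<in> V" using b V n by auto
      show "ADE_adj X 5 6" by (simp add: Type_E ADE_adj_simps)
      fix x assume x: "x \<in> V" "ADE_adj X 5 x"
      then have "x = 6 \<or> x = 4" by (auto simp: Type_E ADE_adj_simps)
      then show "x = 6 \<or> x \<in> V \<and> g (g x) = x" using gg4 x(1) by blast
    qed (use gg5 b mem in auto)
    have gg7: "g (g 7) = 7" if b: "7 \<in> V"
    proof (rule fixgg[of 6 7])
      show "6 \<in> V" using b V n by auto
      show "ADE_adj X 6 7" by (simp add: Type_E ADE_adj_simps)
      fix x assume x: "x \<in> V" "ADE_adj X 6 x"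
      then have "x = 7 \<or> x = 5" by (auto simp: Type_E ADE_adj_simps)
      then show "x = 7 \<or> x \<in> V \<and> g (g x) = x" using gg5 x(1) by blast
    qed (use gg6 b mem V n in auto)
    have gg8: "g (g 8) = 8" if b: "8 \<in> V"
    proof (rule fixgg[of 7 8])
      show "7 \<in> V" using b V n by auto
      show "ADE_adj X 7 8" by (simp add: Type_E ADE_adj_simps)
      fix x assume x: "x \<in> V" "ADE_adj X 7 x"
      then have "x = 8 \<or> x = 6" by (auto simp: Type_E ADE_adj_simps)
      then show "x = 8 \<or> x \<in> V \<and> g (g x) = x" using gg6 x(1) by blast
    qed (use gg7 b mem V n in auto)
    have "a \<in> {1,2,3,4,5,6,7,8}" if "a \<in> V" for a
      using that n V by auto
    then have "g (g a) = a" if "a \<in> V" for a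
      using that gg1 gg2 gg3 gg4 gg5 gg6 gg7 gg8 by blast
    then show ?thesis by blast
  qed
  then show ?thesis unfolding V_def .
qed

section \<open>Transport of these facts to an abstract diagram\<close>

context ADE_diagram
begin

lemma adj_sym: "adj \<iota> \<kappa> \<longleftrightarrow> adj \<kappa> \<iota>"
  using ADE by blast

lemma labelling:
  obtains X f where "ADE_admissible X" "bij_betw f UNIV {1..ADE_rank X}"
    "\<And>\<iota> \<kappa>. adj \<iota> \<kappa> \<longleftrightarrow> ADE_adj X (f \<iota>) (f \<kappa>)"
  using ADE unfolding ADE_adj_def by blast

lemma adj_irrefl [simp]: "\<not> adj \<iota> \<iota>"
  by (rule labelling) (simp add: ADE_adj_irrefl)

text \<open>Connectedness with a predicate in place of paths: the zero set of a vector is spread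
  along edges in this form in \<open>real_form_pos\<close>, \<open>perron_frobenius\<close> and
  \<open>dominant_pos\<close>.\<close>

lemma adj_connected:
  assumes "\<And>\<iota> \<kappa>. adj \<iota> \<kappa> \<Longrightarrow> P \<iota> \<Longrightarrow> P \<kappa>" "P \<iota>"
  shows "P \<kappa>"
proof -
  obtain X f where X: "ADE_admissible X" "bij_betw f UNIV {1..ADE_rank X}"
    "\<And>\<iota> \<kappa>. adj \<iota> \<kappa> \<longleftrightarrow> ADE_adj X (f \<iota>) (f \<kappa>)" by (rule labelling) blast
  have f: "f (inv f a) = a" if "a \<in> {1..ADE_rank X}" for a
    using bij_betw_inv_into_right[OF X(2) that] .
  have inv: "inv f (f \<nu>) = \<nu>" for \<nu> using X(2) by (simp add: bij_betw_def)
  have fV: "f \<nu> \<in> {1..ADE_rank X}" for \<nu> using bij_betwE[OF X(2)] by simp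
  have *: "P (inv f (f \<nu>)) \<longleftrightarrow> P (inv f 1)" for \<nu>
  proof (rule ADE_connected[OF X(1), of "\<lambda>a. P (inv f a)"])
    fix a b assume "a \<in> {1..ADE_rank X}" "b \<in> {1..ADE_rank X}" "ADE_adj X a b"
    then have "adj (inv f a) (inv f b)" using X(3) f by simp
    then show "P (inv f a) \<longleftrightarrow> P (inv f b)" using assms(1) adj_sym by blast
  qed (rule fV)
  show ?thesis using *[of \<iota>] *[of \<kappa>] assms(2) by (simp add: inv)
qed

lemma subadditive:
  obtains u :: "'v \<Rightarrow> int" where "\<And>\<iota>. 0 < u \<iota>" "\<And>\<iota>. (\<Sum>\<kappa> | adj \<iota> \<kappa>. u \<kappa>) \<le> 2 * u \<iota>"
    "\<exists>\<iota>. (\<Sum>\<kappa> | adj \<iota> \<kappa>. u \<kappa>) < 2 * u \<iota>"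
proof -
  obtain X f where X: "ADE_admissible X" "bij_betw f UNIV {1..ADE_rank X}"
    "\<And>\<iota> \<kappa>. adj \<iota> \<kappa> \<longleftrightarrow> ADE_adj X (f \<iota>) (f \<kappa>)" by (rule labelling) blast
  obtain u :: "nat \<Rightarrow> int" where u':
    "(\<forall>a \<in> {1..ADE_rank X}. 0 < u a \<and> (\<Sum>b | b \<in> {1..ADE_rank X} \<and> ADE_adj X a b. u b) \<le> 2 * u a) \<and>
    (\<exists>a \<in> {1..ADE_rank X}. (\<Sum>b | b \<in> {1..ADE_rank X} \<and> ADE_adj X a b. u b) < 2 * u a)"
    by (rule exE[OF ADE_subadditive[OF X(1)]])
  note u = u'[THEN conjunct1, rule_format, THEN conjunct1] u'[THEN conjunct1, rule_format, THEN conjunct2]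
    u'[THEN conjunct2]
  have fV: "f \<nu> \<in> {1..ADE_rank X}" for \<nu> using bij_betwE[OF X(2)] by simp
  have f: "f (inv f a) = a" if "a \<in> {1..ADE_rank X}" for a
    using bij_betw_inv_into_right[OF X(2) that] .
  have inj: "inj f" using X(2) by (simp add: bij_betw_def)
  have "f ` {\<kappa>. adj \<iota> \<kappa>} = {b. b \<in> {1..ADE_rank X} \<and> ADE_adj X (f \<iota>) b}" for \<iota>
  proof (intro set_eqI iffI)
    fix b assume "b \<in> {b. b \<in> {1..ADE_rank X} \<and> ADE_adj X (f \<iota>) b}"
    then show "b \<in> f ` {\<kappa>. adj \<iota> \<kappa>}"
      using f[of b] X(3)[of \<iota> "inv f b"] by (intro image_eqI[of _ _ "inv f b"]) auto
  qed (use fV X(3) in auto)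
  then have "bij_betw f {\<kappa>. adj \<iota> \<kappa>} {b. b \<in> {1..ADE_rank X} \<and> ADE_adj X (f \<iota>) b}" for \<iota>
    using inj by (auto simp: bij_betw_def inj_on_def)
  then have s: "(\<Sum>\<kappa> | adj \<iota> \<kappa>. u (f \<kappa>)) = (\<Sum>b | b \<in> {1..ADE_rank X} \<and> ADE_adj X (f \<iota>) b. u b)" for \<iota>
    by (rule sum.reindex_bij_betw)
  show thesis
  proof (rule that[of "\<lambda>\<iota>. u (f \<iota>)"])
    obtain a where "a \<in> {1..ADE_rank X}" "(\<Sum>b | b \<in> {1..ADE_rank X} \<and> ADE_adj X a b. u b) < 2 * u a"
      using u(3) by blast
    then show "\<exists>\<iota>. (\<Sum>\<kappa> | adj \<iota> \<kappa>. u (f \<kappa>)) < 2 * u (f \<iota>)"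
      using f by (intro exI[of _ "inv f a"]) (simp add: s)
  qed (use u fV s in auto)
qed

lemma automorphism:
  assumes "bij g" "\<And>\<iota> \<kappa>. adj (g \<iota>) (g \<kappa>) \<longleftrightarrow> adj \<iota> \<kappa>"
  shows "(\<forall>\<iota>. g (g \<iota>) = \<iota>) \<or>
    (\<forall>\<iota>. g (g (g \<iota>)) = \<iota> \<and> (g \<iota> \<noteq> \<iota> \<longrightarrow> (\<exists>\<kappa>. adj \<iota> \<kappa> \<and> g \<kappa> = \<kappa>)))"
proof -
  obtain X f where X: "ADE_admissible X" "bij_betw f UNIV {1..ADE_rank X}"
    "\<And>\<iota> \<kappa>. adj \<iota> \<kappa> \<longleftrightarrow> ADE_adj X (f \<iota>) (f \<kappa>)" by (rule labelling) blast
  define V where "V = {1..ADE_rank X}"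
  have fV: "f \<nu> \<in> V" for \<nu> using bij_betwE[OF X(2)] by (simp add: V_def)
  have f: "f (inv f a) = a" if "a \<in> V" for a
    using bij_betw_inv_into_right[OF X(2)] that by (simp add: V_def)
  have inv: "inv f (f \<nu>) = \<nu>" for \<nu> using X(2) by (simp add: bij_betw_def)
  have eq: "f \<nu> = f \<mu> \<longleftrightarrow> \<nu> = \<mu>" for \<nu> \<mu> using inv by metis
  define h where "h a = f (g (inv f a))" for a
  have b1: "bij_betw (inv f) V UNIV"
    using X(2) unfolding V_def by (rule bij_betw_inv_into)
  have "bij_betw (f \<circ> (g \<circ> inv f)) V V"
    using bij_betw_trans[OF bij_betw_trans[OF b1 assms(1)] X(2)] by (simp add: V_def comp_assoc)
  then have "bij_betw h V V" unfolding h_def by (simp add: comp_def)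
  moreover have "ADE_adj X (h a) (h b) \<longleftrightarrow> ADE_adj X a b" if "a \<in> V" "b \<in> V" for a b
    using that f by (simp add: h_def X(3)[symmetric] assms(2)) (simp add: X(3))
  ultimately have "(\<forall>a\<in>V. h (h a) = a) \<or>
    (\<forall>a\<in>V. h (h (h a)) = a \<and> (h a \<noteq> a \<longrightarrow> (\<exists>c\<in>V. ADE_adj X a c \<and> h c = c)))"
    using X(1) unfolding V_def by (intro ADE_automorphism)
  then show ?thesis
  proof
    assume *: "\<forall>a\<in>V. h (h a) = a"
    have "g (g \<iota>) = \<iota>" for \<iota>
      using *[rule_format, OF fV[of \<iota>]] by (simp add: h_def inv eq)
    then show ?thesis by blast
  next
    assume *: "\<forall>a\<in>V. h (h (h a)) = a \<and> (h a \<noteq> a \<longrightarrow> (\<exists>c\<in>V. ADE_adj X a c \<and> h c = c))"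
    have "g (g (g \<iota>)) = \<iota> \<and> (g \<iota> \<noteq> \<iota> \<longrightarrow> (\<exists>\<kappa>. adj \<iota> \<kappa> \<and> g \<kappa> = \<kappa>))" for \<iota>
    proof -
      have "g (g (g \<iota>)) = \<iota>" using *[rule_format, OF fV[of \<iota>]] by (simp add: h_def inv eq)
      moreover have "\<exists>\<kappa>. adj \<iota> \<kappa> \<and> g \<kappa> = \<kappa>" if "g \<iota> \<noteq> \<iota>"
      proof -
        have "h (f \<iota>) \<noteq> f \<iota>" using that by (simp add: h_def inv eq)
        then obtain c where c: "c \<in> V" "ADE_adj X (f \<iota>) c" "h c = c"
          using *[rule_format, OF fV[of \<iota>]] by blast
        then show ?thesis using f[of c] eq
          by (intro exI[of _ "inv f c"]) (metis X(3) h_def)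
      qed
      ultimately show ?thesis by blast
    qed
    then show ?thesis by blast
  qed
qed

section \<open>The root system\<close>

lemma simple_root_sym: "simple_root \<iota> \<kappa> = simple_root \<kappa> \<iota>"
  by (simp add: simple_root_def adj_sym)

text \<open>Elements of the root lattice are handled through their coordinates on the simple roots.\<close>

definition of_coords :: "('v \<Rightarrow> int) \<Rightarrow> 'v \<Rightarrow> int" where
  "of_coords m = (\<lambda>\<kappa>. \<Sum>\<iota>\<in>UNIV. m \<iota> * simple_root \<iota> \<kappa>)"

definition pairing :: "('v \<Rightarrow> int) \<Rightarrow> ('v \<Rightarrow> int) \<Rightarrow> int" where
  "pairing m l = (\<Sum>\<kappa>\<in>UNIV. m \<kappa> * l \<kappa>)"

abbreviation form :: "('v \<Rightarrow> int) \<Rightarrow> ('v \<Rightarrow> int) \<Rightarrow> int" where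
  "form m n \<equiv> pairing m (of_coords n)"

lemma of_coords_apply: "of_coords m \<iota> = 2 * m \<iota> - (\<Sum>\<kappa> | adj \<iota> \<kappa>. m \<kappa>)"
proof -
  have "of_coords m \<iota> = (\<Sum>\<kappa>\<in>UNIV. (if \<kappa> = \<iota> then 2 * m \<iota> else 0) - (if adj \<iota> \<kappa> then m \<kappa> else 0))"
    unfolding of_coords_def by (intro sum.cong) (auto simp: simple_root_def adj_sym)
  also have "\<dots> = 2 * m \<iota> - (\<Sum>\<kappa>\<in>UNIV. if adj \<iota> \<kappa> then m \<kappa> else 0)"
    by (simp add: sum_subtractf)
  finally show ?thesis by (simp add: sum.If_cases)
qed

lemma of_coords_add: "of_coords (\<lambda>\<kappa>. m \<kappa> + n \<kappa>) = (\<lambda>\<kappa>. of_coords m \<kappa> + of_coords n \<kappa>)"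
  by (simp add: of_coords_def sum.distrib distrib_right)

lemma of_coords_diff: "of_coords (\<lambda>\<kappa>. m \<kappa> - n \<kappa>) = (\<lambda>\<kappa>. of_coords m \<kappa> - of_coords n \<kappa>)"
  by (simp add: of_coords_def sum_subtractf left_diff_distrib)

lemma of_coords_scale: "of_coords (\<lambda>\<kappa>. c * m \<kappa>) = (\<lambda>\<kappa>. c * of_coords m \<kappa>)"
  by (simp add: of_coords_def sum_distrib_left mult.assoc)

lemma of_coords_uminus: "of_coords (- m) = - of_coords m"
  by (simp add: of_coords_def sum_negf fun_eq_iff)

lemma pairing_diff_left: "pairing (\<lambda>\<kappa>. m \<kappa> - n \<kappa>) l = pairing m l - pairing n l"
  by (simp add: pairing_def sum_subtractf left_diff_distrib)

lemma pairing_scale_left: "pairing (\<lambda>\<kappa>. c * m \<kappa>) l = c * pairing m l"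
  by (simp add: pairing_def sum_distrib_left mult.assoc)

lemma pairing_uminus_left: "pairing (- m) l = - pairing m l"
  by (simp add: pairing_def sum_negf)

lemma pairing_diff_right: "pairing m (\<lambda>\<kappa>. l \<kappa> - k \<kappa>) = pairing m l - pairing m k"
  by (simp add: pairing_def sum_subtractf right_diff_distrib)

lemma pairing_scale_right: "pairing m (\<lambda>\<kappa>. c * l \<kappa>) = c * pairing m l"
  by (simp add: pairing_def sum_distrib_left mult.left_commute)

lemma pairing_uminus_right: "pairing m (- l) = - pairing m l"
  by (simp add: pairing_def sum_negf)

lemma pairing_simple_root: "pairing m (simple_root \<iota>) = of_coords m \<iota>"
  by (simp add: pairing_def of_coords_def simple_root_sym)

lemma form_sym: "form m n = form n m"
  unfolding pairing_def of_coords_def sum_distrib_left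
  by (subst sum.swap) (simp add: mult.left_commute mult.commute simple_root_sym)

abbreviation unit :: "'v \<Rightarrow> 'v \<Rightarrow> int" where
  "unit \<equiv> fund_weight"

lemma pairing_unit: "pairing (unit \<iota>) l = l \<iota>"
  by (simp add: pairing_def fund_weight_def)

lemma of_coords_unit: "of_coords (unit \<iota>) = simple_root \<iota>"
  by (simp add: of_coords_def fund_weight_def)

definition coord_refl :: "'v \<Rightarrow> ('v \<Rightarrow> int) \<Rightarrow> 'v \<Rightarrow> int" where
  "coord_refl \<iota> m = (\<lambda>\<kappa>. m \<kappa> - of_coords m \<iota> * unit \<iota> \<kappa>)"

lemma of_coords_coord_refl: "of_coords (coord_refl \<iota> m) = simple_refl \<iota> (of_coords m)"
  by (simp add: coord_refl_def simple_refl_def of_coords_diff of_coords_scale of_coords_unit)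

lemma pairing_refl: "pairing (coord_refl \<iota> m) (simple_refl \<iota> l) = pairing m l"
  by (simp add: coord_refl_def simple_refl_def pairing_diff_left pairing_diff_right
      pairing_scale_left pairing_scale_right pairing_unit pairing_simple_root
      of_coords_unit)
    (simp add: simple_root_def algebra_simps)

lemma simple_refl_invol [simp]: "simple_refl \<iota> (simple_refl \<iota> l) = l"
  by (simp add: simple_refl_def fun_eq_iff) (simp add: simple_root_def)

lemma coord_refl_invol [simp]: "coord_refl \<iota> (coord_refl \<iota> m) = m"
proof -
  have "of_coords (coord_refl \<iota> m) \<iota> = - of_coords m \<iota>"
    by (simp add: of_coords_coord_refl simple_refl_def simple_root_def)
  then show ?thesis by (subst coord_refl_def) (simp add: coord_refl_def fun_eq_iff)
qed

text \<open>The form is positive definite since, for the weights of \<open>subadditive\<close>, it is the sum of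
  the squares \<open>u\<^sub>\<iota> u\<^sub>\<kappa> (x\<^sub>\<iota> / u\<^sub>\<iota> - x\<^sub>\<kappa> / u\<^sub>\<kappa>)\<^sup>2\<close> over the edges and of the nonnegative
  terms \<open>(2 u\<^sub>\<iota> - \<Sum>\<^sub>\<kappa> u\<^sub>\<kappa>) x\<^sub>\<iota>\<^sup>2 / u\<^sub>\<iota>\<close>.\<close>

definition real_form :: "('v \<Rightarrow> real) \<Rightarrow> real" where
  "real_form x = (\<Sum>\<iota>\<in>UNIV. 2 * (x \<iota>)\<^sup>2) - (\<Sum>\<iota>\<in>UNIV. \<Sum>\<kappa> | adj \<iota> \<kappa>. x \<iota> * x \<kappa>)"

lemma real_form_pos:
  assumes "x \<noteq> (\<lambda>_. 0)"
  shows "0 < real_form x"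
proof -
  obtain u0 :: "'v \<Rightarrow> int" where u0: "\<And>\<iota>. 0 < u0 \<iota>" "\<And>\<iota>. (\<Sum>\<kappa> | adj \<iota> \<kappa>. u0 \<kappa>) \<le> 2 * u0 \<iota>"
    "\<exists>\<iota>. (\<Sum>\<kappa> | adj \<iota> \<kappa>. u0 \<kappa>) < 2 * u0 \<iota>" proof (rule subadditive)
    fix u assume "\<And>\<iota>. 0 < (u :: 'v \<Rightarrow> int) \<iota>" "\<And>\<iota>. (\<Sum>\<kappa> | adj \<iota> \<kappa>. u \<kappa>) \<le> 2 * u \<iota>"
      "\<exists>\<iota>. (\<Sum>\<kappa> | adj \<iota> \<kappa>. u \<kappa>) < 2 * u \<iota>"
    then show thesis by (rule that)
  qed
  define u :: "'v \<Rightarrow> real" where "u \<iota> = real_of_int (u0 \<iota>)" for \<iota>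
  define c where "c \<iota> = 2 * u \<iota> - (\<Sum>\<kappa> | adj \<iota> \<kappa>. u \<kappa>)" for \<iota>
  have c_int: "c \<iota> = real_of_int (2 * u0 \<iota> - (\<Sum>\<kappa> | adj \<iota> \<kappa>. u0 \<kappa>))" for \<iota>
    by (simp add: c_def u_def)
  have u: "0 < u \<iota>" for \<iota> using u0(1) by (simp add: u_def)
  have c: "0 \<le> c \<iota>" for \<iota> unfolding c_int using u0(2)[of \<iota>] by (simp del: of_int_diff)
  obtain \<iota>0 where \<iota>0: "0 < c \<iota>0" unfolding c_int using u0(3) by (auto simp del: of_int_diff)
  define q where "q \<iota> \<kappa> = u \<iota> * u \<kappa> * (x \<iota> / u \<iota> - x \<kappa> / u \<kappa>)\<^sup>2" for \<iota> \<kappa>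
  have q0: "0 \<le> q \<iota> \<kappa>" for \<iota> \<kappa> using u[of \<iota>] u[of \<kappa>] by (simp add: q_def)
  have q_exp: "q \<iota> \<kappa> = u \<kappa> * (x \<iota>)\<^sup>2 / u \<iota> + u \<iota> * (x \<kappa>)\<^sup>2 / u \<kappa> - 2 * (x \<iota> * x \<kappa>)" for \<iota> \<kappa>
    using u[of \<iota>] u[of \<kappa>] unfolding q_def by (simp add: power2_eq_square field_simps)
  have sw: "(\<Sum>\<iota>\<in>UNIV. \<Sum>\<kappa> | adj \<iota> \<kappa>. u \<iota> * (x \<kappa>)\<^sup>2 / u \<kappa>) =
    (\<Sum>\<iota>\<in>UNIV. \<Sum>\<kappa> | adj \<iota> \<kappa>. u \<kappa> * (x \<iota>)\<^sup>2 / u \<iota>)"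
    using sum.swap_restrict[of UNIV UNIV "\<lambda>\<iota> \<kappa>. u \<iota> * (x \<kappa>)\<^sup>2 / u \<kappa>" adj] by (simp add: adj_sym)
  have e1: "(\<Sum>\<iota>\<in>UNIV. \<Sum>\<kappa> | adj \<iota> \<kappa>. q \<iota> \<kappa>) =
    2 * (\<Sum>\<iota>\<in>UNIV. \<Sum>\<kappa> | adj \<iota> \<kappa>. u \<kappa> * (x \<iota>)\<^sup>2 / u \<iota>) - 2 * (\<Sum>\<iota>\<in>UNIV. \<Sum>\<kappa> | adj \<iota> \<kappa>. x \<iota> * x \<kappa>)"
    unfolding q_exp sum_subtractf sum.distrib sw by (simp add: sum_distrib_left)
  have e2: "(\<Sum>\<iota>\<in>UNIV. c \<iota> * (x \<iota>)\<^sup>2 / u \<iota>) = (\<Sum>\<iota>\<in>UNIV. 2 * (x \<iota>)\<^sup>2) -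
    (\<Sum>\<iota>\<in>UNIV. \<Sum>\<kappa> | adj \<iota> \<kappa>. u \<kappa> * (x \<iota>)\<^sup>2 / u \<iota>)"
    unfolding c_def sum_subtractf[symmetric]
  proof (rule sum.cong)
    fix \<iota>
    have "(\<Sum>\<kappa> | adj \<iota> \<kappa>. u \<kappa> * (x \<iota>)\<^sup>2 / u \<iota>) = (\<Sum>\<kappa> | adj \<iota> \<kappa>. u \<kappa>) * ((x \<iota>)\<^sup>2 / u \<iota>)"
      unfolding sum_distrib_right by simp
    then show "(2 * u \<iota> - (\<Sum>\<kappa> | adj \<iota> \<kappa>. u \<kappa>)) * (x \<iota>)\<^sup>2 / u \<iota> =
      2 * (x \<iota>)\<^sup>2 - (\<Sum>\<kappa> | adj \<iota> \<kappa>. u \<kappa> * (x \<iota>)\<^sup>2 / u \<iota>)"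
      using u[of \<iota>] by (simp add: field_simps)
  qed simp
  have eq: "2 * real_form x = (\<Sum>\<iota>\<in>UNIV. \<Sum>\<kappa> | adj \<iota> \<kappa>. q \<iota> \<kappa>) + 2 * (\<Sum>\<iota>\<in>UNIV. c \<iota> * (x \<iota>)\<^sup>2 / u \<iota>)"
    unfolding real_form_def e1 e2 by argo
  have t0: "0 \<le> c \<iota> * (x \<iota>)\<^sup>2 / u \<iota>" for \<iota> using c[of \<iota>] u[of \<iota>] by simp
  have s0: "0 \<le> (\<Sum>\<iota>\<in>UNIV. \<Sum>\<kappa> | adj \<iota> \<kappa>. q \<iota> \<kappa>)" "0 \<le> (\<Sum>\<iota>\<in>UNIV. c \<iota> * (x \<iota>)\<^sup>2 / u \<iota>)"
    using q0 t0 by (auto intro!: sum_nonneg)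
  show ?thesis
  proof (rule ccontr)
    \<comment> \<open>Both nonnegative parts vanish. Hence \<open>x\<close> is zero at the vertex
      where the subadditive inequality is strict, and the edge squares carry this zero to all
      neighbours.\<close>
    assume "\<not> 0 < real_form x"
    then have z: "(\<Sum>\<iota>\<in>UNIV. \<Sum>\<kappa> | adj \<iota> \<kappa>. q \<iota> \<kappa>) = 0" "(\<Sum>\<iota>\<in>UNIV. c \<iota> * (x \<iota>)\<^sup>2 / u \<iota>) = 0"
      using eq s0 by linarith+
    have "c \<iota>0 * (x \<iota>0)\<^sup>2 / u \<iota>0 = 0"
      using z(2) t0 by (subst (asm) sum_nonneg_eq_0_iff) auto
    then have x0: "x \<iota>0 = 0" using \<iota>0 u[of \<iota>0] by simp
    have "q \<iota> \<kappa> = 0" if "adj \<iota> \<kappa>" for \<iota> \<kappa>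
    proof -
      have "(\<Sum>\<kappa> | adj \<iota> \<kappa>. q \<iota> \<kappa>) = 0"
        using z(1) q0 by (subst (asm) sum_nonneg_eq_0_iff) (auto intro!: sum_nonneg)
      then show ?thesis using that q0 by (subst (asm) sum_nonneg_eq_0_iff) auto
    qed
    then have step: "x \<kappa> = 0" if "adj \<iota> \<kappa>" "x \<iota> = 0" for \<iota> \<kappa>
      using that u[of \<iota>] u[of \<kappa>] by (fastforce simp: q_def)
    have "x \<kappa> = 0" for \<kappa> by (rule adj_connected[of "\<lambda>\<kappa>. x \<kappa> = 0", OF _ x0]) (rule step)
    then show False using assms by auto
  qed
qed

lemma real_form_of_int: "real_form (\<lambda>\<kappa>. real_of_int (m \<kappa>)) = real_of_int (form m m)"
proof -
  have "form m m = (\<Sum>\<iota>\<in>UNIV. 2 * (m \<iota>)\<^sup>2) - (\<Sum>\<iota>\<in>UNIV. \<Sum>\<kappa> | adj \<iota> \<kappa>. m \<iota> * m \<kappa>)"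
    unfolding pairing_def of_coords_apply sum_subtractf[symmetric]
    by (intro sum.cong) (auto simp: algebra_simps power2_eq_square sum_distrib_left)
  then show ?thesis by (simp add: real_form_def)
qed

lemma form_pos: "m \<noteq> (\<lambda>_. 0) \<Longrightarrow> 0 < form m m"
proof -
  assume "m \<noteq> (\<lambda>_. 0)"
  then have "(\<lambda>\<kappa>. real_of_int (m \<kappa>)) \<noteq> (\<lambda>_. 0)" by (auto simp: fun_eq_iff)
  then have "0 < real_of_int (form m m)" unfolding real_form_of_int[symmetric] by (rule real_form_pos)
  then show ?thesis by simp
qed

text \<open>The diagonal contributes even terms and each edge is counted twice. The labelling serves
  to orient the edges.\<close>

lemma form_even: "even (form m m)"
proof -
  define e where "e = (\<Sum>\<iota>\<in>UNIV. \<Sum>\<kappa> | adj \<iota> \<kappa>. m \<iota> * m \<kappa>)"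
  have "even e"
  proof -
    obtain X f where X: "bij_betw f (UNIV :: 'v set) {1..ADE_rank X}"
      by (rule labelling)
    then have inj: "f \<iota> = f \<kappa> \<Longrightarrow> \<iota> = \<kappa>" for \<iota> \<kappa> by (metis bij_betw_inv_into_left UNIV_I)
    have "e = (\<Sum>\<iota>\<in>UNIV. (\<Sum>\<kappa> | adj \<iota> \<kappa> \<and> f \<iota> < f \<kappa>. m \<iota> * m \<kappa>) + (\<Sum>\<kappa> | adj \<iota> \<kappa> \<and> f \<kappa> < f \<iota>. m \<iota> * m \<kappa>))"
      unfolding e_def
    proof (intro sum.cong refl)
      fix \<iota>
      have *: "{\<kappa>. adj \<iota> \<kappa>} = {\<kappa>. adj \<iota> \<kappa> \<and> f \<iota> < f \<kappa>} \<union> {\<kappa>. adj \<iota> \<kappa> \<and> f \<kappa> < f \<iota>}"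
        using inj adj_irrefl less_linear by blast
      show "(\<Sum>\<kappa> | adj \<iota> \<kappa>. m \<iota> * m \<kappa>) = (\<Sum>\<kappa> | adj \<iota> \<kappa> \<and> f \<iota> < f \<kappa>. m \<iota> * m \<kappa>) +
        (\<Sum>\<kappa> | adj \<iota> \<kappa> \<and> f \<kappa> < f \<iota>. m \<iota> * m \<kappa>)"
        by (subst *, rule sum.union_disjoint) auto
    qed
    also have "\<dots> = 2 * (\<Sum>\<iota>\<in>UNIV. \<Sum>\<kappa> | adj \<iota> \<kappa> \<and> f \<iota> < f \<kappa>. m \<iota> * m \<kappa>)"
      unfolding sum.distrib
      using sum.swap_restrict[of UNIV UNIV "\<lambda>\<iota> \<kappa>. m \<iota> * m \<kappa>" "\<lambda>\<iota> \<kappa>. adj \<iota> \<kappa> \<and> f \<kappa> < f \<iota>"]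
      by (simp add: adj_sym mult.commute)
    finally show ?thesis by simp
  qed
  moreover have "form m m = (\<Sum>\<iota>\<in>UNIV. 2 * (m \<iota>)\<^sup>2) - e"
    unfolding pairing_def of_coords_apply e_def sum_subtractf[symmetric]
    by (intro sum.cong) (auto simp: algebra_simps power2_eq_square sum_distrib_left)
  ultimately show ?thesis by (simp flip: sum_distrib_left)
qed

lemma of_coords_inj: "of_coords m = of_coords n \<Longrightarrow> m = n"
proof (rule ccontr)
  assume a: "of_coords m = of_coords n" "m \<noteq> n"
  define k where "k = (\<lambda>\<kappa>. m \<kappa> - n \<kappa>)"
  have "k \<noteq> (\<lambda>_. 0)" using a(2) by (auto simp: k_def fun_eq_iff)
  then have "0 < form k k" by (rule form_pos)
  moreover have "of_coords k = (\<lambda>_. 0)" by (simp add: k_def of_coords_diff a(1))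
  ultimately show False by (simp add: pairing_def)
qed


lemma minus_minus_weight [simp]: "- (- l) = (l :: 'v \<Rightarrow> int)"
  by (simp add: fun_Compl_def)

lemma uminus_weight_eq_iff [simp]: "- l = - k \<longleftrightarrow> l = (k :: 'v \<Rightarrow> int)"
  by (simp add: fun_eq_iff)

text \<open>The minimum over the compact unit sphere, extended by homogeneity. It bounds the
  coefficients of integral vectors of norm 2 and so yields the finiteness of the root
  system.\<close>

lemma real_form_lower_bound: "\<exists>c>0. \<forall>x. c * (\<Sum>\<iota>\<in>UNIV. (x \<iota>)\<^sup>2) \<le> real_form x"
proof -
  define f where "f v = real_form (\<lambda>\<iota>. v $ \<iota>)" for v :: "real ^ 'v"
  have "continuous_on (sphere 0 1) f"
    unfolding f_def real_form_def by (intro continuous_intros)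
  moreover have "sphere (0 :: real ^ 'v) 1 \<noteq> {}"
    by (metis norm_axis_1 mem_sphere_0 empty_iff)
  ultimately obtain v0 where v0: "norm v0 = 1" "\<And>v. norm v = 1 \<Longrightarrow> f v0 \<le> f v"
    using continuous_attains_inf[of "sphere 0 1" f] by auto
  have "(\<lambda>\<iota>. v0 $ \<iota>) \<noteq> (\<lambda>_. 0)"
  proof
    assume "(\<lambda>\<iota>. v0 $ \<iota>) = (\<lambda>_. 0)"
    then have "v0 = 0" by (simp add: vec_eq_iff fun_eq_iff)
    then show False using v0(1) by simp
  qed
  then have pos: "0 < f v0" unfolding f_def by (rule real_form_pos)
  have "f v0 * (\<Sum>\<iota>\<in>UNIV. (x \<iota>)\<^sup>2) \<le> real_form x" for x
  proof (cases "x = (\<lambda>_. 0)")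
    case True
    then show ?thesis by (simp add: real_form_def)
  next
    case False
    define v :: "real ^ 'v" where "v = (\<chi> \<iota>. x \<iota>)"
    have "v \<noteq> 0" using False by (auto simp: v_def vec_eq_iff)
    define t where "t = norm v"
    have t: "t > 0" using \<open>v \<noteq> 0\<close> by (simp add: t_def)
    have t2: "t\<^sup>2 = (\<Sum>\<iota>\<in>UNIV. (x \<iota>)\<^sup>2)"
      by (simp add: t_def v_def norm_vec_def L2_set_def sum_nonneg)
    have "f v0 \<le> f ((1 / t) *\<^sub>R v)" using t by (intro v0(2)) (simp add: t_def)
    also have "\<dots> = real_form x / t\<^sup>2"
      unfolding f_def real_form_def v_def
      by (simp add: diff_divide_distrib sum_divide_distrib power_divide power2_eq_square)
    finally show ?thesis using t unfolding t2[symmetric] by (simp add: field_simps)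
  qed
  then show ?thesis using pos by blast
qed

subsection \<open>Words in the simple reflections\<close>

lemma word_refl_Nil [simp]: "word_refl [] = id"
  by (simp add: word_refl_def)

lemma word_refl_Cons [simp]: "word_refl (\<iota> # is) l = simple_refl \<iota> (word_refl is l)"
  by (simp add: word_refl_def)

lemma word_refl_append [simp]: "word_refl (xs @ ys) l = word_refl xs (word_refl ys l)"
  by (induction xs) simp_all

lemma word_refl_rev [simp]:
  "word_refl (rev is) (word_refl is l) = l" "word_refl is (word_refl (rev is) l) = l"
  by (induction "is" arbitrary: l) simp_all

lemma word_refl_eq_iff: "word_refl is l = word_refl is k \<longleftrightarrow> l = k"
  by (metis word_refl_rev(1))

lemma word_refl_in_weyl: "word_refl is \<in> weyl"
  by (simp add: weyl_def)

lemma simple_refl_linear: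
  "simple_refl \<iota> (\<lambda>\<kappa>. a * l \<kappa> + b * k \<kappa>) = (\<lambda>\<kappa>. a * simple_refl \<iota> l \<kappa> + b * simple_refl \<iota> k \<kappa>)"
  by (simp add: simple_refl_def fun_eq_iff algebra_simps)

lemma word_refl_linear:
  "word_refl is (\<lambda>\<kappa>. a * l \<kappa> + b * k \<kappa>) = (\<lambda>\<kappa>. a * word_refl is l \<kappa> + b * word_refl is k \<kappa>)"
  by (induction "is") (simp_all add: simple_refl_linear)

lemma word_refl_scale: "word_refl is (\<lambda>\<kappa>. a * l \<kappa>) = (\<lambda>\<kappa>. a * word_refl is l \<kappa>)"
  using word_refl_linear[of "is" a l 0 l] by simp

lemma word_refl_diff: "word_refl is (\<lambda>\<kappa>. l \<kappa> - k \<kappa>) = (\<lambda>\<kappa>. word_refl is l \<kappa> - word_refl is k \<kappa>)"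
  using word_refl_linear[of "is" 1 l "-1" k] by simp

lemma word_refl_uminus: "word_refl is (- l) = - word_refl is l"
  using word_refl_linear[of "is" "-1" l 0 l] by (simp add: fun_Compl_def)

definition coord_word :: "'v list \<Rightarrow> ('v \<Rightarrow> int) \<Rightarrow> 'v \<Rightarrow> int" where
  "coord_word is m = foldr coord_refl is m"

lemma coord_word_Nil [simp]: "coord_word [] m = m"
  by (simp add: coord_word_def)

lemma coord_word_Cons [simp]: "coord_word (\<iota> # is) m = coord_refl \<iota> (coord_word is m)"
  by (simp add: coord_word_def)

lemma coord_word_append [simp]: "coord_word (xs @ ys) m = coord_word xs (coord_word ys m)"
  by (simp add: coord_word_def)

lemma of_coords_word: "of_coords (coord_word is m) = word_refl is (of_coords m)"
  by (induction "is") (simp_all add: of_coords_coord_refl)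

lemma pairing_word: "pairing (coord_word is m) (word_refl is l) = pairing m l"
  by (induction "is") (simp_all add: pairing_refl)

lemma coord_word_rev [simp]:
  "coord_word (rev is) (coord_word is m) = m" "coord_word is (coord_word (rev is) m) = m"
  by (induction "is" arbitrary: m) simp_all

lemma coord_refl_linear:
  "coord_refl \<iota> (\<lambda>\<kappa>. a * m \<kappa> + b * n \<kappa>) = (\<lambda>\<kappa>. a * coord_refl \<iota> m \<kappa> + b * coord_refl \<iota> n \<kappa>)"
  by (simp add: coord_refl_def of_coords_add of_coords_scale fun_eq_iff algebra_simps)

lemma coord_word_linear:
  "coord_word is (\<lambda>\<kappa>. a * m \<kappa> + b * n \<kappa>) = (\<lambda>\<kappa>. a * coord_word is m \<kappa> + b * coord_word is n \<kappa>)"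
  by (induction "is") (simp_all add: coord_refl_linear)

lemma coord_word_uminus: "coord_word is (- m) = - coord_word is m"
  using coord_word_linear[of "is" "-1" m 0 m] by (simp add: fun_Compl_def)

text \<open>Invariance of the pairing gives the coefficient at \<open>\<kappa>\<close> the same sign
  as the image of the simple root, so the two signs cancel in the reflection.\<close>

lemma word_refl_conj:
  assumes "word_refl is (simple_root \<iota>) = simple_root \<kappa> \<or> word_refl is (simple_root \<iota>) = - simple_root \<kappa>"
  shows "word_refl is (simple_refl \<iota> l) = simple_refl \<kappa> (word_refl is l)"
proof -
  have "of_coords (coord_word is (unit \<iota>)) = of_coords (unit \<kappa>) \<or>
    of_coords (coord_word is (unit \<iota>)) = of_coords (- unit \<kappa>)"
    using assms by (simp add: of_coords_word of_coords_unit of_coords_uminus)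
  then have "coord_word is (unit \<iota>) = unit \<kappa> \<or> coord_word is (unit \<iota>) = - unit \<kappa>"
    using of_coords_inj by blast
  moreover have "pairing (coord_word is (unit \<iota>)) (word_refl is l) = l \<iota>"
    by (simp add: pairing_word pairing_unit)
  ultimately have *: "word_refl is (simple_root \<iota>) = simple_root \<kappa> \<and> word_refl is l \<kappa> = l \<iota> \<or>
    word_refl is (simple_root \<iota>) = - simple_root \<kappa> \<and> word_refl is l \<kappa> = - l \<iota>"
    by (auto simp: of_coords_word[symmetric] of_coords_unit[symmetric] pairing_unit
      pairing_uminus_left of_coords_uminus)
  have "word_refl is (simple_refl \<iota> l) = (\<lambda>\<nu>. word_refl is l \<nu> - l \<iota> * word_refl is (simple_root \<iota>) \<nu>)"
    by (simp add: simple_refl_def word_refl_diff word_refl_scale)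
  then show ?thesis using * by (auto simp: simple_refl_def)
qed

subsection \<open>Positive and negative roots\<close>

definition root_coords :: "('v \<Rightarrow> int) set" where
  "root_coords = {coord_word is (unit \<iota>) | is \<iota>. True}"

definition pos_coords :: "('v \<Rightarrow> int) set" where
  "pos_coords = {m \<in> root_coords. \<forall>\<kappa>. 0 \<le> m \<kappa>}"

lemma roots_eq: "roots = of_coords ` root_coords"
proof -
  have *: "word_refl is (simple_root \<iota>) = of_coords (coord_word is (unit \<iota>))" for "is" \<iota>
    by (simp add: of_coords_word of_coords_unit)
  have "roots = {word_refl is (simple_root \<iota>) | is \<iota>. True}"
    unfolding roots_def weyl_def by blast
  then show ?thesis unfolding * root_coords_def by blast
qed

lemma unit_in_root_coords: "unit \<iota> \<in> root_coords"
proof -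
  have "unit \<iota> = coord_word [] (unit \<iota>)" by simp
  then show ?thesis unfolding root_coords_def by blast
qed

lemma coord_word_in_root_coords: "m \<in> root_coords \<Longrightarrow> coord_word is m \<in> root_coords"
proof -
  assume "m \<in> root_coords"
  then obtain js \<iota> where "m = coord_word js (unit \<iota>)" unfolding root_coords_def by blast
  then have "coord_word is m = coord_word (is @ js) (unit \<iota>)" by simp
  then show ?thesis unfolding root_coords_def by blast
qed

lemma coord_refl_in_root_coords: "m \<in> root_coords \<Longrightarrow> coord_refl \<iota> m \<in> root_coords"
  using coord_word_in_root_coords[of m "[\<iota>]"] by simp

lemma coord_refl_unit: "coord_refl \<iota> (unit \<iota>) = - unit \<iota>"
  by (simp add: coord_refl_def of_coords_unit fun_eq_iff simple_root_def)

lemma uminus_in_root_coords: "m \<in> root_coords \<Longrightarrow> - m \<in> root_coords"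
proof -
  assume "m \<in> root_coords"
  then obtain "is" \<iota> where "m = coord_word is (unit \<iota>)" unfolding root_coords_def by blast
  then have "- m = coord_word (is @ [\<iota>]) (unit \<iota>)" by (simp add: coord_refl_unit coord_word_uminus)
  then show ?thesis unfolding root_coords_def by blast
qed

lemma form_coord_word: "form (coord_word is m) (coord_word is n) = form m n"
  by (simp add: of_coords_word pairing_word)

lemma root_norm: "m \<in> root_coords \<Longrightarrow> form m m = 2"
  unfolding root_coords_def
  by (auto simp: form_coord_word of_coords_unit pairing_unit simple_root_def)

lemma root_nonzero: "m \<in> root_coords \<Longrightarrow> m \<noteq> (\<lambda>_. 0)"
  using root_norm[of m] by (auto simp: pairing_def)

text \<open>With disjoint supports only the off-diagonal entries of the Cartan matrix
  contribute.\<close>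

lemma form_nonpos_of_disjoint:
  assumes "\<And>\<kappa>. 0 \<le> p \<kappa>" "\<And>\<kappa>. 0 \<le> n \<kappa>" "\<And>\<kappa>. p \<kappa> = 0 \<or> n \<kappa> = 0"
  shows "form p n \<le> 0"
  unfolding pairing_def of_coords_apply
proof (rule sum_nonpos)
  fix \<iota>
  have "0 \<le> (\<Sum>\<kappa> | adj \<iota> \<kappa>. n \<kappa>)" using assms(2) by (intro sum_nonneg)
  then show "p \<iota> * (2 * n \<iota> - (\<Sum>\<kappa> | adj \<iota> \<kappa>. n \<kappa>)) \<le> 0"
    using assms(1)[of \<iota>] assms(3)[of \<iota>] by (auto simp: mult_nonneg_nonpos)
qed

text \<open>Otherwise both parts of \<open>m = p - n\<close> have norm at least 2, as the form is even.\<close>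

lemma root_sign:
  assumes "m \<in> root_coords"
  shows "(\<forall>\<kappa>. 0 \<le> m \<kappa>) \<or> (\<forall>\<kappa>. m \<kappa> \<le> 0)"
proof (rule ccontr)
  assume *: "\<not> ?thesis"
  define p where "p = (\<lambda>\<kappa>. max (m \<kappa>) 0)"
  define n where "n = (\<lambda>\<kappa>. max (- m \<kappa>) 0)"
  have m: "m = (\<lambda>\<kappa>. p \<kappa> - n \<kappa>)" by (auto simp: p_def n_def)
  have "form m m = form p p - 2 * form p n + form n n"
    unfolding m using form_sym[of p n]
    by (simp add: of_coords_diff pairing_diff_left pairing_diff_right)
  moreover have "form p n \<le> 0"
    by (rule form_nonpos_of_disjoint) (auto simp: p_def n_def)
  moreover obtain \<iota> \<kappa> where "m \<iota> < 0" "0 < m \<kappa>" using * by (auto simp: not_le)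
  then have "0 < n \<iota>" "0 < p \<kappa>" by (auto simp: n_def p_def)
  then have "n \<noteq> (\<lambda>_. 0)" "p \<noteq> (\<lambda>_. 0)" by auto
  then have "0 < form p p" "0 < form n n" by (auto intro: form_pos)
  ultimately show False
    using root_norm[OF assms] form_even[of p] form_even[of n] by presburger
qed

lemma finite_root_coords: "finite root_coords"
proof -
  obtain c where c: "c > 0" "\<And>x. c * (\<Sum>\<iota>\<in>UNIV. (x \<iota>)\<^sup>2) \<le> real_form x"
    using real_form_lower_bound by blast
  define K :: int where "K = \<lceil>2 / c\<rceil>"
  have "m \<in> Pi UNIV (\<lambda>_. {-K..K})" if "m \<in> root_coords" for m
  proof
    fix \<kappa>
    have "c * (real_of_int (m \<kappa>))\<^sup>2 \<le> c * (\<Sum>\<iota>\<in>UNIV. (real_of_int (m \<iota>))\<^sup>2)"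
      using c(1) by (intro mult_left_mono member_le_sum) auto
    also have "\<dots> \<le> 2" using c(2)[of "\<lambda>\<kappa>. real_of_int (m \<kappa>)"] root_norm[OF that] by (simp add: real_form_of_int)
    finally have "real_of_int ((m \<kappa>)\<^sup>2) \<le> 2 / c" using c(1) by (simp add: field_simps)
    then have "(m \<kappa>)\<^sup>2 \<le> K" unfolding K_def by linarith
    moreover have "\<bar>m \<kappa>\<bar> \<le> (m \<kappa>)\<^sup>2"
    proof (cases "m \<kappa> = 0")
      case False
      then have "\<bar>m \<kappa>\<bar> * 1 \<le> \<bar>m \<kappa>\<bar> * \<bar>m \<kappa>\<bar>" by (intro mult_left_mono) auto
      then show ?thesis by (simp add: power2_eq_square)
    qed simp
    ultimately show "m \<kappa> \<in> {-K..K}" by auto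
  qed
  moreover have "finite (Pi (UNIV :: 'v set) (\<lambda>_. {-K..K}))"
    unfolding PiE_UNIV_domain[symmetric] by (rule finite_PiE) auto
  ultimately show ?thesis by (meson finite_subset subsetI)
qed

lemma pos_roots_eq: "pos_roots = of_coords ` pos_coords"
proof -
  have "(\<exists>n :: 'v \<Rightarrow> nat. of_coords m = (\<lambda>\<kappa>. \<Sum>\<iota>\<in>UNIV. int (n \<iota>) * simple_root \<iota> \<kappa>)) \<longleftrightarrow> (\<forall>\<kappa>. 0 \<le> m \<kappa>)" for m
  proof
    assume "\<exists>n :: 'v \<Rightarrow> nat. of_coords m = (\<lambda>\<kappa>. \<Sum>\<iota>\<in>UNIV. int (n \<iota>) * simple_root \<iota> \<kappa>)"
    then obtain n :: "'v \<Rightarrow> nat" where "of_coords m = of_coords (\<lambda>\<iota>. int (n \<iota>))"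
      by (auto simp: of_coords_def)
    then have "m = (\<lambda>\<iota>. int (n \<iota>))" by (rule of_coords_inj)
    then show "\<forall>\<kappa>. 0 \<le> m \<kappa>" by simp
  next
    assume "\<forall>\<kappa>. 0 \<le> m \<kappa>"
    then show "\<exists>n :: 'v \<Rightarrow> nat. of_coords m = (\<lambda>\<kappa>. \<Sum>\<iota>\<in>UNIV. int (n \<iota>) * simple_root \<iota> \<kappa>)"
      by (intro exI[of _ "\<lambda>\<iota>. nat (m \<iota>)"]) (simp add: of_coords_def)
  qed
  then show ?thesis unfolding pos_roots_def roots_eq pos_coords_def by blast
qed

lemma finite_pos_roots: "finite pos_roots"
  using finite_root_coords by (simp add: pos_roots_eq pos_coords_def)

lemma pos_roots_iff: "of_coords m \<in> pos_roots \<longleftrightarrow> m \<in> pos_coords"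
  unfolding pos_roots_eq by (auto dest: of_coords_inj)

lemma neg_roots_iff: "b \<in> neg_roots \<longleftrightarrow> - b \<in> pos_roots"
  unfolding neg_roots_def by (force intro: image_eqI[of b uminus "- b"])

lemma roots_pos_or_neg:
  assumes "b \<in> roots"
  shows "b \<in> pos_roots \<or> b \<in> neg_roots"
proof -
  obtain m where m: "m \<in> root_coords" "b = of_coords m" using assms roots_eq by auto
  from root_sign[OF m(1)] show ?thesis
  proof
    assume "\<forall>\<kappa>. 0 \<le> m \<kappa>"
    then show ?thesis using m by (simp add: pos_roots_iff pos_coords_def)
  next
    assume "\<forall>\<kappa>. m \<kappa> \<le> 0"
    then have "- m \<in> pos_coords" using uminus_in_root_coords[OF m(1)] by (simp add: pos_coords_def)
    then show ?thesis using m by (simp add: neg_roots_iff pos_roots_iff of_coords_uminus[symmetric])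
  qed
qed

lemma pos_roots_subset: "b \<in> pos_roots \<Longrightarrow> b \<in> roots"
  by (simp add: pos_roots_def)

lemma pos_not_neg: "b \<in> pos_roots \<Longrightarrow> b \<notin> neg_roots"
proof
  assume b: "b \<in> pos_roots" "b \<in> neg_roots"
  then obtain m where m: "m \<in> pos_coords" "b = of_coords m" unfolding pos_roots_eq by auto
  then have "- m \<in> pos_coords"
    using b(2) by (simp add: neg_roots_iff pos_roots_iff of_coords_uminus[symmetric])
  then have "m \<kappa> = 0" for \<kappa> using m(1) unfolding pos_coords_def by (force intro: antisym)
  then have "m = (\<lambda>_. 0)" by auto
  then show False using m(1) root_nonzero by (auto simp: pos_coords_def)
qed

lemma uminus_pos_roots: "- b \<in> pos_roots \<longleftrightarrow> b \<in> neg_roots"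
  by (simp add: neg_roots_iff)

lemma uminus_neg_roots: "- b \<in> neg_roots \<longleftrightarrow> b \<in> pos_roots"
  by (simp add: neg_roots_iff)

lemma simple_root_pos: "simple_root \<iota> \<in> pos_roots"
  unfolding of_coords_unit[symmetric] pos_roots_iff
  using unit_in_root_coords[of \<iota>] by (simp add: pos_coords_def) (simp add: fund_weight_def)

lemma word_refl_roots: "b \<in> roots \<Longrightarrow> word_refl is b \<in> roots"
  using coord_word_in_root_coords unfolding roots_eq
  by (auto simp: of_coords_word[symmetric] intro!: image_eqI[OF refl])

lemma word_refl_simple_root: "word_refl is (simple_root \<iota>) \<in> roots"
  by (intro word_refl_roots pos_roots_subset simple_root_pos)

text \<open>A positive root other than \<open>unit \<iota>\<close> has a positive coefficient away
  from \<open>\<iota>\<close>, which the reflection leaves alone; by \<open>root_sign\<close> this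
  coefficient decides the sign of the image.\<close>

lemma coord_refl_pos:
  assumes "m \<in> pos_coords" "m \<noteq> unit \<iota>"
  shows "coord_refl \<iota> m \<in> pos_coords"
proof -
  have m: "m \<in> root_coords" "\<And>\<kappa>. 0 \<le> m \<kappa>" using assms(1) by (auto simp: pos_coords_def)
  have "\<exists>\<kappa>. \<kappa> \<noteq> \<iota> \<and> m \<kappa> \<noteq> 0"
  proof (rule ccontr)
    assume obt: "\<nexists>\<kappa>. \<kappa> \<noteq> \<iota> \<and> m \<kappa> \<noteq> 0"
    have z: "m \<kappa> = 0" if "\<kappa> \<noteq> \<iota>" for \<kappa> using obt that by blast
    define c where "c = m \<iota>"
    have *: "m = (\<lambda>\<kappa>. c * unit \<iota> \<kappa>)" using z by (auto simp: fund_weight_def c_def fun_eq_iff)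
    have "form m m = c * (c * 2)"
      by (simp add: * pairing_scale_left pairing_scale_right of_coords_scale of_coords_unit pairing_unit)
        (simp add: simple_root_def)
    then have "c * c = 1" using root_norm[OF m(1)] by simp
    then have "c = 1" using m(2)[of \<iota>] by (auto simp: zmult_eq_1_iff c_def)
    then show False using * assms(2) by simp
  qed
  then obtain \<kappa> where \<kappa>: "\<kappa> \<noteq> \<iota>" "m \<kappa> \<noteq> 0" by blast
  have "0 < m \<kappa>" using m(2)[of \<kappa>] \<kappa>(2) by simp
  then have "0 < coord_refl \<iota> m \<kappa>" using \<kappa>(1) by (simp add: coord_refl_def fund_weight_def)
  moreover have r: "coord_refl \<iota> m \<in> root_coords" by (rule coord_refl_in_root_coords[OF m(1)])
  ultimately have "\<forall>\<kappa>. 0 \<le> coord_refl \<iota> m \<kappa>" using root_sign[OF r] by (meson not_le)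
  then show ?thesis using r by (simp add: pos_coords_def)
qed

lemma simple_refl_pos:
  assumes "b \<in> pos_roots" "b \<noteq> simple_root \<iota>"
  shows "simple_refl \<iota> b \<in> pos_roots"
proof -
  obtain m where m: "m \<in> pos_coords" "b = of_coords m" using assms(1) pos_roots_eq by auto
  then have "m \<noteq> unit \<iota>" using assms(2) by (auto simp: of_coords_unit)
  from coord_refl_pos[OF m(1) this] show ?thesis
    by (simp add: m(2) of_coords_coord_refl[symmetric] pos_roots_iff)
qed

lemma simple_refl_simple_root: "simple_refl \<iota> (simple_root \<iota>) = - simple_root \<iota>"
  by (simp add: simple_refl_def fun_eq_iff) (simp add: simple_root_def)

lemma simple_refl_neg_imp:
  assumes "b \<in> pos_roots" "simple_refl \<iota> b \<in> neg_roots"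
  shows "b = simple_root \<iota>"
  using assms simple_refl_pos pos_not_neg by blast

subsection \<open>Reduced words and the longest element\<close>

text \<open>Peeling off letters from the left, the image of \<open>b\<close> can turn negative only
  at the moment when it equals the simple root of the letter. So every inversion shows up among the
  roots of the word.\<close>

lemma root_crossing:
  assumes "b \<in> pos_roots" "word_refl (rev is) b \<in> neg_roots"
  shows "\<exists>k < length is. b = word_root is k"
  using assms
proof (induction "is" arbitrary: b)
  case Nil
  then show ?case using pos_not_neg by simp
next
  case (Cons \<iota> "is")
  show ?case
  proof (cases "b = simple_root \<iota>")
    case True
    then show ?thesis by (intro exI[of _ 0]) (simp add: word_root_def)
  next
    case False
    then have "simple_refl \<iota> b \<in> pos_roots" using Cons.prems(1) simple_refl_pos by blast
    with Cons obtain k where k: "k < length is" "simple_refl \<iota> b = word_root is k" by auto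
    then have "b = simple_refl \<iota> (word_root is k)" by (metis simple_refl_invol)
    then show ?thesis using k by (intro exI[of _ "Suc k"]) (simp add: word_root_def)
  qed
qed

text \<open>Read from right to left, the image of the simple root starts positive and ends negative;
  the letter at which it changes sign reflects its own simple root.\<close>

lemma word_deletion:
  assumes "word_refl xs (simple_root \<kappa>) \<in> neg_roots"
  shows "\<exists>as \<iota> bs. xs = as @ \<iota> # bs \<and> word_refl bs (simple_root \<kappa>) = simple_root \<iota>"
  using assms
proof (induction xs)
  case Nil
  then show ?case using simple_root_pos pos_not_neg by simp
next
  case (Cons \<iota> xs)
  show ?case
  proof (cases "word_refl xs (simple_root \<kappa>) \<in> neg_roots")
    case True
    then obtain as \<nu> bs where "xs = as @ \<nu> # bs" "word_refl bs (simple_root \<kappa>) = simple_root \<nu>"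
      using Cons.IH by blast
    then show ?thesis by (intro exI[of _ "\<iota> # as"] exI[of _ \<nu>] exI[of _ bs]) simp
  next
    case False
    then have "word_refl xs (simple_root \<kappa>) \<in> pos_roots"
      using word_refl_simple_root roots_pos_or_neg by blast
    then have "word_refl xs (simple_root \<kappa>) = simple_root \<iota>"
      using Cons.prems simple_refl_neg_imp by simp
    then show ?thesis by (intro exI[of _ "[]"] exI[of _ \<iota>] exI[of _ xs]) simp
  qed
qed

definition minimal_word :: "'v list \<Rightarrow> bool" where
  "minimal_word is \<longleftrightarrow> (\<forall>js. word_refl js = word_refl is \<longrightarrow> length is \<le> length js)"

lemma ex_minimal_word: "\<exists>js. minimal_word js \<and> word_refl js = word_refl is \<and> length js = weyl_length (word_refl is)"
proof -
  have "\<exists>n js. length js = n \<and> word_refl js = word_refl is" by blast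
  from LeastI_ex[OF this] obtain js where js: "length js = weyl_length (word_refl is)" "word_refl js = word_refl is"
    unfolding weyl_length_def by blast
  have "minimal_word js" unfolding minimal_word_def js(1) unfolding js(2) weyl_length_def
    by (auto intro: Least_le)
  then show ?thesis using js by blast
qed

text \<open>If two letters \<open>\<iota>\<close>, \<open>\<kappa>\<close> enclose a subword taking \<open>\<alpha>\<^sub>\<kappa>\<close> to \<open>\<plusminus>\<alpha>\<^sub>\<iota>\<close>, both can be deleted.\<close>

lemma minimal_word_no_deletion:
  assumes "minimal_word (as @ \<iota> # bs @ \<kappa> # cs)"
  shows "word_refl bs (simple_root \<kappa>) \<noteq> simple_root \<iota>" "word_refl bs (simple_root \<kappa>) \<noteq> - simple_root \<iota>"
proof -
  have "\<not> (word_refl bs (simple_root \<kappa>) = simple_root \<iota> \<or> word_refl bs (simple_root \<kappa>) = - simple_root \<iota>)"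
  proof
    assume *: "word_refl bs (simple_root \<kappa>) = simple_root \<iota> \<or> word_refl bs (simple_root \<kappa>) = - simple_root \<iota>"
    have "word_refl (as @ bs @ cs) l = word_refl (as @ \<iota> # bs @ \<kappa> # cs) l" for l
      by (simp add: word_refl_conj[OF *])
    then have "word_refl (as @ bs @ cs) = word_refl (as @ \<iota> # bs @ \<kappa> # cs)" by blast
    then show False using assms unfolding minimal_word_def by fastforce
  qed
  then show "word_refl bs (simple_root \<kappa>) \<noteq> simple_root \<iota>" "word_refl bs (simple_root \<kappa>) \<noteq> - simple_root \<iota>"
    by blast+
qed

lemma minimal_word_root_pos:
  assumes "minimal_word is" "k < length is"
  shows "word_root is k \<in> pos_roots"
proof (rule ccontr)
  assume "word_root is k \<notin> pos_roots"
  then have "word_refl (take k is) (simple_root (is ! k)) \<in> neg_roots"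
    unfolding word_root_def using word_refl_simple_root roots_pos_or_neg by blast
  then obtain as \<iota> bs where *: "take k is = as @ \<iota> # bs" "word_refl bs (simple_root (is ! k)) = simple_root \<iota>"
    using word_deletion by blast
  have "is = take k is @ is ! k # drop (Suc k) is" using assms(2) by (simp add: id_take_nth_drop)
  then have "is = as @ \<iota> # bs @ is ! k # drop (Suc k) is" unfolding *(1) by simp
  then show False using assms(1) *(2) minimal_word_no_deletion(1) by metis
qed

text \<open>Equal roots at \<open>j < k\<close> mean that the subword strictly between takes the
  simple root at \<open>k\<close> to minus the one at \<open>j\<close>, which is a deletable
  pair.\<close>

lemma minimal_word_root_inj:
  assumes "minimal_word is"
  shows "inj_on (word_root is) {..<length is}"
proof -
  have "word_root is j \<noteq> word_root is k" if jk: "j < k" "k < length is" for j k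
  proof
    assume eq: "word_root is j = word_root is k"
    define bs where "bs = take (k - Suc j) (drop (Suc j) is)"
    have tk: "take k is = take j is @ is ! j # bs"
    proof -
      have "take k is = take j is @ take (k - j) (drop j is)"
        using jk(1) by (metis le_add_diff_inverse less_imp_le take_add)
      moreover have "take (k - j) (drop j is) = is ! j # bs"
        using jk by (simp add: bs_def take_Cons' Cons_nth_drop_Suc[symmetric])
      ultimately show ?thesis by simp
    qed
    have "simple_root (is ! j) = simple_refl (is ! j) (word_refl bs (simple_root (is ! k)))"
      using eq unfolding word_root_def tk by (simp add: word_refl_eq_iff)
    then have "simple_refl (is ! j) (simple_root (is ! j)) = word_refl bs (simple_root (is ! k))"
      by simp
    then have "word_refl bs (simple_root (is ! k)) = - simple_root (is ! j)"
      by (simp add: simple_refl_simple_root)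
    moreover have "is = take k is @ is ! k # drop (Suc k) is" using jk by (simp add: id_take_nth_drop)
    then have "is = take j is @ is ! j # bs @ is ! k # drop (Suc k) is" unfolding tk by simp
    ultimately show False using assms minimal_word_no_deletion(2) by metis
  qed
  then show ?thesis unfolding inj_on_def by (metis lessThan_iff linorder_neqE_nat)
qed

lemma minimal_word_length_le: "minimal_word is \<Longrightarrow> length is \<le> card pos_roots"
  using card_inj_on_le[OF minimal_word_root_inj _ finite_pos_roots] minimal_word_root_pos
  by (auto simp: image_subset_iff)

lemma minimal_word_rev: "minimal_word is \<Longrightarrow> minimal_word (rev is)"
  unfolding minimal_word_def
proof (intro allI impI)
  fix js assume *: "\<forall>js. word_refl js = word_refl is \<longrightarrow> length is \<le> length js" "word_refl js = word_refl (rev is)"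
  have "word_refl (rev js) l = word_refl is l" for l
    by (metis *(2) word_refl_rev)
  then show "length (rev is) \<le> length js" using *(1) by (metis ext length_rev)
qed

text \<open>The last letter of a nonempty minimal word makes its own simple root negative. This free
  action on chambers is how equalities between Weyl group elements are obtained below.\<close>

lemma word_refl_pos_id:
  assumes "\<And>b. b \<in> pos_roots \<Longrightarrow> word_refl is b \<in> pos_roots"
  shows "word_refl is = id"
proof -
  obtain js where js: "minimal_word js" "word_refl js = word_refl is" using ex_minimal_word by blast
  show ?thesis
  proof (cases js rule: rev_cases)
    case Nil
    then show ?thesis using js by simp
  next
    case (snoc xs \<kappa>)
    have "word_root js (length xs) \<in> pos_roots" using js(1) snoc by (intro minimal_word_root_pos) auto
    then have "word_refl xs (simple_root \<kappa>) \<in> pos_roots" by (simp add: word_root_def snoc)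
    moreover have "word_refl js (simple_root \<kappa>) = - word_refl xs (simple_root \<kappa>)"
      by (simp add: snoc simple_refl_simple_root word_refl_uminus)
    ultimately show ?thesis
      using assms[OF simple_root_pos[of \<kappa>]] js(2) pos_not_neg by (simp add: neg_roots_iff)
  qed
qed

text \<open>Split the word at position \<open>k\<close>: the letter there reflects its own simple
  root and supplies the sign. It lets negativity pass from an element to its inverse.\<close>

lemma word_root_last: "word_refl (rev xs) (word_root xs k) = - word_root (rev xs) (length xs - Suc k)"
  if "k < length xs"
proof -
  have xs: "xs = take k xs @ xs ! k # drop (Suc k) xs" using that by (simp add: id_take_nth_drop)
  define as bs x where "as = take k xs" and "bs = drop (Suc k) xs" and "x = xs ! k"
  have xs: "xs = as @ x # bs" using xs by (simp add: as_def bs_def x_def)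
  have k: "k = length as" using that by (simp add: as_def)
  show ?thesis
    by (simp add: xs k word_root_def nth_append simple_refl_simple_root word_refl_uminus)
qed

text \<open>This reduces the definite description of \<open>longest\<close> to exhibiting one word.
  The roots of a minimal word are distinct positive roots, so lengths are at most
  \<open>card pos_roots\<close>; an element of that length also makes all positive roots negative,
  and composing it suitably with \<open>word_refl xs\<close> gives an element preserving positivity,
  hence the identity.\<close>

lemma longest_eqI:
  assumes w: "\<And>b. b \<in> pos_roots \<Longrightarrow> word_refl xs b \<in> neg_roots"
  shows "longest = word_refl xs" "weyl_length longest = card pos_roots"
proof -
  have le: "weyl_length v \<le> card pos_roots" if "v \<in> weyl" for v
    using that ex_minimal_word minimal_word_length_le unfolding weyl_def by (metis imageE)
  have inv: "word_refl (rev xs) b \<in> neg_roots" if "b \<in> pos_roots" for b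
  proof (rule ccontr)
    assume "word_refl (rev xs) b \<notin> neg_roots"
    then have "word_refl (rev xs) b \<in> pos_roots"
      using that word_refl_roots pos_roots_subset roots_pos_or_neg by blast
    from w[OF this] show False using that pos_not_neg by simp
  qed
  have len: "weyl_length (word_refl xs) = card pos_roots"
  proof (rule antisym)
    obtain js where js: "minimal_word js" "word_refl js = word_refl xs" "length js = weyl_length (word_refl xs)"
      using ex_minimal_word by blast
    have "word_refl (rev js) b = word_refl (rev xs) b" for b by (metis js(2) word_refl_rev)
    then have "pos_roots \<subseteq> word_root js ` {..<length js}"
      using root_crossing[of _ js] inv by auto
    then have "card pos_roots \<le> card (word_root js ` {..<length js})" by (intro card_mono) auto
    also have "\<dots> \<le> length js" using card_image_le[of "{..<length js}" "word_root js"] by simp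
    finally show "card pos_roots \<le> weyl_length (word_refl xs)" using js(3) by simp
  qed (use le word_refl_in_weyl in auto)
  show "longest = word_refl xs"
    unfolding longest_def
  proof (rule the_equality)
    show "word_refl xs \<in> weyl \<and> (\<forall>v\<in>weyl. weyl_length v \<le> weyl_length (word_refl xs))"
      using le len word_refl_in_weyl by auto
  next
    fix w assume w1: "w \<in> weyl \<and> (\<forall>v\<in>weyl. weyl_length v \<le> weyl_length w)"
    then have lw: "weyl_length w = card pos_roots" using le len word_refl_in_weyl by (metis antisym)
    obtain ys where "w = word_refl ys" using w1 by (auto simp: weyl_def)
    then obtain js where js: "minimal_word js" "word_refl js = w" "length js = card pos_roots"
      using ex_minimal_word lw by metis
    have "word_root js ` {..<length js} = pos_roots"
      using minimal_word_root_pos[OF js(1)] finite_pos_roots card_image[OF minimal_word_root_inj[OF js(1)]] js(3)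
      by (intro card_subset_eq) auto
    then have neg: "word_refl (rev js) b \<in> neg_roots" if b: "b \<in> pos_roots" for b
    proof -
      obtain k where k: "k < length js" "b = word_root js k"
        using b \<open>word_root js ` _ = pos_roots\<close> by auto
      have "word_root (rev js) (length js - Suc k) \<in> pos_roots"
        using k(1) by (intro minimal_word_root_pos minimal_word_rev js(1)) auto
      then show ?thesis using word_root_last[OF k(1)] by (simp add: k(2) uminus_neg_roots)
    qed
    have "word_refl (rev js @ xs) = id"
    proof (rule word_refl_pos_id)
      fix b assume "b \<in> pos_roots"
      then have "- word_refl xs b \<in> pos_roots" using w by (simp add: neg_roots_iff)
      from neg[OF this] show "word_refl (rev js @ xs) b \<in> pos_roots"
        by (simp add: word_refl_uminus uminus_neg_roots)
    qed
    then have "word_refl (rev js) (word_refl xs l) = l" for l by (metis word_refl_append id_apply)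
    then have "word_refl xs l = word_refl js l" for l by (metis word_refl_rev(2))
    then show "w = word_refl xs" using js(2) by auto
  qed
  then show "weyl_length longest = card pos_roots" using len by simp
qed

text \<open>Minus the longest element acts on the simple roots by a nonnegative integral matrix
  \<open>P\<close> of square 1 whose rows have height at least 1. The height of
  \<open>unit \<iota>\<close> is \<open>\<Sum> P \<iota> \<kappa> * ht (P \<kappa>)\<close>, hence
  at least \<open>ht (P \<iota>)\<close>; so every row has height exactly 1 and is a unit
  vector.\<close>

lemma longest_simple_root:
  assumes w: "\<And>b. b \<in> pos_roots \<Longrightarrow> word_refl xs b \<in> neg_roots"
  shows "longest (simple_root \<iota>) = - simple_root (star \<iota>)"
proof -
  have long: "longest = word_refl xs" using w by (rule longest_eqI)
  have inv: "word_refl xs (word_refl xs l) = l" for l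
  proof -
    have "word_refl (xs @ xs) = id"
    proof (rule word_refl_pos_id)
      fix b assume "b \<in> pos_roots"
      then have "- word_refl xs b \<in> pos_roots" using w by (simp add: neg_roots_iff)
      from w[OF this] show "word_refl (xs @ xs) b \<in> pos_roots"
        by (simp add: word_refl_uminus uminus_neg_roots)
    qed
    then show ?thesis by (metis word_refl_append id_apply)
  qed
  have "- word_refl xs (simple_root \<nu>) \<in> pos_roots" for \<nu>
    using w[OF simple_root_pos] by (simp add: neg_roots_iff)
  then have "\<exists>p \<in> pos_coords. - word_refl xs (simple_root \<nu>) = of_coords p" for \<nu>
    unfolding pos_roots_eq by auto
  then obtain P where P: "\<And>\<nu>. P \<nu> \<in> pos_coords" "\<And>\<nu>. - word_refl xs (simple_root \<nu>) = of_coords (P \<nu>)"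
    by metis
  define ht where "ht m = (\<Sum>\<kappa>\<in>UNIV. m \<kappa> :: int)" for m :: "'v \<Rightarrow> int"
  have ht1: "1 \<le> ht (P \<nu>)" for \<nu>
  proof (rule ccontr)
    assume "\<not> 1 \<le> ht (P \<nu>)"
    moreover have nn: "\<forall>\<kappa>. 0 \<le> P \<nu> \<kappa>" using P(1)[of \<nu>] by (simp add: pos_coords_def)
    ultimately have "ht (P \<nu>) = 0" using sum_nonneg[of UNIV "P \<nu>"] by (simp add: ht_def)
    then have "P \<nu> = (\<lambda>_. 0)" using nn by (simp add: ht_def sum_nonneg_eq_0_iff fun_eq_iff)
    then show False using P(1)[of \<nu>] root_nonzero[of "P \<nu>"] by (simp add: pos_coords_def)
  qed
  have cP: "coord_word xs (unit \<nu>) = - P \<nu>" for \<nu>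
  proof (rule of_coords_inj)
    have "of_coords (- P \<nu>) = - (- word_refl xs (simple_root \<nu>))"
      unfolding P(2) by (rule of_coords_uminus)
    then show "of_coords (coord_word xs (unit \<nu>)) = of_coords (- P \<nu>)"
      by (simp add: of_coords_word of_coords_unit)
  qed
  have lin: "coord_word xs (\<lambda>\<mu>. \<Sum>\<kappa>\<in>A. m \<kappa> * unit \<kappa> \<mu>) = (\<lambda>\<mu>. \<Sum>\<kappa>\<in>A. m \<kappa> * coord_word xs (unit \<kappa>) \<mu>)"
    if "finite A" for A m
    using that
  proof (induction A rule: finite_induct)
    case empty
    then show ?case using coord_word_linear[of xs 0 undefined 0 undefined] by simp
  next
    case (insert \<kappa> A)
    then show ?case
      using coord_word_linear[of xs "m \<kappa>" "unit \<kappa>" 1 "\<lambda>\<mu>. \<Sum>\<kappa>\<in>A. m \<kappa> * unit \<kappa> \<mu>"] by simp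
  qed
  have "(\<lambda>\<mu>. \<Sum>\<kappa>\<in>UNIV. P \<iota> \<kappa> * unit \<kappa> \<mu>) = P \<iota>"
    by (simp add: fund_weight_def fun_eq_iff)
  then have "coord_word xs (P \<iota>) = (\<lambda>\<mu>. \<Sum>\<kappa>\<in>UNIV. P \<iota> \<kappa> * coord_word xs (unit \<kappa>) \<mu>)"
    using lin[of UNIV "P \<iota>"] by simp
  moreover have "coord_word xs (P \<iota>) = - unit \<iota>"
  proof (rule of_coords_inj)
    have "of_coords (coord_word xs (P \<iota>)) = word_refl xs (- word_refl xs (simple_root \<iota>))"
      unfolding P(2) by (rule of_coords_word)
    also have "\<dots> = - simple_root \<iota>" by (simp add: word_refl_uminus inv)
    finally show "of_coords (coord_word xs (P \<iota>)) = of_coords (- unit \<iota>)"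
      by (simp add: of_coords_uminus of_coords_unit)
  qed
  ultimately have u: "unit \<iota> \<mu> = (\<Sum>\<kappa>\<in>UNIV. P \<iota> \<kappa> * P \<kappa> \<mu>)" for \<mu>
    by (simp add: cP fun_eq_iff sum_negf)
  have "1 = ht (unit \<iota>)" by (simp add: ht_def fund_weight_def)
  also have "\<dots> = (\<Sum>\<kappa>\<in>UNIV. P \<iota> \<kappa> * ht (P \<kappa>))"
    unfolding ht_def u sum_distrib_left by (rule sum.swap)
  also have "\<dots> \<ge> (\<Sum>\<kappa>\<in>UNIV. P \<iota> \<kappa> * 1)"
    using ht1 P(1)[of \<iota>] by (intro sum_mono mult_left_mono) (auto simp: pos_coords_def)
  finally have "ht (P \<iota>) = 1" using ht1[of \<iota>] by (simp add: ht_def)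
  then obtain \<kappa> where \<kappa>: "P \<iota> = unit \<kappa>"
  proof -
    have nn: "\<And>\<kappa>. 0 \<le> P \<iota> \<kappa>" using P(1)[of \<iota>] by (simp add: pos_coords_def)
    obtain \<kappa> where k: "P \<iota> \<kappa> \<noteq> 0" using root_nonzero[of "P \<iota>"] P(1)[of \<iota>] by (auto simp: pos_coords_def)
    have s: "P \<iota> \<kappa> + (\<Sum>\<mu>\<in>UNIV - {\<kappa>}. P \<iota> \<mu>) = 1"
      using \<open>ht (P \<iota>) = 1\<close> by (simp add: ht_def sum.remove[of UNIV \<kappa>])
    have "0 \<le> (\<Sum>\<mu>\<in>UNIV - {\<kappa>}. P \<iota> \<mu>)" using nn by (intro sum_nonneg)
    then have "P \<iota> \<kappa> = 1" "(\<Sum>\<mu>\<in>UNIV - {\<kappa>}. P \<iota> \<mu>) = 0" using s k nn[of \<kappa>] by linarith+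
    then have "P \<iota> = unit \<kappa>"
      using nn by (auto simp: fun_eq_iff fund_weight_def sum_nonneg_eq_0_iff)
    then show thesis by (rule that)
  qed
  have ex: "longest (simple_root \<iota>) = - simple_root \<kappa>"
    using arg_cong[OF P(2)[of \<iota>], of uminus] by (simp add: long \<kappa> of_coords_unit)
  have "\<kappa>' = \<kappa>" if "longest (simple_root \<iota>) = - simple_root \<kappa>'" for \<kappa>'
  proof -
    have "of_coords (unit \<kappa>') = of_coords (unit \<kappa>)" using that ex by (simp add: of_coords_unit)
    then have "unit \<kappa>' \<kappa> = unit \<kappa> \<kappa>" using of_coords_inj by metis
    then show ?thesis by (simp add: fund_weight_def split: if_splits)
  qed
  then have "star \<iota> = \<kappa>" unfolding star_def using ex by (intro the_equality)
  then show ?thesis using ex by simp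
qed

lemma simple_root_inj: "simple_root \<iota> = simple_root \<kappa> \<Longrightarrow> \<iota> = \<kappa>"
proof -
  assume "simple_root \<iota> = simple_root \<kappa>"
  then have "of_coords (unit \<iota>) = of_coords (unit \<kappa>)" by (simp add: of_coords_unit)
  then have "unit \<iota> \<kappa> = unit \<kappa> \<kappa>" using of_coords_inj by metis
  then show ?thesis by (simp add: fund_weight_def split: if_splits)
qed

section \<open>The involution \<open>star\<close> induced by the longest element\<close>

context
  fixes xs :: "'v list"
  assumes w: "\<And>b. b \<in> pos_roots \<Longrightarrow> word_refl xs b \<in> neg_roots"
begin

lemma longest_eq: "longest = word_refl xs"
  using w by (rule longest_eqI)

lemma longest_star: "longest (simple_root \<iota>) = - simple_root (star \<iota>)"
  using w by (rule longest_simple_root)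

lemma longest_invol: "longest (longest l) = l"
proof -
  have "word_refl (xs @ xs) = id"
  proof (rule word_refl_pos_id)
    fix b assume "b \<in> pos_roots"
    then have "- word_refl xs b \<in> pos_roots" using w by (simp add: neg_roots_iff)
    from w[OF this] show "word_refl (xs @ xs) b \<in> pos_roots"
      by (simp add: word_refl_uminus uminus_neg_roots)
  qed
  then show ?thesis unfolding longest_eq by (metis word_refl_append id_apply)
qed

lemma longest_uminus: "longest (- l) = - longest l"
  by (simp add: longest_eq word_refl_uminus)

lemma star_star [simp]: "star (star \<iota>) = \<iota>"
proof -
  have "simple_root (star (star \<iota>)) = longest (longest (simple_root \<iota>))"
    by (simp add: longest_star longest_uminus)
  then show ?thesis by (intro simple_root_inj) (simp add: longest_invol)
qed

lemma coord_word_star: "coord_word xs (unit \<iota>) = - unit (star \<iota>)"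
  by (rule of_coords_inj)
    (use longest_star[of \<iota>] in \<open>simp add: of_coords_word of_coords_uminus of_coords_unit longest_eq\<close>)

lemma adj_star: "adj (star \<iota>) (star \<kappa>) \<longleftrightarrow> adj \<iota> \<kappa>"
proof -
  have "simple_root (star \<iota>) (star \<kappa>) = simple_root \<iota> \<kappa>"
    using pairing_word[of xs "unit \<kappa>" "simple_root \<iota>"] longest_star[of \<iota>]
    by (simp add: coord_word_star longest_eq pairing_uminus_left pairing_uminus_right pairing_unit)
  moreover have "adj \<mu> \<nu> \<longleftrightarrow> simple_root \<mu> \<nu> = - 1" for \<mu> \<nu>
    by (auto simp: simple_root_def)
  ultimately show ?thesis by simp
qed

lemma longest_fund_weight: "longest (fund_weight \<iota>) = - fund_weight (star \<iota>)"
proof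
  fix \<kappa>
  have "star \<kappa> = \<iota> \<longleftrightarrow> \<kappa> = star \<iota>" using star_star by metis
  then show "longest (fund_weight \<iota>) \<kappa> = (- fund_weight (star \<iota>)) \<kappa>"
    using pairing_word[of xs "unit (star \<kappa>)" "fund_weight \<iota>"]
    by (simp add: coord_word_star longest_eq pairing_uminus_left pairing_unit)
      (auto simp: fund_weight_def)
qed

end

end

section \<open>Folding\<close>

context folded_diagram
begin

lemma sigma_inj [simp]: "\<sigma> \<iota> = \<sigma> \<kappa> \<longleftrightarrow> \<iota> = \<kappa>"
  using bij_sigma by (metis bij_inv_eq_iff)

lemma inv_sigma [simp]: "inv \<sigma> (\<sigma> \<iota>) = \<iota>" "\<sigma> (inv \<sigma> \<iota>) = \<iota>"
  using bij_sigma by (simp_all add: bij_is_inj bij_is_surj surj_f_inv_f)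

lemma adj_sigma_pow: "adj ((\<sigma> ^^ l) \<iota>) ((\<sigma> ^^ l) \<kappa>) \<longleftrightarrow> adj \<iota> \<kappa>"
  by (induction l) (simp_all add: adj_sigma)

abbreviation (input) r :: nat where "r \<equiv> sigma_order"

text \<open>The fixed neighbour in the case of order 3 is kept because it pins down the heights
  along an orbit of size 3, see \<open>height_r3\<close>.\<close>

lemma sigma_order_cases:
  "r = 1 \<and> \<sigma> = id \<or>
   r = 2 \<and> (\<exists>\<iota>. \<sigma> \<iota> \<noteq> \<iota>) \<and> (\<forall>\<iota>. \<sigma> (\<sigma> \<iota>) = \<iota>) \<or>
   r = 3 \<and> (\<exists>\<iota>. \<sigma> \<iota> \<noteq> \<iota>) \<and> (\<forall>\<iota>. \<sigma> (\<sigma> (\<sigma> \<iota>)) = \<iota>) \<and> (\<forall>\<iota>. \<sigma> \<iota> \<noteq> \<iota> \<longrightarrow> (\<exists>\<kappa>. adj \<iota> \<kappa> \<and> \<sigma> \<kappa> = \<kappa>))"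
proof (cases "\<sigma> = id")
  case True
  then have "r = 1" unfolding sigma_order_def by (intro Least_equality) auto
  then show ?thesis using True by simp
next
  case False
  then have nf: "\<exists>\<iota>. \<sigma> \<iota> \<noteq> \<iota>" by (auto simp: fun_eq_iff)
  have p1: "\<sigma> ^^ n \<noteq> id" if "n = 1" for n using False that by simp
  have "(\<forall>\<iota>. \<sigma> (\<sigma> \<iota>) = \<iota>) \<or> (\<exists>\<iota>. \<sigma> (\<sigma> \<iota>) \<noteq> \<iota>) \<and>
    (\<forall>\<iota>. \<sigma> (\<sigma> (\<sigma> \<iota>)) = \<iota> \<and> (\<sigma> \<iota> \<noteq> \<iota> \<longrightarrow> (\<exists>\<kappa>. adj \<iota> \<kappa> \<and> \<sigma> \<kappa> = \<kappa>)))"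
    using automorphism[OF bij_sigma adj_sigma] by blast
  then show ?thesis
  proof (elim disjE conjE)
    assume sq: "\<forall>\<iota>. \<sigma> (\<sigma> \<iota>) = \<iota>"
    have "(LEAST n. 0 < n \<and> \<sigma> ^^ n = id) = 2"
    proof (rule Least_equality)
      show "0 < (2::nat) \<and> \<sigma> ^^ 2 = id" using sq by (simp add: numeral_2_eq_2 fun_eq_iff)
      show "2 \<le> n" if n: "0 < n \<and> \<sigma> ^^ n = id" for n
        using n p1[of n] by (cases "n = 1") auto
    qed
    then show ?thesis using nf sq unfolding sigma_order_def by blast
  next
    assume cb: "\<exists>\<iota>. \<sigma> (\<sigma> \<iota>) \<noteq> \<iota>"
      "\<forall>\<iota>. \<sigma> (\<sigma> (\<sigma> \<iota>)) = \<iota> \<and> (\<sigma> \<iota> \<noteq> \<iota> \<longrightarrow> (\<exists>\<kappa>. adj \<iota> \<kappa> \<and> \<sigma> \<kappa> = \<kappa>))"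
    have p2: "\<sigma> ^^ n \<noteq> id" if "n = 2" for n
      using cb(1) that by (auto simp: numeral_2_eq_2 fun_eq_iff)
    have "(LEAST n. 0 < n \<and> \<sigma> ^^ n = id) = 3"
    proof (rule Least_equality)
      show "0 < (3::nat) \<and> \<sigma> ^^ 3 = id" using cb(2) by (simp add: numeral_3_eq_3 fun_eq_iff)
      show "3 \<le> n" if n: "0 < n \<and> \<sigma> ^^ n = id" for n
        using n p1[of n] p2[of n] by (cases "n = 1"; cases "n = 2") auto
    qed
    then show ?thesis using nf cb(2) unfolding sigma_order_def by blast
  qed
qed

lemma r_cases: "r = 1 \<or> r = 2 \<or> r = 3"
  using sigma_order_cases by blast

lemma r_pos: "0 < r"
  using r_cases by auto

lemma sigma_pow_r [simp]: "(\<sigma> ^^ r) \<iota> = \<iota>"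
  using sigma_order_cases by (auto simp: numeral_2_eq_2 numeral_3_eq_3)

lemma sigma_pow_mod: "(\<sigma> ^^ n) \<iota> = (\<sigma> ^^ (n mod r)) \<iota>"
proof -
  have "(\<sigma> ^^ (r * k)) \<iota> = \<iota>" for k
    by (induction k) (simp_all add: funpow_add)
  moreover have "(\<sigma> ^^ n) \<iota> = (\<sigma> ^^ (n mod r)) ((\<sigma> ^^ (r * (n div r))) \<iota>)"
    by (metis comp_apply funpow_add mod_mult_div_eq)
  ultimately show ?thesis by simp
qed

lemma orb_eq: "orb \<iota> = (\<lambda>l. (\<sigma> ^^ l) \<iota>) ` {..<r}"
proof
  show "orb \<iota> \<subseteq> (\<lambda>l. (\<sigma> ^^ l) \<iota>) ` {..<r}"
  proof
    fix \<kappa> assume "\<kappa> \<in> orb \<iota>"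
    then obtain n where "\<kappa> = (\<sigma> ^^ (n mod r)) \<iota>" unfolding orb_def using sigma_pow_mod by blast
    then show "\<kappa> \<in> (\<lambda>l. (\<sigma> ^^ l) \<iota>) ` {..<r}" using r_pos by auto
  qed
  show "(\<lambda>l. (\<sigma> ^^ l) \<iota>) ` {..<r} \<subseteq> orb \<iota>" unfolding orb_def by blast
qed

lemma sigma_pow_fixed: "\<sigma> \<iota> = \<iota> \<Longrightarrow> (\<sigma> ^^ l) \<iota> = \<iota>"
  by (induction l) auto

lemma sigma_pow_inj_on:
  assumes "\<sigma> \<iota> \<noteq> \<iota>"
  shows "inj_on (\<lambda>l. (\<sigma> ^^ l) \<iota>) {..<r}"
proof -
  consider "r = 1" | "r = 2" | "r = 3" "\<sigma> (\<sigma> (\<sigma> \<iota>)) = \<iota>" using sigma_order_cases by blast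
  then show ?thesis
  proof cases
    case 3
    have "\<sigma> (\<sigma> \<iota>) \<noteq> \<iota>" using 3(2) assms by metis
    then show ?thesis using assms unfolding 3(1)
      by (auto simp: inj_on_def numeral_3_eq_3 less_Suc_eq)
  qed (use assms in \<open>auto simp: inj_on_def numeral_2_eq_2 less_Suc_eq\<close>)
qed

lemma d_eq: "d \<iota> = (if \<sigma> \<iota> = \<iota> then 1 else int r)"
proof (cases "\<sigma> \<iota> = \<iota>")
  case True
  then have "orb \<iota> = {\<iota>}" using r_pos by (auto simp: orb_eq sigma_pow_fixed)
  then show ?thesis using True by (simp add: d_def)
next
  case False
  then have "card (orb \<iota>) = r" unfolding orb_eq by (simp add: card_image sigma_pow_inj_on)
  then show ?thesis using False by (simp add: d_def)
qed

lemma d_pos: "0 < d \<iota>"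
  using r_pos by (simp add: d_eq)

lemma d_sigma [simp]: "d (\<sigma> \<iota>) = d \<iota>"
  by (simp add: d_eq)

lemma d_inv_sigma [simp]: "d (inv \<sigma> \<iota>) = d \<iota>"
  by (metis d_sigma inv_sigma(2))

lemma d_sigma_pow [simp]: "d ((\<sigma> ^^ l) \<iota>) = d \<iota>"
  by (induction l) auto

lemma ex_d_eq_r: "\<exists>\<iota>. d \<iota> = int r"
  using sigma_order_cases by (auto simp: d_eq)

lemma d_le_r: "d \<iota> \<le> int r"
  using r_pos by (simp add: d_eq)

lemma sigma_pow_d: "(\<sigma> ^^ nat (d \<iota>)) \<iota> = \<iota>"
  by (auto simp: d_eq)

lemma sigma_pow_mult_d: "(\<sigma> ^^ (nat (d \<iota>) * k)) \<iota> = \<iota>"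
  by (induction k) (simp_all add: funpow_add sigma_pow_d)

text \<open>The duration of an arrow between the rows of \<open>\<iota>\<close> and
  \<open>\<kappa>\<close> in the repetition quiver.\<close>

definition dmin :: "'v \<Rightarrow> 'v \<Rightarrow> int" where
  "dmin \<iota> \<kappa> = min (d \<iota>) (d \<kappa>)"

lemma dmin_pos: "0 < dmin \<iota> \<kappa>"
  using d_pos by (simp add: dmin_def)

lemma dmin_sym: "dmin \<iota> \<kappa> = dmin \<kappa> \<iota>"
  by (simp add: dmin_def min.commute)

lemma dmin_dvd: "dmin \<iota> \<kappa> dvd d \<iota>" "dmin \<iota> \<kappa> dvd d \<kappa>"
  using r_cases by (auto simp: dmin_def min_def d_eq)

lemma orb_self: "\<iota> \<in> orb \<iota>"
  unfolding orb_def by (auto intro: exI[of _ 0])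

lemma orb_sigma [simp]: "orb (\<sigma> \<iota>) = orb \<iota>"
proof
  show "orb (\<sigma> \<iota>) \<subseteq> orb \<iota>"
  proof
    fix \<kappa> assume "\<kappa> \<in> orb (\<sigma> \<iota>)"
    then obtain n where "\<kappa> = (\<sigma> ^^ n) (\<sigma> \<iota>)" unfolding orb_def by blast
    then have "\<kappa> = (\<sigma> ^^ Suc n) \<iota>" by (simp add: funpow_swap1)
    then show "\<kappa> \<in> orb \<iota>" unfolding orb_def by blast
  qed
  have "\<iota> = (\<sigma> ^^ (r - 1)) (\<sigma> \<iota>)"
  proof -
    have "(\<sigma> ^^ (r - 1)) (\<sigma> \<iota>) = (\<sigma> ^^ Suc (r - 1)) \<iota>" by (simp add: funpow_swap1)
    also have "Suc (r - 1) = r" using r_pos by simp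
    finally show ?thesis by simp
  qed
  show "orb \<iota> \<subseteq> orb (\<sigma> \<iota>)"
  proof
    fix \<kappa> assume "\<kappa> \<in> orb \<iota>"
    then obtain n where "\<kappa> = (\<sigma> ^^ n) \<iota>" unfolding orb_def by blast
    then have "\<kappa> = (\<sigma> ^^ n) ((\<sigma> ^^ (r - 1)) (\<sigma> \<iota>))" using arg_cong[OF \<open>\<iota> = _\<close>, of "\<sigma> ^^ n"] by simp
    then have "\<kappa> = (\<sigma> ^^ (n + (r - 1))) (\<sigma> \<iota>)" by (simp add: funpow_add)
    then show "\<kappa> \<in> orb (\<sigma> \<iota>)" unfolding orb_def by blast
  qed
qed

lemma orb_sigma_pow [simp]: "orb ((\<sigma> ^^ l) \<iota>) = orb \<iota>"
  by (induction l) auto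

lemma orb_eq_iff: "orb \<iota> = orb \<kappa> \<longleftrightarrow> \<kappa> \<in> orb \<iota>"
proof
  show "\<kappa> \<in> orb \<iota>" if "orb \<iota> = orb \<kappa>" using that orb_self[of \<kappa>] by simp
  assume "\<kappa> \<in> orb \<iota>"
  then obtain n where "\<kappa> = (\<sigma> ^^ n) \<iota>" unfolding orb_def by blast
  then show "orb \<iota> = orb \<kappa>" by simp
qed

lemma orbit_eq_orb:
  assumes "i \<in> orbits" "\<iota> \<in> i"
  shows "i = orb \<iota>"
proof -
  obtain \<kappa> where "i = orb \<kappa>" using assms(1) by (auto simp: orbits_def)
  then show ?thesis using assms(2) orb_eq_iff[of \<kappa> \<iota>] by simp
qed

lemma orbits_disjoint: "i \<in> orbits \<Longrightarrow> j \<in> orbits \<Longrightarrow> i \<noteq> j \<Longrightarrow> i \<inter> j = {}"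
  by (metis disjoint_iff orbit_eq_orb)

lemma card_orbit: "i \<in> orbits \<Longrightarrow> \<iota> \<in> i \<Longrightarrow> int (card i) = d \<iota>"
  using orbit_eq_orb by (simp add: d_def)

lemma sum_over_orbits: "(\<Sum>\<iota>\<in>UNIV. f \<iota>) = (\<Sum>i\<in>orbits. \<Sum>\<iota>\<in>i. (f \<iota> :: 'b :: comm_monoid_add))"
proof -
  have "(\<Sum>\<iota>\<in>\<Union>orbits. f \<iota>) = (\<Sum>i\<in>orbits. \<Sum>\<iota>\<in>i. f \<iota>)"
    by (subst sum.Union_disjoint) (simp_all add: orbits_disjoint)
  moreover have "\<Union>orbits = UNIV" unfolding orbits_def using orb_self by auto
  ultimately show ?thesis by simp
qed

text \<open>Each orbit contributes 1. A time interval of length \<open>T\<close> meets the row of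
  \<open>\<iota>\<close> with density \<open>1 / (2 * d \<iota>)\<close>, so this sum turns lengths
  of time into numbers of vertices.\<close>

lemma sum_inverse_d: "(\<Sum>\<iota>\<in>UNIV. 1 / real_of_int (d \<iota>)) = real (card orbits)"
proof -
  have "(\<Sum>\<iota>\<in>i. 1 / real_of_int (d \<iota>)) = 1" if "i \<in> orbits" for i
  proof -
    have "(\<Sum>\<iota>\<in>i. 1 / real_of_int (d \<iota>)) = (\<Sum>\<iota>\<in>i. 1 / real (card i))"
    proof (intro sum.cong refl)
      fix \<iota> assume "\<iota> \<in> i"
      from card_orbit[OF that this] have "real_of_int (d \<iota>) = real (card i)" by linarith
      then show "1 / real_of_int (d \<iota>) = 1 / real (card i)" by simp
    qed
    moreover obtain \<iota> where "i = orb \<iota>" using \<open>i \<in> orbits\<close> by (auto simp: orbits_def)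
    then have "\<iota> \<in> i" using orb_self by simp
    then have "card i \<noteq> 0" by (metis card_0_eq empty_iff finite)
    ultimately show ?thesis by simp
  qed
  then show ?thesis unfolding sum_over_orbits by simp
qed

lemma sum_sigma: "(\<Sum>\<iota>\<in>UNIV. f (\<sigma> \<iota>)) = (\<Sum>\<iota>\<in>UNIV. (f \<iota> :: 'b :: comm_monoid_add))"
  using sum.reindex_bij_betw[OF bij_sigma, of f] by simp

subsection \<open>The action on weights\<close>

lemma sigma_act_apply [simp]: "sigma_act l (\<sigma> \<kappa>) = l \<kappa>"
  by (simp add: sigma_act_def)

lemma sigma_act_simple_root: "sigma_act (simple_root \<iota>) = simple_root (\<sigma> \<iota>)"
proof
  fix \<kappa>
  obtain \<mu> where "\<kappa> = \<sigma> \<mu>" by (metis inv_sigma(2))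
  then show "sigma_act (simple_root \<iota>) \<kappa> = simple_root (\<sigma> \<iota>) \<kappa>"
    by (simp add: simple_root_def adj_sigma)
qed

lemma sigma_act_fund_weight: "sigma_act (fund_weight \<iota>) = fund_weight (\<sigma> \<iota>)"
proof
  fix \<kappa>
  obtain \<mu> where "\<kappa> = \<sigma> \<mu>" by (metis inv_sigma(2))
  then show "sigma_act (fund_weight \<iota>) \<kappa> = fund_weight (\<sigma> \<iota>) \<kappa>"
    by (simp add: fund_weight_def)
qed

lemma sigma_act_linear: "sigma_act (\<lambda>\<kappa>. a * l \<kappa> + b * k \<kappa>) = (\<lambda>\<kappa>. a * sigma_act l \<kappa> + b * sigma_act k \<kappa>)"
  by (simp add: sigma_act_def fun_eq_iff)

lemma bij_sigma_act: "bij sigma_act"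
proof (rule o_bij)
  show "(\<lambda>l. l \<circ> \<sigma>) \<circ> sigma_act = id" "sigma_act \<circ> (\<lambda>l. l \<circ> \<sigma>) = id"
    by (simp_all add: sigma_act_def fun_eq_iff)
qed

end

section \<open>Height functions and words\<close>

context Q_datum
begin

definition in_row :: "'v \<Rightarrow> int \<Rightarrow> bool" where
  "in_row \<iota> p \<longleftrightarrow> 2 * d \<iota> dvd p - \<epsilon> \<iota>"

lemma rep_vertices_iff: "(\<iota>, p) \<in> rep_vertices \<longleftrightarrow> in_row \<iota> p"
  by (simp add: rep_vertices_def in_row_def)

lemma in_row_add: "in_row \<iota> (p + 2 * d \<iota> * k) \<longleftrightarrow> in_row \<iota> p"
proof -
  have "p + 2 * d \<iota> * k - \<epsilon> \<iota> = (p - \<epsilon> \<iota>) + 2 * d \<iota> * k" by simp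
  then show ?thesis unfolding in_row_def by (metis dvd_add_left_iff dvd_triv_left)
qed

lemma in_row_diff: "in_row \<iota> (p - 2 * d \<iota> * k) \<longleftrightarrow> in_row \<iota> p"
  using in_row_add[of \<iota> p "- k"] by simp

lemma in_row_step [simp]: "in_row \<iota> (p - 2 * d \<iota>) \<longleftrightarrow> in_row \<iota> p" "in_row \<iota> (p + 2 * d \<iota>) \<longleftrightarrow> in_row \<iota> p"
  using in_row_diff[of \<iota> p 1] in_row_add[of \<iota> p 1] by simp_all

lemma in_row_dvd: "in_row \<iota> p \<Longrightarrow> in_row \<iota> s \<longleftrightarrow> 2 * d \<iota> dvd p - s"
proof -
  assume "in_row \<iota> p"
  then have "2 * d \<iota> dvd p - \<epsilon> \<iota>" by (simp add: in_row_def)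
  moreover have "p - s = (p - \<epsilon> \<iota>) - (s - \<epsilon> \<iota>)" by simp
  ultimately show ?thesis unfolding in_row_def by (metis dvd_diff_right_iff)
qed

lemma in_row_ge: "in_row \<iota> p \<Longrightarrow> in_row \<iota> s \<Longrightarrow> s < p \<Longrightarrow> s + 2 * d \<iota> \<le> p"
  using in_row_dvd[of \<iota> p s] zdvd_imp_le[of "2 * d \<iota>" "p - s"] by auto

lemma in_row_height: "in_row \<iota> (\<xi> \<iota>)"
  using height_parity by (simp add: in_row_def)

lemma in_row_sigma [simp]: "in_row (\<sigma> \<iota>) (p - 2) \<longleftrightarrow> in_row \<iota> p"
proof -
  have "\<epsilon> (fun_powi \<sigma> 1 \<iota>) mod (2 * d \<iota>) = (\<epsilon> \<iota> - 2 * 1) mod (2 * d \<iota>)"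
    using parity unfolding parity_function_def by blast
  then have "2 * d \<iota> dvd \<epsilon> (\<sigma> \<iota>) - (\<epsilon> \<iota> - 2)"
    by (simp add: fun_powi_def mod_eq_dvd_iff)
  moreover have "p - \<epsilon> \<iota> = (p - 2 - \<epsilon> (\<sigma> \<iota>)) + (\<epsilon> (\<sigma> \<iota>) - (\<epsilon> \<iota> - 2))" by simp
  ultimately show ?thesis unfolding in_row_def d_sigma by (metis dvd_add_left_iff)
qed

lemma in_row_sigma_pow: "in_row ((\<sigma> ^^ l) \<iota>) (p - 2 * int l) \<longleftrightarrow> in_row \<iota> p"
proof (induction l arbitrary: p)
  case (Suc l)
  have "in_row ((\<sigma> ^^ Suc l) \<iota>) (p - 2 * int (Suc l)) \<longleftrightarrow> in_row (\<sigma> ((\<sigma> ^^ l) \<iota>)) ((p - 2 * int l) - 2)"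
    by (simp add: algebra_simps)
  then show ?case using Suc.IH by (simp del: funpow.simps)
qed simp

lemma adj_rows:
  assumes "adj \<iota> \<kappa>" "in_row \<iota> p" "in_row \<kappa> s"
  shows "2 * dmin \<iota> \<kappa> dvd p - s - dmin \<iota> \<kappa>"
proof -
  have "\<epsilon> \<iota> mod (2 * dmin \<iota> \<kappa>) = (\<epsilon> \<kappa> + dmin \<iota> \<kappa>) mod (2 * dmin \<iota> \<kappa>)"
    using parity assms(1) unfolding parity_function_def dmin_def by blast
  then have "2 * dmin \<iota> \<kappa> dvd \<epsilon> \<iota> - (\<epsilon> \<kappa> + dmin \<iota> \<kappa>)" by (simp add: mod_eq_dvd_iff)
  moreover have "2 * dmin \<iota> \<kappa> dvd p - \<epsilon> \<iota>" "2 * dmin \<iota> \<kappa> dvd s - \<epsilon> \<kappa>"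
    using assms dmin_dvd[of \<iota> \<kappa>] unfolding in_row_def by (meson dvd_trans mult_dvd_mono dvd_refl)+
  moreover have "p - s - dmin \<iota> \<kappa> = (p - \<epsilon> \<iota>) - (s - \<epsilon> \<kappa>) + (\<epsilon> \<iota> - (\<epsilon> \<kappa> + dmin \<iota> \<kappa>))" by simp
  ultimately show ?thesis by (metis dvd_add dvd_diff)
qed

text \<open>The times of adjacent rows differ by an odd multiple of \<open>dmin\<close>.
  Consequently the vertices present at one time are pairwise non-adjacent and their reflections
  commute.\<close>

lemma adj_rows_neq:
  assumes "adj \<iota> \<kappa>" "in_row \<iota> p" "in_row \<kappa> s"
  shows "p \<noteq> s"
proof
  assume "p = s"
  then have "2 * dmin \<iota> \<kappa> dvd dmin \<iota> \<kappa>" using adj_rows[OF assms] by simp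
  then show False using dmin_pos[of \<iota> \<kappa>] zdvd_imp_le[of "2 * dmin \<iota> \<kappa>" "dmin \<iota> \<kappa>"] by linarith
qed

lemma adj_rows_less:
  assumes "adj \<iota> \<kappa>" "in_row \<iota> p" "in_row \<kappa> s" "s < p"
  shows "s + dmin \<iota> \<kappa> \<le> p"
proof -
  obtain q where q: "p - s - dmin \<iota> \<kappa> = 2 * dmin \<iota> \<kappa> * q" using adj_rows[OF assms(1-3)] by (auto elim: dvdE)
  have "q \<ge> 0"
  proof (rule ccontr)
    assume "\<not> q \<ge> 0"
    then have "2 * dmin \<iota> \<kappa> * q \<le> 2 * dmin \<iota> \<kappa> * (- 1)" using dmin_pos[of \<iota> \<kappa>] by (intro mult_left_mono) auto
    then show False using q assms(4) dmin_pos[of \<iota> \<kappa>] by linarith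
  qed
  then have "0 \<le> 2 * dmin \<iota> \<kappa> * q" using dmin_pos[of \<iota> \<kappa>] by simp
  then show ?thesis using q by linarith
qed

text \<open>For height functions the defining conditions amount to this inequality.\<close>

definition state :: "('v \<Rightarrow> int) \<Rightarrow> bool" where
  "state \<eta> \<longleftrightarrow> (\<forall>\<iota>. in_row \<iota> (\<eta> \<iota>)) \<and> (\<forall>\<iota> \<kappa>. adj \<iota> \<kappa> \<longrightarrow> \<eta> \<iota> - \<eta> \<kappa> \<le> 2 * d \<kappa> - dmin \<iota> \<kappa>)"

lemma state_row: "state \<eta> \<Longrightarrow> in_row \<iota> (\<eta> \<iota>)"
  by (simp add: state_def)

lemma state_le: "state \<eta> \<Longrightarrow> adj \<iota> \<kappa> \<Longrightarrow> \<eta> \<iota> - \<eta> \<kappa> \<le> 2 * d \<kappa> - dmin \<iota> \<kappa>"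
  by (simp add: state_def)

text \<open>Times in adjacent rows cannot be closer than \<open>dmin\<close>, so a strict inequality
  improves to the one in the definition.\<close>

lemma stateI_less:
  assumes "\<And>\<iota>. in_row \<iota> (\<eta> \<iota>)" "\<And>\<iota> \<kappa>. adj \<iota> \<kappa> \<Longrightarrow> \<eta> \<iota> < \<eta> \<kappa> + 2 * d \<kappa>"
  shows "state \<eta>"
  unfolding state_def
proof (intro conjI allI impI)
  fix \<iota> \<kappa> assume a: "adj \<iota> \<kappa>"
  have "adj \<kappa> \<iota>" using a adj_sym by blast
  then have "\<eta> \<iota> + dmin \<kappa> \<iota> \<le> \<eta> \<kappa> + 2 * d \<kappa>" using assms a by (intro adj_rows_less) simp_all
  then show "\<eta> \<iota> - \<eta> \<kappa> \<le> 2 * d \<kappa> - dmin \<iota> \<kappa>" by (simp add: dmin_sym)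
qed (rule assms(1))

lemma state_less: "state \<eta> \<Longrightarrow> adj \<iota> \<kappa> \<Longrightarrow> \<eta> \<iota> < \<eta> \<kappa> + 2 * d \<kappa>"
  using state_le[of \<eta> \<iota> \<kappa>] dmin_pos[of \<iota> \<kappa>] by linarith

lemma state_height: "state \<xi>"
proof (rule stateI_less)
  fix \<iota> \<kappa> assume a: "adj \<iota> \<kappa>"
  have h: "\<And>\<iota> \<kappa>. adj \<iota> \<kappa> \<and> d \<iota> = d \<kappa> \<longrightarrow> \<bar>\<xi> \<iota> - \<xi> \<kappa>\<bar> = d \<iota>"
    "\<And>\<iota> j. j \<in> orbits \<Longrightarrow> orb_adj (orb \<iota>) j \<and> card (orb \<iota>) < card j \<Longrightarrow>
        (\<exists>!\<kappa>. \<kappa> \<in> j \<and> \<bar>\<xi> \<iota> - \<xi> \<kappa>\<bar> = 1 \<and> (\<forall>l < sigma_order. \<xi> ((\<sigma> ^^ l) \<kappa>) = \<xi> \<kappa> - 2 * int l))"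
    using height unfolding height_function_def by blast+
  \<comment> \<open>The heights on the larger orbit descend in steps of 2 from a value within 1 of
    \<open>\<xi> \<mu>\<close>, the lowest being \<open>2 * (r - 1)\<close> below it.\<close>
  have cross: "\<xi> \<mu> - 2 * int r + 1 \<le> \<xi> \<nu> \<and> \<xi> \<nu> \<le> \<xi> \<mu> + 1" if "adj \<mu> \<nu>" "d \<mu> < d \<nu>" for \<mu> \<nu>
  proof -
    have "orb \<nu> \<in> orbits" by (simp add: orbits_def)
    moreover have "orb_adj (orb \<mu>) (orb \<nu>)" unfolding orb_adj_def using that(1) orb_self by blast
    moreover have "card (orb \<mu>) < card (orb \<nu>)" using that(2) by (simp add: d_def)
    ultimately obtain \<kappa> where \<kappa>: "\<kappa> \<in> orb \<nu>" "\<bar>\<xi> \<mu> - \<xi> \<kappa>\<bar> = 1"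
      "\<forall>l < r. \<xi> ((\<sigma> ^^ l) \<kappa>) = \<xi> \<kappa> - 2 * int l"
      using h(2)[of "orb \<nu>" \<mu>] by blast
    have "\<nu> \<in> orb \<kappa>" using \<kappa>(1) orb_eq_iff[of \<nu> \<kappa>] orb_self[of \<nu>] by simp
    then obtain l where "l < r" "\<nu> = (\<sigma> ^^ l) \<kappa>" unfolding orb_eq by auto
    then show ?thesis using \<kappa>(2,3) by auto
  qed
  consider "d \<iota> = d \<kappa>" | "d \<iota> < d \<kappa>" | "d \<kappa> < d \<iota>" by linarith
  then show "\<xi> \<iota> < \<xi> \<kappa> + 2 * d \<kappa>"
  proof cases
    case 1
    then have "\<bar>\<xi> \<iota> - \<xi> \<kappa>\<bar> = d \<iota>" using h(1) a by blast
    then show ?thesis using 1 d_pos[of \<kappa>] by linarith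
  next
    case 2
    then have "d \<kappa> = int r" using d_eq[of \<iota>] d_eq[of \<kappa>] r_pos by (auto split: if_splits)
    then show ?thesis using cross[OF a 2] by linarith
  next
    case 3
    then show ?thesis using cross[of \<kappa> \<iota>] a adj_sym[of \<iota> \<kappa>] d_pos[of \<kappa>] by auto
  qed
qed (rule in_row_height)

text \<open>Joins and meets build the auxiliary states below: the join with the half turn, the join
  with the twisted shift, the meet with a slice.\<close>

lemma state_max: "state \<eta> \<Longrightarrow> state \<zeta> \<Longrightarrow> state (\<lambda>\<iota>. max (\<eta> \<iota>) (\<zeta> \<iota>))"
proof (rule stateI_less)
  assume s: "state \<eta>" "state \<zeta>"
  show "in_row \<iota> (max (\<eta> \<iota>) (\<zeta> \<iota>))" for \<iota> using s state_row by (simp add: max_def)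
  show "max (\<eta> \<iota>) (\<zeta> \<iota>) < max (\<eta> \<kappa>) (\<zeta> \<kappa>) + 2 * d \<kappa>" if "adj \<iota> \<kappa>" for \<iota> \<kappa>
    using state_less[OF s(1) that] state_less[OF s(2) that] by linarith
qed

lemma state_min: "state \<eta> \<Longrightarrow> state \<zeta> \<Longrightarrow> state (\<lambda>\<iota>. min (\<eta> \<iota>) (\<zeta> \<iota>))"
proof (rule stateI_less)
  assume s: "state \<eta>" "state \<zeta>"
  show "in_row \<iota> (min (\<eta> \<iota>) (\<zeta> \<iota>))" for \<iota> using s state_row by (simp add: min_def)
  show "min (\<eta> \<iota>) (\<zeta> \<iota>) < min (\<eta> \<kappa>) (\<zeta> \<kappa>) + 2 * d \<kappa>" if "adj \<iota> \<kappa>" for \<iota> \<kappa>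
    using state_less[OF s(1) that] state_less[OF s(2) that] by linarith
qed

section \<open>Firing sources: adapted words as descending paths of states\<close>

definition fire :: "'v \<Rightarrow> ('v \<Rightarrow> int) \<Rightarrow> 'v \<Rightarrow> int" where
  "fire \<iota> \<eta> = \<eta>(\<iota> := \<eta> \<iota> - 2 * d \<iota>)"

lemma fire_apply: "fire \<iota> \<eta> \<kappa> = (if \<kappa> = \<iota> then \<eta> \<iota> - 2 * d \<iota> else \<eta> \<kappa>)"
  by (simp add: fire_def)

lemma source_less: "source \<eta> \<iota> \<Longrightarrow> adj \<iota> \<kappa> \<Longrightarrow> \<eta> \<kappa> < \<eta> \<iota>"
  by (simp add: source_def)

lemma state_fire:
  assumes "state \<eta>" "source \<eta> \<iota>"
  shows "state (fire \<iota> \<eta>)"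
proof (rule stateI_less)
  show "in_row \<kappa> (fire \<iota> \<eta> \<kappa>)" for \<kappa> using state_row[OF assms(1)] by (simp add: fire_apply)
  show "fire \<iota> \<eta> \<mu> < fire \<iota> \<eta> \<nu> + 2 * d \<nu>" if "adj \<mu> \<nu>" for \<mu> \<nu>
  proof (cases "\<nu> = \<iota>")
    case True
    then have "adj \<iota> \<mu>" "\<mu> \<noteq> \<iota>" using that adj_sym by auto
    then show ?thesis using source_less[OF assms(2)] True by (simp add: fire_apply)
  next
    case False
    then show ?thesis using state_less[OF assms(1) that] d_pos[of \<iota>] by (auto simp: fire_apply)
  qed
qed

text \<open>Take a vertex of maximal height among those where \<open>\<eta>\<close> still exceeds
  \<open>\<zeta>\<close>. A higher neighbour would already lie on \<open>\<zeta>\<close>, and then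
  \<open>\<zeta>\<close> would violate the inequality for states.\<close>

lemma ex_source:
  assumes "state \<eta>" "state \<zeta>" "\<And>\<iota>. \<zeta> \<iota> \<le> \<eta> \<iota>" "\<zeta> \<noteq> \<eta>"
  shows "\<exists>\<iota>. source \<eta> \<iota> \<and> \<zeta> \<iota> \<le> \<eta> \<iota> - 2 * d \<iota>"
proof -
  define A where "A = {\<iota>. \<zeta> \<iota> < \<eta> \<iota>}"
  have "A \<noteq> {}"
  proof
    assume "A = {}"
    then have "\<eta> \<iota> \<le> \<zeta> \<iota>" for \<iota> unfolding A_def using not_less by blast
    then have "\<zeta> = \<eta>" using assms(3) by (intro ext antisym)
    then show False using assms(4) by contradiction
  qed
  then have "Max (\<eta> ` A) \<in> \<eta> ` A" by (intro Max_in) auto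
  then obtain \<iota> where A: "\<iota> \<in> A" "Max (\<eta> ` A) = \<eta> \<iota>" by auto
  then have \<iota>: "\<iota> \<in> A" "\<And>\<kappa>. \<kappa> \<in> A \<Longrightarrow> \<eta> \<kappa> \<le> \<eta> \<iota>"
    using Max_ge[of "\<eta> ` A"] by auto
  have low: "\<zeta> \<iota> + 2 * d \<iota> \<le> \<eta> \<iota>"
    using in_row_ge[OF state_row[OF assms(1)] state_row[OF assms(2)]] \<iota>(1) by (simp add: A_def)
  have "\<eta> \<kappa> < \<eta> \<iota>" if a: "adj \<iota> \<kappa>" for \<kappa>
  proof (rule ccontr)
    assume "\<not> \<eta> \<kappa> < \<eta> \<iota>"
    moreover have "\<eta> \<kappa> \<noteq> \<eta> \<iota>" using adj_rows_neq[OF a] state_row[OF assms(1)] by metis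
    ultimately have gt: "\<eta> \<iota> < \<eta> \<kappa>" by simp
    then have "\<kappa> \<notin> A" using \<iota>(2)[of \<kappa>] by linarith
    then have "\<zeta> \<kappa> = \<eta> \<kappa>" using assms(3)[of \<kappa>] by (simp add: A_def)
    moreover have "\<zeta> \<kappa> < \<zeta> \<iota> + 2 * d \<iota>" using state_less[OF assms(2)] a adj_sym by blast
    ultimately show False using low gt by linarith
  qed
  then show ?thesis using low unfolding source_def by (intro exI[of _ \<iota>]) auto
qed

definition run :: "('v \<Rightarrow> int) \<Rightarrow> 'v list \<Rightarrow> 'v \<Rightarrow> int" where
  "run \<eta> is = (\<lambda>\<iota>. \<eta> \<iota> - 2 * d \<iota> * int (count_list is \<iota>))"

lemma run_Nil [simp]: "run \<eta> [] = \<eta>"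
  by (simp add: run_def)

lemma run_Cons: "run \<eta> (\<iota> # is) = run (fire \<iota> \<eta>) is"
  by (auto simp: run_def fire_apply fun_eq_iff algebra_simps)

lemma adapted_Cons: "adapted \<eta> (\<iota> # is) \<longleftrightarrow> source \<eta> \<iota> \<and> adapted (fire \<iota> \<eta>) is"
  by (simp add: fire_def)

declare adapted.simps(2) [simp del]

lemma run_append: "run \<eta> (xs @ ys) = run (run \<eta> xs) ys"
  by (simp add: run_def fun_eq_iff algebra_simps)

lemma state_run: "state \<eta> \<Longrightarrow> adapted \<eta> is \<Longrightarrow> state (run \<eta> is)"
  by (induction "is" arbitrary: \<eta>) (auto simp: adapted_Cons run_Cons state_fire)

lemma adapted_append: "adapted \<eta> (xs @ ys) \<longleftrightarrow> adapted \<eta> xs \<and> adapted (run \<eta> xs) ys"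
  by (induction xs arbitrary: \<eta>) (auto simp: adapted_Cons run_Cons)

lemma ex_adapted:
  assumes "state \<eta>" "state \<zeta>" "\<And>\<iota>. \<zeta> \<iota> \<le> \<eta> \<iota>"
  shows "\<exists>is. adapted \<eta> is \<and> run \<eta> is = \<zeta>"
  using assms
proof (induction "nat (\<Sum>\<iota>\<in>UNIV. \<eta> \<iota> - \<zeta> \<iota>)" arbitrary: \<eta> rule: less_induct)
  case less
  show ?case
  proof (cases "\<zeta> = \<eta>")
    case True
    then show ?thesis by (intro exI[of _ "[]"]) simp
  next
    case False
    then obtain \<iota> where \<iota>: "source \<eta> \<iota>" "\<zeta> \<iota> \<le> \<eta> \<iota> - 2 * d \<iota>"
      using ex_source less.prems by blast
    have le: "\<zeta> \<kappa> \<le> fire \<iota> \<eta> \<kappa>" for \<kappa> using \<iota>(2) less.prems(3) by (simp add: fire_apply)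
    have "(\<Sum>\<kappa>\<in>UNIV. fire \<iota> \<eta> \<kappa> - \<zeta> \<kappa>) < (\<Sum>\<kappa>\<in>UNIV. \<eta> \<kappa> - \<zeta> \<kappa>)"
      using d_pos[of \<iota>] by (intro sum_strict_mono_ex1) (auto simp: fire_apply)
    moreover have "0 \<le> (\<Sum>\<kappa>\<in>UNIV. fire \<iota> \<eta> \<kappa> - \<zeta> \<kappa>)" using le by (intro sum_nonneg) simp
    ultimately have "nat (\<Sum>\<kappa>\<in>UNIV. fire \<iota> \<eta> \<kappa> - \<zeta> \<kappa>) < nat (\<Sum>\<kappa>\<in>UNIV. \<eta> \<kappa> - \<zeta> \<kappa>)" by simp
    from less.hyps[OF this state_fire[OF less.prems(1) \<iota>(1)] less.prems(2) le]
    obtain js where "adapted (fire \<iota> \<eta>) js" "run (fire \<iota> \<eta>) js = \<zeta>" by blast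
    then show ?thesis using \<iota>(1) by (intro exI[of _ "\<iota> # js"]) (simp add: adapted_Cons run_Cons)
  qed
qed

subsection \<open>Time slices\<close>

text \<open>The last time of the row of \<open>\<iota>\<close> that does not exceed
  \<open>t\<close>. Slices are states cofinal in both directions, and lowering \<open>t\<close> by 1
  fires precisely the vertices at time \<open>t\<close>.\<close>

definition slice :: "int \<Rightarrow> 'v \<Rightarrow> int" where
  "slice t \<iota> = t - (t - \<epsilon> \<iota>) mod (2 * d \<iota>)"

lemma slice_row: "in_row \<iota> (slice t \<iota>)"
proof -
  have "slice t \<iota> - \<epsilon> \<iota> = (t - \<epsilon> \<iota>) - (t - \<epsilon> \<iota>) mod (2 * d \<iota>)" by (simp add: slice_def)
  then show ?thesis unfolding in_row_def by (simp only: dvd_minus_mod)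
qed

lemma slice_le: "slice t \<iota> \<le> t" and slice_gt: "t < slice t \<iota> + 2 * d \<iota>"
  unfolding slice_def using d_pos[of \<iota>] pos_mod_bound[of "2 * d \<iota>"] pos_mod_sign[of "2 * d \<iota>"]
  by (simp_all add: algebra_simps)

lemma slice_eqI:
  assumes "in_row \<iota> s" "s \<le> t" "t < s + 2 * d \<iota>"
  shows "slice t \<iota> = s"
proof (rule ccontr)
  assume "slice t \<iota> \<noteq> s"
  then consider "slice t \<iota> < s" | "s < slice t \<iota>" by linarith
  then show False
  proof cases
    case 1
    then show False using in_row_ge[OF assms(1) slice_row[of \<iota> t]] assms slice_gt[of t \<iota>] by linarith
  next
    case 2
    then show False using in_row_ge[OF slice_row[of \<iota> t] assms(1)] assms slice_le[of t \<iota>] by linarith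
  qed
qed

lemma slice_self [simp]: "in_row \<iota> p \<Longrightarrow> slice p \<iota> = p"
  using d_pos[of \<iota>] by (intro slice_eqI) auto

lemma slice_pred: "slice (t - 1) \<iota> = (if in_row \<iota> t then t - 2 * d \<iota> else slice t \<iota>)"
proof (cases "in_row \<iota> t")
  case True
  then show ?thesis using d_pos[of \<iota>] by (auto intro!: slice_eqI)
next
  case False
  then have "slice t \<iota> \<noteq> t" using slice_row[of \<iota> t] by auto
  then have "slice t \<iota> < t" using slice_le[of t \<iota>] by simp
  then show ?thesis using False slice_gt[of t \<iota>] slice_row[of \<iota> t]
    by (auto intro!: slice_eqI)
qed

lemma slice_ge: "in_row \<iota> p \<Longrightarrow> p \<le> t \<Longrightarrow> p \<le> slice t \<iota>"
  using in_row_ge[of \<iota> p "slice t \<iota>"] slice_row[of \<iota> t] slice_gt[of t \<iota>] by linarith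

lemma state_slice: "state (slice t)"
proof (rule stateI_less[OF slice_row])
  fix \<iota> \<kappa>
  show "slice t \<iota> < slice t \<kappa> + 2 * d \<kappa>" using slice_le[of t \<iota>] slice_gt[of t \<kappa>] by linarith
qed

text \<open>Around a source every state looks like a slice. This carries the mesh relation, which is
  stated on slices, over to arbitrary states.\<close>

lemma source_nbr:
  assumes "state \<eta>" "source \<eta> \<iota>" "adj \<iota> \<kappa>"
  shows "slice (\<eta> \<iota>) \<kappa> = \<eta> \<kappa>"
  using source_less[OF assms(2,3)] state_less[OF assms(1,3)] state_row[OF assms(1)]
  by (intro slice_eqI) auto

definition level :: "int \<Rightarrow> 'v list" where
  "level t = (SOME xs. distinct xs \<and> set xs = {\<iota>. in_row \<iota> t})"

lemma level: "distinct (level t)" "set (level t) = {\<iota>. in_row \<iota> t}"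
proof -
  have "\<exists>xs. distinct xs \<and> set xs = {\<iota>. in_row \<iota> t}" using finite_distinct_list[of "{\<iota>. in_row \<iota> t}"] by auto
  from someI_ex[OF this] show "distinct (level t)" "set (level t) = {\<iota>. in_row \<iota> t}"
    unfolding level_def by auto
qed

text \<open>Reflecting in one letter does not change the coefficients at the other, non-adjacent
  letters, so the corrections simply add up.\<close>

lemma word_refl_commuting:
  assumes "distinct xs" "\<And>\<iota> \<kappa>. \<iota> \<in> set xs \<Longrightarrow> \<kappa> \<in> set xs \<Longrightarrow> \<not> adj \<iota> \<kappa>"
  shows "word_refl xs l = (\<lambda>\<kappa>. l \<kappa> - (\<Sum>\<iota>\<in>set xs. l \<iota> * simple_root \<iota> \<kappa>))"
  using assms
proof (induction xs)
  case (Cons \<iota> xs)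
  have IH: "word_refl xs l = (\<lambda>\<kappa>. l \<kappa> - (\<Sum>\<iota>\<in>set xs. l \<iota> * simple_root \<iota> \<kappa>))"
    using Cons by simp
  have "word_refl xs l \<iota> = l \<iota>"
  proof -
    have "simple_root \<mu> \<iota> = 0" if "\<mu> \<in> set xs" for \<mu>
      using Cons.prems that by (auto simp: simple_root_def)
    then show ?thesis unfolding IH by simp
  qed
  then show ?case using Cons.prems(1) by (simp add: simple_refl_def IH fun_eq_iff)
qed simp

lemma level_refl: "word_refl (level t) l = (\<lambda>\<kappa>. l \<kappa> - (\<Sum>\<iota> | in_row \<iota> t. l \<iota> * simple_root \<iota> \<kappa>))"
proof -
  have "\<not> adj \<iota> \<kappa>" if "\<iota> \<in> set (level t)" "\<kappa> \<in> set (level t)" for \<iota> \<kappa>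
    using that adj_rows_neq[of \<iota> \<kappa> t t] by (auto simp: level)
  from word_refl_commuting[OF level(1) this] show ?thesis by (simp add: level(2))
qed

lemma level_refl_invol: "word_refl (level t) (word_refl (level t) l) = l"
proof -
  have na: "\<not> adj \<iota> \<kappa>" if "\<iota> \<in> set (rev (level t))" "\<kappa> \<in> set (rev (level t))" for \<iota> \<kappa>
    using that adj_rows_neq[of \<iota> \<kappa> t t] by (auto simp: level)
  have "word_refl (rev (level t)) k = word_refl (level t) k" for k
    using word_refl_commuting[of "rev (level t)" k, OF _ na] by (simp add: level level_refl)
  then show ?thesis by (metis word_refl_rev(1))
qed

text \<open>The Weyl group element of the path from the slice at time 0 to the slice at time \<open>t\<close>.\<close>

definition frame_word :: "int \<Rightarrow> 'v list" where
  "frame_word t = (if 0 \<le> t then concat (map (\<lambda>i. level (int i)) [1..<Suc (nat t)])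
     else concat (map (\<lambda>i. level (- int i)) [0..<nat (- t)]))"

abbreviation frame :: "int \<Rightarrow> ('v \<Rightarrow> int) \<Rightarrow> 'v \<Rightarrow> int" where
  "frame t \<equiv> word_refl (frame_word t)"

lemma frame_0 [simp]: "frame 0 l = l"
  by (simp add: frame_word_def)

text \<open>For positive \<open>t\<close> the word ends with the level at \<open>t\<close>, and
  stepping back removes it, which agrees with appending it once more because a level acts as an
  involution. For \<open>t \<le> 0\<close> the word is literally extended.\<close>

lemma frame_pred: "frame (t - 1) l = frame t (word_refl (level t) l)"
proof (cases "1 \<le> t")
  case True
  define n where "n = nat (t - 1)"
  then have n: "t = int (Suc n)" using True by simp
  have "frame_word t = frame_word (t - 1) @ level t"
    by (simp add: n frame_word_def nat_add_distrib)
  then show ?thesis by (simp add: level_refl_invol)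
next
  case False
  define n where "n = nat (- t)"
  then have n: "t = - int n" using False by simp
  have "frame_word (t - 1) = frame_word t @ level t"
    by (simp add: n frame_word_def nat_add_distrib)
  then show ?thesis by simp
qed

lemma frame_succ: "frame t l = frame (t - 1) (word_refl (level t) l)"
  by (simp add: frame_pred level_refl_invol)

section \<open>Weights and roots attached to the vertices of the quiver\<close>

definition lam :: "'v \<Rightarrow> int \<Rightarrow> 'v \<Rightarrow> int" where
  "lam \<iota> p = frame p (fund_weight \<iota>)"

lemma level_refl_fund_weight:
  "word_refl (level t) (fund_weight \<iota>) =
    (if in_row \<iota> t then (\<lambda>\<kappa>. fund_weight \<iota> \<kappa> - simple_root \<iota> \<kappa>) else fund_weight \<iota>)"
proof -
  have "(\<Sum>\<mu> | in_row \<mu> t. fund_weight \<iota> \<mu> * simple_root \<mu> \<kappa>) =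
    (\<Sum>\<mu> | in_row \<mu> t. if \<mu> = \<iota> then simple_root \<iota> \<kappa> else 0)" for \<kappa>
    by (intro sum.cong) (auto simp: fund_weight_def)
  then show ?thesis by (simp add: level_refl fun_eq_iff)
qed

text \<open>A level moves a fundamental weight only if it contains that vertex, so between two times
  of a row its weight is frozen. Thus the image depends on a vertex of the quiver and not on the
  history.\<close>

lemma frame_fund_weight: "frame t (fund_weight \<iota>) = lam \<iota> (slice t \<iota>)"
proof -
  have "frame (slice t \<iota> + int n) (fund_weight \<iota>) = lam \<iota> (slice t \<iota>)"
    if "slice t \<iota> + int n < slice t \<iota> + 2 * d \<iota>" for n
    using that
  proof (induction n)
    case (Suc n)
    have "\<not> in_row \<iota> (slice t \<iota> + int (Suc n))"
    proof
      assume "in_row \<iota> (slice t \<iota> + int (Suc n))"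
      from in_row_ge[OF this slice_row[of \<iota> t]] show False using Suc.prems by simp
    qed
    then show ?case
      using Suc frame_succ[of "slice t \<iota> + int (Suc n)" "fund_weight \<iota>"]
      by (simp add: level_refl_fund_weight)
  qed (simp add: lam_def)
  from this[of "nat (t - slice t \<iota>)"] show ?thesis using slice_le[of t \<iota>] slice_gt[of t \<iota>] by simp
qed

lemma simple_root_expand: "simple_root \<iota> = (\<lambda>\<mu>. 2 * fund_weight \<iota> \<mu> - (\<Sum>\<kappa> | adj \<iota> \<kappa>. fund_weight \<kappa> \<mu>))"
proof
  fix \<mu>
  have "(\<Sum>\<kappa> | adj \<iota> \<kappa>. fund_weight \<kappa> \<mu>) = of_bool (adj \<iota> \<mu>)"
    by (simp add: fund_weight_def of_bool_def sum.If_cases)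
  then show "simple_root \<iota> \<mu> = 2 * fund_weight \<iota> \<mu> - (\<Sum>\<kappa> | adj \<iota> \<kappa>. fund_weight \<kappa> \<mu>)"
    by (auto simp: simple_root_def fund_weight_def)
qed

lemma word_refl_sum:
  assumes "finite A"
  shows "word_refl is (\<lambda>\<mu>. \<Sum>\<kappa>\<in>A. c \<kappa> * f \<kappa> \<mu>) = (\<lambda>\<mu>. \<Sum>\<kappa>\<in>A. c \<kappa> * word_refl is (f \<kappa>) \<mu>)"
  using assms
proof (induction A rule: finite_induct)
  case empty
  then show ?case using word_refl_linear[of "is" 0 undefined 0 undefined] by simp
next
  case (insert \<kappa> A)
  then show ?case
    using word_refl_linear[of "is" "c \<kappa>" "f \<kappa>" 1 "\<lambda>\<mu>. \<Sum>\<kappa>\<in>A. c \<kappa> * f \<kappa> \<mu>"] by simp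
qed

lemma weight_expand: "l = (\<lambda>\<mu>. \<Sum>\<kappa>\<in>UNIV. l \<kappa> * fund_weight \<kappa> \<mu>)"
  by (simp add: fund_weight_def fun_eq_iff)

lemma word_refl_expand: "word_refl is l \<mu> = (\<Sum>\<kappa>\<in>UNIV. l \<kappa> * word_refl is (fund_weight \<kappa>) \<mu>)"
  by (subst weight_expand) (simp add: word_refl_sum)

text \<open>Written as a difference of weights, so that every linear map known on \<open>lam\<close>
  transports it at once; \<open>beta_eq\<close> identifies it with the root of the overview.\<close>

definition beta :: "'v \<Rightarrow> int \<Rightarrow> 'v \<Rightarrow> int" where
  "beta \<iota> p = (\<lambda>\<mu>. lam \<iota> p \<mu> - lam \<iota> (p - 2 * d \<iota>) \<mu>)"

lemma beta_eq: "in_row \<iota> p \<Longrightarrow> beta \<iota> p = frame p (simple_root \<iota>)"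
proof -
  assume p: "in_row \<iota> p"
  have "lam \<iota> (p - 2 * d \<iota>) = frame (p - 1) (fund_weight \<iota>)"
    using p by (simp add: frame_fund_weight slice_pred)
  also have "\<dots> = frame p (\<lambda>\<kappa>. fund_weight \<iota> \<kappa> - simple_root \<iota> \<kappa>)"
    using p by (simp add: frame_pred level_refl_fund_weight)
  finally show ?thesis by (simp add: beta_def lam_def word_refl_diff)
qed

text \<open>This is \<open>simple_root_expand\<close> carried along by the frame, combined with the
  fact that firing subtracts the root from the weight of its row.\<close>

lemma mesh:
  assumes "in_row \<iota> p"
  shows "lam \<iota> p \<mu> + lam \<iota> (p - 2 * d \<iota>) \<mu> = (\<Sum>\<kappa> | adj \<iota> \<kappa>. lam \<kappa> (slice p \<kappa>) \<mu>)"
proof -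
  have "frame p (simple_root \<iota>) \<mu> = 2 * lam \<iota> p \<mu> - (\<Sum>\<kappa> | adj \<iota> \<kappa>. lam \<kappa> (slice p \<kappa>) \<mu>)"
    using word_refl_sum[of "{\<kappa>. adj \<iota> \<kappa>}" "frame_word p" "\<lambda>_. 1" fund_weight]
      word_refl_linear[of "frame_word p" 2 "fund_weight \<iota>" "-1" "\<lambda>\<mu>. \<Sum>\<kappa> | adj \<iota> \<kappa>. fund_weight \<kappa> \<mu>"]
    by (subst simple_root_expand) (simp add: frame_fund_weight slice_self[OF assms])
  then show ?thesis using beta_eq[OF assms] fun_cong[OF beta_def[of \<iota> p], of \<mu>] by simp
qed

text \<open>The Weyl group element of a path from the slice at time 0 to the height function \<open>\<eta>\<close>.\<close>

definition place :: "('v \<Rightarrow> int) \<Rightarrow> ('v \<Rightarrow> int) \<Rightarrow> 'v \<Rightarrow> int" where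
  "place \<eta> l = (\<lambda>\<mu>. \<Sum>\<kappa>\<in>UNIV. l \<kappa> * lam \<kappa> (\<eta> \<kappa>) \<mu>)"

lemma place_slice: "place (slice t) = frame t"
  by (intro ext) (simp add: place_def word_refl_expand[of "frame_word t"] frame_fund_weight)

lemma place_fund_weight: "place \<eta> (fund_weight \<iota>) = lam \<iota> (\<eta> \<iota>)"
  by (simp add: place_def fund_weight_def)

lemma place_simple_root:
  assumes "state \<eta>" "source \<eta> \<iota>"
  shows "place \<eta> (simple_root \<iota>) = beta \<iota> (\<eta> \<iota>)"
proof
  fix \<mu>
  have "place \<eta> (simple_root \<iota>) \<mu> = 2 * lam \<iota> (\<eta> \<iota>) \<mu> - (\<Sum>\<kappa> | adj \<iota> \<kappa>. lam \<kappa> (\<eta> \<kappa>) \<mu>)"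
  proof -
    have "place \<eta> (simple_root \<iota>) \<mu> =
      (\<Sum>\<kappa>\<in>UNIV. (if \<kappa> = \<iota> then 2 * lam \<iota> (\<eta> \<iota>) \<mu> else 0) - (if adj \<iota> \<kappa> then lam \<kappa> (\<eta> \<kappa>) \<mu> else 0))"
      unfolding place_def by (intro sum.cong) (auto simp: simple_root_def)
    then show ?thesis by (simp add: sum_subtractf sum.If_cases)
  qed
  also have "(\<Sum>\<kappa> | adj \<iota> \<kappa>. lam \<kappa> (\<eta> \<kappa>) \<mu>) = (\<Sum>\<kappa> | adj \<iota> \<kappa>. lam \<kappa> (slice (\<eta> \<iota>) \<kappa>) \<mu>)"
    by (intro sum.cong) (auto simp: source_nbr[OF assms])
  finally show "place \<eta> (simple_root \<iota>) \<mu> = beta \<iota> (\<eta> \<iota>) \<mu>"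
    using mesh[OF state_row[OF assms(1)], of \<iota> \<mu>] by (simp add: beta_def)
qed

lemma place_fire:
  assumes "state \<eta>" "source \<eta> \<iota>"
  shows "place (fire \<iota> \<eta>) l = place \<eta> (simple_refl \<iota> l)"
proof
  fix \<mu>
  have "place (fire \<iota> \<eta>) l \<mu> = (\<Sum>\<kappa>\<in>UNIV. l \<kappa> * lam \<kappa> (\<eta> \<kappa>) \<mu> - (if \<kappa> = \<iota> then l \<iota> * beta \<iota> (\<eta> \<iota>) \<mu> else 0))"
    unfolding place_def by (intro sum.cong) (auto simp: fire_apply beta_def algebra_simps)
  also have "\<dots> = place \<eta> l \<mu> - l \<iota> * place \<eta> (simple_root \<iota>) \<mu>"
    by (simp add: sum_subtractf place_simple_root[OF assms]) (simp add: place_def)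
  also have "\<dots> = place \<eta> (simple_refl \<iota> l) \<mu>"
    by (simp add: place_def simple_refl_def sum_subtractf sum_distrib_left algebra_simps)
  finally show "place (fire \<iota> \<eta>) l \<mu> = place \<eta> (simple_refl \<iota> l) \<mu>" .
qed

lemma place_run: "state \<eta> \<Longrightarrow> adapted \<eta> is \<Longrightarrow> place (run \<eta> is) l = place \<eta> (word_refl is l)"
  by (induction "is" arbitrary: \<eta>) (auto simp: adapted_Cons run_Cons state_fire place_fire)

lemma place_word:
  assumes "state \<eta>"
  shows "\<exists>xs. place \<eta> = word_refl xs"
proof -
  \<comment> \<open>Late enough for the slice to lie above all of \<open>\<eta>\<close>, which is
    then reached by firing.\<close>
  define t where "t = Max (range \<eta>)"
  have "\<eta> \<iota> \<le> slice t \<iota>" for \<iota>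
    by (intro slice_ge state_row assms) (simp add: t_def)
  then obtain js where "adapted (slice t) js" "run (slice t) js = \<eta>"
    using ex_adapted[OF state_slice assms] by blast
  then have "place \<eta> l = word_refl (frame_word t @ js) l" for l
    using place_run[OF state_slice, of t js l] by (simp add: place_slice)
  then have "place \<eta> = word_refl (frame_word t @ js)" by (rule ext)
  then show ?thesis by (rule exI)
qed

lemma bij_word_refl: "bij (word_refl is)"
  by (rule o_bij[of "word_refl (rev is)"]) (auto simp: fun_eq_iff)

lemma bij_place: "state \<eta> \<Longrightarrow> bij (place \<eta>)"
  using place_word[of \<eta>] bij_word_refl by auto

subsection \<open>The twisted shift\<close>

definition shift :: "('v \<Rightarrow> int) \<Rightarrow> 'v \<Rightarrow> int" where
  "shift \<eta> = (\<lambda>\<iota>. \<eta> (inv \<sigma> \<iota>) - 2)"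

lemma shift_sigma [simp]: "shift \<eta> (\<sigma> \<iota>) = \<eta> \<iota> - 2"
  by (simp add: shift_def)

lemma in_row_shift: "in_row \<iota> (shift \<eta> \<iota>) \<longleftrightarrow> in_row (inv \<sigma> \<iota>) (\<eta> (inv \<sigma> \<iota>))"
  using in_row_sigma[of "inv \<sigma> \<iota>" "\<eta> (inv \<sigma> \<iota>)"] by (simp add: shift_def)

lemma adj_inv_sigma: "adj (inv \<sigma> \<iota>) (inv \<sigma> \<kappa>) \<longleftrightarrow> adj \<iota> \<kappa>"
  by (metis adj_sigma inv_sigma(2))

lemma state_shift:
  assumes "state \<eta>"
  shows "state (shift \<eta>)"
proof (rule stateI_less)
  show "in_row \<iota> (shift \<eta> \<iota>)" for \<iota> by (simp add: in_row_shift state_row[OF assms])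
  show "shift \<eta> \<iota> < shift \<eta> \<kappa> + 2 * d \<kappa>" if "adj \<iota> \<kappa>" for \<iota> \<kappa>
    using state_less[OF assms, of "inv \<sigma> \<iota>" "inv \<sigma> \<kappa>"] that by (simp add: adj_inv_sigma shift_def)
qed

definition cox :: "('v \<Rightarrow> int) \<Rightarrow> 'v \<Rightarrow> int" where
  "cox l = frame (- 2) (sigma_act l)"

lemma level_sigma: "sigma_act (word_refl (level t) l) = word_refl (level (t - 2)) (sigma_act l)"
proof
  fix \<mu>
  obtain \<kappa> where \<kappa>: "\<mu> = \<sigma> \<kappa>" by (metis inv_sigma(2))
  have "(\<Sum>\<iota> | in_row \<iota> (t - 2). sigma_act l \<iota> * simple_root \<iota> (\<sigma> \<kappa>)) =
    (\<Sum>\<iota> | in_row \<iota> t. sigma_act l (\<sigma> \<iota>) * simple_root (\<sigma> \<iota>) (\<sigma> \<kappa>))"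
  proof (rule sum.reindex_bij_witness[of _ \<sigma> "inv \<sigma>"])
    show "\<And>a. a \<in> {\<iota>. in_row \<iota> (t - 2)} \<Longrightarrow> inv \<sigma> a \<in> {\<iota>. in_row \<iota> t}"
      using in_row_sigma[of "inv \<sigma> _" t] by simp
  qed auto
  then show "sigma_act (word_refl (level t) l) \<mu> = word_refl (level (t - 2)) (sigma_act l) \<mu>"
    by (simp add: \<kappa> level_refl sigma_act_simple_root[symmetric])
qed

text \<open>The shift by \<open>\<sigma>\<close> and two time units maps rows to rows, so it
  conjugates the level at \<open>t\<close> into the level at \<open>t - 2\<close>. At time 0 the
  claim is the definition of \<open>cox\<close>, and the induction runs in both directions.\<close>

lemma frame_cox: "frame (t - 2) (sigma_act l) = cox (frame t l)"
proof (induction t arbitrary: l rule: int_induct[of _ 0])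
  case base
  then show ?case by (simp add: cox_def)
next
  case (step1 t)
  have "frame (t + 1 - 2) (sigma_act l) = frame (t + 1 - 2 - 1) (word_refl (level (t + 1 - 2)) (sigma_act l))"
    by (rule frame_succ)
  also have "\<dots> = frame (t - 2) (sigma_act (word_refl (level (t + 1)) l))"
    using level_sigma[of "t + 1" l] by (simp add: algebra_simps)
  also have "\<dots> = cox (frame (t + 1) l)" using step1(2) frame_succ[of "t + 1" l] by simp
  finally show ?case .
next
  case (step2 t)
  have "frame (t - 1 - 2) (sigma_act l) = frame (t - 2 - 1) (sigma_act l)" by (simp add: algebra_simps)
  also have "\<dots> = frame (t - 2) (sigma_act (word_refl (level t) l))"
    by (simp only: frame_pred level_sigma)
  also have "\<dots> = cox (frame (t - 1) l)" using step2(2) frame_pred[of t l] by simp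
  finally show ?case .
qed

lemma cox_lam: "cox (lam \<iota> p) = lam (\<sigma> \<iota>) (p - 2)"
  unfolding lam_def frame_cox[symmetric] by (simp add: sigma_act_fund_weight)

lemma cox_linear: "cox (\<lambda>\<kappa>. a * l \<kappa> + b * k \<kappa>) = (\<lambda>\<kappa>. a * cox l \<kappa> + b * cox k \<kappa>)"
  by (simp add: cox_def sigma_act_linear word_refl_linear)

lemma cox_diff: "cox (\<lambda>\<kappa>. l \<kappa> - k \<kappa>) = (\<lambda>\<kappa>. cox l \<kappa> - cox k \<kappa>)"
  using cox_linear[of 1 l "-1" k] by simp

lemma cox_sum:
  assumes "finite A"
  shows "cox (\<lambda>\<mu>. \<Sum>\<kappa>\<in>A. c \<kappa> * f \<kappa> \<mu>) = (\<lambda>\<mu>. \<Sum>\<kappa>\<in>A. c \<kappa> * cox (f \<kappa>) \<mu>)"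
  using assms
proof (induction A rule: finite_induct)
  case empty
  then show ?case using cox_linear[of 0 undefined 0 undefined] by simp
next
  case (insert \<kappa> A)
  then show ?case
    using cox_linear[of "c \<kappa>" "f \<kappa>" 1 "\<lambda>\<mu>. \<Sum>\<kappa>\<in>A. c \<kappa> * f \<kappa> \<mu>"] by simp
qed

lemma bij_cox: "bij cox"
proof -
  have "cox = frame (- 2) \<circ> sigma_act" by (auto simp: cox_def)
  then show ?thesis using bij_comp[OF bij_sigma_act bij_word_refl] by simp
qed

lemma place_shift: "place (shift \<eta>) (sigma_act l) = cox (place \<eta> l)"
proof
  fix \<mu>
  have "place (shift \<eta>) (sigma_act l) \<mu> = (\<Sum>\<kappa>\<in>UNIV. sigma_act l (\<sigma> \<kappa>) * lam (\<sigma> \<kappa>) (shift \<eta> (\<sigma> \<kappa>)) \<mu>)"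
    unfolding place_def by (rule sum_sigma[symmetric])
  also have "\<dots> = (\<Sum>\<kappa>\<in>UNIV. l \<kappa> * cox (lam \<kappa> (\<eta> \<kappa>)) \<mu>)" by (simp add: cox_lam)
  also have "\<dots> = cox (place \<eta> l) \<mu>" by (simp add: place_def cox_sum)
  finally show "place (shift \<eta>) (sigma_act l) \<mu> = cox (place \<eta> l) \<mu>" .
qed

end

section \<open>A positive trigonometric solution of the mesh relations\<close>

text \<open>The first order condition at a minimum. It turns a null vector of a semidefinite form
  into a kernel vector.\<close>

lemma linear_coeff_zero:
  fixes a c :: real
  assumes "\<And>t. 0 \<le> a * t + c * t\<^sup>2"
  shows "a = 0"
proof (rule ccontr)
  assume "a \<noteq> 0"
  define s where "s = \<bar>c\<bar> + 1"
  have s: "s > 0" "c < s" by (auto simp: s_def)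
  have "a * (- a / s) + c * (- a / s)\<^sup>2 = a\<^sup>2 * (c - s) / s\<^sup>2"
    using s by (simp add: field_simps power2_eq_square)
  moreover have "a\<^sup>2 * (c - s) / s\<^sup>2 < 0"
    using s \<open>a \<noteq> 0\<close> by (intro divide_neg_pos mult_pos_neg) auto
  ultimately show False using assms[of "- a / s"] by simp
qed

lemma funpow_left_inverse:
  fixes f g :: "'a \<Rightarrow> 'a"
  shows "(\<And>x. g (f x) = x) \<Longrightarrow> (g ^^ n) ((f ^^ n) x) = x"
  by (induction n) (simp_all add: funpow_swap1[of g])

context Q_datum
begin

text \<open>The mean of the cosine over the \<open>r\<close> equally spaced phases of an orbit: the
  normalised Dirichlet kernel, \<open>sin (r \<theta>) / (r sin \<theta>)\<close> where the
  denominator does not vanish.\<close>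

definition dirichlet :: "real \<Rightarrow> real" where
  "dirichlet \<theta> = (\<Sum>l<r. cos ((real r - 1 - 2 * real l) * \<theta>)) / real r"

lemma dirichlet_0 [simp]: "dirichlet 0 = 1"
  using r_pos by (simp add: dirichlet_def)

lemma dirichlet_pos:
  assumes "0 \<le> \<theta>" "real r * \<theta> \<le> pi / 2"
  shows "0 < dirichlet \<theta>"
  unfolding dirichlet_def
proof (intro divide_pos_pos sum_pos)
  fix l assume "l \<in> {..<r}"
  then have "\<bar>real r - 1 - 2 * real l\<bar> \<le> real r - 1" by (auto simp: abs_if)
  then have "\<bar>(real r - 1 - 2 * real l) * \<theta>\<bar> \<le> (real r - 1) * \<theta>"
    using assms(1) by (simp add: abs_mult mult_right_mono)
  also have "\<dots> < pi / 2"
  proof (cases "\<theta> = 0")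
    case False
    then show ?thesis using assms by (simp add: algebra_simps)
  qed simp
  finally show "0 < cos ((real r - 1 - 2 * real l) * \<theta>)" by (intro cos_gt_zero_pi) auto
qed (use r_pos in auto)

lemma sum_lessThan_r: "(\<Sum>l<r. f l) = (if r = 1 then f 0 else if r = 2 then f 0 + f 1 else f 0 + f 1 + f (2::nat))"
  using r_cases by (auto simp: numeral_2_eq_2 numeral_3_eq_3 add.assoc)

text \<open>The phases are symmetric about 0, so the sine parts cancel.\<close>

lemma sum_cos_shift: "(\<Sum>l<r. cos (a + (real r - 1 - 2 * real l) * \<theta>)) = real r * dirichlet \<theta> * cos a"
proof -
  have "real r * dirichlet \<theta> = (\<Sum>l<r. cos ((real r - 1 - 2 * real l) * \<theta>))"
    using r_pos by (simp add: dirichlet_def)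
  moreover have "(\<Sum>l<r. cos (a + (real r - 1 - 2 * real l) * \<theta>)) =
    (\<Sum>l<r. cos ((real r - 1 - 2 * real l) * \<theta>)) * cos a"
    unfolding sum_lessThan_r using r_cases
    by (elim disjE) (simp_all add: cos_add cos_diff distrib_right)
  ultimately show ?thesis by simp
qed

text \<open>Edges from a fixed vertex to a larger orbit get the weight \<open>dirichlet\<close>, which makes the
  system symmetrizable.\<close>

definition edge_weight :: "real \<Rightarrow> 'v \<Rightarrow> 'v \<Rightarrow> real" where
  "edge_weight \<theta> \<iota> \<kappa> = (if d \<iota> < d \<kappa> then dirichlet \<theta> else 1)"

definition vertex_weight :: "real \<Rightarrow> 'v \<Rightarrow> real" where
  "vertex_weight \<theta> \<iota> = (if d \<iota> = 1 then 1 else dirichlet \<theta>)"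

definition deformed_form :: "real \<Rightarrow> ('v \<Rightarrow> real) \<Rightarrow> ('v \<Rightarrow> real) \<Rightarrow> real" where
  "deformed_form \<theta> x y = (\<Sum>\<iota>\<in>UNIV. 2 * vertex_weight \<theta> \<iota> * cos (real_of_int (d \<iota>) * \<theta>) * x \<iota> * y \<iota>) -
     (\<Sum>\<iota>\<in>UNIV. \<Sum>\<kappa> | adj \<iota> \<kappa>. vertex_weight \<theta> \<iota> * edge_weight \<theta> \<iota> \<kappa> * x \<iota> * y \<kappa>)"

lemma weights_sym: "vertex_weight \<theta> \<iota> * edge_weight \<theta> \<iota> \<kappa> = vertex_weight \<theta> \<kappa> * edge_weight \<theta> \<kappa> \<iota>"
  unfolding vertex_weight_def edge_weight_def using r_pos by (auto simp: d_eq)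

lemma weights_pos:
  assumes "0 \<le> \<theta>" "real r * \<theta> \<le> pi / 2"
  shows "0 < vertex_weight \<theta> \<iota>" "0 < edge_weight \<theta> \<iota> \<kappa>"
  using dirichlet_pos[OF assms] by (auto simp: vertex_weight_def edge_weight_def)

lemma deformed_form_0: "deformed_form 0 x x = real_form x"
proof -
  have "vertex_weight 0 \<iota> = 1" "edge_weight 0 \<iota> \<kappa> = 1" for \<iota> \<kappa>
    by (simp_all add: vertex_weight_def edge_weight_def)
  then show ?thesis by (simp add: deformed_form_def real_form_def power2_eq_square mult.assoc)
qed

lemma deformed_form_sym: "deformed_form \<theta> x y = deformed_form \<theta> y x"
proof -
  have "(\<Sum>\<iota>\<in>UNIV. \<Sum>\<kappa> | adj \<iota> \<kappa>. vertex_weight \<theta> \<iota> * edge_weight \<theta> \<iota> \<kappa> * x \<iota> * y \<kappa>) =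
    (\<Sum>\<kappa>\<in>UNIV. \<Sum>\<iota> | adj \<iota> \<kappa>. vertex_weight \<theta> \<iota> * edge_weight \<theta> \<iota> \<kappa> * x \<iota> * y \<kappa>)"
    using sum.swap_restrict[of UNIV UNIV _ adj] by simp
  also have "\<dots> = (\<Sum>\<kappa>\<in>UNIV. \<Sum>\<iota> | adj \<kappa> \<iota>. vertex_weight \<theta> \<kappa> * edge_weight \<theta> \<kappa> \<iota> * y \<kappa> * x \<iota>)"
  proof (intro sum.cong)
    show "{\<iota>. adj \<iota> \<kappa>} = {\<iota>. adj \<kappa> \<iota>}" for \<kappa> using adj_sym by blast
    show "vertex_weight \<theta> \<iota> * edge_weight \<theta> \<iota> \<kappa> * x \<iota> * y \<kappa> =
      vertex_weight \<theta> \<kappa> * edge_weight \<theta> \<kappa> \<iota> * y \<kappa> * x \<iota>" for \<iota> \<kappa>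
      unfolding weights_sym[of \<theta> \<iota> \<kappa>] by simp
  qed simp
  finally show ?thesis by (simp add: deformed_form_def mult_ac)
qed

lemma deformed_form_add: "deformed_form \<theta> (\<lambda>\<iota>. x \<iota> + z \<iota>) y = deformed_form \<theta> x y + deformed_form \<theta> z y"
  by (simp add: deformed_form_def algebra_simps sum.distrib)

lemma deformed_form_scale: "deformed_form \<theta> (\<lambda>\<iota>. t * x \<iota>) y = t * deformed_form \<theta> x y"
  by (simp add: deformed_form_def algebra_simps sum_distrib_left)

lemma deformed_form_unit:
  "deformed_form \<theta> (\<lambda>\<kappa>. of_bool (\<kappa> = \<iota>)) y = vertex_weight \<theta> \<iota> *
    (2 * cos (real_of_int (d \<iota>) * \<theta>) * y \<iota> - (\<Sum>\<kappa> | adj \<iota> \<kappa>. edge_weight \<theta> \<iota> \<kappa> * y \<kappa>))"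
proof -
  have "(\<Sum>\<mu>\<in>UNIV. \<Sum>\<kappa> | adj \<mu> \<kappa>. vertex_weight \<theta> \<mu> * edge_weight \<theta> \<mu> \<kappa> * of_bool (\<mu> = \<iota>) * y \<kappa>) =
    (\<Sum>\<mu>\<in>UNIV. if \<mu> = \<iota> then \<Sum>\<kappa> | adj \<iota> \<kappa>. vertex_weight \<theta> \<iota> * edge_weight \<theta> \<iota> \<kappa> * y \<kappa> else 0)"
    by (intro sum.cong) auto
  moreover have "(\<Sum>\<mu>\<in>UNIV. 2 * vertex_weight \<theta> \<mu> * cos (real_of_int (d \<mu>) * \<theta>) * of_bool (\<mu> = \<iota>) * y \<mu>) =
    (\<Sum>\<mu>\<in>UNIV. if \<mu> = \<iota> then 2 * vertex_weight \<theta> \<iota> * cos (real_of_int (d \<iota>) * \<theta>) * y \<iota> else 0)"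
    by (intro sum.cong) auto
  ultimately show ?thesis
    by (simp add: deformed_form_def algebra_simps sum_distrib_left)
qed

lemma continuous_deformed_form:
  "continuous_on UNIV (\<lambda>z. deformed_form (fst z) (\<lambda>\<iota>. snd z $ \<iota>) (\<lambda>\<iota>. (snd z :: real ^ 'v) $ \<iota>))"
proof -
  have "continuous_on UNIV (\<lambda>z :: real \<times> (real ^ 'v). dirichlet (fst z))"
    unfolding dirichlet_def by (intro continuous_intros) (use r_pos in auto)
  then have "continuous_on UNIV (\<lambda>z :: real \<times> (real ^ 'v). vertex_weight (fst z) \<iota>) \<and>
    continuous_on UNIV (\<lambda>z :: real \<times> (real ^ 'v). edge_weight (fst z) \<iota> \<kappa>)" for \<iota> \<kappa>
    unfolding vertex_weight_def edge_weight_def by (cases "d \<iota> = 1"; cases "d \<iota> < d \<kappa>") simp_all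
  then have "continuous_on UNIV (\<lambda>z :: real \<times> (real ^ 'v). vertex_weight (fst z) \<iota>)"
    and "continuous_on UNIV (\<lambda>z :: real \<times> (real ^ 'v). edge_weight (fst z) \<iota> \<kappa>)" for \<iota> \<kappa>
    by blast+
  then show ?thesis unfolding deformed_form_def by (intro continuous_intros)
qed

text \<open>The angle \<open>\<theta>\<close> is the least one at which the deformed form stops being positive definite;
  the absolute values of a null vector then form a null vector.\<close>

lemma perron_frobenius:
  obtains \<theta> and b :: "'v \<Rightarrow> real" where "0 < \<theta>" "real r * \<theta> \<le> pi / 2" "\<And>\<iota>. 0 < b \<iota>"
    "\<And>\<iota>. b (\<sigma> \<iota>) = b \<iota>"
    "\<And>\<iota>. 2 * cos (real_of_int (d \<iota>) * \<theta>) * b \<iota> = (\<Sum>\<kappa> | adj \<iota> \<kappa>. edge_weight \<theta> \<iota> \<kappa> * b \<kappa>)"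
proof -
  define F where "F z = deformed_form (fst z) (\<lambda>\<iota>. snd z $ \<iota>) (\<lambda>\<iota>. (snd z :: real ^ 'v) $ \<iota>)" for z
  have contF: "continuous_on UNIV F" unfolding F_def by (rule continuous_deformed_form)
  \<comment> \<open>At this angle the diagonal entry of a vertex with \<open>d = r\<close> vanishes,
    so the form is not positive definite there and the compact set \<open>C\<close> of bad pairs is
    nonempty.\<close>
  define \<theta>1 where "\<theta>1 = pi / (2 * real r)"
  have \<theta>1: "0 < \<theta>1" "real r * \<theta>1 = pi / 2" using r_pos by (auto simp: \<theta>1_def)
  define C where "C = ({0..\<theta>1} \<times> sphere (0 :: real ^ 'v) 1) \<inter> {z. F z \<le> 0}"
  have "closed {z. F z \<le> 0}" using contF by (intro closed_Collect_le) auto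
  then have "compact C" unfolding C_def by (intro compact_Int_closed compact_Times) auto
  moreover have "C \<noteq> {}"
  proof -
    obtain \<iota> where \<iota>: "d \<iota> = int r" using ex_d_eq_r by blast
    have ax: "(\<lambda>\<kappa>. (axis \<iota> 1 :: real ^ 'v) $ \<kappa>) = (\<lambda>\<kappa>. of_bool (\<kappa> = \<iota>))" by (auto simp: axis_def)
    have "(\<Sum>\<kappa> | adj \<iota> \<kappa>. edge_weight \<theta>1 \<iota> \<kappa> * of_bool (\<kappa> = \<iota>)) = 0"
      by (intro sum.neutral) auto
    then have "F (\<theta>1, axis \<iota> 1) = 0"
      unfolding F_def by (simp add: ax deformed_form_unit \<iota> \<theta>1)
    then have "(\<theta>1, axis \<iota> 1) \<in> C" using \<theta>1 by (simp add: C_def)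
    then show ?thesis by blast
  qed
  ultimately have "\<exists>x\<in>C. \<forall>y\<in>C. fst x \<le> fst y"
    by (rule continuous_attains_inf) (intro continuous_intros)
  then obtain z0 where z0: "z0 \<in> C" "\<And>z. z \<in> C \<Longrightarrow> fst z0 \<le> fst z" by blast
  define \<theta> v0 where "\<theta> = fst z0" and "v0 = snd z0"
  have z: "0 \<le> \<theta>" "\<theta> \<le> \<theta>1" "norm v0 = 1" "F (\<theta>, v0) \<le> 0"
    using z0(1) by (auto simp: C_def \<theta>_def v0_def mem_Times_iff)
  have r\<theta>: "real r * \<theta> \<le> pi / 2" using z(2) \<theta>1(2) r_pos by (metis mult_le_cancel_left_pos of_nat_0_less_iff)
  have v0: "v0 \<noteq> 0" using z(3) by auto
  have \<theta>0: "0 < \<theta>"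
  proof (rule ccontr)
    assume "\<not> 0 < \<theta>"
    then have "\<theta> = 0" using z(1) by simp
    then have "real_form (\<lambda>\<iota>. v0 $ \<iota>) \<le> 0" using z(4) by (simp add: F_def deformed_form_0)
    moreover have "(\<lambda>\<iota>. v0 $ \<iota>) \<noteq> (\<lambda>_. 0)" using v0 by (auto simp: vec_eq_iff fun_eq_iff)
    ultimately show False using real_form_pos by fastforce
  qed
  \<comment> \<open>By continuity a negative value would persist at slightly smaller angles, against
    the minimality of \<open>\<theta>\<close>.\<close>
  have psd: "0 \<le> deformed_form \<theta> x x" for x
  proof (rule ccontr)
    assume neg: "\<not> 0 \<le> deformed_form \<theta> x x"
    define w :: "real ^ 'v" where "w = (\<chi> \<iota>. x \<iota>)"
    have "w \<noteq> 0"
    proof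
      assume "w = 0"
      then have "x = (\<lambda>_. 0)" by (auto simp: w_def vec_eq_iff)
      then show False using neg by (simp add: deformed_form_def)
    qed
    define v where "v = (1 / norm w) *\<^sub>R w"
    have nv: "norm v = 1" using \<open>w \<noteq> 0\<close> by (simp add: v_def)
    have vx: "(\<lambda>\<iota>. v $ \<iota>) = (\<lambda>\<iota>. (1 / norm w) * x \<iota>)" by (simp add: v_def w_def fun_eq_iff)
    have "F (\<theta>, v) = (1 / norm w) * ((1 / norm w) * deformed_form \<theta> x x)"
      unfolding F_def fst_conv snd_conv vx
      by (subst deformed_form_scale, subst deformed_form_sym, subst deformed_form_scale, rule refl)
    then have "F (\<theta>, v) < 0" using neg \<open>w \<noteq> 0\<close> by (simp add: mult_pos_neg divide_neg_pos)
    moreover have "continuous_on UNIV (\<lambda>t. F (t, v))"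
      by (rule continuous_on_compose2[OF contF]) (auto intro: continuous_intros)
    then have "((\<lambda>t. F (t, v)) \<longlongrightarrow> F (\<theta>, v)) (at \<theta>)"
      by (simp add: continuous_on_eq_continuous_at isCont_def)
    ultimately have "eventually (\<lambda>t. F (t, v) < 0) (at \<theta>)" by (simp add: order_tendstoD(2))
    then obtain e where e: "0 < e" "\<And>t. t \<noteq> \<theta> \<Longrightarrow> dist t \<theta> < e \<Longrightarrow> F (t, v) < 0"
      unfolding eventually_at by auto
    define t where "t = \<theta> - min e \<theta> / 2"
    have t: "t < \<theta>" "0 \<le> t" "dist t \<theta> < e" using e(1) \<theta>0 by (auto simp: t_def dist_real_def)
    then have "F (t, v) < 0" using e(2)[of t] by simp
    then have "(t, v) \<in> C" using t z(2) nv by (simp add: C_def)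
    then show False using z0(2)[of "(t, v)"] t(1) by (simp add: \<theta>_def)
  qed
  define y where "y \<iota> = \<bar>v0 $ \<iota>\<bar>" for \<iota>
  have wpos: "0 < vertex_weight \<theta> \<iota>" "0 < edge_weight \<theta> \<iota> \<kappa>" for \<iota> \<kappa>
    using weights_pos[OF z(1) r\<theta>] by auto
  \<comment> \<open>Passing to absolute values keeps the diagonal terms and can only increase the
    subtracted products, whose weights are positive.\<close>
  have "deformed_form \<theta> y y \<le> F (\<theta>, v0)"
    unfolding F_def deformed_form_def fst_conv snd_conv
  proof (intro diff_mono sum_mono)
    fix \<iota> \<kappa>
    show "2 * vertex_weight \<theta> \<iota> * cos (real_of_int (d \<iota>) * \<theta>) * y \<iota> * y \<iota> \<le> 2 * vertex_weight \<theta> \<iota> * cos (real_of_int (d \<iota>) * \<theta>) * v0 $ \<iota> * v0 $ \<iota>"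
      by (simp add: y_def mult.assoc)
    show "vertex_weight \<theta> \<iota> * edge_weight \<theta> \<iota> \<kappa> * v0 $ \<iota> * v0 $ \<kappa> \<le> vertex_weight \<theta> \<iota> * edge_weight \<theta> \<iota> \<kappa> * y \<iota> * y \<kappa>"
    proof -
      have "v0 $ \<iota> * v0 $ \<kappa> \<le> y \<iota> * y \<kappa>"
        unfolding y_def abs_mult[symmetric] by (rule abs_ge_self)
      moreover have "0 \<le> vertex_weight \<theta> \<iota> * edge_weight \<theta> \<iota> \<kappa>"
        using wpos(1)[of \<iota>] wpos(2)[of \<iota> \<kappa>] by simp
      ultimately show ?thesis unfolding mult.assoc[of "vertex_weight \<theta> \<iota> * edge_weight \<theta> \<iota> \<kappa>"]
        by (rule mult_left_mono)
    qed
  qed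
  then have y0: "deformed_form \<theta> y y = 0" using z(4) psd[of y] by linarith
  have ker: "2 * cos (real_of_int (d \<iota>) * \<theta>) * y \<iota> = (\<Sum>\<kappa> | adj \<iota> \<kappa>. edge_weight \<theta> \<iota> \<kappa> * y \<kappa>)" for \<iota>
  proof -
    define e where "e = (\<lambda>\<kappa>. of_bool (\<kappa> = \<iota>) :: real)"
    have "2 * deformed_form \<theta> e y = 0"
    proof (rule linear_coeff_zero)
      fix t
      have "deformed_form \<theta> (\<lambda>\<kappa>. y \<kappa> + t * e \<kappa>) (\<lambda>\<kappa>. y \<kappa> + t * e \<kappa>) =
        deformed_form \<theta> y (\<lambda>\<kappa>. y \<kappa> + t * e \<kappa>) + t * deformed_form \<theta> e (\<lambda>\<kappa>. y \<kappa> + t * e \<kappa>)"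
        by (simp add: deformed_form_add deformed_form_scale)
      also have "deformed_form \<theta> y (\<lambda>\<kappa>. y \<kappa> + t * e \<kappa>) = deformed_form \<theta> y y + t * deformed_form \<theta> e y"
        by (subst deformed_form_sym) (simp add: deformed_form_add deformed_form_scale)
      also have "deformed_form \<theta> e (\<lambda>\<kappa>. y \<kappa> + t * e \<kappa>) = deformed_form \<theta> e y + t * deformed_form \<theta> e e"
        by (subst deformed_form_sym) (simp add: deformed_form_add deformed_form_scale deformed_form_sym[of \<theta> y e])
      finally show "0 \<le> 2 * deformed_form \<theta> e y * t + deformed_form \<theta> e e * t\<^sup>2"
        using psd[of "\<lambda>\<kappa>. y \<kappa> + t * e \<kappa>"] y0 by (simp add: algebra_simps power2_eq_square)
    qed
    then show ?thesis using wpos(1)[of \<iota>] by (simp add: e_def deformed_form_unit)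
  qed
  have ynn: "0 \<le> y \<iota>" for \<iota> by (simp add: y_def)
  have ypos: "0 < y \<iota>" for \<iota>
  proof (rule ccontr)
    assume "\<not> 0 < y \<iota>"
    then have "y \<iota> = 0" using ynn[of \<iota>] by simp
    have "y \<mu> = 0" for \<mu>
    proof (rule adj_connected[of "\<lambda>\<mu>. y \<mu> = 0", OF _ \<open>y \<iota> = 0\<close>])
      fix \<mu> \<nu> assume a: "adj \<mu> \<nu>" "y \<mu> = 0"
      then have "(\<Sum>\<kappa> | adj \<mu> \<kappa>. edge_weight \<theta> \<mu> \<kappa> * y \<kappa>) = 0" using ker[of \<mu>] by simp
      then have "edge_weight \<theta> \<mu> \<nu> * y \<nu> = 0"
        using a(1) ynn wpos(2) by (subst (asm) sum_nonneg_eq_0_iff) (auto simp: less_imp_le)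
      then show "y \<nu> = 0" using wpos(2)[of \<mu> \<nu>] by simp
    qed
    then have "v0 = 0" by (simp add: y_def vec_eq_iff)
    then show False using v0 by simp
  qed
  \<comment> \<open>The weights are invariant under \<open>\<sigma>\<close>, so averaging keeps the
    eigenvector equation and makes the solution constant on orbits.\<close>
  define b where "b \<iota> = (\<Sum>l<r. y ((\<sigma> ^^ l) \<iota>))" for \<iota>
  show thesis
  proof (rule that[of \<theta> b])
    show "0 < b \<iota>" for \<iota> unfolding b_def using ypos r_pos by (intro sum_pos) auto
    show "b (\<sigma> \<iota>) = b \<iota>" for \<iota>
    proof -
      have "y \<iota> + b (\<sigma> \<iota>) = (\<Sum>l<Suc r. y ((\<sigma> ^^ l) \<iota>))"
        unfolding sum.lessThan_Suc_shift b_def by (simp add: funpow_swap1)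
      also have "\<dots> = b \<iota> + y \<iota>" by (simp add: b_def)
      finally show ?thesis by simp
    qed
    show "2 * cos (real_of_int (d \<iota>) * \<theta>) * b \<iota> = (\<Sum>\<kappa> | adj \<iota> \<kappa>. edge_weight \<theta> \<iota> \<kappa> * b \<kappa>)" for \<iota>
    proof -
      have "(\<Sum>\<kappa> | adj \<iota> \<kappa>. edge_weight \<theta> \<iota> \<kappa> * y ((\<sigma> ^^ l) \<kappa>)) = 2 * cos (real_of_int (d \<iota>) * \<theta>) * y ((\<sigma> ^^ l) \<iota>)" for l
      proof -
        have "(\<Sum>\<kappa> | adj \<iota> \<kappa>. edge_weight \<theta> \<iota> \<kappa> * y ((\<sigma> ^^ l) \<kappa>)) =
          (\<Sum>\<kappa> | adj ((\<sigma> ^^ l) \<iota>) \<kappa>. edge_weight \<theta> ((\<sigma> ^^ l) \<iota>) \<kappa> * y \<kappa>)"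
        proof (rule sum.reindex_bij_witness[of _ "inv \<sigma> ^^ l" "\<sigma> ^^ l"])
          have a: "(inv \<sigma> ^^ l) ((\<sigma> ^^ l) \<mu>) = \<mu>" "(\<sigma> ^^ l) ((inv \<sigma> ^^ l) \<mu>) = \<mu>" for \<mu>
            by (simp_all add: funpow_left_inverse)
          show "(inv \<sigma> ^^ l) ((\<sigma> ^^ l) \<mu>) = \<mu>" for \<mu> by (rule a)
          show "(\<sigma> ^^ l) ((inv \<sigma> ^^ l) \<mu>) = \<mu>" for \<mu> by (rule a)
          show "(inv \<sigma> ^^ l) \<mu> \<in> {\<kappa>. adj \<iota> \<kappa>}" if "\<mu> \<in> {\<kappa>. adj ((\<sigma> ^^ l) \<iota>) \<kappa>}" for \<mu>
            using that adj_sigma_pow[of l \<iota> "(inv \<sigma> ^^ l) \<mu>"] by (simp add: a)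
        qed (simp_all add: adj_sigma_pow edge_weight_def)
        then show ?thesis using ker[of "(\<sigma> ^^ l) \<iota>"] by simp
      qed
      then have "(\<Sum>l<r. \<Sum>\<kappa> | adj \<iota> \<kappa>. edge_weight \<theta> \<iota> \<kappa> * y ((\<sigma> ^^ l) \<kappa>)) = 2 * cos (real_of_int (d \<iota>) * \<theta>) * b \<iota>"
        by (simp add: b_def sum_distrib_left)
      then show ?thesis unfolding b_def sum_distrib_left by (subst sum.swap) simp
    qed
  qed (use \<theta>0 r\<theta> in auto)
qed

text \<open>The rows of a nontrivial orbit are copies of one row with period \<open>2 * r\<close>,
  successively shifted by 2. A window of that length therefore sees \<open>r\<close> times of one
  parity, once each; \<open>c\<close> is the latest of them and \<open>j\<close> records the
  rotation.\<close>

lemma slice_sigma_pow: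
  assumes "\<sigma> \<kappa> \<noteq> \<kappa>"
  obtains c j where "c = t \<or> c = t - 1" "even (c - slice t \<kappa>)"
    "\<And>l. l < r \<Longrightarrow> slice t ((\<sigma> ^^ l) \<kappa>) = c - 2 * int ((j + l) mod r)" "j < r"
proof -
  define x where "x = slice t \<kappa>"
  have d: "d \<kappa> = int r" using assms by (simp add: d_eq)
  have x: "in_row \<kappa> x" "x \<le> t" "t < x + 2 * int r"
    using slice_row[of \<kappa> t] slice_le[of t \<kappa>] slice_gt[of t \<kappa>] d by (auto simp: x_def)
  define c where "c = (if even (t - x) then t else t - 1)"
  have c: "c = t \<or> c = t - 1" "even (c - x)" by (auto simp: c_def)
  then obtain k where k: "c = x + 2 * k" by (metis add.commute diff_add_cancel evenE)
  have k': "0 \<le> k" "k < int r" using k c(1) x by auto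
  define j where "j = nat k"
  have j: "j < r" "c = x + 2 * int j" using k k' by (auto simp: j_def)
  have "slice t ((\<sigma> ^^ l) \<kappa>) = c - 2 * int ((j + l) mod r)" if l: "l < r" for l
  proof (rule slice_eqI)
    have row: "in_row ((\<sigma> ^^ l) \<kappa>) (x - 2 * int l)" using in_row_sigma_pow[of l \<kappa> x] x(1) by simp
    have "c - 2 * int ((j + l) mod r) = (x - 2 * int l) + 2 * d ((\<sigma> ^^ l) \<kappa>) * int ((j + l) div r)"
    proof -
      have "int (j + l) = int r * int ((j + l) div r) + int ((j + l) mod r)"
        by (metis mult_div_mod_eq of_nat_add of_nat_mult)
      then show ?thesis using j(2) by (simp add: d algebra_simps)
    qed
    then show "in_row ((\<sigma> ^^ l) \<kappa>) (c - 2 * int ((j + l) mod r))" using row by (simp only: in_row_add)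
    have m: "int ((j + l) mod r) < int r" using r_pos by simp
    show "c - 2 * int ((j + l) mod r) \<le> t" using c(1) by linarith
    show "t < c - 2 * int ((j + l) mod r) + 2 * d ((\<sigma> ^^ l) \<kappa>)" using c(1) m by (auto simp: d)
  qed
  then show thesis using that[of c j] c j(1) by (simp add: x_def)
qed

lemma sum_rotate:
  assumes "j < r"
  shows "(\<Sum>l<r. f ((j + l) mod r)) = (\<Sum>l<r. f l :: real)"
proof -
  consider "r = 1" "j = 0" | "r = 2" "j = 0" | "r = 2" "j = 1" | "r = 3" "j = 0" | "r = 3" "j = 1" | "r = 3" "j = 2"
    using assms r_cases by fastforce
  then show ?thesis unfolding sum_lessThan_r by cases (simp_all add: numeral_2_eq_2)
qed

lemma sum_orbit_average:
  assumes "\<And>\<kappa>. \<kappa> \<in> A \<Longrightarrow> \<sigma> \<kappa> \<in> A"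
  shows "real r * (\<Sum>\<kappa>\<in>A. f \<kappa>) = (\<Sum>\<kappa>\<in>A. \<Sum>l<r. f ((\<sigma> ^^ l) \<kappa>))"
proof -
  have "(\<Sum>\<kappa>\<in>A. f ((\<sigma> ^^ l) \<kappa>)) = (\<Sum>\<kappa>\<in>A. f \<kappa>)" for l
  proof -
    have inj: "inj_on (\<sigma> ^^ l) A"
      using bij_sigma by (meson bij_is_inj inj_fn inj_on_subset subset_UNIV)
    have "(\<sigma> ^^ l) \<kappa> \<in> A" if "\<kappa> \<in> A" for \<kappa> using that assms by (induction l) auto
    then have "(\<sigma> ^^ l) ` A = A" by (intro endo_inj_surj inj) auto
    then show ?thesis using sum.reindex[OF inj, of f] by (simp add: comp_def)
  qed
  then show ?thesis by (subst sum.swap) simp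
qed

section \<open>Waves and the linear functionals they define\<close>

context
  fixes \<theta> :: real and b :: "'v \<Rightarrow> real"
  assumes \<theta>: "0 < \<theta>" "real r * \<theta> \<le> pi / 2"
    and b: "\<And>\<iota>. 0 < b \<iota>" "\<And>\<iota>. b (\<sigma> \<iota>) = b \<iota>"
    and eigen: "\<And>\<iota>. 2 * cos (real_of_int (d \<iota>) * \<theta>) * b \<iota> = (\<Sum>\<kappa> | adj \<iota> \<kappa>. edge_weight \<theta> \<iota> \<kappa> * b \<kappa>)"
begin

text \<open>The shift by \<open>d \<iota>\<close> puts the phase at the middle of the period from
  \<open>p\<close> to \<open>p + 2 * d \<iota>\<close>, during which the row keeps its
  weight.\<close>

definition wave :: "real \<Rightarrow> 'v \<Rightarrow> int \<Rightarrow> real" where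
  "wave \<psi> \<iota> p = b \<iota> * cos (\<theta> * (real_of_int (p + d \<iota>) - \<psi>))"

lemma b_sigma_pow: "b ((\<sigma> ^^ l) \<iota>) = b \<iota>"
  by (induction l) (simp_all add: b)

text \<open>As \<open>d = r\<close> on such an orbit, its phases are spread symmetrically around
  \<open>c + 1\<close>, and their cosines average to the Dirichlet factor times the central cosine.
  Averaging at every element of \<open>A\<close> avoids choosing representatives of orbits.\<close>

lemma sum_wave_orbits:
  assumes A: "\<And>\<kappa>. \<kappa> \<in> A \<Longrightarrow> \<sigma> \<kappa> \<in> A" "\<And>\<kappa>. \<kappa> \<in> A \<Longrightarrow> \<sigma> \<kappa> \<noteq> \<kappa>"
  shows "\<exists>c. (\<forall>\<kappa>\<in>A. (c \<kappa> = t \<or> c \<kappa> = t - 1) \<and> even (c \<kappa> - slice t \<kappa>)) \<and>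
    (\<Sum>\<kappa>\<in>A. wave \<psi> \<kappa> (slice t \<kappa>)) = (\<Sum>\<kappa>\<in>A. dirichlet \<theta> * b \<kappa> * cos (\<theta> * (real_of_int (c \<kappa>) + 1 - \<psi>)))"
proof -
  define Q where "Q \<kappa> c \<longleftrightarrow> (c = t \<or> c = t - 1) \<and> even (c - slice t \<kappa>) \<and>
    (\<Sum>l<r. wave \<psi> ((\<sigma> ^^ l) \<kappa>) (slice t ((\<sigma> ^^ l) \<kappa>))) =
    real r * (dirichlet \<theta> * b \<kappa> * cos (\<theta> * (real_of_int c + 1 - \<psi>)))" for \<kappa> c
  have "\<exists>c. Q \<kappa> c" if "\<kappa> \<in> A" for \<kappa>
  proof -
    have nf: "\<sigma> \<kappa> \<noteq> \<kappa>" using A(2) that .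
    obtain c j where c: "c = t \<or> c = t - 1" "even (c - slice t \<kappa>)"
      "\<And>l. l < r \<Longrightarrow> slice t ((\<sigma> ^^ l) \<kappa>) = c - 2 * int ((j + l) mod r)" "j < r"
      using slice_sigma_pow[OF nf] by metis
    have d: "d \<kappa> = int r" using nf by (simp add: d_eq)
    have "(\<Sum>l<r. wave \<psi> ((\<sigma> ^^ l) \<kappa>) (slice t ((\<sigma> ^^ l) \<kappa>))) =
      (\<Sum>l<r. b \<kappa> * cos (\<theta> * (real_of_int c + 1 - \<psi>) + (real r - 1 - 2 * real ((j + l) mod r)) * \<theta>))"
    proof (intro sum.cong refl)
      fix l assume "l \<in> {..<r}"
      then have "slice t ((\<sigma> ^^ l) \<kappa>) = c - 2 * int ((j + l) mod r)" using c(3) by simp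
      then have e: "real_of_int (slice t ((\<sigma> ^^ l) \<kappa>)) = real_of_int c - 2 * real ((j + l) mod r)" by linarith
      show "wave \<psi> ((\<sigma> ^^ l) \<kappa>) (slice t ((\<sigma> ^^ l) \<kappa>)) =
        b \<kappa> * cos (\<theta> * (real_of_int c + 1 - \<psi>) + (real r - 1 - 2 * real ((j + l) mod r)) * \<theta>)"
        unfolding wave_def b_sigma_pow d_sigma_pow d
        by (intro arg_cong[where f="\<lambda>x. b \<kappa> * cos x"]) (simp add: e algebra_simps)
    qed
    also have "\<dots> = (\<Sum>l<r. b \<kappa> * cos (\<theta> * (real_of_int c + 1 - \<psi>) + (real r - 1 - 2 * real l) * \<theta>))"
      by (rule sum_rotate[OF c(4)])
    also have "\<dots> = b \<kappa> * (real r * dirichlet \<theta> * cos (\<theta> * (real_of_int c + 1 - \<psi>)))"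
      by (simp only: sum_distrib_left[symmetric] sum_cos_shift)
    finally show ?thesis unfolding Q_def using c(1,2) by (intro exI[of _ c]) simp
  qed
  then obtain c where "\<And>\<kappa>. \<kappa> \<in> A \<Longrightarrow> Q \<kappa> (c \<kappa>)" by metis
  note c = this[unfolded Q_def]
  have "real r * (\<Sum>\<kappa>\<in>A. wave \<psi> \<kappa> (slice t \<kappa>)) =
    (\<Sum>\<kappa>\<in>A. \<Sum>l<r. wave \<psi> ((\<sigma> ^^ l) \<kappa>) (slice t ((\<sigma> ^^ l) \<kappa>)))"
    by (rule sum_orbit_average) (rule A(1))
  also have "\<dots> = (\<Sum>\<kappa>\<in>A. real r * (dirichlet \<theta> * b \<kappa> * cos (\<theta> * (real_of_int (c \<kappa>) + 1 - \<psi>))))"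
    using c by (intro sum.cong refl) blast
  finally have "real r * (\<Sum>\<kappa>\<in>A. wave \<psi> \<kappa> (slice t \<kappa>)) =
    real r * (\<Sum>\<kappa>\<in>A. dirichlet \<theta> * b \<kappa> * cos (\<theta> * (real_of_int (c \<kappa>) + 1 - \<psi>)))"
    unfolding sum_distrib_left .
  then have "(\<Sum>\<kappa>\<in>A. wave \<psi> \<kappa> (slice t \<kappa>)) =
    (\<Sum>\<kappa>\<in>A. dirichlet \<theta> * b \<kappa> * cos (\<theta> * (real_of_int (c \<kappa>) + 1 - \<psi>)))"
    using r_pos by simp
  then show ?thesis using c by (intro exI[of _ c]) blast
qed

lemma nbrs_split:
  "(\<Sum>\<kappa> | adj \<iota> \<kappa>. f \<kappa> :: real) = (\<Sum>\<kappa> | adj \<iota> \<kappa> \<and> d \<kappa> \<le> d \<iota>. f \<kappa>) + (\<Sum>\<kappa> | adj \<iota> \<kappa> \<and> d \<iota> < d \<kappa>. f \<kappa>)"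
  by (subst sum.union_disjoint[symmetric]) (auto intro!: sum.cong)

lemma larger_nbrs:
  assumes "\<kappa> \<in> {\<kappa>. adj \<iota> \<kappa> \<and> d \<iota> < d \<kappa>}"
  shows "\<sigma> \<kappa> \<in> {\<kappa>. adj \<iota> \<kappa> \<and> d \<iota> < d \<kappa>}" "\<sigma> \<kappa> \<noteq> \<kappa>" "d \<iota> = 1"
proof -
  have "\<sigma> \<iota> = \<iota>" using assms d_le_r[of \<kappa>] by (auto simp: d_eq[of \<iota>] split: if_splits)
  then show "\<sigma> \<kappa> \<in> {\<kappa>. adj \<iota> \<kappa> \<and> d \<iota> < d \<kappa>}" using assms adj_sigma[of \<iota> \<kappa>] by auto
  show "\<sigma> \<kappa> \<noteq> \<kappa>" using assms d_pos[of \<iota>] by (auto simp: d_eq[of \<kappa>])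
  show "d \<iota> = 1" using \<open>\<sigma> \<iota> = \<iota>\<close> by (simp add: d_eq)
qed

lemma sum_wave_larger:
  "\<exists>c. (\<forall>\<kappa>\<in>{\<kappa>. adj \<iota> \<kappa> \<and> d \<iota> < d \<kappa>}. (c \<kappa> = t \<or> c \<kappa> = t - 1) \<and> even (c \<kappa> - slice t \<kappa>)) \<and>
    (\<Sum>\<kappa> | adj \<iota> \<kappa> \<and> d \<iota> < d \<kappa>. wave \<psi> \<kappa> (slice t \<kappa>)) =
    (\<Sum>\<kappa> | adj \<iota> \<kappa> \<and> d \<iota> < d \<kappa>. dirichlet \<theta> * b \<kappa> * cos (\<theta> * (real_of_int (c \<kappa>) + 1 - \<psi>)))"
proof (rule sum_wave_orbits)
  fix \<kappa> assume \<kappa>: "\<kappa> \<in> {\<kappa>. adj \<iota> \<kappa> \<and> d \<iota> < d \<kappa>}"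
  show "\<sigma> \<kappa> \<in> {\<kappa>. adj \<iota> \<kappa> \<and> d \<iota> < d \<kappa>}" by (rule larger_nbrs(1)[OF \<kappa>])
  show "\<sigma> \<kappa> \<noteq> \<kappa>" by (rule larger_nbrs(2)[OF \<kappa>])
qed

text \<open>All neighbours end up with the phase \<open>p\<close>: one with
  \<open>d \<kappa> \<le> d \<iota>\<close> is seen at time \<open>p - d \<kappa>\<close>, and an
  orbit of larger neighbours has its centre \<open>c + 1\<close> at \<open>p\<close>. What remains
  is the eigenvector equation.\<close>

lemma wave_mesh:
  assumes "in_row \<iota> p"
  shows "wave \<psi> \<iota> p + wave \<psi> \<iota> (p - 2 * d \<iota>) = (\<Sum>\<kappa> | adj \<iota> \<kappa>. wave \<psi> \<kappa> (slice p \<kappa>))"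
proof -
  define a where "a = \<theta> * (real_of_int p - \<psi>)"
  define C where "C = cos a"
  have C_eq: "C = cos (\<theta> * (real_of_int p - \<psi>))" by (simp add: C_def a_def)
  have "\<theta> * (real_of_int (p + d \<iota>) - \<psi>) = a + real_of_int (d \<iota>) * \<theta>"
    "\<theta> * (real_of_int (p - 2 * d \<iota> + d \<iota>) - \<psi>) = a - real_of_int (d \<iota>) * \<theta>"
    by (simp_all add: a_def algebra_simps)
  then have "wave \<psi> \<iota> p + wave \<psi> \<iota> (p - 2 * d \<iota>) =
    b \<iota> * (cos (a + real_of_int (d \<iota>) * \<theta>) + cos (a - real_of_int (d \<iota>) * \<theta>))"
    by (simp only: wave_def distrib_left)
  also have "\<dots> = 2 * cos (real_of_int (d \<iota>) * \<theta>) * b \<iota> * C"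
    by (simp add: cos_add cos_diff C_def)
  also have "\<dots> = (\<Sum>\<kappa> | adj \<iota> \<kappa>. edge_weight \<theta> \<iota> \<kappa> * b \<kappa> * C)"
    by (simp add: eigen sum_distrib_right)
  also have "\<dots> = (\<Sum>\<kappa> | adj \<iota> \<kappa>. wave \<psi> \<kappa> (slice p \<kappa>))"
  proof -
    have small: "edge_weight \<theta> \<iota> \<kappa> * b \<kappa> * C = wave \<psi> \<kappa> (slice p \<kappa>)" if "adj \<iota> \<kappa>" "d \<kappa> \<le> d \<iota>" for \<kappa>
    proof -
      have dm: "dmin \<iota> \<kappa> = d \<kappa>" using that(2) by (simp add: dmin_def)
      have "2 * d \<kappa> dvd p - slice p \<kappa> - d \<kappa>"
        using adj_rows[OF that(1) assms slice_row[of \<kappa> p]] by (simp add: dm)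
      then have "in_row \<kappa> (p - d \<kappa>)"
      proof -
        have "slice p \<kappa> - (p - d \<kappa>) = - (p - slice p \<kappa> - d \<kappa>)" by simp
        then show ?thesis
          using in_row_dvd[OF slice_row[of \<kappa> p], of "p - d \<kappa>"] \<open>2 * d \<kappa> dvd p - slice p \<kappa> - d \<kappa>\<close>
          by (simp only: dvd_minus_iff)
      qed
      then have "slice p \<kappa> = p - d \<kappa>" using d_pos[of \<kappa>] by (intro slice_eqI) auto
      then show ?thesis using that(2) by (simp add: wave_def edge_weight_def C_eq)
    qed
    let ?A = "{\<kappa>. adj \<iota> \<kappa> \<and> d \<iota> < d \<kappa>}"
    from sum_wave_larger[of \<iota> p \<psi>]
    obtain c where c': "\<forall>\<kappa>\<in>?A. (c \<kappa> = p \<or> c \<kappa> = p - 1) \<and> even (c \<kappa> - slice p \<kappa>)"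
      and c2: "(\<Sum>\<kappa>\<in>?A. wave \<psi> \<kappa> (slice p \<kappa>)) = (\<Sum>\<kappa>\<in>?A. dirichlet \<theta> * b \<kappa> * cos (\<theta> * (real_of_int (c \<kappa>) + 1 - \<psi>)))"
      by (elim exE conjE) (rule that)
    note c = bspec[OF c'] c2
    have e: "dirichlet \<theta> * b \<kappa> * cos (\<theta> * (real_of_int (c \<kappa>) + 1 - \<psi>)) = edge_weight \<theta> \<iota> \<kappa> * b \<kappa> * C" if "\<kappa> \<in> ?A" for \<kappa>
    proof -
      have "d \<iota> = 1" using larger_nbrs(3)[OF that] .
      then have dm: "dmin \<iota> \<kappa> = 1" using d_pos[of \<kappa>] by (simp add: dmin_def)
      have "adj \<iota> \<kappa>" using that by simp
      from adj_rows[OF this assms slice_row[of \<kappa> p]] have "even (p - slice p \<kappa> - 1)" by (simp add: dm)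
      then have "c \<kappa> = p - 1" using c(1)[OF that] by auto
      then show ?thesis using that by (simp add: edge_weight_def C_eq)
    qed
    have "(\<Sum>\<kappa>\<in>?A. edge_weight \<theta> \<iota> \<kappa> * b \<kappa> * C) = (\<Sum>\<kappa>\<in>?A. wave \<psi> \<kappa> (slice p \<kappa>))"
      unfolding c(2) by (rule sum.cong[OF refl]) (rule e[symmetric])
    moreover have "(\<Sum>\<kappa> | adj \<iota> \<kappa> \<and> d \<kappa> \<le> d \<iota>. edge_weight \<theta> \<iota> \<kappa> * b \<kappa> * C) =
      (\<Sum>\<kappa> | adj \<iota> \<kappa> \<and> d \<kappa> \<le> d \<iota>. wave \<psi> \<kappa> (slice p \<kappa>))"
      using small by (intro sum.cong) auto
    ultimately show ?thesis
      using nbrs_split[of "\<lambda>\<kappa>. edge_weight \<theta> \<iota> \<kappa> * b \<kappa> * C" \<iota>] nbrs_split[of "\<lambda>\<kappa>. wave \<psi> \<kappa> (slice p \<kappa>)" \<iota>]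
      by simp
  qed
  finally show ?thesis .
qed

text \<open>Prescribed on the fundamental weights, which are the weights along the slice at time 0.
  Weights and waves satisfy the same mesh relations, so the functional returns the wave at every
  vertex.\<close>

definition wave_functional :: "real \<Rightarrow> ('v \<Rightarrow> int) \<Rightarrow> real" where
  "wave_functional \<psi> l = (\<Sum>\<kappa>\<in>UNIV. real_of_int (l \<kappa>) * wave \<psi> \<kappa> (slice 0 \<kappa>))"

lemma wave_functional_diff: "wave_functional \<psi> (\<lambda>\<mu>. l \<mu> - k \<mu>) = wave_functional \<psi> l - wave_functional \<psi> k"
  by (simp add: wave_functional_def left_diff_distrib sum_subtractf)

lemma wave_functional_scale: "wave_functional \<psi> (\<lambda>\<mu>. c * l \<mu>) = real_of_int c * wave_functional \<psi> l"
  by (simp add: wave_functional_def sum_distrib_left mult.assoc)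

lemma wave_functional_sum: "wave_functional \<psi> (\<lambda>\<mu>. \<Sum>x\<in>A. f x \<mu>) = (\<Sum>x\<in>A. wave_functional \<psi> (f x))"
  unfolding wave_functional_def of_int_sum sum_distrib_right by (rule sum.swap)

lemma wave_functional_frame: "wave_functional \<psi> (frame t (fund_weight \<kappa>)) = wave \<psi> \<kappa> (slice t \<kappa>)"
proof (induction t arbitrary: \<kappa> rule: int_induct[of _ 0])
  case base
  have "wave_functional \<psi> (fund_weight \<kappa>) = (\<Sum>\<mu>\<in>UNIV. if \<mu> = \<kappa> then wave \<psi> \<kappa> (slice 0 \<kappa>) else 0)"
    unfolding wave_functional_def by (intro sum.cong) (auto simp: fund_weight_def)
  then show ?case by simp
next
  case (step1 t)
  define s where "s = t + 1"
  have IH: "wave_functional \<psi> (frame (s - 1) (fund_weight \<kappa>)) = wave \<psi> \<kappa> (slice (s - 1) \<kappa>)" for \<kappa>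
    using step1(2) by (simp add: s_def)
  show ?case unfolding s_def[symmetric]
  proof (cases "in_row \<kappa> s")
    case True
    have "lam \<kappa> s = (\<lambda>\<mu>. (\<Sum>\<nu> | adj \<kappa> \<nu>. lam \<nu> (slice s \<nu>) \<mu>) - lam \<kappa> (s - 2 * d \<kappa>) \<mu>)"
      using mesh[OF True] by (auto simp: fun_eq_iff algebra_simps)
    then have "wave_functional \<psi> (lam \<kappa> s) = (\<Sum>\<nu> | adj \<kappa> \<nu>. wave_functional \<psi> (lam \<nu> (slice s \<nu>))) -
      wave_functional \<psi> (lam \<kappa> (s - 2 * d \<kappa>))"
      by (simp add: wave_functional_diff wave_functional_sum)
    also have "(\<Sum>\<nu> | adj \<kappa> \<nu>. wave_functional \<psi> (lam \<nu> (slice s \<nu>))) = (\<Sum>\<nu> | adj \<kappa> \<nu>. wave \<psi> \<nu> (slice s \<nu>))"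
    proof (intro sum.cong refl)
      fix \<nu> assume "\<nu> \<in> {\<nu>. adj \<kappa> \<nu>}"
      then have "\<not> in_row \<nu> s" using True adj_rows_neq[of \<kappa> \<nu> s s] by auto
      then have "slice (s - 1) \<nu> = slice s \<nu>" by (simp add: slice_pred)
      then show "wave_functional \<psi> (lam \<nu> (slice s \<nu>)) = wave \<psi> \<nu> (slice s \<nu>)"
        using IH[of \<nu>] by (simp add: frame_fund_weight)
    qed
    also have "wave_functional \<psi> (lam \<kappa> (s - 2 * d \<kappa>)) = wave \<psi> \<kappa> (s - 2 * d \<kappa>)"
      using IH[of \<kappa>] True by (simp add: frame_fund_weight slice_pred)
    finally show "wave_functional \<psi> (frame s (fund_weight \<kappa>)) = wave \<psi> \<kappa> (slice s \<kappa>)"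
      using True wave_mesh[OF True, of \<psi>] by (simp add: frame_fund_weight)
  next
    case False
    then show "wave_functional \<psi> (frame s (fund_weight \<kappa>)) = wave \<psi> \<kappa> (slice s \<kappa>)"
      using IH[of \<kappa>] by (simp add: frame_fund_weight slice_pred)
  qed
next
  case (step2 t)
  have IH: "wave_functional \<psi> (lam \<kappa> (slice t \<kappa>)) = wave \<psi> \<kappa> (slice t \<kappa>)" for \<kappa>
    using step2(2) by (simp add: frame_fund_weight)
  show ?case
  proof (cases "in_row \<kappa> t")
    case True
    have "lam \<kappa> (t - 2 * d \<kappa>) = (\<lambda>\<mu>. (\<Sum>\<nu> | adj \<kappa> \<nu>. lam \<nu> (slice t \<nu>) \<mu>) - lam \<kappa> t \<mu>)"
      using mesh[OF True] by (auto simp: fun_eq_iff algebra_simps)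
    then have "wave_functional \<psi> (lam \<kappa> (t - 2 * d \<kappa>)) =
      (\<Sum>\<nu> | adj \<kappa> \<nu>. wave_functional \<psi> (lam \<nu> (slice t \<nu>))) - wave_functional \<psi> (lam \<kappa> t)"
      by (simp add: wave_functional_diff wave_functional_sum)
    also have "\<dots> = wave \<psi> \<kappa> (t - 2 * d \<kappa>)"
      using IH IH[of \<kappa>] True wave_mesh[OF True, of \<psi>] by simp
    finally show ?thesis using True by (simp add: frame_fund_weight slice_pred)
  next
    case False
    then show ?thesis using IH[of \<kappa>] by (simp add: frame_fund_weight slice_pred)
  qed
qed

lemma wave_functional_lam: "in_row \<iota> p \<Longrightarrow> wave_functional \<psi> (lam \<iota> p) = wave \<psi> \<iota> p"
  using wave_functional_frame[of \<psi> p \<iota>] by (simp add: frame_fund_weight)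

text \<open>For such \<open>\<psi>\<close> the offset \<open>u\<close> of the row of
  \<open>\<iota>\<close> is smaller than \<open>d \<iota>\<close>, so its cosine strictly exceeds
  \<open>cos (d \<theta>)\<close>, while the neighbours contribute at most their amplitudes. By the
  eigenvector equation the functional lies in the open chamber of the frame at time
  \<open>t\<close>.\<close>

lemma wave_functional_simple_root:
  assumes "real_of_int t < \<psi>" "\<psi> < real_of_int t + 1"
  shows "0 < wave_functional \<psi> (frame t (simple_root \<iota>))"
proof -
  define u where "u = real_of_int (slice t \<iota> + d \<iota>) - \<psi>"
  have u: "\<bar>u\<bar> < d \<iota>"
  proof -
    have "real_of_int (slice t \<iota>) \<le> real_of_int t" using slice_le[of t \<iota>] by simp
    moreover have "t + 1 \<le> slice t \<iota> + 2 * d \<iota>" using slice_gt[of t \<iota>] by simp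
    then have "real_of_int t + 1 \<le> real_of_int (slice t \<iota>) + 2 * real_of_int (d \<iota>)" by linarith
    ultimately show ?thesis using assms by (simp add: u_def abs_if)
  qed
  have d\<theta>: "real_of_int (d \<iota>) * \<theta> \<le> pi / 2"
  proof -
    have "real_of_int (d \<iota>) \<le> real r" using d_le_r[of \<iota>] by linarith
    then show ?thesis using \<theta> by (meson less_imp_le mult_right_mono order_trans)
  qed
  have "cos (real_of_int (d \<iota>) * \<theta>) < cos (\<theta> * \<bar>u\<bar>)"
  proof (rule cos_monotone_0_pi)
    show "0 \<le> \<theta> * \<bar>u\<bar>" using \<theta>(1) by simp
    show "\<theta> * \<bar>u\<bar> < real_of_int (d \<iota>) * \<theta>" using u \<theta>(1) by (simp add: mult.commute)
    show "real_of_int (d \<iota>) * \<theta> \<le> pi" using d\<theta> pi_gt_zero by linarith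
  qed
  also have "cos (\<theta> * \<bar>u\<bar>) = cos (\<theta> * u)" by (simp add: abs_if)
  finally have less: "cos (real_of_int (d \<iota>) * \<theta>) < cos (\<theta> * u)" .
  have "(\<Sum>\<kappa> | adj \<iota> \<kappa>. wave \<psi> \<kappa> (slice t \<kappa>)) \<le> (\<Sum>\<kappa> | adj \<iota> \<kappa>. edge_weight \<theta> \<iota> \<kappa> * b \<kappa>)"
  proof -
    let ?A = "{\<kappa>. adj \<iota> \<kappa> \<and> d \<iota> < d \<kappa>}"
    from sum_wave_larger[of \<iota> t \<psi>]
    obtain c where c: "(\<Sum>\<kappa>\<in>?A. wave \<psi> \<kappa> (slice t \<kappa>)) = (\<Sum>\<kappa>\<in>?A. dirichlet \<theta> * b \<kappa> * cos (\<theta> * (real_of_int (c \<kappa>) + 1 - \<psi>)))"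
      by (elim exE conjE) (rule that)
    have q: "0 < dirichlet \<theta>" using \<theta> by (intro dirichlet_pos) auto
    have "(\<Sum>\<kappa>\<in>?A. wave \<psi> \<kappa> (slice t \<kappa>)) \<le> (\<Sum>\<kappa>\<in>?A. edge_weight \<theta> \<iota> \<kappa> * b \<kappa>)"
      unfolding c
    proof (rule sum_mono)
      fix \<kappa> assume "\<kappa> \<in> ?A"
      then show "dirichlet \<theta> * b \<kappa> * cos (\<theta> * (real_of_int (c \<kappa>) + 1 - \<psi>)) \<le> edge_weight \<theta> \<iota> \<kappa> * b \<kappa>"
        using mult_left_le[of "cos (\<theta> * (real_of_int (c \<kappa>) + 1 - \<psi>))" "dirichlet \<theta> * b \<kappa>"] q b(1)[of \<kappa>]
        by (simp add: edge_weight_def)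
    qed
    moreover have "(\<Sum>\<kappa> | adj \<iota> \<kappa> \<and> d \<kappa> \<le> d \<iota>. wave \<psi> \<kappa> (slice t \<kappa>)) \<le> (\<Sum>\<kappa> | adj \<iota> \<kappa> \<and> d \<kappa> \<le> d \<iota>. edge_weight \<theta> \<iota> \<kappa> * b \<kappa>)"
    proof (rule sum_mono)
      fix \<kappa> assume "\<kappa> \<in> {\<kappa>. adj \<iota> \<kappa> \<and> d \<kappa> \<le> d \<iota>}"
      then show "wave \<psi> \<kappa> (slice t \<kappa>) \<le> edge_weight \<theta> \<iota> \<kappa> * b \<kappa>"
        using b(1)[of \<kappa>] by (auto simp: edge_weight_def wave_def intro: mult_left_le)
    qed
    ultimately show ?thesis
      using nbrs_split[of "\<lambda>\<kappa>. edge_weight \<theta> \<iota> \<kappa> * b \<kappa>" \<iota>] nbrs_split[of "\<lambda>\<kappa>. wave \<psi> \<kappa> (slice t \<kappa>)" \<iota>] by simp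
  qed
  also have "\<dots> = 2 * cos (real_of_int (d \<iota>) * \<theta>) * b \<iota>" by (simp add: eigen)
  also have "\<dots> < 2 * cos (\<theta> * u) * b \<iota>" using less b(1)[of \<iota>] by simp
  also have "\<dots> = 2 * wave \<psi> \<iota> (slice t \<iota>)" by (simp add: wave_def u_def)
  finally have "0 < 2 * wave \<psi> \<iota> (slice t \<iota>) - (\<Sum>\<kappa> | adj \<iota> \<kappa>. wave \<psi> \<kappa> (slice t \<kappa>))" by simp
  also have "\<dots> = wave_functional \<psi> (frame t (simple_root \<iota>))"
  proof -
    have "frame t (simple_root \<iota>) = (\<lambda>\<mu>. 2 * frame t (fund_weight \<iota>) \<mu> - (\<Sum>\<kappa> | adj \<iota> \<kappa>. frame t (fund_weight \<kappa>) \<mu>))"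
      using word_refl_sum[of "{\<kappa>. adj \<iota> \<kappa>}" "frame_word t" "\<lambda>_. 1" fund_weight]
        word_refl_linear[of "frame_word t" 2 "fund_weight \<iota>" "-1" "\<lambda>\<mu>. \<Sum>\<kappa> | adj \<iota> \<kappa>. fund_weight \<kappa> \<mu>"]
      by (subst simple_root_expand) simp
    then show ?thesis
      by (simp add: wave_functional_diff wave_functional_scale wave_functional_sum wave_functional_frame)
  qed
  finally show ?thesis .
qed

lemma wave_functional_antiperiodic: "wave_functional (\<psi> - pi / \<theta>) l = - wave_functional \<psi> l"
proof -
  have "wave (\<psi> - pi / \<theta>) \<kappa> p = - wave \<psi> \<kappa> p" for \<kappa> p
  proof -
    have "\<theta> * (real_of_int (p + d \<kappa>) - (\<psi> - pi / \<theta>)) = \<theta> * (real_of_int (p + d \<kappa>) - \<psi>) + pi"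
      using \<theta>(1) by (simp add: field_simps)
    then show ?thesis by (simp add: wave_def)
  qed
  then show ?thesis by (simp add: wave_functional_def sum_negf)
qed

text \<open>The product formula for a difference of cosines. The sign depends on the time alone and
  not on the row: a root becomes positive as \<open>\<psi>\<close> passes \<open>p\<close> and stays
  so for half a period.\<close>

lemma wave_functional_beta:
  assumes "in_row \<iota> p"
  shows "wave_functional \<psi> (beta \<iota> p) = 2 * b \<iota> * sin (real_of_int (d \<iota>) * \<theta>) * sin (\<theta> * (\<psi> - real_of_int p))"
proof -
  have "wave_functional \<psi> (beta \<iota> p) = wave \<psi> \<iota> p - wave \<psi> \<iota> (p - 2 * d \<iota>)"
    using assms by (simp add: beta_def wave_functional_diff wave_functional_lam)
  also have "\<dots> = 2 * b \<iota> * sin (real_of_int (d \<iota>) * \<theta>) * sin (\<theta> * (\<psi> - real_of_int p))"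
  proof -
    define a where "a = \<theta> * (\<psi> - real_of_int p)"
    have "\<theta> * (real_of_int (p + d \<iota>) - \<psi>) = real_of_int (d \<iota>) * \<theta> - a"
      "\<theta> * (real_of_int (p - 2 * d \<iota> + d \<iota>) - \<psi>) = - (real_of_int (d \<iota>) * \<theta> + a)"
      by (simp_all add: a_def algebra_simps)
    then have "wave \<psi> \<iota> p - wave \<psi> \<iota> (p - 2 * d \<iota>) =
      b \<iota> * (cos (real_of_int (d \<iota>) * \<theta> - a) - cos (real_of_int (d \<iota>) * \<theta> + a))"
      by (simp only: wave_def right_diff_distrib cos_minus)
    then show ?thesis unfolding a_def[symmetric] by (simp add: cos_diff cos_add)
  qed
  finally show ?thesis .
qed

lemma sin_d_pos: "0 < sin (real_of_int (d \<iota>) * \<theta>)"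
proof (rule sin_gt_zero)
  show "0 < real_of_int (d \<iota>) * \<theta>" using d_pos[of \<iota>] \<theta>(1) by simp
  have "real_of_int (d \<iota>) \<le> real r" using d_le_r[of \<iota>] by linarith
  then have "real_of_int (d \<iota>) * \<theta> \<le> pi / 2" using \<theta> by (meson less_imp_le mult_right_mono order_trans)
  then show "real_of_int (d \<iota>) * \<theta> < pi" using pi_gt_zero by linarith
qed

lemma wave_functional_beta_pos:
  assumes "in_row \<iota> p" "\<psi> - pi / \<theta> < real_of_int p" "real_of_int p < \<psi>"
  shows "0 < wave_functional \<psi> (beta \<iota> p)"
proof -
  have "0 < sin (\<theta> * (\<psi> - real_of_int p))"
    using assms(2,3) \<theta>(1) by (intro sin_gt_zero) (auto simp: field_simps)
  then show ?thesis using sin_d_pos b(1) by (simp add: wave_functional_beta[OF assms(1)])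
qed

end

text \<open>Only these properties of the waves are used afterwards; the angle survives as
  \<open>H = pi / \<theta>\<close> and the eigenvector disappears.\<close>

lemma chamber_rotation:
  obtains H :: real and L :: "real \<Rightarrow> ('v \<Rightarrow> int) \<Rightarrow> real" where "0 < H"
    "\<And>\<psi> l k. L \<psi> (\<lambda>\<mu>. l \<mu> - k \<mu>) = L \<psi> l - L \<psi> k"
    "\<And>\<psi> c l. L \<psi> (\<lambda>\<mu>. c * l \<mu>) = real_of_int c * L \<psi> l"
    "\<And>\<psi> A f. L \<psi> (\<lambda>\<mu>. \<Sum>x\<in>A. f x \<mu>) = (\<Sum>x\<in>A. L \<psi> (f x))"
    "\<And>\<psi> t \<iota>. real_of_int t < \<psi> \<Longrightarrow> \<psi> < real_of_int t + 1 \<Longrightarrow> 0 < L \<psi> (frame t (simple_root \<iota>))"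
    "\<And>\<psi> l. L (\<psi> - H) l = - L \<psi> l"
    "\<And>\<psi> \<iota> p. in_row \<iota> p \<Longrightarrow> \<psi> - H < real_of_int p \<Longrightarrow> real_of_int p < \<psi> \<Longrightarrow> 0 < L \<psi> (beta \<iota> p)"
proof -
  obtain \<theta> and b :: "'v \<Rightarrow> real" where \<theta>: "0 < \<theta>" "real r * \<theta> \<le> pi / 2" "\<And>\<iota>. 0 < b \<iota>"
    "\<And>\<iota>. b (\<sigma> \<iota>) = b \<iota>"
    "\<And>\<iota>. 2 * cos (real_of_int (d \<iota>) * \<theta>) * b \<iota> = (\<Sum>\<kappa> | adj \<iota> \<kappa>. edge_weight \<theta> \<iota> \<kappa> * b \<kappa>)"
    by (rule perron_frobenius) blast
  note L = wave_functional_diff[OF \<theta>] wave_functional_scale[OF \<theta>] wave_functional_sum[OF \<theta>]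
    wave_functional_simple_root[OF \<theta>] wave_functional_antiperiodic[OF \<theta>] wave_functional_beta_pos[OF \<theta>]
  show thesis
  proof (rule that[of "pi / \<theta>" "wave_functional \<theta> b"])
    show "0 < pi / \<theta>" using \<theta>(1) by simp
  qed (fact L | rule L; assumption)+
qed

end

section \<open>The half turn\<close>

context Q_datum
begin

text \<open>The facts about the half turn that are needed below, bundled so that one number with all
  of them can be chosen.\<close>

definition is_half_turn :: "int \<Rightarrow> bool" where
  "is_half_turn h \<longleftrightarrow> 0 < h \<and> (\<exists>xs. \<forall>b\<in>pos_roots. word_refl xs b \<in> neg_roots) \<and>
    (\<forall>t l. frame (t - h) l = frame t (longest l)) \<and>
    (\<forall>\<iota> p t. in_row \<iota> p \<and> t - h < p \<and> p \<le> t \<longrightarrow> (\<exists>b\<in>pos_roots. beta \<iota> p = frame t b)) \<and>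
    (\<forall>\<iota> p \<kappa> s. in_row \<iota> p \<and> in_row \<kappa> s \<and> p - h < s \<and> s \<le> p \<and> beta \<iota> p = beta \<kappa> s \<longrightarrow> (\<iota>, p) = (\<kappa>, s))"

lemma ex_half_turn: "\<exists>h. is_half_turn h"
proof -
  obtain H :: real and L :: "real \<Rightarrow> ('v \<Rightarrow> int) \<Rightarrow> real" where H: "0 < H"
    and Lscale: "\<And>\<psi> c l. L \<psi> (\<lambda>\<mu>. c * l \<mu>) = real_of_int c * L \<psi> l"
    and Lsum: "\<And>\<psi> (A :: 'v set) f. L \<psi> (\<lambda>\<mu>. \<Sum>x\<in>A. f x \<mu>) = (\<Sum>x\<in>A. L \<psi> (f x))"
    and Lpos: "\<And>\<psi> t \<iota>. real_of_int t < \<psi> \<Longrightarrow> \<psi> < real_of_int t + 1 \<Longrightarrow> 0 < L \<psi> (frame t (simple_root \<iota>))"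
    and Lanti: "\<And>\<psi> l. L (\<psi> - H) l = - L \<psi> l"
    and Lbeta: "\<And>\<psi> \<iota> p. in_row \<iota> p \<Longrightarrow> \<psi> - H < real_of_int p \<Longrightarrow> real_of_int p < \<psi> \<Longrightarrow> 0 < L \<psi> (beta \<iota> p)"
    by (rule chamber_rotation) (rule that)
  have Lcoords: "L \<psi> (word_refl xs (of_coords m)) = (\<Sum>\<iota>\<in>UNIV. real_of_int (m \<iota>) * L \<psi> (word_refl xs (simple_root \<iota>)))" for \<psi> xs m
    by (simp add: of_coords_def word_refl_sum Lsum Lscale)
  have Lroot: "0 < L \<psi> (word_refl xs (of_coords m))"
    if "\<And>\<iota>. 0 < L \<psi> (word_refl xs (simple_root \<iota>))" "m \<in> pos_coords" for \<psi> xs m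
  proof -
    have m: "\<And>\<iota>. 0 \<le> m \<iota>" "m \<noteq> (\<lambda>_. 0)" using that(2) root_nonzero[of m] by (auto simp: pos_coords_def)
    then obtain \<kappa> where "m \<kappa> \<noteq> 0" by auto
    then have "0 < m \<kappa>" using m(1)[of \<kappa>] by simp
    then have "0 < (\<Sum>\<iota>\<in>UNIV. real_of_int (m \<iota>) * L \<psi> (word_refl xs (simple_root \<iota>)))"
      using that(1) m(1) by (intro sum_pos2[of _ \<kappa>]) (auto simp: less_imp_le)
    then show ?thesis by (simp add: Lcoords)
  qed
  \<comment> \<open>The functionals at \<open>\<psi>\<close> and \<open>\<psi> - H\<close> are
    opposite, so the chambers of the two frames are opposite as well.\<close>
  have opp: "\<exists>xs. (\<forall>b\<in>pos_roots. word_refl xs b \<in> neg_roots) \<and> (\<forall>l. frame t' l = frame t (word_refl xs l))"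
    if t: "real_of_int t < \<psi>" "\<psi> < real_of_int t + 1" "real_of_int t' < \<psi> - H" "\<psi> - H < real_of_int t' + 1" for t t' \<psi>
  proof (intro exI[of _ "rev (frame_word t) @ frame_word t'"] conjI ballI allI)
    fix l show "frame t' l = frame t (word_refl (rev (frame_word t) @ frame_word t') l)" by simp
  next
    fix b assume "b \<in> pos_roots"
    then obtain m where m: "m \<in> pos_coords" "b = of_coords m" using pos_roots_eq by auto
    define b' where "b' = word_refl (rev (frame_word t) @ frame_word t') b"
    have b': "frame t b' = frame t' b" by (simp add: b'_def)
    have "0 < L (\<psi> - H) (frame t' b)" unfolding m(2)
      by (rule Lroot) (auto intro: Lpos t m(1))
    then have neg: "L \<psi> (frame t b') < 0" unfolding b' by (simp add: Lanti)
    have "b' \<in> roots" unfolding b'_def using \<open>b \<in> pos_roots\<close> by (intro word_refl_roots pos_roots_subset)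
    moreover have "b' \<notin> pos_roots"
    proof
      assume "b' \<in> pos_roots"
      then obtain m' where m': "m' \<in> pos_coords" "b' = of_coords m'" using pos_roots_eq by auto
      have "0 < L \<psi> (frame t b')" unfolding m'(2) by (rule Lroot) (auto intro: Lpos t m'(1))
      then show False using neg by simp
    qed
    ultimately show "b' \<in> neg_roots" using roots_pos_or_neg by blast
  qed
  have long: "frame t' l = frame t (longest l)"
    if t: "real_of_int t < \<psi>" "\<psi> < real_of_int t + 1" "real_of_int t' < \<psi> - H" "\<psi> - H < real_of_int t' + 1" for t t' \<psi> l
  proof -
    obtain xs where xs: "\<forall>b\<in>pos_roots. word_refl xs b \<in> neg_roots" "\<forall>l. frame t' l = frame t (word_refl xs l)"
      using opp[OF t] by blast
    have "longest = word_refl xs" by (rule longest_eqI(1)) (use xs(1) in blast)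
    then show ?thesis using xs(2) by simp
  qed
  \<comment> \<open>Let \<open>\<psi>\<close> cross an integer \<open>k\<close> at which a vertex
    lives. If \<open>H\<close> were not an integer, the frame opposite to it would be the same on
    both sides, so the frames at \<open>k\<close> and \<open>k - 1\<close> would agree, although the
    level at \<open>k\<close> moves a fundamental weight.\<close>
  have "\<exists>h. H = real_of_int h"
  proof (rule ccontr)
    assume notint: "\<nexists>h. H = real_of_int h"
    obtain \<iota> :: 'v where True by simp
    define k where "k = \<epsilon> \<iota>"
    have row: "in_row \<iota> k" by (simp add: k_def in_row_def)
    define t' where "t' = \<lfloor>real_of_int k - H\<rfloor>"
    have "real_of_int t' \<noteq> real_of_int k - H"
    proof
      assume "real_of_int t' = real_of_int k - H"
      then have "H = real_of_int (k - t')" by simp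
      then show False using notint by blast
    qed
    then have t': "real_of_int t' < real_of_int k - H" "real_of_int k - H < real_of_int t' + 1"
      unfolding t'_def by (auto simp: order_less_le) linarith
    define e where "e = min (min ((real_of_int k - H - real_of_int t') / 2) ((real_of_int t' + 1 - (real_of_int k - H)) / 2)) (1 / 2)"
    have e: "0 < e" "e < 1" "e < real_of_int k - H - real_of_int t'" "e < real_of_int t' + 1 - (real_of_int k - H)"
      using t' by (auto simp: e_def min_def field_simps)
    have 1: "frame t' l = frame k (longest l)" for l
      by (rule long[of k "real_of_int k + e"]) (use e in auto)
    have 2: "frame t' l = frame (k - 1) (longest l)" for l
      by (rule long[of "k - 1" "real_of_int k - e"]) (use e in auto)
    obtain xs where xs: "\<forall>b\<in>pos_roots. word_refl xs b \<in> neg_roots"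
      using opp[of k "real_of_int k + e" t'] e by auto
    have inv: "longest (longest l) = l" for l by (rule longest_invol) (use xs in blast)
    have "frame k (fund_weight \<iota>) = frame (k - 1) (fund_weight \<iota>)"
      using 1[of "longest (fund_weight \<iota>)"] 2[of "longest (fund_weight \<iota>)"] by (simp add: inv)
    then have "fund_weight \<iota> = word_refl (level k) (fund_weight \<iota>)"
      by (simp add: frame_pred word_refl_eq_iff)
    then have "fund_weight \<iota> \<iota> = fund_weight \<iota> \<iota> - simple_root \<iota> \<iota>"
      using row by (simp add: level_refl_fund_weight fun_eq_iff)
    then show False by (simp add: simple_root_def)
  qed
  then obtain h where h: "H = real_of_int h" by blast
  have hpos: "0 < h" using H h by simp
  have half: "frame (t - h) l = frame t (longest l)" for t l
    by (rule long[of t "real_of_int t + 1 / 2"]) (auto simp: h)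
  have pos: "\<exists>b\<in>pos_roots. beta \<iota> p = frame t b" if p: "in_row \<iota> p" "t - h < p" "p \<le> t" for \<iota> p t
  proof -
    define b where "b = word_refl (rev (frame_word t) @ frame_word p) (simple_root \<iota>)"
    have b: "frame t b = beta \<iota> p" using p(1) by (simp add: b_def beta_eq)
    have "t - h + 1 \<le> p" using p(2) by simp
    then have "real_of_int t - real_of_int h + 1 \<le> real_of_int p" by linarith
    then have pos: "0 < L (real_of_int t + 1 / 2) (frame t b)" unfolding b
      by (intro Lbeta p(1)) (use p(3) in \<open>auto simp: h\<close>)
    have "b \<in> roots" unfolding b_def by (rule word_refl_simple_root)
    moreover have "b \<notin> neg_roots"
    proof
      assume "b \<in> neg_roots"
      then obtain m' where m': "m' \<in> pos_coords" "- b = of_coords m'" using pos_roots_eq by (auto simp: neg_roots_iff)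
      have "0 < L (real_of_int t + 1 / 2) (frame t (- b))" unfolding m'(2) by (rule Lroot) (auto intro: Lpos m'(1))
      moreover have "frame t (- b) = (\<lambda>\<mu>. (- 1) * frame t b \<mu>)" by (simp add: word_refl_uminus fun_eq_iff)
      ultimately show False using pos Lscale[of _ "- 1" "frame t b"] by simp
    qed
    ultimately have "b \<in> pos_roots" using roots_pos_or_neg by blast
    then show ?thesis using b by metis
  qed
  have inj: "(\<iota>, p) = (\<kappa>, s)"
    if a: "in_row \<iota> p" "in_row \<kappa> s" "p - h < s" "s \<le> p" "beta \<iota> p = beta \<kappa> s" for \<iota> p \<kappa> s
  proof (cases "s = p")
    case True
    then have "simple_root \<iota> = simple_root \<kappa>" using a by (simp add: beta_eq word_refl_eq_iff)
    then show ?thesis using True simple_root_inj by simp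
  next
    \<comment> \<open>At \<open>\<psi> = p - 1 / 2\<close> the root at the earlier time
      \<open>s\<close> is already positive and the one at time \<open>p\<close> still
      negative.\<close>
    case False
    then have sp: "real_of_int s \<le> real_of_int p - 1" "real_of_int p - real_of_int h < real_of_int s"
      using a(3,4) by linarith+
    then have "0 < L (real_of_int p - 1 / 2) (beta \<kappa> s)" by (intro Lbeta a(2)) (auto simp: h)
    moreover have "0 < L (real_of_int p - 1 / 2 + H) (beta \<iota> p)"
    proof (rule Lbeta[OF a(1)])
      have "1 \<le> real_of_int h" using hpos by linarith
      then show "real_of_int p < real_of_int p - 1 / 2 + H" by (simp add: h)
    qed simp
    ultimately show ?thesis using Lanti[of "real_of_int p - 1 / 2 + H" "beta \<iota> p"] a(5) by simp
  qed
  have "\<exists>xs. \<forall>b\<in>pos_roots. word_refl xs b \<in> neg_roots"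
    using opp[of 0 "1 / 2" "- h"] by (auto simp: h)
  then have "is_half_turn h" unfolding is_half_turn_def using hpos half pos inj by blast
  then show ?thesis by blast
qed

definition turn :: int where
  "turn = (SOME h. is_half_turn h)"

lemma is_half_turn_turn: "is_half_turn turn"
  unfolding turn_def using ex_half_turn by (rule someI_ex)

lemma turn_pos: "0 < turn"
  using is_half_turn_turn by (simp add: is_half_turn_def)

lemma longest_word: "\<exists>xs. longest = word_refl xs \<and> (\<forall>b\<in>pos_roots. word_refl xs b \<in> neg_roots)"
proof -
  obtain xs where xs: "\<forall>b\<in>pos_roots. word_refl xs b \<in> neg_roots"
    using is_half_turn_turn by (auto simp: is_half_turn_def)
  moreover have "longest = word_refl xs" by (rule longest_eqI(1)) (use xs in blast)
  ultimately show ?thesis by blast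
qed

lemma frame_turn: "frame (t - turn) l = frame t (longest l)"
  using is_half_turn_turn by (simp add: is_half_turn_def)

lemma beta_window_pos: "in_row \<iota> p \<Longrightarrow> t - turn < p \<Longrightarrow> p \<le> t \<Longrightarrow> \<exists>b\<in>pos_roots. beta \<iota> p = frame t b"
  using is_half_turn_turn by (simp add: is_half_turn_def)

lemma beta_window_inj:
  "in_row \<iota> p \<Longrightarrow> in_row \<kappa> s \<Longrightarrow> p - turn < s \<Longrightarrow> s \<le> p \<Longrightarrow> beta \<iota> p = beta \<kappa> s \<Longrightarrow> (\<iota>, p) = (\<kappa>, s)"
  using is_half_turn_turn unfolding is_half_turn_def by blast

lemma longest_longest [simp]: "longest (longest l) = l"
proof -
  obtain xs where xs: "\<forall>b\<in>pos_roots. word_refl xs b \<in> neg_roots" using longest_word by blast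
  show ?thesis by (rule longest_invol[of xs]) (use xs in blast)
qed

lemma star_invol [simp]: "star (star \<iota>) = \<iota>"
proof -
  obtain xs where xs: "\<forall>b\<in>pos_roots. word_refl xs b \<in> neg_roots" using longest_word by blast
  show ?thesis by (rule star_star[of xs]) (use xs in blast)
qed

lemma star_adj [simp]: "adj (star \<iota>) (star \<kappa>) \<longleftrightarrow> adj \<iota> \<kappa>"
proof -
  obtain xs where xs: "\<forall>b\<in>pos_roots. word_refl xs b \<in> neg_roots" using longest_word by blast
  show ?thesis by (rule adj_star[of xs]) (use xs in blast)
qed

lemma longest_fund: "longest (fund_weight \<iota>) = - fund_weight (star \<iota>)"
proof -
  obtain xs where xs: "\<forall>b\<in>pos_roots. word_refl xs b \<in> neg_roots" using longest_word by blast
  show ?thesis by (rule longest_fund_weight[of xs]) (use xs in blast)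
qed

lemma longest_root: "longest (simple_root \<iota>) = - simple_root (star \<iota>)"
proof -
  obtain xs where xs: "\<forall>b\<in>pos_roots. word_refl xs b \<in> neg_roots" using longest_word by blast
  show ?thesis by (rule longest_star[of xs]) (use xs in blast)
qed

lemma longest_diff: "longest (\<lambda>\<mu>. l \<mu> - k \<mu>) = (\<lambda>\<mu>. longest l \<mu> - longest k \<mu>)"
proof -
  obtain xs where "longest = word_refl xs" using longest_word by blast
  then show ?thesis by (simp add: word_refl_diff)
qed

lemma longest_apply: "longest l \<mu> = - l (star \<mu>)"
proof -
  obtain xs where xs: "longest = word_refl xs" "\<forall>b\<in>pos_roots. word_refl xs b \<in> neg_roots"
    using longest_word by blast
  have "pairing (coord_word xs (unit (star \<mu>))) (word_refl xs l) = l (star \<mu>)"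
    by (simp add: pairing_word pairing_unit)
  moreover have "coord_word xs (unit (star \<mu>)) = - unit (star (star \<mu>))"
    by (rule coord_word_star) (use xs(2) in blast)
  ultimately show ?thesis by (simp add: xs(1) pairing_uminus_left pairing_unit)
qed

lemma card_pos_roots: "weyl_length longest = card pos_roots"
proof -
  obtain xs where xs: "\<forall>b\<in>pos_roots. word_refl xs b \<in> neg_roots" using longest_word by blast
  show ?thesis by (rule longest_eqI(2)[of xs]) (use xs in blast)
qed

lemma sum_star: "(\<Sum>\<iota>\<in>UNIV. f (star \<iota>)) = (\<Sum>\<iota>\<in>UNIV. (f \<iota> :: 'b :: comm_monoid_add))"
  by (rule sum.reindex_bij_witness[of _ star star]) auto

text \<open>The longest element intertwines the levels at \<open>p\<close> and
  \<open>p - turn\<close>. Evaluated on a fundamental weight at its own coordinate, a level gives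
  \<open>- 1\<close> or \<open>1\<close> according to whether the row occurs at that time.\<close>

lemma in_row_turn: "in_row (star \<iota>) (p - turn) \<longleftrightarrow> in_row \<iota> p"
proof -
  define f where "f = fund_weight (star \<iota>)"
  have "frame p (word_refl (level p) (longest f)) = frame (p - 1 - turn) f"
    by (simp only: frame_turn frame_pred)
  also have "\<dots> = frame (p - turn - 1) f" by (simp add: algebra_simps)
  also have "\<dots> = frame p (longest (word_refl (level (p - turn)) f))"
    by (simp only: frame_pred frame_turn)
  finally have "word_refl (level p) (longest f) = longest (word_refl (level (p - turn)) f)"
    by (simp add: word_refl_eq_iff)
  moreover have "longest f = - fund_weight \<iota>" by (simp add: f_def longest_fund)
  ultimately have e: "- word_refl (level p) (fund_weight \<iota>) \<iota> = longest (word_refl (level (p - turn)) f) \<iota>"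
    by (simp add: word_refl_uminus fun_eq_iff)
  have l1: "word_refl (level p) (fund_weight \<iota>) \<iota> = (if in_row \<iota> p then - 1 else 1)"
    by (simp add: level_refl_fund_weight) (simp add: fund_weight_def simple_root_def)
  have "longest (\<lambda>\<mu>. f \<mu> - simple_root (star \<iota>) \<mu>) \<iota> = 1" "longest f \<iota> = - 1"
    by (simp_all add: longest_diff f_def longest_fund longest_root) (simp_all add: fund_weight_def simple_root_def)
  moreover have "word_refl (level (p - turn)) f =
    (if in_row (star \<iota>) (p - turn) then (\<lambda>\<mu>. f \<mu> - simple_root (star \<iota>) \<mu>) else f)"
    unfolding f_def by (rule level_refl_fund_weight)
  ultimately have "longest (word_refl (level (p - turn)) f) \<iota> = (if in_row (star \<iota>) (p - turn) then 1 else - 1)"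
    by simp
  then show ?thesis using e l1 by (simp split: if_splits)
qed

lemma d_star [simp]: "d (star \<iota>) = d \<iota>"
proof -
  have dvd: "d (star \<iota>) dvd d \<iota>" for \<iota>
  proof -
    have "in_row \<iota> (\<epsilon> \<iota>)" by (simp add: in_row_def)
    then have "in_row (star \<iota>) (\<epsilon> \<iota> - turn)" "in_row (star \<iota>) (\<epsilon> \<iota> + 2 * d \<iota> - turn)"
      by (simp_all add: in_row_turn)
    then have "2 * d (star \<iota>) dvd (\<epsilon> \<iota> + 2 * d \<iota> - turn) - (\<epsilon> \<iota> - turn)" using in_row_dvd by blast
    then show ?thesis by simp
  qed
  from dvd[of \<iota>] dvd[of "star \<iota>"] show ?thesis
    using d_pos[of \<iota>] d_pos[of "star \<iota>"] by (intro zdvd_antisym_nonneg) auto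
qed

lemma lam_turn: "lam (star \<iota>) (p - turn) = - lam \<iota> p"
  by (simp add: lam_def frame_turn longest_fund word_refl_uminus)

lemma beta_turn: "beta (star \<iota>) (p - turn) = - beta \<iota> p"
proof -
  have "p - turn - 2 * d (star \<iota>) = (p - 2 * d \<iota>) - turn" by simp
  then show ?thesis unfolding beta_def by (simp only: lam_turn) auto
qed

definition turned :: "('v \<Rightarrow> int) \<Rightarrow> 'v \<Rightarrow> int" where
  "turned \<eta> = (\<lambda>\<iota>. \<eta> (star \<iota>) - turn)"

lemma state_turned: "state \<eta> \<Longrightarrow> state (turned \<eta>)"
proof (rule stateI_less)
  assume s: "state \<eta>"
  show "in_row \<iota> (turned \<eta> \<iota>)" for \<iota>
    using in_row_turn[of "star \<iota>" "\<eta> (star \<iota>)"] state_row[OF s] by (simp add: turned_def)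
  show "turned \<eta> \<iota> < turned \<eta> \<kappa> + 2 * d \<kappa>" if "adj \<iota> \<kappa>" for \<iota> \<kappa>
    using state_less[OF s, of "star \<iota>" "star \<kappa>"] that by (simp add: turned_def)
qed

lemma place_turned: "place (turned \<eta>) l = place \<eta> (longest l)"
proof
  fix \<mu>
  have "place (turned \<eta>) l \<mu> = (\<Sum>\<kappa>\<in>UNIV. l (star \<kappa>) * lam (star \<kappa>) (turned \<eta> (star \<kappa>)) \<mu>)"
    unfolding place_def by (rule sum_star[symmetric])
  then show "place (turned \<eta>) l \<mu> = place \<eta> (longest l) \<mu>"
    by (simp add: turned_def lam_turn place_def longest_apply)
qed

subsection \<open>Roots of adapted words\<close>

text \<open>The time at which the letter at position \<open>k\<close> is fired; with it a word
  becomes a list of vertices of the quiver.\<close>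

definition word_height :: "('v \<Rightarrow> int) \<Rightarrow> 'v list \<Rightarrow> nat \<Rightarrow> int" where
  "word_height \<eta> is k = run \<eta> (take k is) (is ! k)"

lemma adapted_source:
  assumes "adapted \<eta> is" "k < length is"
  shows "source (run \<eta> (take k is)) (is ! k)"
proof -
  have "is = take k is @ is ! k # drop (Suc k) is" using assms(2) by (simp add: id_take_nth_drop)
  then have "adapted \<eta> (take k is @ is ! k # drop (Suc k) is)" using assms(1) by simp
  then show ?thesis by (simp add: adapted_append adapted_Cons)
qed

lemma adapted_take: "adapted \<eta> is \<Longrightarrow> adapted \<eta> (take k is)"
  using adapted_append[of \<eta> "take k is" "drop k is"] by simp

lemma place_word_root:
  assumes "state \<eta>" "adapted \<eta> is" "k < length is"
  shows "place \<eta> (word_root is k) = beta (is ! k) (word_height \<eta> is k)"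
  unfolding word_root_def word_height_def
  using place_run[OF assms(1) adapted_take[OF assms(2)]]
    place_simple_root[OF state_run[OF assms(1) adapted_take[OF assms(2)]] adapted_source[OF assms(2,3)]]
  by metis

lemma word_height_row: "state \<eta> \<Longrightarrow> adapted \<eta> is \<Longrightarrow> in_row (is ! k) (word_height \<eta> is k)"
  unfolding word_height_def by (intro state_row state_run adapted_take)

lemma count_list_take_le: "count_list (take k is) x \<le> count_list is x"
  by (metis append_take_drop_id count_list_append le_add1)

lemma word_height_le: "word_height \<eta> is k \<le> \<eta> (is ! k)"
  using d_pos[of "is ! k"] by (simp add: word_height_def run_def)

lemma count_list_take_less:
  assumes "j < k" "j < length is" "is ! j = x"
  shows "count_list (take j is) x < count_list (take k is) x"
proof -
  have "count_list (take (Suc j) is) x = Suc (count_list (take j is) x)"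
    using assms by (simp add: take_Suc_conv_app_nth)
  moreover have "take (Suc j) is = take (Suc j) (take k is)" using assms(1) by (simp add: min_def)
  then have "count_list (take (Suc j) is) x \<le> count_list (take k is) x" by (metis count_list_take_le)
  ultimately show ?thesis by simp
qed

lemma word_height_decreasing:
  assumes "j < k" "k < length is" "is ! j = is ! k"
  shows "word_height \<eta> is k < word_height \<eta> is j"
  using count_list_take_less[of j k "is" "is ! k"] assms d_pos[of "is ! k"]
  by (simp add: word_height_def run_def)

lemma word_height_gt:
  assumes "k < length is"
  shows "run \<eta> is (is ! k) < word_height \<eta> is k"
  using count_list_take_less[of k "length is" "is" "is ! k"] assms d_pos[of "is ! k"]
  by (simp add: word_height_def run_def)

lemma word_vertices_inj: "inj_on (\<lambda>k. (is ! k, word_height \<eta> is k)) {..<length is}"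
proof (rule inj_onI)
  fix j k assume "j \<in> {..<length is}" "k \<in> {..<length is}"
    and e: "(is ! j, word_height \<eta> is j) = (is ! k, word_height \<eta> is k)"
  then show "j = k"
    using word_height_decreasing[of j k "is" \<eta>] word_height_decreasing[of k j "is" \<eta>]
    by (cases j k rule: linorder_cases) auto
qed

text \<open>The row of \<open>\<iota>\<close> is fired \<open>(\<eta> \<iota> - \<eta> (star
  \<iota>) + turn) / (2 * d \<iota>)\<close> times. Summed over all rows the heights cancel, because
  \<open>star\<close> is a permutation preserving \<open>d\<close>.\<close>

lemma length_turned:
  assumes "run \<eta> is = turned \<eta>"
  shows "2 * real (length is) = real_of_int turn * real (card orbits)"
proof -
  have c: "real (count_list is \<iota>) = (real_of_int (\<eta> \<iota>) / (2 * real_of_int (d \<iota>)) -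
      real_of_int (\<eta> (star \<iota>)) / (2 * real_of_int (d \<iota>))) + real_of_int turn / 2 * (1 / real_of_int (d \<iota>))" for \<iota>
  proof -
    have "\<eta> \<iota> - 2 * d \<iota> * int (count_list is \<iota>) = \<eta> (star \<iota>) - turn"
      using fun_cong[OF assms, of \<iota>] by (simp add: run_def turned_def)
    then have "2 * d \<iota> * int (count_list is \<iota>) = \<eta> \<iota> - \<eta> (star \<iota>) + turn" by linarith
    from arg_cong[OF this, of real_of_int]
    have "2 * real_of_int (d \<iota>) * real (count_list is \<iota>) = real_of_int (\<eta> \<iota>) - real_of_int (\<eta> (star \<iota>)) + real_of_int turn"
      by simp
    then show ?thesis using d_pos[of \<iota>] by (simp add: field_simps)
  qed
  have "real (length is) = (\<Sum>\<iota>\<in>UNIV. real (count_list is \<iota>))"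
    using sum_count_set[of "is" UNIV] by (simp flip: of_nat_sum)
  also have "\<dots> = real_of_int turn / 2 * (\<Sum>\<iota>\<in>UNIV. 1 / real_of_int (d \<iota>))"
  proof -
    have "(\<Sum>\<iota>\<in>UNIV. real_of_int (\<eta> (star \<iota>)) / (2 * real_of_int (d \<iota>))) = (\<Sum>\<iota>\<in>UNIV. real_of_int (\<eta> \<iota>) / (2 * real_of_int (d \<iota>)))"
      using sum_star[of "\<lambda>\<iota>. real_of_int (\<eta> \<iota>) / (2 * real_of_int (d \<iota>))"] by simp
    then show ?thesis unfolding c sum.distrib sum_subtractf sum_distrib_left by simp
  qed
  finally show ?thesis by (simp add: sum_inverse_d)
qed

lemma pos_roots_word_roots:
  assumes "word_refl is = longest"
  shows "pos_roots \<subseteq> word_root is ` {..<length is}"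
proof
  fix b assume b: "b \<in> pos_roots"
  obtain xs where xs: "longest = word_refl xs" "\<forall>b\<in>pos_roots. word_refl xs b \<in> neg_roots"
    using longest_word by blast
  have "word_refl (rev is) b = longest b"
    using word_refl_rev(1)[of "is" "longest b"] assms by simp
  then have "word_refl (rev is) b \<in> neg_roots" using xs b by simp
  then show "b \<in> word_root is ` {..<length is}" using root_crossing[OF b] by auto
qed

text \<open>Sweeping one half turn down from the slice at time 0 spells the longest element. The
  vertices met lie in a window in which the roots are positive and pairwise distinct, so their
  number is that of the positive roots.\<close>

lemma turn_card: "2 * real (card pos_roots) = real_of_int turn * real (card orbits)"
proof -
  have sl: "turned (slice 0) = slice (- turn)"
  proof
    fix \<iota>
    show "turned (slice 0) \<iota> = slice (- turn) \<iota>"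
      using state_row[OF state_turned[OF state_slice[of 0]], of \<iota>] slice_le[of 0 "star \<iota>"] slice_gt[of 0 "star \<iota>"]
      by (intro slice_eqI[symmetric]) (auto simp: turned_def)
  qed
  have "slice (- turn) \<iota> \<le> slice 0 \<iota>" for \<iota>
    using slice_row slice_le[of "- turn" \<iota>] turn_pos by (intro slice_ge) (auto intro: order_trans)
  then obtain js where js: "adapted (slice 0) js" "run (slice 0) js = slice (- turn)"
    using ex_adapted[OF state_slice state_slice] by blast
  have "word_refl js l = longest l" for l
    using place_run[OF state_slice js(1), of l] place_turned[of "slice 0" l]
    by (simp add: js(2) sl place_slice)
  then have w: "word_refl js = longest" by blast
  have "card pos_roots \<le> card (word_root js ` {..<length js})"
    by (intro card_mono pos_roots_word_roots w) auto
  also have "\<dots> \<le> length js" using card_image_le[of "{..<length js}" "word_root js"] by simp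
  finally have le: "card pos_roots \<le> length js" .
  have win: "- turn < word_height (slice 0) js k \<and> word_height (slice 0) js k \<le> 0" if k: "k < length js" for k
  proof
    show "word_height (slice 0) js k \<le> 0" using word_height_le[of "slice 0" js k] slice_le[of 0] by (meson order_trans)
    have row: "in_row (js ! k) (word_height (slice 0) js k)" by (rule word_height_row[OF state_slice js(1)])
    show "- turn < word_height (slice 0) js k"
    proof (rule ccontr)
      assume "\<not> - turn < word_height (slice 0) js k"
      then have "word_height (slice 0) js k \<le> slice (- turn) (js ! k)" by (intro slice_ge row) simp
      then show False using word_height_gt[OF k, of "slice 0"] js(2) by simp
    qed
  qed
  have root: "word_root js k = beta (js ! k) (word_height (slice 0) js k)" if "k < length js" for k
    using place_word_root[OF state_slice js(1) that] by (simp add: place_slice)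
  have "word_root js ` {..<length js} \<subseteq> pos_roots"
  proof
    fix b assume "b \<in> word_root js ` {..<length js}"
    then obtain k where k: "k < length js" "b = word_root js k" by auto
    obtain b' where "b' \<in> pos_roots" "beta (js ! k) (word_height (slice 0) js k) = frame 0 b'"
      using beta_window_pos[of "js ! k" "word_height (slice 0) js k" 0] win[OF k(1)] word_height_row[OF state_slice js(1)] by auto
    then show "b \<in> pos_roots" using root[OF k(1)] k(2) by simp
  qed
  moreover have "inj_on (word_root js) {..<length js}"
  proof (rule inj_onI)
    fix j k assume jk: "j \<in> {..<length js}" "k \<in> {..<length js}" "word_root js j = word_root js k"
    define p s where "p = word_height (slice 0) js j" and "s = word_height (slice 0) js k"
    have rows: "in_row (js ! j) p" "in_row (js ! k) s"
      using word_height_row[OF state_slice js(1)] by (auto simp: p_def s_def)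
    have w: "- turn < p" "p \<le> 0" "- turn < s" "s \<le> 0" using win jk by (auto simp: p_def s_def)
    have e: "beta (js ! j) p = beta (js ! k) s" using jk root by (simp add: p_def s_def)
    have "(js ! j, p) = (js ! k, s)"
    proof (cases "s \<le> p")
      case True
      then show ?thesis using beta_window_inj[OF rows _ _ e] w by simp
    next
      case False
      then show ?thesis using beta_window_inj[OF rows(2,1) _ _ e[symmetric]] w by simp
    qed
    then show "j = k" using word_vertices_inj[of js "slice 0"] jk unfolding inj_on_def p_def s_def by blast
  qed
  ultimately have "length js \<le> card pos_roots"
    using card_inj_on_le[OF _ _ finite_pos_roots, of "word_root js" "{..<length js}"] by simp
  then have "card pos_roots = length js" using le by simp
  then show ?thesis using length_turned[of "slice 0" js] js(2) sl by simp
qed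

text \<open>Fire the other rows down to time \<open>\<eta> \<kappa>\<close>, leaving
  \<open>\<kappa>\<close> alone; then \<open>\<kappa>\<close> is a source. The word used does not
  contain \<open>\<kappa>\<close>, so the coefficient of its simple root stays 1, and one positive
  coefficient decides the sign.\<close>

lemma beta_state_pos:
  assumes "state \<eta>"
  shows "\<exists>b\<in>pos_roots. beta \<kappa> (\<eta> \<kappa>) = place \<eta> b"
proof -
  define \<zeta> where "\<zeta> = (\<lambda>\<iota>. min (\<eta> \<iota>) (slice (\<eta> \<kappa>) \<iota>))"
  have st: "state \<zeta>" unfolding \<zeta>_def by (intro state_min assms state_slice)
  have \<kappa>: "\<zeta> \<kappa> = \<eta> \<kappa>" using state_row[OF assms, of \<kappa>] by (simp add: \<zeta>_def)
  obtain js where js: "adapted \<eta> js" "run \<eta> js = \<zeta>"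
    using ex_adapted[OF assms st] by (auto simp: \<zeta>_def)
  have "2 * d \<kappa> * int (count_list js \<kappa>) = 0" using \<kappa> js(2)[symmetric] by (simp add: run_def)
  then have "count_list js \<kappa> = 0" using d_pos[of \<kappa>] by simp
  then have notin: "\<kappa> \<notin> set js" by (simp add: count_list_0_iff)
  have "source \<zeta> \<kappa>" unfolding source_def
  proof (intro allI impI)
    fix \<mu> assume a: "adj \<kappa> \<mu>"
    have "\<zeta> \<mu> \<le> \<zeta> \<kappa>" unfolding \<kappa> using slice_le[of "\<eta> \<kappa>" \<mu>] by (simp add: \<zeta>_def min_def)
    moreover have "\<zeta> \<kappa> \<noteq> \<zeta> \<mu>" by (rule adj_rows_neq[OF a state_row[OF st] state_row[OF st]])
    ultimately show "\<zeta> \<mu> < \<zeta> \<kappa>" by simp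
  qed
  then have "beta \<kappa> (\<eta> \<kappa>) = place \<zeta> (simple_root \<kappa>)" using place_simple_root[OF st] \<kappa> by metis
  then have b: "beta \<kappa> (\<eta> \<kappa>) = place \<eta> (word_refl js (simple_root \<kappa>))"
    using place_run[OF assms js(1)] js(2) by simp
  have "coord_word js (unit \<kappa>) \<kappa> = 1"
    using notin by (induction js) (auto simp: coord_refl_def fund_weight_def)
  moreover have r: "coord_word js (unit \<kappa>) \<in> root_coords"
    by (intro coord_word_in_root_coords unit_in_root_coords)
  ultimately have "\<forall>\<mu>. 0 \<le> coord_word js (unit \<kappa>) \<mu>"
    using root_sign[OF r] by (metis not_one_le_zero)
  then have "coord_word js (unit \<kappa>) \<in> pos_coords" using r by (simp add: pos_coords_def)
  then have "word_refl js (simple_root \<kappa>) \<in> pos_roots"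
    unfolding pos_roots_iff[symmetric] by (simp add: of_coords_word of_coords_unit)
  then show ?thesis using b by blast
qed

lemma place_inj: "state \<eta> \<Longrightarrow> place \<eta> l = place \<eta> k \<Longrightarrow> l = k"
  using bij_place by (metis bij_is_inj injD)

lemma place_uminus: "place \<eta> (- l) = - place \<eta> l"
  by (simp add: place_def sum_negf fun_eq_iff)

text \<open>Otherwise the join of \<open>\<eta>\<close> with its half turn passes, at
  \<open>\<iota>\<close> and \<open>star \<iota>\<close>, through two vertices exactly a half turn
  apart. Their roots are opposite, but \<open>beta_state_pos\<close> makes both positive.\<close>

lemma turned_less:
  assumes "state \<eta>"
  shows "turned \<eta> \<iota> < \<eta> \<iota>"
proof (rule ccontr)
  assume "\<not> turned \<eta> \<iota> < \<eta> \<iota>"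
  then have ge: "\<eta> \<iota> \<le> turned \<eta> \<iota>" by simp
  define \<zeta> where "\<zeta> = (\<lambda>\<kappa>. max (\<eta> \<kappa>) (turned \<eta> \<kappa>))"
  have st: "state \<zeta>" unfolding \<zeta>_def by (intro state_max assms state_turned)
  have z: "\<zeta> \<iota> = \<eta> (star \<iota>) - turn" "\<zeta> (star \<iota>) = \<eta> (star \<iota>)"
    using ge turn_pos by (auto simp: \<zeta>_def turned_def)
  obtain b b' where b: "b \<in> pos_roots" "beta \<iota> (\<zeta> \<iota>) = place \<zeta> b"
    "b' \<in> pos_roots" "beta (star \<iota>) (\<zeta> (star \<iota>)) = place \<zeta> b'"
    using beta_state_pos[OF st] by metis
  have "beta \<iota> (\<zeta> \<iota>) = - beta (star \<iota>) (\<zeta> (star \<iota>))"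
    using beta_turn[of "star \<iota>" "\<eta> (star \<iota>)"] by (simp add: z)
  then have "place \<zeta> b = place \<zeta> (- b')" using b by (simp add: place_uminus)
  then have "b = - b'" by (rule place_inj[OF st])
  then show False using b(1,3) pos_not_neg[of b] by (simp add: neg_roots_iff)
qed

end

section \<open>Compatible readings and the twisted Coxeter element\<close>

context Q_datum
begin

definition region :: "('v \<Rightarrow> int) \<Rightarrow> ('v \<Rightarrow> int) \<Rightarrow> ('v \<times> int) set" where
  "region \<eta> \<zeta> = {(\<iota>, p). in_row \<iota> p \<and> \<zeta> \<iota> < p \<and> p \<le> \<eta> \<iota>}"

lemma region_iff: "(\<iota>, p) \<in> region \<eta> \<zeta> \<longleftrightarrow> in_row \<iota> p \<and> \<zeta> \<iota> < p \<and> p \<le> \<eta> \<iota>"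
  by (simp add: region_def)

lemma rep_arrow_iff:
  "rep_arrow (\<iota>, p) (\<kappa>, s) \<longleftrightarrow> in_row \<iota> p \<and> in_row \<kappa> s \<and> adj \<iota> \<kappa> \<and> s = p + dmin \<iota> \<kappa>"
  by (auto simp: rep_arrow_def rep_vertices_iff dmin_def)

lemma finite_region: "finite (region \<eta> \<zeta>)"
proof -
  have "region \<eta> \<zeta> \<subseteq> Sigma UNIV (\<lambda>\<iota>. {\<zeta> \<iota>..\<eta> \<iota>})" by (auto simp: region_def)
  then show ?thesis by (rule finite_subset) (intro finite_SigmaI, auto)
qed

lemma ex_compatible_reading:
  assumes "finite X"
  shows "\<exists>xs. compatible_reading X xs"
proof -
  obtain ys where ys: "set ys = X" "distinct ys" using finite_distinct_list[OF assms] by blast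
  define xs where "xs = sort_key (\<lambda>x. - snd x) ys"
  have "sorted (map (\<lambda>x. - snd x) xs)" by (simp add: xs_def)
  then have mono: "snd (xs ! k) \<le> snd (xs ! k')" if "k' \<le> k" "k < length xs" for k k'
    using that sorted_nth_mono[of "map (\<lambda>x. - snd x) xs" k' k] by simp
  have "k < k'" if "k < length xs" "k' < length xs" "rep_arrow (xs ! k') (xs ! k)" for k k'
  proof (rule ccontr)
    assume "\<not> k < k'"
    then have "snd (xs ! k) \<le> snd (xs ! k')" using mono that by simp
    moreover have "snd (xs ! k') < snd (xs ! k)"
      using that(3) dmin_pos[of "fst (xs ! k')" "fst (xs ! k)"] by (auto simp: rep_arrow_def dmin_def)
    ultimately show False by simp
  qed
  then have "compatible_reading X xs" using ys by (simp add: compatible_reading_def xs_def)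
  then show ?thesis by blast
qed

text \<open>If the neighbour lies in a larger orbit, the times \<open>p + 1, p - 1, \<dots>\<close>
  are distributed over the members of that orbit, and one rotates to the member that owns
  \<open>p + 1\<close>.\<close>

lemma ex_next_row:
  assumes "adj \<iota> \<kappa>" "in_row \<iota> p"
  shows "\<exists>\<mu>. adj \<iota> \<mu> \<and> in_row \<mu> (p + dmin \<iota> \<mu>)"
proof (cases "d \<kappa> \<le> d \<iota>")
  case True
  then have dm: "dmin \<iota> \<kappa> = d \<kappa>" by (simp add: dmin_def)
  have "2 * d \<kappa> dvd p - slice p \<kappa> - d \<kappa>" using adj_rows[OF assms slice_row[of \<kappa> p]] by (simp add: dm)
  moreover have "slice p \<kappa> - (p + d \<kappa>) = - (p - slice p \<kappa> - d \<kappa>) + 2 * d \<kappa> * (- 1)" by simp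
  ultimately have "2 * d \<kappa> dvd slice p \<kappa> - (p + d \<kappa>)" by (metis dvd_add dvd_minus_iff dvd_triv_left)
  then have "in_row \<kappa> (p + d \<kappa>)" using in_row_dvd[OF slice_row[of \<kappa> p]] by blast
  then show ?thesis using assms(1) dm by metis
next
  case False
  then have \<kappa>: "\<sigma> \<kappa> \<noteq> \<kappa>" using d_pos[of \<iota>] by (auto simp: d_eq[of \<kappa>])
  have \<iota>: "\<sigma> \<iota> = \<iota>" using False d_le_r[of \<kappa>] by (auto simp: d_eq[of \<iota>] split: if_splits)
  obtain c j where c: "c = p + 1 \<or> c = p + 1 - 1" "even (c - slice (p + 1) \<kappa>)"
    "\<And>l. l < r \<Longrightarrow> slice (p + 1) ((\<sigma> ^^ l) \<kappa>) = c - 2 * int ((j + l) mod r)" "j < r"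
    using slice_sigma_pow[OF \<kappa>] by metis
  have "dmin \<iota> \<kappa> = 1" using \<iota> d_pos[of \<kappa>] by (simp add: dmin_def d_eq[of \<iota>])
  then have "even (p - slice (p + 1) \<kappa> - 1)" using adj_rows[OF assms slice_row[of \<kappa> "p + 1"]] by simp
  then have cp: "c = p + 1" using c(1,2) by auto
  define l where "l = (r - j) mod r"
  have l: "l < r" using r_pos by (simp add: l_def)
  have "(j + l) mod r = 0" unfolding l_def using c(4) by (simp add: mod_add_right_eq)
  then have "slice (p + 1) ((\<sigma> ^^ l) \<kappa>) = p + 1" using c(3)[OF l] cp by simp
  then have row: "in_row ((\<sigma> ^^ l) \<kappa>) (p + 1)" using slice_row by metis
  have "adj ((\<sigma> ^^ l) \<iota>) ((\<sigma> ^^ l) \<kappa>)" using assms(1) by (simp add: adj_sigma_pow)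
  then have "adj \<iota> ((\<sigma> ^^ l) \<kappa>)" using \<iota> by (simp add: sigma_pow_fixed)
  moreover have "dmin \<iota> ((\<sigma> ^^ l) \<kappa>) = 1" using \<open>dmin \<iota> \<kappa> = 1\<close> by (simp add: dmin_def)
  ultimately show ?thesis using row by metis
qed

lemma state_below_region:
  assumes "state \<zeta>" "(\<iota>, p) \<in> region \<eta> \<zeta>" "adj \<iota> \<kappa>"
  shows "\<zeta> \<kappa> < p"
proof -
  have "\<zeta> \<iota> + 2 * d \<iota> \<le> p" using assms(2) state_row[OF assms(1)] by (intro in_row_ge) (auto simp: region_iff)
  moreover have "\<zeta> \<kappa> < \<zeta> \<iota> + 2 * d \<iota>" using state_less[OF assms(1)] assms(3) adj_sym by blast
  ultimately show ?thesis by simp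
qed

text \<open>Between two consecutive vertices of a row there is a neighbouring vertex.\<close>

lemma region_out_arrow:
  assumes "state \<eta>" "state \<zeta>" "(\<iota>, p) \<in> region \<eta> \<zeta>" "p < \<eta> \<iota>" "adj \<iota> \<kappa>"
  shows "\<exists>y\<in>region \<eta> \<zeta>. rep_arrow (\<iota>, p) y"
proof -
  have row: "in_row \<iota> p" using assms(3) by (simp add: region_iff)
  obtain \<mu> where \<mu>: "adj \<iota> \<mu>" "in_row \<mu> (p + dmin \<iota> \<mu>)" using ex_next_row[OF assms(5) row] by blast
  have "\<zeta> \<mu> < p + dmin \<iota> \<mu>" using state_below_region[OF assms(2,3) \<mu>(1)] dmin_pos[of \<iota> \<mu>] by simp
  moreover have "p + dmin \<iota> \<mu> \<le> \<eta> \<mu>"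
  proof (rule ccontr)
    assume "\<not> p + dmin \<iota> \<mu> \<le> \<eta> \<mu>"
    then have "\<eta> \<mu> + 2 * d \<mu> \<le> p + dmin \<iota> \<mu>" by (intro in_row_ge \<mu>(2) state_row assms(1)) simp
    moreover have "p + 2 * d \<iota> \<le> \<eta> \<iota>" by (intro in_row_ge row state_row assms(1,4))
    ultimately show False using state_le[OF assms(1) \<mu>(1)] d_pos[of \<iota>] by linarith
  qed
  ultimately show ?thesis using \<mu> row by (intro bexI[of _ "(\<mu>, p + dmin \<iota> \<mu>)"]) (auto simp: region_iff rep_arrow_iff)
qed

text \<open>Below a higher neighbour, at distance \<open>dmin\<close> after
  \<open>\<eta> \<iota>\<close>, lies a vertex of the region receiving an arrow from the given
  one.\<close>

lemma region_first_source:
  assumes "state \<eta>" "state \<zeta>" "(\<iota>, \<eta> \<iota>) \<in> region \<eta> \<zeta>"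
    "\<And>y. y \<in> region \<eta> \<zeta> \<Longrightarrow> \<not> rep_arrow (\<iota>, \<eta> \<iota>) y"
  shows "source \<eta> \<iota>"
  unfolding source_def
proof (intro allI impI)
  fix \<kappa> assume a: "adj \<iota> \<kappa>"
  show "\<eta> \<kappa> < \<eta> \<iota>"
  proof (rule ccontr)
    assume "\<not> \<eta> \<kappa> < \<eta> \<iota>"
    moreover have "\<eta> \<iota> \<noteq> \<eta> \<kappa>" by (rule adj_rows_neq[OF a state_row[OF assms(1)] state_row[OF assms(1)]])
    ultimately have gt: "\<eta> \<iota> < \<eta> \<kappa>" by simp
    have a': "adj \<kappa> \<iota>" using a adj_sym by blast
    have ge: "\<eta> \<iota> + dmin \<iota> \<kappa> \<le> \<eta> \<kappa>"
      using adj_rows_less[OF a' state_row[OF assms(1)] state_row[OF assms(1)] gt] by (simp add: dmin_sym)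
    have row: "in_row \<kappa> (\<eta> \<iota> + dmin \<iota> \<kappa>)"
    proof (cases "d \<kappa> \<le> d \<iota>")
      case True
      then have dm: "dmin \<iota> \<kappa> = d \<kappa>" by (simp add: dmin_def)
      have "2 * d \<kappa> dvd \<eta> \<kappa> - \<eta> \<iota> - d \<kappa>"
        using adj_rows[OF a' state_row[OF assms(1)] state_row[OF assms(1)]] dm by (simp add: dmin_sym[of \<kappa>])
      then have "2 * d \<kappa> dvd \<eta> \<kappa> - (\<eta> \<iota> + d \<kappa>)" by (simp add: algebra_simps)
      then show ?thesis using in_row_dvd[OF state_row[OF assms(1)]] dm by simp
    next
      case False
      then have "dmin \<iota> \<kappa> = d \<iota>" by (simp add: dmin_def)
      then have "\<eta> \<kappa> = \<eta> \<iota> + dmin \<iota> \<kappa>" using ge state_le[OF assms(1) a'] by (simp add: dmin_sym[of \<kappa>])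
      then show ?thesis using state_row[OF assms(1), of \<kappa>] by simp
    qed
    have "\<zeta> \<kappa> < \<eta> \<iota> + dmin \<iota> \<kappa>" using state_below_region[OF assms(2,3) a] dmin_pos[of \<iota> \<kappa>] by simp
    then have "(\<kappa>, \<eta> \<iota> + dmin \<iota> \<kappa>) \<in> region \<eta> \<zeta>" using row ge by (simp add: region_iff)
    moreover have "rep_arrow (\<iota>, \<eta> \<iota>) (\<kappa>, \<eta> \<iota> + dmin \<iota> \<kappa>)"
      using row a state_row[OF assms(1)] by (simp add: rep_arrow_iff)
    ultimately show False using assms(4) by blast
  qed
qed

lemma compatible_reading_Cons:
  assumes "compatible_reading X (x # xs)"
  shows "x \<in> X" "\<And>y. y \<in> X \<Longrightarrow> \<not> rep_arrow x y" "compatible_reading (X - {x}) xs"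
proof -
  have c: "distinct (x # xs)" "set (x # xs) = X"
    "\<And>k k'. k < length (x # xs) \<Longrightarrow> k' < length (x # xs) \<Longrightarrow> rep_arrow ((x # xs) ! k') ((x # xs) ! k) \<Longrightarrow> k < k'"
    using assms unfolding compatible_reading_def by auto
  show "x \<in> X" using c(2) by auto
  show "\<not> rep_arrow x y" if "y \<in> X" for y
  proof
    assume a: "rep_arrow x y"
    obtain k where "k < length (x # xs)" "(x # xs) ! k = y" using \<open>y \<in> X\<close> c(2) by (metis in_set_conv_nth)
    then show False using c(3)[of k 0] a by simp
  qed
  show "compatible_reading (X - {x}) xs"
    unfolding compatible_reading_def
  proof (intro conjI allI impI)
    show "set xs = X - {x}" using c(1,2) by auto
    show "k < k'" if "k < length xs" "k' < length xs" "rep_arrow (xs ! k') (xs ! k)" for k k'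
      using c(3)[of "Suc k" "Suc k'"] that by simp
  qed (use c(1) in simp)
qed

text \<open>The first vertex of a reading has no arrow into the region, so it is the top of its row
  and a source; then induct. The alternative in the fourth hypothesis is for the one-vertex diagram,
  whose row has no arrows: there a reading is forced only if the region has at most one
  vertex.\<close>

lemma compatible_reading_adapted:
  assumes "state \<eta>" "state \<zeta>" "\<And>\<iota>. \<zeta> \<iota> \<le> \<eta> \<iota>"
    "\<And>\<iota>. (\<exists>\<kappa>. adj \<iota> \<kappa>) \<or> \<eta> \<iota> - 2 * d \<iota> \<le> \<zeta> \<iota>"
    "compatible_reading (region \<eta> \<zeta>) xs"
  shows "adapted \<eta> (map fst xs) \<and> run \<eta> (map fst xs) = \<zeta>"
  using assms
proof (induction xs arbitrary: \<eta>)
  case Nil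
  then have empty: "region \<eta> \<zeta> = {}" by (simp add: compatible_reading_def)
  have "\<eta> \<iota> = \<zeta> \<iota>" for \<iota>
  proof (rule ccontr)
    assume "\<eta> \<iota> \<noteq> \<zeta> \<iota>"
    then have "(\<iota>, \<eta> \<iota>) \<in> region \<eta> \<zeta>" using Nil.prems(3)[of \<iota>] state_row[OF Nil.prems(1)] by (simp add: region_iff)
    then show False using empty by blast
  qed
  then show ?case by auto
next
  case (Cons x xs)
  note st = Cons.prems(1,2)
  obtain \<iota> p where x: "x = (\<iota>, p)" by (cases x)
  note rd = compatible_reading_Cons[OF Cons.prems(5), unfolded x]
  have row: "in_row \<iota> p" "\<zeta> \<iota> < p" "p \<le> \<eta> \<iota>" using rd(1) by (auto simp: region_iff)
  have p: "p = \<eta> \<iota>"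
  proof (rule ccontr)
    assume "p \<noteq> \<eta> \<iota>"
    then have less: "p < \<eta> \<iota>" using row(3) by simp
    show False
    proof (cases "\<exists>\<kappa>. adj \<iota> \<kappa>")
      case True
      then obtain \<kappa> where "adj \<iota> \<kappa>" by blast
      from region_out_arrow[OF st rd(1) less this] show False using rd(2) by blast
    next
      case False
      then have "\<eta> \<iota> - 2 * d \<iota> \<le> \<zeta> \<iota>" using Cons.prems(4) by blast
      moreover have "p + 2 * d \<iota> \<le> \<eta> \<iota>" by (intro in_row_ge row(1) state_row st(1) less)
      ultimately show False using row(2) by simp
    qed
  qed
  have src: "source \<eta> \<iota>" by (rule region_first_source[OF st]) (use rd(1,2) p in auto)
  have low: "\<zeta> \<iota> + 2 * d \<iota> \<le> \<eta> \<iota>" using in_row_ge[OF row(1) state_row[OF st(2)] row(2)] p by simp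
  have reg: "region (fire \<iota> \<eta>) \<zeta> = region \<eta> \<zeta> - {(\<iota>, p)}"
  proof (intro set_eqI iffI)
    fix y assume y: "y \<in> region \<eta> \<zeta> - {(\<iota>, p)}"
    obtain \<kappa> s where [simp]: "y = (\<kappa>, s)" by (cases y)
    have "s + 2 * d \<iota> \<le> \<eta> \<iota>" if "\<kappa> = \<iota>"
    proof -
      have "in_row \<iota> s" "s < \<eta> \<iota>" using y that p by (auto simp: region_iff)
      from in_row_ge[OF state_row[OF st(1)] this] show ?thesis .
    qed
    then show "y \<in> region (fire \<iota> \<eta>) \<zeta>" using y by (auto simp: region_iff fire_apply)
  qed (use d_pos[of \<iota>] p in \<open>auto simp: region_iff fire_apply split: if_splits\<close>)
  have "adapted (fire \<iota> \<eta>) (map fst xs) \<and> run (fire \<iota> \<eta>) (map fst xs) = \<zeta>"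
  proof (rule Cons.IH)
    show "state (fire \<iota> \<eta>)" by (rule state_fire[OF st(1) src])
    show "\<zeta> \<kappa> \<le> fire \<iota> \<eta> \<kappa>" for \<kappa> using Cons.prems(3)[of \<kappa>] low by (simp add: fire_apply)
    show "(\<exists>\<mu>. adj \<kappa> \<mu>) \<or> fire \<iota> \<eta> \<kappa> - 2 * d \<kappa> \<le> \<zeta> \<kappa>" for \<kappa>
      using Cons.prems(4)[of \<kappa>] d_pos[of \<iota>] by (auto simp: fire_apply)
    show "compatible_reading (region (fire \<iota> \<eta>) \<zeta>) xs" using rd(3) reg by simp
  qed (rule st(2))
  then show ?case using src by (simp add: x adapted_Cons run_Cons)
qed

lemma place_w_of_region:
  assumes "state \<eta>" "state \<zeta>" "\<And>\<iota>. \<zeta> \<iota> \<le> \<eta> \<iota>"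
    "\<And>\<iota>. (\<exists>\<kappa>. adj \<iota> \<kappa>) \<or> \<eta> \<iota> - 2 * d \<iota> \<le> \<zeta> \<iota>"
  shows "place \<eta> (w_of (region \<eta> \<zeta>) l) = place \<zeta> l"
proof -
  define xs where "xs = (SOME xs. compatible_reading (region \<eta> \<zeta>) xs)"
  have "compatible_reading (region \<eta> \<zeta>) xs"
    unfolding xs_def by (rule someI_ex) (rule ex_compatible_reading[OF finite_region])
  from compatible_reading_adapted[OF assms this]
  have "adapted \<eta> (map fst xs)" "run \<eta> (map fst xs) = \<zeta>" by auto
  then show ?thesis using place_run[OF assms(1)] unfolding w_of_def xs_def by metis
qed

subsection \<open>Heights along orbits\<close>

lemma height_sigma_dvd: "2 * d \<kappa> dvd \<xi> (\<sigma> \<kappa>) - \<xi> \<kappa> + 2"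
proof -
  have "in_row (\<sigma> \<kappa>) (\<xi> \<kappa> - 2)" using in_row_height by simp
  then have "2 * d (\<sigma> \<kappa>) dvd \<xi> (\<sigma> \<kappa>) - (\<xi> \<kappa> - 2)" using in_row_dvd[OF in_row_height] by blast
  then show ?thesis by (simp add: algebra_simps)
qed

lemma height_r2:
  assumes "r = 2" "\<sigma> \<kappa> \<noteq> \<kappa>"
  shows "\<xi> (\<sigma> \<kappa>) + 2 \<le> \<xi> \<kappa> \<or> \<xi> \<kappa> + 2 \<le> \<xi> (\<sigma> \<kappa>)" "inv \<sigma> \<kappa> = \<sigma> \<kappa>" "orb \<kappa> = {\<kappa>, \<sigma> \<kappa>}"
proof -
  have "4 dvd \<xi> (\<sigma> \<kappa>) - \<xi> \<kappa> + 2" using height_sigma_dvd[of \<kappa>] assms by (simp add: d_eq)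
  then show "\<xi> (\<sigma> \<kappa>) + 2 \<le> \<xi> \<kappa> \<or> \<xi> \<kappa> + 2 \<le> \<xi> (\<sigma> \<kappa>)" by presburger
  have "\<sigma> (\<sigma> \<kappa>) = \<kappa>" using sigma_order_cases assms(1) by auto
  then show "inv \<sigma> \<kappa> = \<sigma> \<kappa>" by (metis inv_sigma(1))
  have "{..<2::nat} = {0, 1}" by auto
  then show "orb \<kappa> = {\<kappa>, \<sigma> \<kappa>}" by (auto simp: orb_eq assms(1))
qed

text \<open>The fixed neighbour \<open>\<nu>\<close> confines both heights to the interval from
  \<open>\<xi> \<nu> - 5\<close> to \<open>\<xi> \<nu> + 1\<close>, and the congruence modulo 6
  between the rows leaves two values for their difference.\<close>

lemma height_r3:
  assumes "r = 3" "\<sigma> \<kappa> \<noteq> \<kappa>"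
  shows "\<xi> (\<sigma> \<kappa>) = \<xi> \<kappa> - 2 \<or> \<xi> (\<sigma> \<kappa>) = \<xi> \<kappa> + 4" "inv \<sigma> \<kappa> = \<sigma> (\<sigma> \<kappa>)" "orb \<kappa> = {\<kappa>, \<sigma> \<kappa>, \<sigma> (\<sigma> \<kappa>)}"
    "\<sigma> (\<sigma> (\<sigma> \<kappa>)) = \<kappa>"
proof -
  obtain \<nu> where \<nu>: "adj \<kappa> \<nu>" "\<sigma> \<nu> = \<nu>" using sigma_order_cases assms by auto
  have d: "d \<nu> = 1" "d \<kappa> = 3" "d (\<sigma> \<kappa>) = 3" using assms \<nu> by (auto simp: d_eq)
  have a: "adj (\<sigma> \<kappa>) \<nu>" using \<nu> adj_sigma[of \<kappa> \<nu>] by simp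
  have a': "adj \<nu> \<kappa>" "adj \<nu> (\<sigma> \<kappa>)" using \<nu>(1) a adj_sym by blast+
  have "\<xi> \<kappa> - \<xi> \<nu> \<le> 1" "\<xi> (\<sigma> \<kappa>) - \<xi> \<nu> \<le> 1" "\<xi> \<nu> - \<xi> \<kappa> \<le> 5" "\<xi> \<nu> - \<xi> (\<sigma> \<kappa>) \<le> 5"
    using state_le[OF state_height \<nu>(1)] state_le[OF state_height a] state_le[OF state_height a'(1)]
      state_le[OF state_height a'(2)] by (auto simp: dmin_def d)
  then have "\<bar>\<xi> (\<sigma> \<kappa>) - \<xi> \<kappa>\<bar> \<le> 6" by linarith
  moreover have "6 dvd \<xi> (\<sigma> \<kappa>) - \<xi> \<kappa> + 2" using height_sigma_dvd[of \<kappa>] d by simp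
  ultimately show "\<xi> (\<sigma> \<kappa>) = \<xi> \<kappa> - 2 \<or> \<xi> (\<sigma> \<kappa>) = \<xi> \<kappa> + 4" by presburger
  show s3: "\<sigma> (\<sigma> (\<sigma> \<kappa>)) = \<kappa>" using sigma_order_cases assms(1) by auto
  then show "inv \<sigma> \<kappa> = \<sigma> (\<sigma> \<kappa>)" by (metis inv_sigma(1))
  have "{..<3::nat} = {0, 1, 2}" by auto
  then show "orb \<kappa> = {\<kappa>, \<sigma> \<kappa>, \<sigma> (\<sigma> \<kappa>)}" by (auto simp: orb_eq assms(1) numeral_2_eq_2)
qed

lemma orbit_cases:
  obtains "\<sigma> \<kappa> = \<kappa>" "d \<kappa> = 1" "inv \<sigma> \<kappa> = \<kappa>" "orb \<kappa> = {\<kappa>}" | "r = 2" "\<sigma> \<kappa> \<noteq> \<kappa>" | "r = 3" "\<sigma> \<kappa> \<noteq> \<kappa>"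
proof -
  consider "\<sigma> \<kappa> = \<kappa>" | "r = 2" "\<sigma> \<kappa> \<noteq> \<kappa>" | "r = 3" "\<sigma> \<kappa> \<noteq> \<kappa>" using sigma_order_cases by fastforce
  then show thesis
  proof cases
    case 1
    have "d \<kappa> = 1" using 1 by (simp add: d_eq)
    moreover have "inv \<sigma> \<kappa> = \<kappa>" using 1 by (metis inv_sigma(1))
    moreover have "orb \<kappa> = {\<kappa>}" using 1 r_pos by (auto simp: orb_eq sigma_pow_fixed)
    ultimately show thesis using that(1) 1 by blast
  qed (use that in auto)
qed

lemma height_inj_on_orb: "\<mu> \<in> orb \<kappa> \<Longrightarrow> \<xi> \<mu> = \<xi> \<kappa> \<Longrightarrow> \<mu> = \<kappa>"
proof (cases \<kappa> rule: orbit_cases)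
  case 2
  then show "\<mu> \<in> orb \<kappa> \<Longrightarrow> \<xi> \<mu> = \<xi> \<kappa> \<Longrightarrow> \<mu> = \<kappa>" using height_r2[OF 2] by auto
next
  case 3
  have "\<sigma> (\<sigma> \<kappa>) \<noteq> \<sigma> \<kappa>" using 3 by simp
  then show "\<mu> \<in> orb \<kappa> \<Longrightarrow> \<xi> \<mu> = \<xi> \<kappa> \<Longrightarrow> \<mu> = \<kappa>" using height_r3[OF 3] height_r3(1)[of "\<sigma> \<kappa>"] 3 by auto
qed simp

lemma top_vertex_eqI:
  assumes "i \<in> orbits" "\<iota> \<in> i" "\<And>\<kappa>. \<kappa> \<in> i \<Longrightarrow> \<xi> \<kappa> \<le> \<xi> \<iota>"
  shows "top_vertex i = \<iota>"
proof -
  have M: "Max (\<xi> ` i) = \<xi> \<iota>" using assms by (intro Max_eqI) auto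
  have "i = orb \<iota>" by (rule orbit_eq_orb[OF assms(1,2)])
  then show ?thesis unfolding top_vertex_def M
    by (intro the_equality) (use assms(2) height_inj_on_orb in auto)
qed

lemma top_vertex:
  assumes "i \<in> orbits"
  shows "top_vertex i \<in> i" "\<And>\<kappa>. \<kappa> \<in> i \<Longrightarrow> \<xi> \<kappa> \<le> \<xi> (top_vertex i)"
proof -
  have "i \<noteq> {}" using assms orb_self by (auto simp: orbits_def)
  then have "Max (\<xi> ` i) \<in> \<xi> ` i" by (intro Max_in) auto
  then obtain \<iota> where \<iota>: "\<iota> \<in> i" "Max (\<xi> ` i) = \<xi> \<iota>" by auto
  then have le: "\<And>\<kappa>. \<kappa> \<in> i \<Longrightarrow> \<xi> \<kappa> \<le> \<xi> \<iota>" using Max_ge[of "\<xi> ` i"] by auto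
  have "top_vertex i = \<iota>" by (rule top_vertex_eqI[OF assms \<iota>(1) le])
  then show "top_vertex i \<in> i" "\<And>\<kappa>. \<kappa> \<in> i \<Longrightarrow> \<xi> \<kappa> \<le> \<xi> (top_vertex i)" using \<iota>(1) le by auto
qed

text \<open>The base point hidden in the definition of \<open>tau\<close>: \<open>X_prime\<close> is
  the region between \<open>raised\<close> and \<open>\<xi>\<close>, and \<open>X_circ\<close> the
  one between \<open>raised\<close> and its twisted shift. Conjugating by
  \<open>w_of X_prime\<close> moves the base point back to \<open>\<xi>\<close>.\<close>

abbreviation raised :: "'v \<Rightarrow> int" where
  "raised \<equiv> \<lambda>\<iota>. max (\<xi> \<iota>) (shift \<xi> \<iota>)"

lemma state_raised: "state raised"
  by (intro state_max state_shift state_height)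

lemma orb_in_orbits: "orb \<kappa> \<in> orbits"
  by (simp add: orbits_def)

lemma X_prime_eq: "X_prime = region raised \<xi>"
proof (intro set_eqI iffI)
  fix x assume "x \<in> X_prime"
  then obtain i p where "x = (\<sigma> (top_vertex i), p)" "in_row (\<sigma> (top_vertex i)) p"
    "\<xi> (\<sigma> (top_vertex i)) < p" "p \<le> \<xi> (top_vertex i) - 2"
    unfolding X_prime_def rep_vertices_iff by blast
  then show "x \<in> region raised \<xi>" by (simp add: region_iff)
next
  fix x assume "x \<in> region raised \<xi>"
  then obtain \<kappa> p where x: "x = (\<kappa>, p)" "in_row \<kappa> p" "\<xi> \<kappa> < p" "p \<le> max (\<xi> \<kappa>) (shift \<xi> \<kappa>)"
    by (cases x) (auto simp: region_iff)
  define \<mu> where "\<mu> = inv \<sigma> \<kappa>"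
  have \<mu>: "\<kappa> = \<sigma> \<mu>" by (simp add: \<mu>_def)
  have p: "p \<le> \<xi> \<mu> - 2" using x by (simp add: \<mu>)
  have "top_vertex (orb \<mu>) = \<mu>"
  proof (rule top_vertex_eqI[OF orb_in_orbits orb_self])
    fix \<nu> assume \<nu>: "\<nu> \<in> orb \<mu>"
    show "\<xi> \<nu> \<le> \<xi> \<mu>"
    proof (cases \<mu> rule: orbit_cases)
      case 1
      then show ?thesis using \<nu> by simp
    next
      case 2
      then show ?thesis using height_r2[OF 2] \<nu> x(3) p \<mu> by auto
    next
      case 3
      then show ?thesis using height_r3(1)[OF 3] x(3) p \<mu> by auto
    qed
  qed
  then show "x \<in> X_prime"
    using x p orb_in_orbits[of \<mu>] unfolding X_prime_def rep_vertices_iff \<mu> by force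
qed

text \<open>Computed by the size of the orbit: the twisted shift lowers \<open>raised\<close> by one
  full step \<open>2 * d \<kappa>\<close> at the top vertex of an orbit and leaves it unchanged at
  the other vertices.\<close>

lemma raised_region_iff:
  "(\<kappa>, p) \<in> region raised (shift raised) \<longleftrightarrow> p = \<xi> \<kappa> \<and> (\<forall>\<nu>\<in>orb \<kappa>. \<xi> \<nu> \<le> \<xi> \<kappa>)"
  and raised_shift_le: "shift raised \<kappa> \<le> raised \<kappa>"
  and raised_shift_ge: "raised \<kappa> - 2 * d \<kappa> \<le> shift raised \<kappa>"
proof -
  have sh: "shift raised \<kappa> = max (\<xi> (inv \<sigma> \<kappa>)) (\<xi> (inv \<sigma> (inv \<sigma> \<kappa>)) - 2) - 2" "raised \<kappa> = max (\<xi> \<kappa>) (\<xi> (inv \<sigma> \<kappa>) - 2)"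
    by (simp_all add: shift_def)
  have row: "p = \<xi> \<kappa>" if "in_row \<kappa> p" "\<xi> \<kappa> - 2 * d \<kappa> < p" "p \<le> \<xi> \<kappa>"
    using in_row_ge[OF in_row_height that(1)] that by fastforce
  have "((\<kappa>, p) \<in> region raised (shift raised) \<longleftrightarrow> p = \<xi> \<kappa> \<and> (\<forall>\<nu>\<in>orb \<kappa>. \<xi> \<nu> \<le> \<xi> \<kappa>)) \<and>
    shift raised \<kappa> \<le> raised \<kappa> \<and> raised \<kappa> - 2 * d \<kappa> \<le> shift raised \<kappa>"
  proof (cases \<kappa> rule: orbit_cases)
    case 1
    have "raised \<kappa> = \<xi> \<kappa>" "shift raised \<kappa> = \<xi> \<kappa> - 2" unfolding sh by (simp_all add: 1)
    then show ?thesis using row in_row_height[of \<kappa>] by (auto simp: region_iff 1 simp del: shift_sigma)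
  next
    case 2
    have d: "d \<kappa> = 2" using 2 by (simp add: d_eq)
    have inv: "inv \<sigma> \<kappa> = \<sigma> \<kappa>" "inv \<sigma> (inv \<sigma> \<kappa>) = \<kappa>" using height_r2(2)[OF 2] by simp_all
    from height_r2(1)[OF 2] show ?thesis
    proof
      assume le: "\<xi> (\<sigma> \<kappa>) + 2 \<le> \<xi> \<kappa>"
      then have "raised \<kappa> = \<xi> \<kappa>" "shift raised \<kappa> = \<xi> \<kappa> - 4" unfolding sh inv by auto
      then show ?thesis using row in_row_height[of \<kappa>] le height_r2(3)[OF 2] by (auto simp: region_iff d)
    next
      assume le: "\<xi> \<kappa> + 2 \<le> \<xi> (\<sigma> \<kappa>)"
      then have "raised \<kappa> = \<xi> (\<sigma> \<kappa>) - 2" "shift raised \<kappa> = \<xi> (\<sigma> \<kappa>) - 2" unfolding sh inv by auto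
      then show ?thesis using le height_r2(3)[OF 2] by (auto simp: region_iff d)
    qed
  next
    case 3
    have d: "d \<kappa> = 3" using 3 by (simp add: d_eq)
    note h = height_r3[OF 3]
    have nf: "\<sigma> (\<sigma> \<kappa>) \<noteq> \<sigma> \<kappa>" "\<sigma> (\<sigma> (\<sigma> \<kappa>)) \<noteq> \<sigma> (\<sigma> \<kappa>)" using 3(2) by simp_all
    have h1: "\<xi> (\<sigma> (\<sigma> \<kappa>)) = \<xi> (\<sigma> \<kappa>) - 2 \<or> \<xi> (\<sigma> (\<sigma> \<kappa>)) = \<xi> (\<sigma> \<kappa>) + 4"
      using height_r3(1)[OF 3(1) nf(1)] .
    have h2: "\<xi> \<kappa> = \<xi> (\<sigma> (\<sigma> \<kappa>)) - 2 \<or> \<xi> \<kappa> = \<xi> (\<sigma> (\<sigma> \<kappa>)) + 4"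
      using height_r3(1)[OF 3(1) nf(2)] by (simp add: h(4))
    have inv: "inv \<sigma> \<kappa> = \<sigma> (\<sigma> \<kappa>)" "inv \<sigma> (inv \<sigma> \<kappa>) = \<sigma> \<kappa>" using h(2) by simp_all
    from h2 show ?thesis
    proof
      assume e: "\<xi> \<kappa> = \<xi> (\<sigma> (\<sigma> \<kappa>)) + 4"
      have z: "\<xi> (\<sigma> (\<sigma> \<kappa>)) = \<xi> \<kappa> - 4" "\<xi> (\<sigma> \<kappa>) = \<xi> \<kappa> - 2"
        using h(1) h1 e by (elim disjE; linarith)+
      have "raised \<kappa> = \<xi> \<kappa>" "shift raised \<kappa> = \<xi> \<kappa> - 6" unfolding sh inv by (simp_all add: z)
      moreover have "\<forall>\<nu>\<in>orb \<kappa>. \<xi> \<nu> \<le> \<xi> \<kappa>" unfolding h(3) using z by simp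
      ultimately show ?thesis using row in_row_height[of \<kappa>] by (auto simp: region_iff d)
    next
      assume e: "\<xi> \<kappa> = \<xi> (\<sigma> (\<sigma> \<kappa>)) - 2"
      then have z: "\<xi> (\<sigma> (\<sigma> \<kappa>)) = \<xi> \<kappa> + 2" by simp
      have z': "\<xi> (\<sigma> \<kappa>) \<le> \<xi> \<kappa> + 4" using h(1) by linarith
      have "raised \<kappa> = \<xi> \<kappa>" "shift raised \<kappa> = \<xi> \<kappa>" unfolding sh inv z using z' by simp_all
      moreover have "\<not> (\<forall>\<nu>\<in>orb \<kappa>. \<xi> \<nu> \<le> \<xi> \<kappa>)" unfolding h(3) using z by simp
      ultimately show ?thesis by (auto simp: region_iff d)
    qed
  qed
  then show "(\<kappa>, p) \<in> region raised (shift raised) \<longleftrightarrow> p = \<xi> \<kappa> \<and> (\<forall>\<nu>\<in>orb \<kappa>. \<xi> \<nu> \<le> \<xi> \<kappa>)"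
    "shift raised \<kappa> \<le> raised \<kappa>" "raised \<kappa> - 2 * d \<kappa> \<le> shift raised \<kappa>" by blast+
qed

lemma X_circ_eq: "X_circ = region raised (shift raised)"
proof (intro set_eqI iffI)
  fix x assume "x \<in> X_circ"
  then obtain i where i: "i \<in> orbits" "x = (top_vertex i, \<xi> (top_vertex i))" unfolding X_circ_def by blast
  have "i = orb (top_vertex i)" by (rule orbit_eq_orb[OF i(1) top_vertex(1)[OF i(1)]])
  then have "\<forall>\<nu>\<in>orb (top_vertex i). \<xi> \<nu> \<le> \<xi> (top_vertex i)" using top_vertex(2)[OF i(1)] by simp
  then show "x \<in> region raised (shift raised)" unfolding i(2) raised_region_iff by simp
next
  fix x assume x: "x \<in> region raised (shift raised)"
  obtain \<kappa> p where \<kappa>: "x = (\<kappa>, p)" by (cases x)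
  have p: "p = \<xi> \<kappa>" "\<forall>\<nu>\<in>orb \<kappa>. \<xi> \<nu> \<le> \<xi> \<kappa>" using x unfolding \<kappa> raised_region_iff by auto
  have "top_vertex (orb \<kappa>) = \<kappa>" by (rule top_vertex_eqI[OF orb_in_orbits orb_self]) (use p(2) in blast)
  then show "x \<in> X_circ" using \<kappa> p(1) orb_in_orbits[of \<kappa>] unfolding X_circ_def by force
qed

lemma place_tau: "place \<xi> (tau l) = cox (place \<xi> l)"
proof -
  \<comment> \<open>A vertex without neighbours is the whole diagram, so \<open>\<sigma>\<close>
    fixes it.\<close>
  have no_nbr: "raised \<iota> - 2 * d \<iota> \<le> \<xi> \<iota>" if "\<nexists>\<kappa>. adj \<iota> \<kappa>" for \<iota>
  proof -
    have "\<kappa> = \<iota>" for \<kappa>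
      by (rule adj_connected[of "\<lambda>\<kappa>. \<kappa> = \<iota>", OF _ refl]) (use that in blast)
    then have "\<sigma> \<iota> = \<iota>" "inv \<sigma> \<iota> = \<iota>" by blast+
    then show ?thesis using d_pos[of \<iota>] by (simp add: shift_def)
  qed
  have X': "place raised (w_of X_prime l) = place \<xi> l" for l
    unfolding X_prime_eq by (rule place_w_of_region[OF state_raised state_height]) (use no_nbr in auto)
  have X0: "place raised (w_of X_circ l) = place (shift raised) l" for l
    unfolding X_circ_eq
    by (rule place_w_of_region[OF state_raised state_shift[OF state_raised] raised_shift_le])
      (use raised_shift_ge in blast)
  have "bij (w_of X_prime)" unfolding w_of_def by (rule bij_word_refl)
  then have "w_of X_prime (tau l) = w_of X_circ (sigma_act (w_of X_prime l))"
    by (simp add: tau_def tau_circ_def bij_is_surj surj_f_inv_f)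
  then have "place \<xi> (tau l) = place (shift raised) (sigma_act (w_of X_prime l))"
    using X'[of "tau l"] X0 by simp
  also have "\<dots> = cox (place raised (w_of X_prime l))" by (rule place_shift)
  finally show ?thesis by (simp add: X')
qed

lemma bij_tau: "bij tau"
proof -
  have "bij (place \<xi>)" by (rule bij_place[OF state_height])
  have "tau = inv (place \<xi>) \<circ> (cox \<circ> place \<xi>)"
    using bij_is_inj[OF \<open>bij (place \<xi>)\<close>] by (intro ext) (simp add: place_tau[symmetric])
  then show ?thesis using \<open>bij (place \<xi>)\<close> bij_cox by (simp add: bij_comp bij_imp_bij_inv)
qed

lemma place_tau_pow: "place \<xi> ((tau ^^ n) l) = (cox ^^ n) (place \<xi> l)"
  by (induction n) (simp_all add: place_tau)

lemma cox_beta: "cox (beta \<iota> p) = beta (\<sigma> \<iota>) (p - 2)"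
proof -
  have "p - 2 * d \<iota> - 2 = p - 2 - 2 * d (\<sigma> \<iota>)" by simp
  then show ?thesis by (simp only: beta_def cox_diff cox_lam)
qed

lemma cox_pow_beta: "(cox ^^ n) (beta \<iota> p) = beta ((\<sigma> ^^ n) \<iota>) (p - 2 * int n)"
  by (induction n) (simp_all add: cox_beta algebra_simps)

lemma cox_pow_lam: "(cox ^^ n) (lam \<iota> p) = lam ((\<sigma> ^^ n) \<iota>) (p - 2 * int n)"
  by (induction n) (simp_all add: cox_lam algebra_simps)

section \<open>The orbits of \<open>tau\<close> on roots, read along the rows\<close>

definition root_at :: "'v \<Rightarrow> int \<Rightarrow> 'v \<Rightarrow> int" where
  "root_at \<iota> p = inv (place \<xi>) (beta \<iota> p)"

lemma place_root_at: "place \<xi> (root_at \<iota> p) = beta \<iota> p"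
  unfolding root_at_def using bij_place[OF state_height] by (simp add: bij_is_surj surj_f_inv_f)

lemma root_at_eqI: "place \<xi> b = beta \<iota> p \<Longrightarrow> b = root_at \<iota> p"
  by (rule place_inj[OF state_height]) (simp add: place_root_at)

lemma tau_pow_root_at: "(tau ^^ (nat (d \<iota>) * k)) (root_at \<iota> p) = root_at \<iota> (p - 2 * d \<iota> * int k)"
  using d_pos[of \<iota>]
  by (intro root_at_eqI) (simp add: place_tau_pow place_root_at cox_pow_beta sigma_pow_mult_d mult.assoc)

lemma fun_powi_tau_root_at: "fun_powi tau (d \<iota> * k) (root_at \<iota> p) = root_at \<iota> (p - 2 * d \<iota> * k)"
proof (cases "0 \<le> k")
  case True
  then have "0 \<le> d \<iota> * k" "nat (d \<iota> * k) = nat (d \<iota>) * nat k" using d_pos[of \<iota>] by (simp_all add: nat_mult_distrib)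
  then show ?thesis using tau_pow_root_at[of \<iota> "nat k" p] True by (simp add: fun_powi_def)
next
  case False
  define m where "m = nat (- k)"
  have k: "k = - int m" "0 < m" using False by (auto simp: m_def)
  have neg: "\<not> 0 \<le> d \<iota> * k" using False d_pos[of \<iota>] by (simp add: mult_le_0_iff zero_le_mult_iff)
  have n: "nat (- (d \<iota> * k)) = nat (d \<iota>) * m" using d_pos[of \<iota>] by (simp add: k nat_mult_distrib)
  have "root_at \<iota> p = (tau ^^ (nat (d \<iota>) * m)) (root_at \<iota> (p + 2 * d \<iota> * int m))"
    using tau_pow_root_at[of \<iota> m "p + 2 * d \<iota> * int m"] by simp
  then have "(inv tau ^^ (nat (d \<iota>) * m)) (root_at \<iota> p) = root_at \<iota> (p + 2 * d \<iota> * int m)"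
    using funpow_left_inverse[of "inv tau" tau] bij_is_inj[OF bij_tau] by (metis inv_f_f)
  then show ?thesis unfolding fun_powi_def n using neg by (simp add: k)
qed

text \<open>As \<open>\<sigma>\<close> to the power \<open>d \<iota>\<close> fixes
  \<open>\<iota>\<close>, the \<open>d \<iota>\<close>-th power of \<open>tau\<close> moves the
  weight of the row one step down, and \<open>gamma\<close> becomes the difference that defines
  \<open>beta\<close>.\<close>

lemma gamma_eq: "gamma \<iota> = root_at \<iota> (\<xi> \<iota>)"
proof (rule root_at_eqI)
  have "gamma \<iota> = (\<lambda>\<mu>. fund_weight \<iota> \<mu> - (tau ^^ nat (d \<iota>)) (fund_weight \<iota>) \<mu>)"
    using d_pos[of \<iota>] by (simp add: gamma_def fun_powi_def fun_diff_def)
  moreover have "place \<xi> (\<lambda>\<mu>. l \<mu> - k \<mu>) = (\<lambda>\<mu>. place \<xi> l \<mu> - place \<xi> k \<mu>)" for l k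
    by (simp add: place_def left_diff_distrib sum_subtractf)
  ultimately show "place \<xi> (gamma \<iota>) = beta \<iota> (\<xi> \<iota>)"
    using d_pos[of \<iota>] by (simp add: place_tau_pow place_fund_weight cox_pow_lam sigma_pow_d beta_def)
qed

lemma root_at_gamma:
  assumes "in_row \<iota> p"
  shows "fun_powi tau ((\<xi> \<iota> - p) div 2) (gamma \<iota>) = root_at \<iota> p"
proof -
  obtain k where k: "\<xi> \<iota> - p = 2 * d \<iota> * k"
    using in_row_dvd[OF in_row_height, of \<iota> p] assms by (auto elim: dvdE)
  then have "(\<xi> \<iota> - p) div 2 = d \<iota> * k" "\<xi> \<iota> - 2 * d \<iota> * k = p" by auto
  then show ?thesis by (simp add: gamma_eq fun_powi_tau_root_at)
qed

lemma root_at_turn: "root_at (star \<iota>) (p - turn) = - root_at \<iota> p"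
  by (rule root_at_eqI[symmetric]) (simp add: place_uminus place_root_at beta_turn)

end

section \<open>The dual Coxeter number\<close>

context Q_datum
begin

section \<open>The action of \<open>\<sigma>\<close> on root coordinates and its invariants\<close>

definition twist :: "nat \<Rightarrow> ('v \<Rightarrow> int) \<Rightarrow> 'v \<Rightarrow> int" where
  "twist l m = (\<lambda>\<kappa>. m ((\<sigma> ^^ l) \<kappa>))"

lemma twist_0 [simp]: "twist 0 m = m"
  by (simp add: twist_def)

lemma twist_Suc: "twist (Suc l) m = twist 1 (twist l m)"
  by (simp add: twist_def fun_eq_iff funpow_swap1)

lemma of_coords_twist1: "of_coords (twist 1 m) = twist 1 (of_coords m)"
proof
  fix \<iota>
  have "(\<Sum>\<kappa> | adj \<iota> \<kappa>. m (\<sigma> \<kappa>)) = (\<Sum>\<kappa> | adj (\<sigma> \<iota>) \<kappa>. m \<kappa>)"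
  proof (rule sum.reindex_bij_witness[of _ "inv \<sigma>" \<sigma>])
    show "inv \<sigma> \<kappa> \<in> {\<kappa>. adj \<iota> \<kappa>}" if "\<kappa> \<in> {\<kappa>. adj (\<sigma> \<iota>) \<kappa>}" for \<kappa>
      using that adj_sigma[of \<iota> "inv \<sigma> \<kappa>"] by simp
  qed (auto simp: adj_sigma)
  then show "of_coords (twist 1 m) \<iota> = twist 1 (of_coords m) \<iota>"
    by (simp add: of_coords_apply twist_def)
qed

lemma of_coords_twist: "of_coords (twist l m) = twist l (of_coords m)"
proof (induction l)
  case (Suc l)
  then show ?case by (simp only: twist_Suc of_coords_twist1)
qed simp

lemma pairing_twist: "pairing (twist l m) (twist l k) = pairing m k"
proof (induction l)
  case (Suc l)
  have "pairing (twist 1 (twist l m)) (twist 1 (twist l k)) = pairing (twist l m) (twist l k)"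
    unfolding pairing_def using sum_sigma[of "\<lambda>\<kappa>. twist l m \<kappa> * twist l k \<kappa>"] by (simp add: twist_def)
  then show ?case by (simp only: twist_Suc Suc.IH)
qed simp

lemma form_twist: "form (twist l m) (twist l k) = form m k"
  by (simp add: of_coords_twist pairing_twist)

lemma twist1_coord_refl: "twist 1 (coord_refl \<iota> m) = coord_refl (inv \<sigma> \<iota>) (twist 1 m)"
proof
  fix \<kappa>
  have "of_coords (twist 1 m) (inv \<sigma> \<iota>) = of_coords m \<iota>"
    unfolding of_coords_twist1 by (simp add: twist_def)
  moreover have "\<sigma> \<kappa> = \<iota> \<longleftrightarrow> \<kappa> = inv \<sigma> \<iota>" by (metis inv_sigma)
  ultimately show "twist 1 (coord_refl \<iota> m) \<kappa> = coord_refl (inv \<sigma> \<iota>) (twist 1 m) \<kappa>"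
    unfolding coord_refl_def by (simp add: twist_def fund_weight_def)
qed

lemma twist1_coord_word: "twist 1 (coord_word is m) = coord_word (map (inv \<sigma>) is) (twist 1 m)"
  by (induction "is") (simp_all only: coord_word_Nil coord_word_Cons list.map twist1_coord_refl)

lemma twist_root: "m \<in> root_coords \<Longrightarrow> twist l m \<in> root_coords"
proof (induction l)
  case (Suc l)
  obtain "is" \<iota> where "twist l m = coord_word is (unit \<iota>)"
    using Suc unfolding root_coords_def by blast
  then have "twist (Suc l) m = coord_word (map (inv \<sigma>) is) (twist 1 (unit \<iota>))"
    by (simp only: twist_Suc twist1_coord_word)
  moreover have "twist 1 (unit \<iota>) = unit (inv \<sigma> \<iota>)"
  proof
    fix \<kappa>
    have "\<sigma> \<kappa> = \<iota> \<longleftrightarrow> \<kappa> = inv \<sigma> \<iota>" by (metis inv_sigma)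
    then show "twist 1 (unit \<iota>) \<kappa> = unit (inv \<sigma> \<iota>) \<kappa>" by (simp add: twist_def fund_weight_def)
  qed
  ultimately show ?case by (simp add: coord_word_in_root_coords unit_in_root_coords)
qed simp

text \<open>A sum over all \<open>r\<close> powers of \<open>\<sigma>\<close>, so that fixed vectors
  are multiplied by \<open>r\<close>. It represents the projection to the fixed part without
  denominators.\<close>

definition hat :: "('v \<Rightarrow> int) \<Rightarrow> 'v \<Rightarrow> int" where
  "hat m = (\<lambda>\<kappa>. \<Sum>l<r. twist l m \<kappa>)"

lemma hat_sigma [simp]: "hat m (\<sigma> \<kappa>) = hat m \<kappa>"
proof -
  have "twist 0 m \<kappa> + hat m (\<sigma> \<kappa>) = (\<Sum>l<Suc r. twist l m \<kappa>)"
    unfolding sum.lessThan_Suc_shift hat_def by (simp add: twist_def funpow_swap1)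
  also have "\<dots> = hat m \<kappa> + twist 0 m \<kappa>" by (simp add: hat_def twist_def)
  finally show ?thesis by simp
qed

lemma hat_sigma_pow [simp]: "hat m ((\<sigma> ^^ l) \<kappa>) = hat m \<kappa>"
  by (induction l) simp_all

lemma hat_orb: "\<kappa> \<in> orb \<iota> \<Longrightarrow> hat m \<kappa> = hat m \<iota>"
  unfolding orb_def by auto

lemma hat_twist: "hat (twist l m) = hat m"
proof (induction l)
  case (Suc l)
  have "hat (twist 1 k) \<kappa> = hat k (\<sigma> \<kappa>)" for k \<kappa>
    by (simp add: hat_def twist_def funpow_swap1)
  then show ?case unfolding twist_Suc using Suc by (simp add: fun_eq_iff)
qed simp

lemma hat_eq_orbit_sum: "d \<iota> * hat m \<iota> = int r * (\<Sum>\<kappa>\<in>orb \<iota>. m \<kappa>)"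
proof (cases "\<sigma> \<iota> = \<iota>")
  case True
  then have "orb \<iota> = {\<iota>}" using r_pos by (auto simp: orb_eq sigma_pow_fixed)
  then show ?thesis using True by (simp add: d_eq hat_def twist_def sigma_pow_fixed)
next
  case False
  then show ?thesis
    by (simp add: d_eq hat_def twist_def orb_eq sum.reindex[OF sigma_pow_inj_on[OF False]] comp_def)
qed

lemma of_coords_sum: "finite A \<Longrightarrow> of_coords (\<lambda>\<kappa>. \<Sum>x\<in>A. f x \<kappa>) = (\<lambda>\<kappa>. \<Sum>x\<in>A. of_coords (f x) \<kappa>)"
  unfolding of_coords_def sum_distrib_right by (subst sum.swap) simp

lemma pairing_sum_left: "pairing (\<lambda>\<kappa>. \<Sum>x\<in>A. f x \<kappa>) k = (\<Sum>x\<in>A. pairing (f x) k)"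
  unfolding pairing_def sum_distrib_right by (rule sum.swap)

lemma pairing_sum_right: "pairing k (\<lambda>\<kappa>. \<Sum>x\<in>A. f x \<kappa>) = (\<Sum>x\<in>A. pairing k (f x))"
  unfolding pairing_def sum_distrib_left by (rule sum.swap)

lemma of_coords_hat: "of_coords (hat m) = hat (of_coords m)"
  unfolding hat_def by (simp add: of_coords_sum of_coords_twist)

lemma form_hat: "form m (hat k) = (\<Sum>l<r. form m (twist l k))"
  unfolding hat_def by (simp add: of_coords_sum pairing_sum_right)

lemma form_hat_hat: "form (hat m) (hat k) = int r * form m (hat k)"
proof -
  have "form (twist l m) (hat k) = form m (hat k)" for l
  proof -
    have "twist l (hat k) = hat k" by (simp add: twist_def fun_eq_iff)
    then show ?thesis using form_twist[of l m "hat k"] by simp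
  qed
  then have "(\<Sum>l<r. form (twist l m) (hat k)) = int r * form m (hat k)" by simp
  then show ?thesis unfolding hat_def[of m] pairing_sum_left .
qed

subsection \<open>Reflections in orbits\<close>

lemma orb_not_adj: "\<iota> \<in> orb \<kappa> \<Longrightarrow> \<mu> \<in> orb \<kappa> \<Longrightarrow> \<not> adj \<iota> \<mu>"
proof -
  assume "\<iota> \<in> orb \<kappa>" "\<mu> \<in> orb \<kappa>"
  then have "\<mu> \<in> orb \<iota>" using orb_eq_iff[of \<kappa> \<iota>] by simp
  then obtain l where l: "l < r" "\<mu> = (\<sigma> ^^ l) \<iota>" unfolding orb_eq by auto
  then consider "\<mu> = \<iota>" | "\<mu> = \<sigma> \<iota>" | "r = 3" "\<mu> = \<sigma> (\<sigma> \<iota>)"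
    using r_cases by (auto simp: less_Suc_eq numeral_2_eq_2 numeral_3_eq_3)
  then show ?thesis
  proof cases
    case 3
    have "\<sigma> (\<sigma> (\<sigma> \<iota>)) = \<iota>" using sigma_order_cases 3(1) by auto
    then show ?thesis using adj_sigma[of \<iota> \<mu>] 3(2) not_adj_sigma[of \<iota>] adj_sym[of "\<sigma> \<iota>" \<iota>] by auto
  qed (auto simp: not_adj_sigma)
qed

text \<open>The product of the commuting reflections of an orbit. These are the simple reflections
  of the folded Weyl group, and they commute with \<open>\<sigma>\<close>.\<close>

definition orb_refl :: "'v \<Rightarrow> ('v \<Rightarrow> int) \<Rightarrow> 'v \<Rightarrow> int" where
  "orb_refl \<iota> m = (\<lambda>\<kappa>. m \<kappa> - (if \<kappa> \<in> orb \<iota> then of_coords m \<kappa> else 0))"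

lemma coord_word_commuting:
  assumes "distinct xs" "\<And>\<iota> \<kappa>. \<iota> \<in> set xs \<Longrightarrow> \<kappa> \<in> set xs \<Longrightarrow> \<not> adj \<iota> \<kappa>"
  shows "coord_word xs m = (\<lambda>\<kappa>. m \<kappa> - (if \<kappa> \<in> set xs then of_coords m \<kappa> else 0))"
  using assms
proof (induction xs)
  case (Cons \<iota> xs)
  have IH: "coord_word xs m = (\<lambda>\<kappa>. m \<kappa> - (if \<kappa> \<in> set xs then of_coords m \<kappa> else 0))"
    using Cons by simp
  have "of_coords (coord_word xs m) \<iota> = of_coords m \<iota>"
  proof -
    have "of_coords (coord_word xs m) = (\<lambda>\<kappa>. of_coords m \<kappa> - (\<Sum>\<mu>\<in>set xs. of_coords m \<mu> * simple_root \<mu> \<kappa>))"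
      unfolding of_coords_word using Cons.prems by (intro word_refl_commuting) auto
    moreover have "simple_root \<mu> \<iota> = 0" if "\<mu> \<in> set xs" for \<mu>
      using Cons.prems that by (auto simp: simple_root_def)
    ultimately show ?thesis by simp
  qed
  then show ?case unfolding coord_word_Cons coord_refl_def
    using Cons.prems(1) by (auto simp: IH fund_weight_def fun_eq_iff)
qed simp

lemma orb_refl_word: "\<exists>xs. \<forall>m. orb_refl \<iota> m = coord_word xs m"
proof -
  obtain xs where "set xs = orb \<iota>" "distinct xs" using finite_distinct_list[of "orb \<iota>"] by auto
  then show ?thesis using coord_word_commuting[of xs] orb_not_adj[of _ \<iota>] unfolding orb_refl_def by metis
qed

lemma orb_refl_root: "m \<in> root_coords \<Longrightarrow> orb_refl \<iota> m \<in> root_coords"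
  using orb_refl_word[of \<iota>] coord_word_in_root_coords by auto

lemma form_orb_refl: "form (orb_refl \<iota> m) (orb_refl \<iota> k) = form m k"
  using orb_refl_word[of \<iota>] form_coord_word by auto

lemma orb_refl_uminus: "orb_refl \<iota> (- m) = - orb_refl \<iota> m"
  by (simp add: orb_refl_def of_coords_uminus fun_eq_iff)

lemma of_coords_orb_refl_on_orb: "\<kappa> \<in> orb \<iota> \<Longrightarrow> of_coords (orb_refl \<iota> m) \<kappa> = - of_coords m \<kappa>"
proof -
  assume k: "\<kappa> \<in> orb \<iota>"
  have "(\<Sum>\<mu> | adj \<kappa> \<mu>. orb_refl \<iota> m \<mu>) = (\<Sum>\<mu> | adj \<kappa> \<mu>. m \<mu>)"
    using orb_not_adj[OF k] by (intro sum.cong) (auto simp: orb_refl_def)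
  then show ?thesis using k by (simp add: of_coords_apply orb_refl_def)
qed

lemma orb_refl_invol: "orb_refl \<iota> (orb_refl \<iota> m) = m"
proof
  fix \<kappa>
  have "orb_refl \<iota> (orb_refl \<iota> m) \<kappa> = orb_refl \<iota> m \<kappa> - (if \<kappa> \<in> orb \<iota> then of_coords (orb_refl \<iota> m) \<kappa> else 0)"
    by (simp only: orb_refl_def[of \<iota> "orb_refl \<iota> m"])
  then show "orb_refl \<iota> (orb_refl \<iota> m) \<kappa> = m \<kappa>"
    using of_coords_orb_refl_on_orb[of \<kappa> \<iota> m] by (auto simp: orb_refl_def)
qed

lemma orb_sigma_iff: "\<sigma> \<kappa> \<in> orb \<iota> \<longleftrightarrow> \<kappa> \<in> orb \<iota>"
  using orb_eq_iff[of \<iota> \<kappa>] orb_eq_iff[of \<iota> "\<sigma> \<kappa>"] by simp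

lemma twist_orb_refl: "twist l (orb_refl \<iota> m) = orb_refl \<iota> (twist l m)"
proof (induction l)
  case (Suc l)
  have "twist 1 (orb_refl \<iota> k) = orb_refl \<iota> (twist 1 k)" for k
    by (simp add: twist_def orb_refl_def fun_eq_iff orb_sigma_iff of_coords_twist1[unfolded twist_def, simplified])
  then show ?case by (simp only: twist_Suc Suc.IH)
qed simp

lemma hat_orb_refl: "hat (orb_refl \<iota> m) = orb_refl \<iota> (hat m)"
proof
  fix \<kappa>
  have "hat (orb_refl \<iota> m) \<kappa> = (\<Sum>l<r. orb_refl \<iota> (twist l m) \<kappa>)" by (simp add: hat_def twist_orb_refl)
  also have "\<dots> = hat m \<kappa> - (if \<kappa> \<in> orb \<iota> then hat (of_coords m) \<kappa> else 0)"
    by (simp add: orb_refl_def sum_subtractf hat_def of_coords_twist)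
  finally show "hat (orb_refl \<iota> m) \<kappa> = orb_refl \<iota> (hat m) \<kappa>" by (simp add: orb_refl_def of_coords_hat)
qed

lemma height_orb_refl: "(\<Sum>\<kappa>\<in>UNIV. orb_refl \<iota> m \<kappa>) = (\<Sum>\<kappa>\<in>UNIV. m \<kappa>) - (\<Sum>\<kappa>\<in>orb \<iota>. of_coords m \<kappa>)"
  by (simp add: orb_refl_def sum_subtractf sum.If_cases)

text \<open>The roots reached by the folded Weyl group from simple ones. That these are all roots
  gives an induction over roots which respects the folding.\<close>

inductive_set orb_roots :: "('v \<Rightarrow> int) set" where
  unit: "unit \<iota> \<in> orb_roots"
| orb: "m \<in> orb_roots \<Longrightarrow> orb_refl \<iota> m \<in> orb_roots"

lemma orb_refl_unit: "orb_refl \<iota> (unit \<iota>) = - unit \<iota>"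
proof -
  have "of_coords (unit \<iota>) \<kappa> = 2 * of_bool (\<kappa> = \<iota>)" if "\<kappa> \<in> orb \<iota>" for \<kappa>
    using orb_not_adj[OF orb_self that] by (simp add: of_coords_unit simple_root_def)
  then show ?thesis using orb_self[of \<iota>] by (auto simp: orb_refl_def fun_eq_iff fund_weight_def)
qed

lemma orb_roots_uminus: "m \<in> orb_roots \<Longrightarrow> - m \<in> orb_roots"
proof (induction rule: orb_roots.induct)
  case (unit \<iota>)
  then show ?case using orb_roots.orb[OF orb_roots.unit, of \<iota> \<iota>] by (simp only: orb_refl_unit)
next
  case (orb m \<iota>)
  then show ?case using orb_roots.orb[OF orb(2), of \<iota>] by (simp only: orb_refl_uminus)
qed

lemma hat_pos: "(\<And>\<kappa>. 0 \<le> m \<kappa>) \<Longrightarrow> 0 \<le> hat m \<kappa>"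
  by (auto simp: hat_def twist_def intro: sum_nonneg)

lemma hat_eq_0:
  assumes "\<And>\<kappa>. 0 \<le> m \<kappa>" "hat m \<kappa> = 0"
  shows "m \<kappa> = 0"
proof -
  have "\<forall>l\<in>{..<r}. twist l m \<kappa> = 0"
    using assms unfolding hat_def by (subst (asm) sum_nonneg_eq_0_iff) (auto simp: twist_def)
  then have "twist 0 m \<kappa> = 0" using r_pos by blast
  then show ?thesis by simp
qed

text \<open>Descent on the height. Since \<open>hat m\<close> has positive norm, some orbit pairs
  positively with \<open>m\<close>, and reflecting in it lowers the height. If the result is
  negative, \<open>m\<close> lives on that orbit, whose vertices are pairwise non-adjacent, and norm
  2 makes it simple.\<close>

lemma pos_orb_roots: "m \<in> pos_coords \<Longrightarrow> m \<in> orb_roots"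
proof (induction "nat (\<Sum>\<kappa>\<in>UNIV. m \<kappa>)" arbitrary: m rule: less_induct)
  case less
  have m: "m \<in> root_coords" "\<And>\<kappa>. 0 \<le> m \<kappa>" using less.prems by (auto simp: pos_coords_def)
  have "hat m \<noteq> (\<lambda>_. 0)"
  proof
    assume z: "hat m = (\<lambda>_. 0)"
    have "m \<kappa> = 0" for \<kappa> by (rule hat_eq_0[OF m(2)]) (simp add: z)
    then show False using root_nonzero[OF m(1)] by auto
  qed
  then have "0 < form (hat m) (hat m)" by (rule form_pos)
  have "\<exists>\<iota>. 0 < of_coords (hat m) \<iota>"
  proof (rule ccontr)
    assume "\<nexists>\<iota>. 0 < of_coords (hat m) \<iota>"
    then have "form (hat m) (hat m) \<le> 0"
      unfolding pairing_def using hat_pos[OF m(2)] by (intro sum_nonpos mult_nonneg_nonpos) (auto simp: not_less)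
    then show False using \<open>0 < form (hat m) (hat m)\<close> by simp
  qed
  then obtain \<iota> where "0 < of_coords (hat m) \<iota>" by blast
  then have "0 < d \<iota> * hat (of_coords m) \<iota>" using d_pos[of \<iota>] by (simp add: of_coords_hat)
  then have pos: "0 < (\<Sum>\<kappa>\<in>orb \<iota>. of_coords m \<kappa>)"
    unfolding hat_eq_orbit_sum using r_pos by (simp add: zero_less_mult_iff)
  define n where "n = orb_refl \<iota> m"
  have nr: "n \<in> root_coords" unfolding n_def by (rule orb_refl_root[OF m(1)])
  from root_sign[OF nr] show ?case
  proof
    assume n0: "\<forall>\<kappa>. 0 \<le> n \<kappa>"
    then have "n \<in> pos_coords" using nr by (simp add: pos_coords_def)
    moreover have "nat (\<Sum>\<kappa>\<in>UNIV. n \<kappa>) < nat (\<Sum>\<kappa>\<in>UNIV. m \<kappa>)"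
      using pos n0 sum_nonneg[of UNIV n] unfolding n_def height_orb_refl by simp
    ultimately have "n \<in> orb_roots" using less.hyps by blast
    then have "orb_refl \<iota> n \<in> orb_roots" by (rule orb_roots.orb)
    then show ?thesis by (simp add: n_def orb_refl_invol)
  next
    assume n0: "\<forall>\<kappa>. n \<kappa> \<le> 0"
    have out: "m \<kappa> = 0" if "\<kappa> \<notin> orb \<iota>" for \<kappa>
    proof -
      have "n \<kappa> = m \<kappa>" using that by (simp add: n_def orb_refl_def)
      then show ?thesis using n0 m(2) by (metis antisym)
    qed
    have "form m m = (\<Sum>\<kappa>\<in>UNIV. 2 * (m \<kappa>)\<^sup>2)"
      unfolding pairing_def
    proof (rule sum.cong[OF refl])
      fix \<kappa>
      show "m \<kappa> * of_coords m \<kappa> = 2 * (m \<kappa>)\<^sup>2"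
      proof (cases "\<kappa> \<in> orb \<iota>")
        case True
        have "(\<Sum>\<mu> | adj \<kappa> \<mu>. m \<mu>) = 0" using out orb_not_adj[OF True] by (intro sum.neutral) auto
        then show ?thesis by (simp add: of_coords_apply power2_eq_square)
      qed (simp add: out)
    qed
    then have s: "(\<Sum>\<kappa>\<in>UNIV. (m \<kappa>)\<^sup>2) = 1" using root_norm[OF m(1)] by (simp flip: sum_distrib_left)
    obtain \<mu> where \<mu>: "m \<mu> \<noteq> 0" using root_nonzero[OF m(1)] by auto
    have e: "(m \<mu>)\<^sup>2 + (\<Sum>\<kappa>\<in>UNIV - {\<mu>}. (m \<kappa>)\<^sup>2) = 1" using s by (simp add: sum.remove[of UNIV \<mu>])
    have ge: "0 \<le> (\<Sum>\<kappa>\<in>UNIV - {\<mu>}. (m \<kappa>)\<^sup>2)" by (intro sum_nonneg) simp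
    have "0 < (m \<mu>)\<^sup>2" using \<mu> by simp
    then have "(m \<mu>)\<^sup>2 = 1" "(\<Sum>\<kappa>\<in>UNIV - {\<mu>}. (m \<kappa>)\<^sup>2) = 0" using e ge by linarith+
    then have "m \<mu> = 1" "\<And>\<kappa>. \<kappa> \<noteq> \<mu> \<Longrightarrow> m \<kappa> = 0"
      using m(2)[of \<mu>] by (auto simp: power2_eq_1_iff sum_nonneg_eq_0_iff)
    then have "m = unit \<mu>" by (auto simp: fund_weight_def fun_eq_iff)
    then show ?thesis by (simp add: orb_roots.unit)
  qed
qed

lemma orb_roots_eq: "orb_roots = root_coords"
proof
  show "orb_roots \<subseteq> root_coords"
  proof
    fix m assume "m \<in> orb_roots"
    then show "m \<in> root_coords" by induction (auto intro: unit_in_root_coords orb_refl_root)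
  qed
  show "root_coords \<subseteq> orb_roots"
  proof
    fix m assume m: "m \<in> root_coords"
    from root_sign[OF m] show "m \<in> orb_roots"
    proof
      assume "\<forall>\<kappa>. m \<kappa> \<le> 0"
      then have "- m \<in> pos_coords" using uminus_in_root_coords[OF m] by (simp add: pos_coords_def)
      then show ?thesis using orb_roots_uminus[OF pos_orb_roots] by fastforce
    qed (use m pos_orb_roots in \<open>auto simp: pos_coords_def\<close>)
  qed
qed

subsection \<open>Long and short roots\<close>

text \<open>The squared length of the corresponding root of the folded system, normalised to 1 on
  short roots if there are two lengths: it is \<open>d \<iota>\<close> on
  \<open>unit \<iota>\<close>. By \<open>weightn_form_hat\<close> it is inverse to
  \<open>form m (hat m)\<close> up to the factor \<open>2 * r\<close>.\<close>

definition weightn :: "('v \<Rightarrow> int) \<Rightarrow> int" where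
  "weightn m = (if twist 1 m = m then 1 else int r)"

lemma weightn_pos: "0 < weightn m"
  using r_pos by (simp add: weightn_def)

lemma twist_fixed: "twist 1 m = m \<Longrightarrow> twist l m = m"
  by (induction l) (simp_all only: twist_0 twist_Suc)

lemma weightn_orb_refl: "weightn (orb_refl \<iota> m) = weightn m"
proof -
  have "twist 1 (orb_refl \<iota> m) = orb_refl \<iota> m \<longleftrightarrow> twist 1 m = m"
    unfolding twist_orb_refl by (metis orb_refl_invol)
  then show ?thesis by (simp add: weightn_def)
qed

lemma weightn_unit: "weightn (unit \<iota>) = d \<iota>"
proof -
  have "twist 1 (unit \<iota>) = unit \<iota> \<longleftrightarrow> \<sigma> \<iota> = \<iota>"
  proof
    assume "twist 1 (unit \<iota>) = unit \<iota>"
    then have "twist 1 (unit \<iota>) \<iota> = unit \<iota> \<iota>" by simp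
    then show "\<sigma> \<iota> = \<iota>" by (simp add: twist_def fund_weight_def split: if_splits)
  next
    assume "\<sigma> \<iota> = \<iota>"
    then have "\<sigma> \<kappa> = \<iota> \<longleftrightarrow> \<kappa> = \<iota>" for \<kappa> by (metis sigma_inj)
    then show "twist 1 (unit \<iota>) = unit \<iota>" by (simp add: twist_def fund_weight_def)
  qed
  then show ?thesis by (simp add: weightn_def d_eq)
qed

lemma weightn_form_hat: "m \<in> root_coords \<Longrightarrow> weightn m * form m (hat m) = 2 * int r"
  unfolding orb_roots_eq[symmetric]
proof (induction rule: orb_roots.induct)
  case (unit \<iota>)
  have "d \<iota> * form (unit \<iota>) (hat (unit \<iota>)) = d \<iota> * hat (of_coords (unit \<iota>)) \<iota>"
    by (simp add: pairing_unit of_coords_hat)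
  also have "\<dots> = int r * (\<Sum>\<kappa>\<in>orb \<iota>. of_coords (unit \<iota>) \<kappa>)" by (rule hat_eq_orbit_sum)
  also have "(\<Sum>\<kappa>\<in>orb \<iota>. of_coords (unit \<iota>) \<kappa>) = (\<Sum>\<kappa>\<in>orb \<iota>. if \<kappa> = \<iota> then 2 else 0)"
    using orb_not_adj[OF orb_self] by (intro sum.cong) (auto simp: of_coords_unit simple_root_def)
  also have "\<dots> = 2" using orb_self by simp
  finally have "d \<iota> * form (unit \<iota>) (hat (unit \<iota>)) = 2 * int r" by simp
  then show ?case by (simp add: weightn_unit)
next
  case (orb m \<iota>)
  then show ?case by (simp add: weightn_orb_refl hat_orb_refl form_orb_refl)
qed

section \<open>Dominant vectors and domination between roots\<close>

definition dominant :: "('v \<Rightarrow> int) \<Rightarrow> bool" where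
  "dominant x \<longleftrightarrow> (\<forall>\<kappa>. 0 \<le> of_coords x \<kappa>)"

text \<open>The negative part \<open>n\<close> pairs nonnegatively with \<open>x\<close>, but this
  pairing is at most \<open>- form n n\<close>; so \<open>n = 0\<close>. A zero coefficient would
  then spread to all neighbours.\<close>

lemma dominant_pos:
  assumes "dominant x" "x \<noteq> (\<lambda>_. 0)"
  shows "0 < x \<kappa>"
proof -
  define p where "p = (\<lambda>\<kappa>. max (x \<kappa>) 0)"
  define n where "n = (\<lambda>\<kappa>. max (- x \<kappa>) 0)"
  have x: "x = (\<lambda>\<kappa>. p \<kappa> - n \<kappa>)" by (auto simp: p_def n_def)
  have "0 \<le> form n x"
    unfolding pairing_def using assms(1) by (intro sum_nonneg) (auto simp: n_def dominant_def)
  also have "form n x = form n p - form n n"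
    by (subst x) (simp add: of_coords_diff pairing_diff_right)
  also have "form n p \<le> 0" by (rule form_nonpos_of_disjoint) (auto simp: p_def n_def)
  finally have "form n n \<le> 0" by simp
  then have "n = (\<lambda>_. 0)" using form_pos[of n] by fastforce
  then have nn: "0 \<le> x \<kappa>" for \<kappa> by (metis max.cobounded1 n_def neg_le_0_iff_le)
  have "x \<kappa> \<noteq> 0"
  proof
    assume "x \<kappa> = 0"
    have "x \<mu> = 0" for \<mu>
    proof (rule adj_connected[of "\<lambda>\<mu>. x \<mu> = 0", OF _ \<open>x \<kappa> = 0\<close>])
      fix \<mu> \<nu> assume a: "adj \<mu> \<nu>" "x \<mu> = 0"
      have "0 \<le> of_coords x \<mu>" using assms(1) by (simp add: dominant_def)
      then have "(\<Sum>\<kappa> | adj \<mu> \<kappa>. x \<kappa>) \<le> 0" using a(2) by (simp add: of_coords_apply)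
      moreover have "x \<nu> \<le> (\<Sum>\<kappa> | adj \<mu> \<kappa>. x \<kappa>)" using a(1) nn by (intro member_le_sum) auto
      ultimately show "x \<nu> = 0" using nn[of \<nu>] by simp
    qed
    then show False using assms(2) by auto
  qed
  then show ?thesis using nn[of \<kappa>] by simp
qed

lemma form_le_1:
  assumes "m \<in> root_coords" "k \<in> root_coords" "m \<noteq> k"
  shows "form m k \<le> 1"
proof -
  have "(\<lambda>\<kappa>. m \<kappa> - k \<kappa>) \<noteq> (\<lambda>_. 0)" using assms(3) by (auto simp: fun_eq_iff)
  then have "0 < form (\<lambda>\<kappa>. m \<kappa> - k \<kappa>) (\<lambda>\<kappa>. m \<kappa> - k \<kappa>)" by (rule form_pos)
  also have "\<dots> = 4 - 2 * form m k"
    using root_norm[OF assms(1)] root_norm[OF assms(2)] form_sym[of m k]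
    by (simp add: of_coords_diff pairing_diff_left pairing_diff_right)
  finally show ?thesis by simp
qed

lemma root_refl:
  assumes "m \<in> root_coords" "k \<in> root_coords"
  shows "(\<lambda>\<kappa>. m \<kappa> - form m k * k \<kappa>) \<in> root_coords"
proof -
  obtain "is" \<iota> where k: "k = coord_word is (unit \<iota>)" using assms(2) unfolding root_coords_def by blast
  define n where "n = coord_word (rev is) m"
  have m: "m = coord_word is n" by (simp add: n_def)
  have "form m k = form n (unit \<iota>)" unfolding m k by (rule form_coord_word)
  also have "\<dots> = of_coords n \<iota>" using form_sym[of n "unit \<iota>"] by (simp add: pairing_unit)
  finally have "(\<lambda>\<kappa>. m \<kappa> - form m k * k \<kappa>) = coord_word is (coord_refl \<iota> n)"
    unfolding coord_refl_def using coord_word_linear[of "is" 1 n "- of_coords n \<iota>" "unit \<iota>"]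
    by (simp add: m[symmetric] k[symmetric])
  moreover have "coord_word is (coord_refl \<iota> n) \<in> root_coords"
    unfolding n_def by (intro coord_word_in_root_coords coord_refl_in_root_coords assms(1))
  ultimately show ?thesis by simp
qed

definition height_of :: "('v \<Rightarrow> int) \<Rightarrow> int" where
  "height_of m = (\<Sum>\<kappa>\<in>UNIV. m \<kappa>)"

lemma sum_hat: "(\<Sum>\<kappa>\<in>UNIV. hat m \<kappa>) = int r * height_of m"
proof -
  have "(\<Sum>\<kappa>\<in>UNIV. twist l m \<kappa>) = height_of m" for l
  proof (induction l)
    case (Suc l)
    have "(\<Sum>\<kappa>\<in>UNIV. twist 1 (twist l m) \<kappa>) = (\<Sum>\<kappa>\<in>UNIV. twist l m \<kappa>)"
      using sum_sigma[of "twist l m"] by (simp add: twist_def)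
    then show ?case by (simp only: twist_Suc Suc.IH)
  qed (simp add: height_of_def)
  then show ?thesis unfolding hat_def by (subst sum.swap) simp
qed

text \<open>Maximise the height among the candidates. Reflecting in an orbit on which the pairing is
  negative would increase the height as well as \<open>hat\<close>.\<close>

lemma ex_dominating:
  assumes "m \<in> root_coords"
  shows "\<exists>k\<in>root_coords. weightn k = weightn m \<and> dominant (hat k) \<and> (\<forall>\<kappa>. hat m \<kappa> \<le> hat k \<kappa>) \<and> height_of m \<le> height_of k"
proof -
  define A where "A = {k \<in> root_coords. weightn k = weightn m \<and> (\<forall>\<kappa>. hat m \<kappa> \<le> hat k \<kappa>)}"
  have fin: "finite A" using finite_root_coords by (simp add: A_def)
  have mA: "m \<in> A" using assms by (simp add: A_def)
  have "Max (height_of ` A) \<in> height_of ` A" using fin mA by (intro Max_in) auto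
  then obtain k where k: "k \<in> A" "Max (height_of ` A) = height_of k" by auto
  have le: "height_of n \<le> height_of k" if "n \<in> A" for n
    using Max_ge[of "height_of ` A" "height_of n"] fin that k(2) by simp
  have "dominant (hat k)"
  proof (rule ccontr)
    assume "\<not> dominant (hat k)"
    then obtain \<iota> where neg: "hat (of_coords k) \<iota> < 0" by (auto simp: dominant_def of_coords_hat not_le)
    have "d \<iota> * hat (of_coords k) \<iota> < 0" using neg d_pos[of \<iota>] by (simp add: mult_pos_neg)
    then have s: "(\<Sum>\<kappa>\<in>orb \<iota>. of_coords k \<kappa>) < 0" unfolding hat_eq_orbit_sum using r_pos by (simp add: mult_less_0_iff)
    have "hat k \<kappa> \<le> hat (orb_refl \<iota> k) \<kappa>" for \<kappa>
      unfolding hat_orb_refl using hat_orb[of \<kappa> \<iota> "of_coords k"] neg by (auto simp: orb_refl_def[of _ "hat k"] of_coords_hat)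
    then have "orb_refl \<iota> k \<in> A"
      using k(1) orb_refl_root[of k \<iota>] unfolding A_def by (auto simp: weightn_orb_refl intro: order_trans)
    then have "height_of (orb_refl \<iota> k) \<le> height_of k" by (rule le)
    then show False using s unfolding height_of_def height_orb_refl by simp
  qed
  then show ?thesis using k(1) le[OF mA] by (auto simp: A_def)
qed


subsection \<open>The dominant root of the larger length\<close>

text \<open>A lift of the highest root of the folded system, which is long there.\<close>

definition theta :: "'v \<Rightarrow> int" where
  "theta = (SOME k. k \<in> root_coords \<and> weightn k = int r \<and> dominant (hat k))"

lemma theta: "theta \<in> root_coords" "weightn theta = int r" "dominant (hat theta)"
proof -
  obtain \<iota> where i: "d \<iota> = int r" using ex_d_eq_r by auto
  have "\<exists>k. k \<in> root_coords \<and> weightn k = int r \<and> dominant (hat k)"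
    using ex_dominating[OF unit_in_root_coords[of \<iota>]] i by (auto simp: weightn_unit)
  then have "theta \<in> root_coords \<and> weightn theta = int r \<and> dominant (hat theta)"
    unfolding theta_def by (rule someI_ex)
  then show "theta \<in> root_coords" "weightn theta = int r" "dominant (hat theta)" by auto
qed

lemma hat_root_nonzero:
  assumes "m \<in> root_coords"
  shows "hat m \<noteq> (\<lambda>_. 0)"
proof
  assume "hat m = (\<lambda>_. 0)"
  then have "form m (hat m) = 0" by (simp add: pairing_def of_coords_def)
  then show False using weightn_form_hat[OF assms] r_pos by simp
qed

lemma hat_theta_pos: "0 < hat theta \<kappa>"
  using dominant_pos[OF theta(3) hat_root_nonzero[OF theta(1)]] .

lemma pos_hat_imp_pos:
  assumes "m \<in> root_coords" "0 < hat m \<kappa>"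
  shows "m \<in> pos_coords"
proof -
  have "\<not> (\<forall>\<mu>. m \<mu> \<le> 0)"
  proof
    assume "\<forall>\<mu>. m \<mu> \<le> 0"
    then have "hat m \<kappa> \<le> 0" unfolding hat_def by (intro sum_nonpos) (simp add: twist_def)
    then show False using assms(2) by simp
  qed
  then show ?thesis using root_sign[OF assms(1)] assms(1) by (auto simp: pos_coords_def)
qed

lemma form_theta_hat: "form theta (hat theta) = 2"
  using weightn_form_hat[OF theta(1)] theta(2) r_pos by simp

lemma form_hat_theta: "form (hat theta) (hat theta) = 2 * int r"
  by (simp add: form_hat_hat form_theta_hat)

lemma twist_hat: "twist l (hat k) = hat k"
  by (simp add: twist_def fun_eq_iff)

lemma form_twist_theta_hat: "form (twist l theta) (hat theta) = 2"
  using form_twist[of l theta "hat theta"] by (simp add: twist_hat form_theta_hat)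

lemma twist_twist: "twist a (twist b m) = twist (a + b) m"
  by (simp add: twist_def fun_eq_iff funpow_add add.commute[of a b])

lemma twist_r: "twist r m = m"
  by (simp add: twist_def)

text \<open>The products of \<open>theta\<close> with its \<open>r\<close> twists sum to 2, and
  \<open>theta\<close> itself already contributes 2. For \<open>r = 3\<close> the two remaining
  products are equal by invariance, so both vanish.\<close>

lemma theta_orthogonal0:
  assumes "0 < l" "l < r"
  shows "form theta (twist l theta) = 0"
proof -
  have e: "(\<Sum>l<r. form theta (twist l theta)) = 2" using form_theta_hat by (simp add: form_hat)
  have s: "form theta theta = 2" by (rule root_norm[OF theta(1)])
  from r_cases show ?thesis
  proof (elim disjE)
    assume "r = 2"
    then show ?thesis using e s assms by (simp add: numeral_2_eq_2 less_Suc_eq)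
  next
    assume r: "r = 3"
    have "form (twist 1 theta) (twist 1 (twist 2 theta)) = form theta (twist 2 theta)" by (rule form_twist)
    then have "form theta (twist 2 theta) = form (twist 1 theta) theta"
      using twist_r[of theta] r by (simp add: twist_twist numeral_3_eq_3)
    then have "form theta (twist 2 theta) = form theta (twist 1 theta)" using form_sym[of theta "twist 1 theta"] by simp
    moreover have "{..<3::nat} = {0, 1, 2}" by auto
    ultimately show ?thesis using e s assms r by (auto simp: less_Suc_eq numeral_3_eq_3 numeral_2_eq_2)
  qed (use assms in simp)
qed

lemma theta_orthogonal:
  assumes "a < r" "b < r" "a \<noteq> b"
  shows "form (twist a theta) (twist b theta) = 0"
proof -
  have *: "form (twist a theta) (twist b theta) = 0" if "a < b" "b < r" for a b
  proof -
    have "form (twist a theta) (twist a (twist (b - a) theta)) = 0"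
      unfolding form_twist using theta_orthogonal0[of "b - a"] that by simp
    then show ?thesis using that by (simp add: twist_twist)
  qed
  show ?thesis using *[of a b] *[of b a] assms form_sym[of "twist a theta" "twist b theta"] by (cases a b rule: linorder_cases) auto
qed

lemma form_twist_theta_self: "form (twist a theta) (twist a theta) = 2"
  by (rule root_norm[OF twist_root[OF theta(1)]])

text \<open>For \<open>n \<le> r\<close> the product of the reflections in the first
  \<open>n\<close> twists of \<open>theta\<close>, which are orthogonal. At \<open>n = r\<close> it
  covers the reflection in the highest root; the other values of \<open>n\<close> serve the
  induction.\<close>

definition theta_refl :: "nat \<Rightarrow> ('v \<Rightarrow> int) \<Rightarrow> 'v \<Rightarrow> int" where
  "theta_refl n m = (\<lambda>\<kappa>. m \<kappa> - (\<Sum>l<n. form m (twist l theta) * twist l theta \<kappa>))"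

lemma form_theta_refl: "form (theta_refl n m) k = form m k - (\<Sum>l<n. form m (twist l theta) * form (twist l theta) k)"
  unfolding theta_refl_def pairing_diff_left pairing_sum_left pairing_scale_left ..

lemma theta_refl_root: "m \<in> root_coords \<Longrightarrow> n \<le> r \<Longrightarrow> theta_refl n m \<in> root_coords"
proof (induction n)
  case (Suc n)
  have "form (theta_refl n m) (twist n theta) = form m (twist n theta)"
    unfolding form_theta_refl using Suc.prems by (simp add: theta_orthogonal)
  then have "theta_refl (Suc n) m = (\<lambda>\<kappa>. theta_refl n m \<kappa> - form (theta_refl n m) (twist n theta) * twist n theta \<kappa>)"
    by (simp add: theta_refl_def fun_eq_iff)
  then show ?case using root_refl[OF Suc.IH twist_root[OF theta(1)], of n] Suc.prems by simp
qed (simp add: theta_refl_def)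

lemma hat_sum_scale: "hat (\<lambda>\<kappa>. m \<kappa> - (\<Sum>l\<in>A. c l * f l \<kappa>)) \<kappa> = hat m \<kappa> - (\<Sum>l\<in>A. c l * hat (f l) \<kappa>)"
  unfolding hat_def twist_def sum_subtractf sum_distrib_left by (subst sum.swap) simp

lemma hat_theta_refl: "hat (theta_refl r m) \<kappa> = hat m \<kappa> - form m (hat theta) * hat theta \<kappa>"
  unfolding theta_refl_def hat_sum_scale hat_twist form_hat[of _ theta] by (simp add: sum_distrib_right)

lemma form_theta_refl_hat: "form (theta_refl r m) (hat theta) = - form m (hat theta)"
  unfolding form_theta_refl form_twist_theta_hat form_hat[of m theta] by (simp add: sum_distrib_right[symmetric])

text \<open>Cauchy-Schwarz with its case of equality: the two projections have equal norm, and the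
  norm of their difference is \<open>2 * r * (2 - form m (hat theta))\<close>.\<close>

lemma theta_form_bound:
  assumes "m \<in> root_coords" "weightn m = int r"
  shows "form m (hat theta) \<le> 2" "form m (hat theta) = 2 \<longleftrightarrow> hat m = hat theta"
proof -
  let ?x = "\<lambda>\<kappa>. hat m \<kappa> - hat theta \<kappa>"
  have "form m (hat m) = 2" using weightn_form_hat[OF assms(1)] assms(2) r_pos by simp
  then have q: "form ?x ?x = 2 * int r * (2 - form m (hat theta))"
    using form_sym[of "hat m" "hat theta"]
    by (simp add: of_coords_diff pairing_diff_left pairing_diff_right form_hat_hat form_theta_hat algebra_simps)
  show le: "form m (hat theta) \<le> 2"
  proof (cases "?x = (\<lambda>_. 0)")
    case True
    then have "hat m = hat theta" by (auto simp: fun_eq_iff)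
    then show ?thesis using \<open>form m (hat m) = 2\<close> by simp
  next
    case False
    then have "0 < form ?x ?x" by (rule form_pos)
    then show ?thesis unfolding q using r_pos by (simp add: zero_less_mult_iff)
  qed
  show "form m (hat theta) = 2 \<longleftrightarrow> hat m = hat theta"
  proof
    assume "form m (hat theta) = 2"
    then have "form ?x ?x = 0" by (simp add: q)
    then have "?x = (\<lambda>_. 0)" using form_pos[of ?x] by fastforce
    then show "hat m = hat theta" by (auto simp: fun_eq_iff)
  next
    assume "hat m = hat theta"
    then show "form m (hat theta) = 2" using \<open>form m (hat m) = 2\<close> by simp
  qed
qed

lemma weightn_cases: "weightn m = int r \<or> weightn m = 1 \<and> 1 < r \<and> twist 1 m = m"
  using r_pos by (auto simp: weightn_def)

lemma fixed_form:
  assumes "m \<in> root_coords" "weightn m \<noteq> int r"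
  shows "form m (hat theta) = int r * form m theta" "form m theta \<le> 1"
proof -
  have f: "twist 1 m = m" using weightn_cases[of m] assms(2) by auto
  have "form m (twist l theta) = form m theta" for l
    using form_twist[of l m theta] twist_fixed[OF f, of l] by simp
  then show "form m (hat theta) = int r * form m theta" by (simp add: form_hat)
  show "form m theta \<le> 1" using assms theta by (intro form_le_1) auto
qed

text \<open>Replace \<open>n\<close> by a dominating root \<open>m\<close> with dominant
  \<open>hat m\<close>; then \<open>a = form m (hat theta)\<close> is positive. The reflection of
  \<open>m\<close> in \<open>theta\<close> pairs negatively with the dominant
  \<open>hat theta\<close>, so it is a negative root, which says that \<open>hat m\<close> is at
  most \<open>a\<close> times \<open>hat theta\<close>. It remains to bound \<open>a\<close>: by 1
  for a long root unless the two projections agree, by \<open>r\<close> for a short one.\<close>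

lemma hat_theta_dominates:
  assumes "n \<in> root_coords"
  shows "weightn n * hat n \<kappa> \<le> int r * hat theta \<kappa>"
proof -
  obtain m where m: "m \<in> root_coords" "weightn m = weightn n" "dominant (hat m)" "hat n \<kappa> \<le> hat m \<kappa>"
    using ex_dominating[OF assms] by auto
  define a where "a = form m (hat theta)"
  have mm: "hat m \<noteq> (\<lambda>_. 0)" by (rule hat_root_nonzero[OF m(1)])
  have "int r * a = form (hat theta) (hat m)" unfolding a_def using form_sym[of "hat m" "hat theta"] by (simp add: form_hat_hat)
  also have "\<dots> > 0"
  proof -
    have ge: "0 \<le> hat theta \<mu> * of_coords (hat m) \<mu>" for \<mu>
      using hat_theta_pos[of \<mu>] m(3) by (simp add: dominant_def)
    have "form (hat theta) (hat m) \<noteq> 0"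
    proof
      assume "form (hat theta) (hat m) = 0"
      then have "\<forall>\<mu>\<in>UNIV. hat theta \<mu> * of_coords (hat m) \<mu> = 0"
        unfolding pairing_def by (subst (asm) sum_nonneg_eq_0_iff) (auto simp: ge)
      then have "of_coords (hat m) \<mu> = 0" for \<mu> using hat_theta_pos[of \<mu>] by (metis UNIV_I less_irrefl mult_eq_0_iff)
      then have "form (hat m) (hat m) = 0" by (simp add: pairing_def)
      then show False using form_pos[OF mm] by simp
    qed
    moreover have "0 \<le> form (hat theta) (hat m)" unfolding pairing_def by (intro sum_nonneg ge)
    ultimately show ?thesis by simp
  qed
  finally have a: "0 < a" using r_pos by (simp add: zero_less_mult_iff)
  have k: "theta_refl r m \<in> root_coords" using theta_refl_root[OF m(1)] by simp
  have "\<not> (\<forall>\<mu>. 0 \<le> theta_refl r m \<mu>)"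
  proof
    assume "\<forall>\<mu>. 0 \<le> theta_refl r m \<mu>"
    then have "0 \<le> form (theta_refl r m) (hat theta)"
      unfolding pairing_def using theta(3) by (intro sum_nonneg mult_nonneg_nonneg) (auto simp: dominant_def)
    then show False using a by (simp add: form_theta_refl_hat a_def)
  qed
  then have "\<forall>\<mu>. theta_refl r m \<mu> \<le> 0" using root_sign[OF k] by blast
  then have "hat (theta_refl r m) \<kappa> \<le> 0" unfolding hat_def by (intro sum_nonpos) (simp add: twist_def)
  then have le: "hat m \<kappa> \<le> a * hat theta \<kappa>" by (simp add: hat_theta_refl a_def)
  have main: "weightn m * hat m \<kappa> \<le> int r * hat theta \<kappa>"
  proof (cases "weightn m = int r")
    case True
    have "a \<le> 2" "a = 2 \<longleftrightarrow> hat m = hat theta" unfolding a_def by (rule theta_form_bound[OF m(1) True])+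
    moreover have "a = 1 \<or> a = 2" using a \<open>a \<le> 2\<close> by linarith
    ultimately have "hat m \<kappa> \<le> hat theta \<kappa>" using le by auto
    then show ?thesis using True by (simp add: mult_left_mono)
  next
    case False
    have "a = int r * form m theta" "form m theta \<le> 1" unfolding a_def by (rule fixed_form[OF m(1) False])+
    then have "a \<le> int r" using mult_left_mono[of "form m theta" 1 "int r"] by simp
    then have "a * hat theta \<kappa> \<le> int r * hat theta \<kappa>" using hat_theta_pos[of \<kappa>] by (intro mult_right_mono) auto
    then show ?thesis using le weightn_cases[of m] False by simp
  qed
  have "weightn n * hat n \<kappa> \<le> weightn n * hat m \<kappa>" using m(4) weightn_pos[of n] by (intro mult_left_mono) auto
  then show ?thesis using main m(2) by simp
qed

subsection \<open>Roots of the folded Cartan matrix\<close>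

lemma int_card_orb: "int (card (orb \<iota>)) = d \<iota>"
  by (simp add: d_def)

lemma orb_adj_orb: "orb_adj (orb \<kappa>) (orb \<iota>) \<longleftrightarrow> (\<exists>\<mu>\<in>orb \<iota>. adj \<mu> \<kappa>)"
proof
  assume "orb_adj (orb \<kappa>) (orb \<iota>)"
  then obtain k \<mu> where k: "k \<in> orb \<kappa>" "\<mu> \<in> orb \<iota>" "adj k \<mu>" by (auto simp: orb_adj_def)
  have "\<kappa> \<in> orb k" using k(1) orb_eq_iff[of \<kappa> k] orb_self[of \<kappa>] by simp
  then obtain l where "\<kappa> = (\<sigma> ^^ l) k" by (auto simp: orb_eq)
  then have "adj ((\<sigma> ^^ l) \<mu>) \<kappa>" using k(3) by (simp add: adj_sigma_pow adj_sym)
  moreover have "(\<sigma> ^^ l) \<mu> \<in> orb \<iota>" using k(2) orb_eq_iff[of \<iota> \<mu>] orb_eq_iff[of \<iota> "(\<sigma> ^^ l) \<mu>"] by simp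
  ultimately show "\<exists>\<mu>\<in>orb \<iota>. adj \<mu> \<kappa>" by blast
next
  assume "\<exists>\<mu>\<in>orb \<iota>. adj \<mu> \<kappa>"
  then obtain \<mu> where "\<mu> \<in> orb \<iota>" "adj \<kappa> \<mu>" using adj_sym by blast
  then show "orb_adj (orb \<kappa>) (orb \<iota>)" using orb_self[of \<kappa>] unfolding orb_adj_def by blast
qed

text \<open>For two orbits of size \<open>r\<close> the uniqueness of the neighbour comes from the
  rows: those of \<open>\<mu>\<close> and \<open>(\<sigma> ^^ l) \<mu>\<close> differ by
  \<open>2 * l\<close>, while adjacency to \<open>\<kappa>\<close> fixes times modulo
  \<open>2 * r\<close>.\<close>

lemma card_adj_orb:
  assumes "\<mu> \<in> orb \<iota>" "adj \<mu> \<kappa>"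
  shows "int (card {\<nu> \<in> orb \<iota>. adj \<nu> \<kappa>}) = (if d \<kappa> < d \<iota> then d \<iota> else 1)"
proof (cases "\<sigma> \<iota> = \<iota>")
  case True
  then have "orb \<iota> = {\<iota>}" using r_pos by (auto simp: orb_eq sigma_pow_fixed)
  then have "{\<nu> \<in> orb \<iota>. adj \<nu> \<kappa>} = {\<iota>}" using assms by auto
  moreover have "d \<iota> = 1" using True by (simp add: d_eq)
  ultimately show ?thesis by simp
next
  case i: False
  show ?thesis
  proof (cases "\<sigma> \<kappa> = \<kappa>")
    case True
    have "adj \<nu> \<kappa>" if "\<nu> \<in> orb \<iota>" for \<nu>
    proof -
      have "\<nu> \<in> orb \<mu>" using that assms(1) orb_eq_iff[of \<iota> \<mu>] by simp
      then obtain l where "\<nu> = (\<sigma> ^^ l) \<mu>" by (auto simp: orb_eq)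
      then show ?thesis using adj_sigma_pow[of l \<mu> \<kappa>] assms(2) sigma_pow_fixed[OF True, of l] by simp
    qed
    then have "{\<nu> \<in> orb \<iota>. adj \<nu> \<kappa>} = orb \<iota>" by auto
    moreover have "r \<noteq> 1" using i sigma_order_cases by auto
    ultimately show ?thesis using True i r_pos by (auto simp: int_card_orb d_eq)
  next
    case False
    have dk: "d \<kappa> = int r" and di: "d \<iota> = int r" using False i by (simp_all add: d_eq)
    have "\<nu> = \<mu>" if n: "\<nu> \<in> orb \<iota>" "adj \<nu> \<kappa>" for \<nu>
    proof -
      have "\<nu> \<in> orb \<mu>" using n(1) assms(1) orb_eq_iff[of \<iota> \<mu>] by simp
      then obtain l where l: "l < r" "\<nu> = (\<sigma> ^^ l) \<mu>" by (auto simp: orb_eq)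
      have dm: "d \<mu> = int r" using assms(1) di orb_eq_iff[of \<iota> \<mu>] by (simp add: d_def)
      have dn: "d \<nu> = int r" using dm l by simp
      have rk: "in_row \<kappa> (\<xi> \<kappa>)" "in_row \<mu> (\<xi> \<mu>)" by (rule in_row_height)+
      then have rn: "in_row \<nu> (\<xi> \<mu> - 2 * int l)" unfolding l(2) by (simp only: in_row_sigma_pow)
      have "2 * int r dvd \<xi> \<mu> - \<xi> \<kappa> - int r" using adj_rows[OF assms(2) rk(2,1)] by (simp add: dmin_def dm dk)
      moreover have "2 * int r dvd \<xi> \<mu> - 2 * int l - \<xi> \<kappa> - int r"
        using adj_rows[OF n(2) rn rk(1)] by (simp add: dmin_def dn dk)
      ultimately have "2 * int r dvd (\<xi> \<mu> - \<xi> \<kappa> - int r) - (\<xi> \<mu> - 2 * int l - \<xi> \<kappa> - int r)" by (rule dvd_diff)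
      then have "int r dvd int l" by simp
      then have "l = 0" using l(1) by (metis nat_dvd_not_less neq0_conv of_nat_dvd_iff)
      then show ?thesis using l(2) by simp
    qed
    have "{\<nu> \<in> orb \<iota>. adj \<nu> \<kappa>} = {\<mu>}"
    proof (rule equalityI)
      show "{\<nu> \<in> orb \<iota>. adj \<nu> \<kappa>} \<subseteq> {\<mu>}" using \<open>\<And>\<nu>. \<nu> \<in> orb \<iota> \<Longrightarrow> adj \<nu> \<kappa> \<Longrightarrow> \<nu> = \<mu>\<close> by blast
    qed (use assms in simp)
    then show ?thesis using dk di by simp
  qed
qed

lemma cartan_orb: "cartan (orb \<kappa>) (orb \<iota>) = 2 * of_bool (\<kappa> \<in> orb \<iota>) - int (card {\<nu> \<in> orb \<iota>. adj \<nu> \<kappa>})"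
proof (cases "\<kappa> \<in> orb \<iota>")
  case True
  then have "{\<nu> \<in> orb \<iota>. adj \<nu> \<kappa>} = {}" using orb_not_adj by auto
  moreover have "orb \<kappa> = orb \<iota>" using True orb_eq_iff by metis
  ultimately show ?thesis using True by (simp add: cartan_def)
next
  case False
  then have ne: "orb \<kappa> \<noteq> orb \<iota>" using orb_eq_iff by metis
  show ?thesis
  proof (cases "\<exists>\<mu>\<in>orb \<iota>. adj \<mu> \<kappa>")
    case True
    then obtain \<mu> where m: "\<mu> \<in> orb \<iota>" "adj \<mu> \<kappa>" by blast
    have "\<lceil>real (card (orb \<iota>)) / real (card (orb \<kappa>))\<rceil> = (if d \<kappa> < d \<iota> then d \<iota> else 1)"
    proof -
      have c: "real (card (orb \<iota>)) = real_of_int (d \<iota>)" "real (card (orb \<kappa>)) = real_of_int (d \<kappa>)" by (simp_all add: d_def)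
      show ?thesis
      proof (cases "d \<kappa> < d \<iota>")
        case True
        then have "d \<kappa> = 1" using d_le_r[of \<iota>] by (auto simp: d_eq[of \<kappa>] split: if_splits)
        then show ?thesis using True by (simp add: c)
      next
        case False
        then have "\<lceil>real_of_int (d \<iota>) / real_of_int (d \<kappa>)\<rceil> = 1"
          using d_pos[of \<iota>] d_pos[of \<kappa>] by (intro ceiling_unique) (simp_all add: divide_simps)
        then show ?thesis using False by (simp add: c)
      qed
    qed
    then show ?thesis using False ne True card_adj_orb[OF m] by (simp add: cartan_def orb_adj_orb)
  next
    case none: False
    then have "{\<nu> \<in> orb \<iota>. adj \<nu> \<kappa>} = {}" by auto
    then show ?thesis using False none ne by (simp add: cartan_def orb_adj_orb)
  qed
qed

lemma cartan_symmetrizable: "d \<iota> * cartan (orb \<iota>) (orb \<kappa>) = d \<kappa> * cartan (orb \<kappa>) (orb \<iota>)"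
proof (cases "orb \<iota> = orb \<kappa>")
  case True
  then show ?thesis by (simp add: cartan_def d_def)
next
  case ne: False
  have s: "orb_adj (orb \<iota>) (orb \<kappa>) = orb_adj (orb \<kappa>) (orb \<iota>)" unfolding orb_adj_def using adj_sym by blast
  have sw: "\<iota> \<notin> orb \<kappa>" "\<kappa> \<notin> orb \<iota>" using ne orb_eq_iff by metis+
  show ?thesis
  proof (cases "orb_adj (orb \<iota>) (orb \<kappa>)")
    case True
    then obtain a b where "a \<in> orb \<kappa>" "adj a \<iota>" "b \<in> orb \<iota>" "adj b \<kappa>"
      using s by (auto simp: orb_adj_orb)
    then have "int (card {\<nu> \<in> orb \<kappa>. adj \<nu> \<iota>}) = (if d \<iota> < d \<kappa> then d \<kappa> else 1)"
      "int (card {\<nu> \<in> orb \<iota>. adj \<nu> \<kappa>}) = (if d \<kappa> < d \<iota> then d \<iota> else 1)"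
      by (simp_all only: card_adj_orb)
    then show ?thesis using sw r_pos by (auto simp: cartan_orb d_eq split: if_splits)
  qed (use ne s in \<open>simp add: cartan_def\<close>)
qed

definition fold_sum :: "('v \<Rightarrow> int) \<Rightarrow> 'v set \<Rightarrow> int" where
  "fold_sum m i = (\<Sum>\<kappa>\<in>i. m \<kappa>)"

lemma hat_fold_sum: "d \<iota> * hat m \<iota> = int r * fold_sum m (orb \<iota>)"
  by (simp add: hat_eq_orbit_sum fold_sum_def)

lemma fold_sum_of_coords: "fold_sum (of_coords m) (orb \<iota>) = (\<Sum>j\<in>orbits. fold_sum m j * cartan j (orb \<iota>))"
proof -
  have "fold_sum (of_coords m) (orb \<iota>) = (\<Sum>\<nu>\<in>orb \<iota>. \<Sum>\<kappa>\<in>UNIV. m \<kappa> * simple_root \<kappa> \<nu>)"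
    by (simp add: fold_sum_def of_coords_def)
  also have "\<dots> = (\<Sum>\<kappa>\<in>UNIV. m \<kappa> * (\<Sum>\<nu>\<in>orb \<iota>. simple_root \<kappa> \<nu>))"
    by (subst sum.swap) (simp add: sum_distrib_left)
  also have "\<dots> = (\<Sum>\<kappa>\<in>UNIV. m \<kappa> * cartan (orb \<kappa>) (orb \<iota>))"
  proof (rule sum.cong)
    fix \<kappa>
    have "(\<Sum>\<nu>\<in>orb \<iota>. simple_root \<kappa> \<nu>) = (\<Sum>\<nu>\<in>orb \<iota>. 2 * of_bool (\<nu> = \<kappa>) - of_bool (adj \<nu> \<kappa>))"
      by (intro sum.cong) (auto simp: simple_root_def adj_sym)
    also have "\<dots> = 2 * of_bool (\<kappa> \<in> orb \<iota>) - int (card {\<nu> \<in> orb \<iota>. adj \<nu> \<kappa>})"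
      by (simp add: sum_subtractf of_bool_def sum.If_cases sum_distrib_left[symmetric] Int_def conj_commute)
    also have "\<dots> = cartan (orb \<kappa>) (orb \<iota>)" by (simp add: cartan_orb)
    finally show "m \<kappa> * (\<Sum>\<nu>\<in>orb \<iota>. simple_root \<kappa> \<nu>) = m \<kappa> * cartan (orb \<kappa>) (orb \<iota>)" by simp
  qed simp
  also have "\<dots> = (\<Sum>j\<in>orbits. \<Sum>\<kappa>\<in>j. m \<kappa> * cartan (orb \<kappa>) (orb \<iota>))" by (rule sum_over_orbits)
  also have "\<dots> = (\<Sum>j\<in>orbits. fold_sum m j * cartan j (orb \<iota>))"
    unfolding fold_sum_def sum_distrib_right
    by (intro sum.cong refl) (metis orbit_eq_orb)
  finally show ?thesis .
qed

text \<open>A root of the folded system is the restriction of a root \<open>m\<close>; its coroot has the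
  orbit sums of \<open>m\<close> as coefficients.\<close>

definition folds :: "('v \<Rightarrow> int) \<Rightarrow> ('v set \<Rightarrow> int) \<times> ('v set \<Rightarrow> int) \<Rightarrow> bool" where
  "folds m = (\<lambda>(b, b'). \<forall>\<iota>. b' (orb \<iota>) = fold_sum m (orb \<iota>) \<and> d \<iota> * b (orb \<iota>) = weightn m * b' (orb \<iota>))"

lemma folds_unit: "folds (unit \<iota>) (\<lambda>j. of_bool (j = orb \<iota>), \<lambda>j. of_bool (j = orb \<iota>))"
proof -
  have A: "of_bool (orb \<kappa> = orb \<iota>) = fold_sum (unit \<iota>) (orb \<kappa>)" for \<kappa>
    unfolding fold_sum_def fund_weight_def orb_eq_iff by (simp add: of_bool_def)
  have B: "d \<kappa> * of_bool (orb \<kappa> = orb \<iota>) = d \<iota> * of_bool (orb \<kappa> = orb \<iota>)" for \<kappa>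
    by (simp add: d_def)
  show ?thesis unfolding folds_def prod.case weightn_unit using A B by blast
qed

text \<open>The coroot part is the orbit sum of the reflected coordinates, by
  \<open>fold_sum_of_coords\<close>. The root part follows from it because the Cartan matrix is
  symmetrised by \<open>d\<close>.\<close>

lemma folds_reflect:
  assumes "folds m (b, b')"
  shows "folds (orb_refl \<iota> m) (b(orb \<iota> := b (orb \<iota>) - (\<Sum>j\<in>orbits. cartan (orb \<iota>) j * b j)),
    b'(orb \<iota> := b' (orb \<iota>) - (\<Sum>j\<in>orbits. b' j * cartan j (orb \<iota>))))"
proof -
  have b': "b' (orb \<kappa>) = fold_sum m (orb \<kappa>)" and b: "d \<kappa> * b (orb \<kappa>) = weightn m * b' (orb \<kappa>)" for \<kappa>
    using assms by (auto simp: folds_def)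
  have f: "fold_sum (orb_refl \<iota> m) (orb \<kappa>) = fold_sum m (orb \<kappa>) - (if orb \<kappa> = orb \<iota> then fold_sum (of_coords m) (orb \<iota>) else 0)" for \<kappa>
  proof (cases "orb \<kappa> = orb \<iota>")
    case True
    have "fold_sum (orb_refl \<iota> m) (orb \<iota>) = (\<Sum>\<mu>\<in>orb \<iota>. m \<mu> - of_coords m \<mu>)"
      unfolding fold_sum_def by (intro sum.cong) (auto simp: orb_refl_def)
    then show ?thesis using True by (simp add: fold_sum_def sum_subtractf)
  next
    case False
    have "orb \<kappa> \<inter> orb \<iota> = {}" using False orbits_disjoint[of "orb \<kappa>" "orb \<iota>"] by (simp add: orbits_def)
    then have "fold_sum (orb_refl \<iota> m) (orb \<kappa>) = (\<Sum>\<mu>\<in>orb \<kappa>. m \<mu>)"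
      unfolding fold_sum_def by (intro sum.cong) (auto simp: orb_refl_def)
    then show ?thesis using False by (simp add: fold_sum_def)
  qed
  have s: "(\<Sum>j\<in>orbits. b' j * cartan j (orb \<iota>)) = fold_sum (of_coords m) (orb \<iota>)"
    unfolding fold_sum_of_coords by (intro sum.cong refl) (auto simp: orbits_def b')
  have "d \<iota> * (\<Sum>j\<in>orbits. cartan (orb \<iota>) j * b j) = (\<Sum>j\<in>orbits. weightn m * (b' j * cartan j (orb \<iota>)))"
    unfolding sum_distrib_left
  proof (rule sum.cong)
    fix j assume "j \<in> orbits"
    then obtain \<kappa> where j: "j = orb \<kappa>" by (auto simp: orbits_def)
    have "d \<iota> * (cartan (orb \<iota>) (orb \<kappa>) * b (orb \<kappa>)) = d \<kappa> * cartan (orb \<kappa>) (orb \<iota>) * b (orb \<kappa>)"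
      using cartan_symmetrizable[of \<iota> \<kappa>] by simp
    also have "\<dots> = (d \<kappa> * b (orb \<kappa>)) * cartan (orb \<kappa>) (orb \<iota>)" by simp
    finally show "d \<iota> * (cartan (orb \<iota>) j * b j) = weightn m * (b' j * cartan j (orb \<iota>))" unfolding j b by simp
  qed simp
  also have "\<dots> = weightn m * fold_sum (of_coords m) (orb \<iota>)" by (simp add: sum_distrib_left[symmetric] s)
  finally have t: "d \<iota> * (\<Sum>j\<in>orbits. cartan (orb \<iota>) j * b j) = weightn m * fold_sum (of_coords m) (orb \<iota>)" .
  show ?thesis unfolding folds_def
  proof (clarify, intro conjI)
    fix \<kappa>
    show "(b'(orb \<iota> := b' (orb \<iota>) - (\<Sum>j\<in>orbits. b' j * cartan j (orb \<iota>)))) (orb \<kappa>) = fold_sum (orb_refl \<iota> m) (orb \<kappa>)"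
      by (simp add: f s b')
    show "d \<kappa> * (b(orb \<iota> := b (orb \<iota>) - (\<Sum>j\<in>orbits. cartan (orb \<iota>) j * b j))) (orb \<kappa>) =
      weightn (orb_refl \<iota> m) * (b'(orb \<iota> := b' (orb \<iota>) - (\<Sum>j\<in>orbits. b' j * cartan j (orb \<iota>)))) (orb \<kappa>)"
    proof (cases "orb \<kappa> = orb \<iota>")
      case True
      then have "d \<kappa> = d \<iota>" by (simp add: d_def)
      then show ?thesis using True by (simp add: weightn_orb_refl s right_diff_distrib t b)
    qed (simp add: weightn_orb_refl b)
  qed
qed

lemma root_coroots_fold:
  "(b, b') \<in> root_coroots orbits cartan \<Longrightarrow> \<exists>m\<in>root_coords. folds m (b, b')"
proof (induction rule: root_coroots.induct)
  case (simple i)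
  then obtain \<iota> where "i = orb \<iota>" by (auto simp: orbits_def)
  then show ?case using folds_unit[of \<iota>] unit_in_root_coords[of \<iota>] by auto
next
  case (reflect b b' i)
  then obtain \<iota> m where i: "i = orb \<iota>" "m \<in> root_coords" "folds m (b, b')" by (auto simp: orbits_def)
  then show ?case using folds_reflect[OF i(3), of \<iota>] orb_refl_root[OF i(2), of \<iota>] by blast
qed

lemma fold_root_coroots: "m \<in> root_coords \<Longrightarrow> \<exists>y\<in>root_coroots orbits cartan. folds m y"
  unfolding orb_roots_eq[symmetric]
proof (induction rule: orb_roots.induct)
  case (unit \<iota>)
  have "(\<lambda>j. of_bool (j = orb \<iota>), \<lambda>j. of_bool (j = orb \<iota>)) \<in> root_coroots orbits cartan"
    by (rule root_coroots.simple) (simp add: orbits_def)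
  then show ?case using folds_unit by blast
next
  case (orb m \<iota>)
  then obtain b b' where b: "(b, b') \<in> root_coroots orbits cartan" "folds m (b, b')" by auto
  have "orb \<iota> \<in> orbits" by (simp add: orbits_def)
  then show ?case using root_coroots.reflect[OF b(1)] folds_reflect[OF b(2)] by blast
qed

lemma folds_hat: "folds m (b, b') \<Longrightarrow> int r * b (orb \<iota>) = weightn m * hat m \<iota>"
proof -
  assume "folds m (b, b')"
  then have "d \<iota> * b (orb \<iota>) = weightn m * fold_sum m (orb \<iota>)" by (simp add: folds_def)
  then have "d \<iota> * (int r * b (orb \<iota>)) = weightn m * (int r * fold_sum m (orb \<iota>))"
    by (simp add: mult.left_commute)
  also have "\<dots> = d \<iota> * (weightn m * hat m \<iota>)" by (simp add: hat_fold_sum[symmetric] mult.left_commute)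
  finally show ?thesis using d_pos[of \<iota>] by simp
qed

lemma folds_height: "folds m (b, b') \<Longrightarrow> (\<Sum>i\<in>orbits. b' i) = height_of m"
proof -
  assume "folds m (b, b')"
  then have "(\<Sum>i\<in>orbits. b' i) = (\<Sum>i\<in>orbits. \<Sum>\<kappa>\<in>i. m \<kappa>)"
    by (intro sum.cong) (auto simp: folds_def fold_sum_def orbits_def)
  then show ?thesis unfolding height_of_def sum_over_orbits[of m] .
qed

text \<open>The orbit sums of \<open>theta\<close> are the coefficients of the coroot of the highest
  root, so they add up to the height of \<open>theta\<close>. The definite description also asks
  that any other maximal pair yield the same number.\<close>

lemma hdual_eq: "hdual = 1 + height_of theta"
proof -
  let ?P = "\<lambda>h. \<exists>t t'. (t, t') \<in> root_coroots orbits cartan \<and>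
    (\<forall>(b, b') \<in> root_coroots orbits cartan. \<forall>i\<in>orbits. b i \<le> t i) \<and> h = (\<Sum>i\<in>orbits. t' i)"
  obtain t t' where t: "(t, t') \<in> root_coroots orbits cartan" "folds theta (t, t')"
    using fold_root_coroots[OF theta(1)] by auto
  have tT: "t (orb \<iota>) = hat theta \<iota>" for \<iota> using folds_hat[OF t(2), of \<iota>] theta(2) r_pos by simp
  have dom: "b (orb \<iota>) \<le> t (orb \<iota>)" if bb: "(b, b') \<in> root_coroots orbits cartan" for b b' \<iota>
  proof -
    obtain m where m: "m \<in> root_coords" "folds m (b, b')" using root_coroots_fold[OF bb] by blast
    have "int r * b (orb \<iota>) \<le> int r * hat theta \<iota>"
      unfolding folds_hat[OF m(2)] by (rule hat_theta_dominates[OF m(1)])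
    then show ?thesis using r_pos by (simp add: tT)
  qed
  have "?P (height_of theta)"
    by (rule exI[of _ t], rule exI[of _ t']) (use t dom folds_height[OF t(2)] in \<open>auto simp: orbits_def\<close>)
  moreover have "h = height_of theta" if h: "?P h" for h
  proof -
    from h obtain u u' where u: "(u, u') \<in> root_coroots orbits cartan"
      "\<forall>(b, b') \<in> root_coroots orbits cartan. \<forall>i\<in>orbits. b i \<le> u i" "h = (\<Sum>i\<in>orbits. u' i)" by auto
    obtain n where n: "n \<in> root_coords" "folds n (u, u')" using root_coroots_fold[OF u(1)] by blast
    have "u (orb \<iota>) = t (orb \<iota>)" for \<iota>
    proof (rule antisym)
      show "u (orb \<iota>) \<le> t (orb \<iota>)" by (rule dom[OF u(1)])
      show "t (orb \<iota>) \<le> u (orb \<iota>)" using u(2) t(1) by (auto simp: orbits_def)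
    qed
    then have e: "weightn n * hat n \<iota> = int r * hat theta \<iota>" for \<iota> using folds_hat[OF n(2), of \<iota>] tT by simp
    \<comment> \<open>Comparing norms turns the equality of the root parts into
      \<open>weightn n = r\<close>; then the projections, and with them the heights, agree.\<close>
    have "weightn n * (weightn n * form (hat n) (hat n)) = form (\<lambda>\<iota>. weightn n * hat n \<iota>) (\<lambda>\<iota>. weightn n * hat n \<iota>)"
      by (simp only: of_coords_scale pairing_scale_left pairing_scale_right)
    also have "\<dots> = int r * (int r * (2 * int r))"
      unfolding e by (simp only: of_coords_scale pairing_scale_left pairing_scale_right form_hat_theta)
    finally have "int r * (weightn n * (weightn n * form n (hat n))) = int r * (int r * (2 * int r))"
      by (simp add: form_hat_hat mult.left_commute)
    then have "weightn n * (2 * int r) = int r * (2 * int r)" using r_pos weightn_form_hat[OF n(1)] by simp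
    then have w: "weightn n = int r" using r_pos by simp
    then have "hat n \<iota> = hat theta \<iota>" for \<iota> using e[of \<iota>] r_pos by simp
    then have "int r * height_of n = int r * height_of theta" unfolding sum_hat[symmetric] by simp
    then show ?thesis using u(3) folds_height[OF n(2)] r_pos by simp
  qed
  ultimately have "(THE h. ?P h) = height_of theta" by (rule the_equality)
  then show ?thesis by (simp add: hdual_def dual_coxeter_number_def)
qed


subsection \<open>Counting roots\<close>

definition orb_coord :: "'v \<Rightarrow> 'v \<Rightarrow> int" where
  "orb_coord \<iota> = (\<lambda>\<kappa>. of_bool (\<kappa> \<in> orb \<iota>))"

lemma orb_refl_eq: 
  assumes "twist 1 y = y"
  shows "orb_refl \<iota> y = (\<lambda>\<kappa>. y \<kappa> - of_coords y \<iota> * orb_coord \<iota> \<kappa>)"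
proof
  fix \<kappa>
  have inv: "of_coords y (\<sigma> \<mu>) = of_coords y \<mu>" for \<mu>
    using fun_cong[OF of_coords_twist1[of y], of \<mu>] assms by (simp add: twist_def)
  have "of_coords y ((\<sigma> ^^ l) \<mu>) = of_coords y \<mu>" for l \<mu>
    by (induction l) (simp_all add: inv)
  then show "orb_refl \<iota> y \<kappa> = y \<kappa> - of_coords y \<iota> * orb_coord \<iota> \<kappa>"
    by (auto simp: orb_refl_def orb_coord_def orb_eq)
qed

lemma orb_refl_orb_coord: "orb_refl \<iota> (orb_coord \<iota>) = - orb_coord \<iota>"
proof
  fix \<kappa>
  have "of_coords (orb_coord \<iota>) \<kappa> = 2" if "\<kappa> \<in> orb \<iota>"
  proof -
    have "(\<Sum>\<mu> | adj \<kappa> \<mu>. orb_coord \<iota> \<mu>) = 0"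
      using orb_not_adj[OF that] by (intro sum.neutral) (auto simp: orb_coord_def)
    then show ?thesis using that by (simp add: of_coords_apply orb_coord_def)
  qed
  then show "orb_refl \<iota> (orb_coord \<iota>) \<kappa> = (- orb_coord \<iota>) \<kappa>"
    by (auto simp: orb_refl_def orb_coord_def)
qed

lemma form_orb_coord: "form (orb_coord \<iota>) m = fold_sum (of_coords m) (orb \<iota>)"
  unfolding pairing_def orb_coord_def fold_sum_def
  by (simp add: of_bool_def sum.If_cases if_distrib[of "\<lambda>x. x * _"] cong: if_cong)

text \<open>The sum of \<open>weightn b * form b x * form b y\<close> over all roots is a form on
  the \<open>\<sigma>\<close>-fixed part invariant under the folded Weyl group; this is its value at
  the indicator of an orbit.\<close>

definition casimir :: "'v \<Rightarrow> int" where
  "casimir \<iota> = (\<Sum>b\<in>root_coords. weightn b * (form b (orb_coord \<iota>))\<^sup>2)"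

text \<open>Reflecting the summation variable in the orbit of \<open>\<iota>\<close> negates the first factor.\<close>

lemma casimir_reflect:
  assumes "\<And>b. b \<in> root_coords \<Longrightarrow> f (orb_refl \<iota> b) = f b - c * form b (orb_coord \<iota>)"
  shows "2 * (\<Sum>b\<in>root_coords. weightn b * (form b (orb_coord \<iota>) * f b)) = c * casimir \<iota>"
proof -
  let ?g = "\<lambda>b. weightn b * (form b (orb_coord \<iota>) * f b)"
  have neg: "form (orb_refl \<iota> b) (orb_coord \<iota>) = - form b (orb_coord \<iota>)" for b
  proof -
    have "form (orb_refl \<iota> b) (orb_coord \<iota>) = form (orb_refl \<iota> (orb_refl \<iota> b)) (orb_refl \<iota> (orb_coord \<iota>))"
      by (rule form_orb_refl[symmetric])
    then show ?thesis by (simp add: orb_refl_invol orb_refl_orb_coord of_coords_uminus pairing_uminus_right)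
  qed
  have "(\<Sum>b\<in>root_coords. ?g b) = (\<Sum>b\<in>root_coords. ?g (orb_refl \<iota> b))"
    by (rule sum.reindex_bij_witness[of _ "orb_refl \<iota>" "orb_refl \<iota>"]) (simp_all add: orb_refl_invol orb_refl_root)
  also have "\<dots> = (\<Sum>b\<in>root_coords. c * (weightn b * (form b (orb_coord \<iota>))\<^sup>2) - ?g b)"
    by (intro sum.cong refl) (simp add: weightn_orb_refl neg assms algebra_simps power2_eq_square)
  also have "\<dots> = c * casimir \<iota> - (\<Sum>b\<in>root_coords. ?g b)"
    by (simp add: sum_subtractf sum_distrib_left casimir_def)
  finally show ?thesis by simp
qed

lemma casimir_form:
  assumes "twist 1 y = y"
  shows "2 * (\<Sum>b\<in>root_coords. weightn b * (form b (orb_coord \<iota>) * form b y)) = of_coords y \<iota> * casimir \<iota>"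
proof (rule casimir_reflect)
  fix b
  have "form (orb_refl \<iota> b) y = form b (orb_refl \<iota> y)"
    using form_orb_refl[of \<iota> b "orb_refl \<iota> y"] by (simp add: orb_refl_invol)
  also have "\<dots> = form b y - of_coords y \<iota> * form b (orb_coord \<iota>)"
    unfolding orb_refl_eq[OF assms] of_coords_diff of_coords_scale pairing_diff_right pairing_scale_right ..
  finally show "form (orb_refl \<iota> b) y = form b y - of_coords y \<iota> * form b (orb_coord \<iota>)" .
qed

lemma fold_sum_orb_refl_self: "fold_sum (orb_refl \<iota> m) (orb \<iota>) = fold_sum m (orb \<iota>) - form m (orb_coord \<iota>)"
proof -
  have "fold_sum (orb_refl \<iota> m) (orb \<iota>) = (\<Sum>\<mu>\<in>orb \<iota>. m \<mu> - of_coords m \<mu>)"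
    unfolding fold_sum_def by (intro sum.cong) (auto simp: orb_refl_def)
  then show ?thesis unfolding form_sym[of m] form_orb_coord by (simp add: fold_sum_def sum_subtractf)
qed

text \<open>Here the functional is an orbit sum of simple root coefficients instead of a pairing
  with a vector. This instance computes the trace.\<close>

lemma casimir_fold_sum:
  "2 * (\<Sum>b\<in>root_coords. weightn b * (form b (orb_coord \<iota>) * fold_sum b (orb \<iota>))) = casimir \<iota>"
  using casimir_reflect[of "\<lambda>b. fold_sum b (orb \<iota>)" \<iota> 1] by (simp add: fold_sum_orb_refl_self)

lemma twist_orb_coord: "twist 1 (orb_coord \<iota>) = orb_coord \<iota>"
  by (simp add: twist_def orb_coord_def orb_sigma_iff)

lemma of_coords_orb_coord: "d \<iota> * of_coords (orb_coord \<kappa>) \<iota> = form (orb_coord \<iota>) (orb_coord \<kappa>)"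
proof -
  have "of_coords (orb_coord \<kappa>) \<mu> = of_coords (orb_coord \<kappa>) \<iota>" if "\<mu> \<in> orb \<iota>" for \<mu>
  proof -
    have "twist l (of_coords (orb_coord \<kappa>)) = of_coords (orb_coord \<kappa>)" for l
      unfolding of_coords_twist[symmetric] twist_fixed[OF twist_orb_coord] ..
    then have "of_coords (orb_coord \<kappa>) ((\<sigma> ^^ l) \<iota>) = of_coords (orb_coord \<kappa>) \<iota>" for l
      by (metis twist_def)
    then show ?thesis using that by (auto simp: orb_eq)
  qed
  then show ?thesis by (simp add: form_orb_coord fold_sum_def d_def)
qed

lemma casimir_sym: "of_coords (orb_coord \<kappa>) \<iota> * casimir \<iota> = of_coords (orb_coord \<iota>) \<kappa> * casimir \<kappa>"
  unfolding casimir_form[OF twist_orb_coord, symmetric] by (simp add: mult.commute[of "form _ (orb_coord \<iota>)"])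

lemma casimir_adj:
  assumes "adj \<iota> \<kappa>"
  shows "d \<kappa> * casimir \<iota> = d \<iota> * casimir \<kappa>"
proof -
  have "of_coords (orb_coord \<kappa>) \<iota> < 0"
  proof -
    have "orb_coord \<kappa> \<iota> = 0" using assms orb_not_adj[OF _ orb_self, of \<iota> \<kappa>] by (auto simp: orb_coord_def)
    moreover have "orb_coord \<kappa> \<kappa> \<le> (\<Sum>\<mu> | adj \<iota> \<mu>. orb_coord \<kappa> \<mu>)"
      using assms by (intro member_le_sum) (auto simp: orb_coord_def)
    ultimately show ?thesis by (simp add: of_coords_apply orb_coord_def orb_self)
  qed
  moreover have "of_coords (orb_coord \<kappa>) \<iota> * (d \<kappa> * casimir \<iota>) = of_coords (orb_coord \<kappa>) \<iota> * (d \<iota> * casimir \<kappa>)"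
  proof -
    have "d \<iota> * of_coords (orb_coord \<kappa>) \<iota> = d \<kappa> * of_coords (orb_coord \<iota>) \<kappa>"
      unfolding of_coords_orb_coord by (rule form_sym)
    then have e: "(d \<iota> * of_coords (orb_coord \<kappa>) \<iota>) * casimir \<kappa> = d \<kappa> * (of_coords (orb_coord \<kappa>) \<iota> * casimir \<iota>)"
      by (simp add: casimir_sym[of \<kappa> \<iota>])
    have "of_coords (orb_coord \<kappa>) \<iota> * (d \<kappa> * casimir \<iota>) = d \<kappa> * (of_coords (orb_coord \<kappa>) \<iota> * casimir \<iota>)"
      by (rule mult.left_commute)
    also have "\<dots> = of_coords (orb_coord \<kappa>) \<iota> * (d \<iota> * casimir \<kappa>)" unfolding e[symmetric] by simp
    finally show ?thesis .
  qed
  ultimately show ?thesis by (metis less_irrefl mult_cancel_left)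
qed

text \<open>Schur's lemma by hand: symmetry of the invariant form relates its values on adjacent
  orbits, where the off-diagonal entry is nonzero, and connectedness leaves a single constant of
  proportionality.\<close>

lemma casimir_const: "\<exists>K. \<forall>\<iota>. int r * casimir \<iota> = d \<iota> * K"
proof -
  obtain \<kappa> where k: "d \<kappa> = int r" using ex_d_eq_r by auto
  have "int r * casimir \<iota> = d \<iota> * casimir \<kappa>" for \<iota>
  proof (rule adj_connected[of "\<lambda>\<iota>. int r * casimir \<iota> = d \<iota> * casimir \<kappa>" \<kappa>])
    fix \<mu> \<nu> assume a: "adj \<mu> \<nu>" "int r * casimir \<mu> = d \<mu> * casimir \<kappa>"
    have "d \<mu> * (int r * casimir \<nu>) = int r * (d \<nu> * casimir \<mu>)" using casimir_adj[OF a(1)] by simp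
    also have "\<dots> = d \<mu> * (d \<nu> * casimir \<kappa>)" using a(2) by (simp add: mult.left_commute)
    finally show "int r * casimir \<nu> = d \<nu> * casimir \<kappa>" using d_pos[of \<mu>] by simp
  qed (simp add: k)
  then show ?thesis by blast
qed

section \<open>Splitting sums over roots, and the two evaluations of the constant\<close>

lemma root_coords_split:
  "root_coords = pos_coords \<union> uminus ` pos_coords" "pos_coords \<inter> uminus ` pos_coords = {}"
proof -
  show "root_coords = pos_coords \<union> uminus ` pos_coords"
  proof
    show "root_coords \<subseteq> pos_coords \<union> uminus ` pos_coords"
    proof
      fix m assume m: "m \<in> root_coords"
      from root_sign[OF m] show "m \<in> pos_coords \<union> uminus ` pos_coords"
      proof
        assume "\<forall>\<kappa>. m \<kappa> \<le> 0"
        then have "- m \<in> pos_coords" using uminus_in_root_coords[OF m] by (simp add: pos_coords_def)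
        then show ?thesis by (metis UnI2 image_eqI minus_minus_weight)
      qed (use m in \<open>simp add: pos_coords_def\<close>)
    qed
  qed (auto simp: pos_coords_def uminus_in_root_coords)
  show "pos_coords \<inter> uminus ` pos_coords = {}"
  proof (rule ccontr)
    assume "pos_coords \<inter> uminus ` pos_coords \<noteq> {}"
    then obtain m where m: "m \<in> pos_coords" "- m \<in> pos_coords" by auto
    have "m \<kappa> = 0" for \<kappa>
    proof -
      have "0 \<le> m \<kappa>" "0 \<le> (- m) \<kappa>" using m unfolding pos_coords_def by blast+
      then show ?thesis by simp
    qed
    then show False using root_nonzero[of m] m(1) by (auto simp: pos_coords_def)
  qed
qed

lemma finite_pos_coords: "finite pos_coords"
  using finite_root_coords by (simp add: pos_coords_def)

lemma card_root_coords: "card root_coords = 2 * card pos_roots"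
proof -
  have c: "card (uminus ` pos_coords) = card pos_coords" by (rule card_image) (simp add: inj_on_def)
  have "card pos_roots = card pos_coords"
    unfolding pos_roots_eq by (rule card_image) (auto simp: inj_on_def dest: of_coords_inj)
  then show ?thesis
    using card_Un_disjoint[OF finite_pos_coords _ root_coords_split(2)] finite_pos_coords c
    by (simp add: root_coords_split(1)[symmetric])
qed

lemma sum_root_coords_even:
  assumes "\<And>b. f (- b) = f b"
  shows "(\<Sum>b\<in>root_coords. f b) = 2 * (\<Sum>b\<in>pos_coords. (f b :: int))"
proof -
  have inj: "inj_on uminus (pos_coords :: ('v \<Rightarrow> int) set)" by (simp add: inj_on_def)
  have "(\<Sum>b\<in>root_coords. f b) = (\<Sum>b\<in>pos_coords. f b) + (\<Sum>b\<in>uminus ` pos_coords. f b)"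
    unfolding root_coords_split(1) using finite_pos_coords root_coords_split(2) by (intro sum.union_disjoint) auto
  also have "(\<Sum>b\<in>uminus ` pos_coords. f b) = (\<Sum>b\<in>pos_coords. f b)"
    unfolding sum.reindex[OF inj] by (simp add: assms)
  finally show ?thesis by simp
qed

definition orb_rep :: "'v set \<Rightarrow> 'v" where
  "orb_rep i = (SOME \<iota>. \<iota> \<in> i)"

lemma orb_orb_rep: "i \<in> orbits \<Longrightarrow> i = orb (orb_rep i)"
proof -
  assume i: "i \<in> orbits"
  then obtain \<iota> where "i = orb \<iota>" by (auto simp: orbits_def)
  then have "orb_rep i \<in> i" unfolding orb_rep_def using orb_self someI by metis
  then show ?thesis by (rule orbit_eq_orb[OF i])
qed

lemma form_hat_expand: "form b (hat m) = (\<Sum>i\<in>orbits. hat m (orb_rep i) * form b (orb_coord (orb_rep i)))"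
proof -
  have "form b (hat m) = (\<Sum>\<kappa>\<in>UNIV. hat m \<kappa> * of_coords b \<kappa>)"
    using form_sym[of b "hat m"] by (simp only: pairing_def)
  also have "\<dots> = (\<Sum>i\<in>orbits. \<Sum>\<kappa>\<in>i. hat m \<kappa> * of_coords b \<kappa>)" by (rule sum_over_orbits)
  also have "\<dots> = (\<Sum>i\<in>orbits. hat m (orb_rep i) * form b (orb_coord (orb_rep i)))"
  proof (rule sum.cong[OF refl])
    fix i assume i: "i \<in> orbits"
    have "(\<Sum>\<kappa>\<in>i. hat m \<kappa> * of_coords b \<kappa>) = (\<Sum>\<kappa>\<in>i. hat m (orb_rep i) * of_coords b \<kappa>)"
      using orb_orb_rep[OF i] hat_orb[of _ "orb_rep i" m] by (intro sum.cong refl) auto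
    also have "\<dots> = hat m (orb_rep i) * fold_sum (of_coords b) (orb (orb_rep i))"
      using orb_orb_rep[OF i] by (simp add: fold_sum_def sum_distrib_left)
    finally show "(\<Sum>\<kappa>\<in>i. hat m \<kappa> * of_coords b \<kappa>) = hat m (orb_rep i) * form b (orb_coord (orb_rep i))"
      unfolding form_sym[of b] form_orb_coord .
  qed
  finally show ?thesis .
qed

text \<open>Evaluate the sum of \<open>weightn b * form b (hat b)\<close> in two ways: each root
  contributes \<open>2 * r\<close>, and after expanding \<open>hat b\<close> over the orbits each
  orbit contributes half of \<open>K\<close>.\<close>

lemma casimir_trace:
  assumes K: "\<And>\<iota>. int r * casimir \<iota> = d \<iota> * K"
  shows "K * int (card orbits) = 8 * int r * int (card pos_roots)"
proof -
  have "(\<Sum>b\<in>root_coords. weightn b * form b (hat b))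
      = (\<Sum>b\<in>root_coords. \<Sum>i\<in>orbits. weightn b * (form b (orb_coord (orb_rep i)) * hat b (orb_rep i)))"
    unfolding form_hat_expand by (simp add: sum_distrib_left mult.commute[of "hat _ _"])
  also have "\<dots> = (\<Sum>i\<in>orbits. \<Sum>b\<in>root_coords. weightn b * (form b (orb_coord (orb_rep i)) * hat b (orb_rep i)))"
    by (rule sum.swap)
  finally have s: "2 * (2 * int r * int (card root_coords))
      = (\<Sum>i\<in>orbits. 2 * (\<Sum>b\<in>root_coords. weightn b * (form b (orb_coord (orb_rep i)) * hat b (orb_rep i))))"
    by (simp add: weightn_form_hat sum_distrib_left[symmetric] mult_ac)
  have k: "2 * (\<Sum>b\<in>root_coords. weightn b * (form b (orb_coord \<iota>) * hat b \<iota>)) = K" for \<iota>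
  proof -
    have "d \<iota> * (2 * (\<Sum>b\<in>root_coords. weightn b * (form b (orb_coord \<iota>) * hat b \<iota>)))
        = 2 * (\<Sum>b\<in>root_coords. weightn b * (form b (orb_coord \<iota>) * (d \<iota> * hat b \<iota>)))"
      by (simp add: sum_distrib_left mult.left_commute)
    also have "\<dots> = int r * (2 * (\<Sum>b\<in>root_coords. weightn b * (form b (orb_coord \<iota>) * fold_sum b (orb \<iota>))))"
      unfolding hat_fold_sum by (simp add: sum_distrib_left mult.left_commute)
    also have "\<dots> = d \<iota> * K" unfolding casimir_fold_sum by (rule K)
    finally show ?thesis using d_pos[of \<iota>] by simp
  qed
  show ?thesis using s unfolding k by (simp add: card_root_coords mult_ac)
qed

text \<open>The invariant form at \<open>hat theta\<close>, whose norm is \<open>2 * r\<close>;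
  expanding one factor over the orbits reduces it to \<open>casimir_form\<close>.\<close>

lemma casimir_theta:
  assumes K: "\<And>\<iota>. int r * casimir \<iota> = d \<iota> * K"
  shows "(\<Sum>b\<in>root_coords. weightn b * (form b (hat theta))\<^sup>2) = K"
proof -
  let ?T = "hat theta"
  have tw: "twist 1 ?T = ?T" by (rule twist_hat)
  have oc: "of_coords ?T \<kappa> = of_coords ?T \<iota>" if "\<kappa> \<in> orb \<iota>" for \<kappa> \<iota>
    unfolding of_coords_hat by (rule hat_orb[OF that])
  have T: "form b ?T = (\<Sum>i\<in>orbits. ?T (orb_rep i) * form b (orb_coord (orb_rep i)))" for b by (rule form_hat_expand)
  let ?S = "\<Sum>b\<in>root_coords. weightn b * (form b ?T)\<^sup>2"
  have "?S = (\<Sum>b\<in>root_coords. \<Sum>i\<in>orbits. ?T (orb_rep i) * (weightn b * (form b (orb_coord (orb_rep i)) * form b ?T)))"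
  proof (rule sum.cong[OF refl])
    fix b
    have "weightn b * (form b ?T)\<^sup>2 = (\<Sum>i\<in>orbits. ?T (orb_rep i) * form b (orb_coord (orb_rep i))) * (weightn b * form b ?T)"
      unfolding T[symmetric] by (simp add: power2_eq_square)
    then show "weightn b * (form b ?T)\<^sup>2 = (\<Sum>i\<in>orbits. ?T (orb_rep i) * (weightn b * (form b (orb_coord (orb_rep i)) * form b ?T)))"
      unfolding sum_distrib_right by (simp add: mult.assoc mult.left_commute)
  qed
  also have "\<dots> = (\<Sum>i\<in>orbits. ?T (orb_rep i) * (\<Sum>b\<in>root_coords. weightn b * (form b (orb_coord (orb_rep i)) * form b ?T)))"
    by (subst sum.swap) (simp add: sum_distrib_left)
  finally have "2 * int r * ?S = (\<Sum>i\<in>orbits. ?T (orb_rep i) * (int r * (2 * (\<Sum>b\<in>root_coords. weightn b * (form b (orb_coord (orb_rep i)) * form b ?T)))))"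
    by (simp add: sum_distrib_left mult.assoc mult.left_commute)
  also have "\<dots> = (\<Sum>i\<in>orbits. ?T (orb_rep i) * (d (orb_rep i) * of_coords ?T (orb_rep i)) * K)"
  proof (rule sum.cong[OF refl])
    fix i
    have "int r * (of_coords ?T (orb_rep i) * casimir (orb_rep i)) = of_coords ?T (orb_rep i) * (d (orb_rep i) * K)"
      using K[of "orb_rep i"] by (simp add: mult.left_commute)
    then show "?T (orb_rep i) * (int r * (2 * (\<Sum>b\<in>root_coords. weightn b * (form b (orb_coord (orb_rep i)) * form b ?T))))
        = ?T (orb_rep i) * (d (orb_rep i) * of_coords ?T (orb_rep i)) * K"
      unfolding casimir_form[OF tw] by simp
  qed
  also have "\<dots> = (\<Sum>i\<in>orbits. \<Sum>\<kappa>\<in>i. ?T \<kappa> * of_coords ?T \<kappa>) * K"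
    unfolding sum_distrib_right
  proof (rule sum.cong[OF refl])
    fix i assume i: "i \<in> orbits"
    have "(\<Sum>\<kappa>\<in>i. ?T \<kappa> * of_coords ?T \<kappa>) = (\<Sum>\<kappa>\<in>i. ?T (orb_rep i) * of_coords ?T (orb_rep i))"
      using orb_orb_rep[OF i] hat_orb[of _ "orb_rep i" theta] oc[of _ "orb_rep i"] by (intro sum.cong refl) auto
    also have "\<dots> = d (orb_rep i) * (?T (orb_rep i) * of_coords ?T (orb_rep i))"
      using orb_orb_rep[OF i] by (simp add: d_def)
    finally show "?T (orb_rep i) * (d (orb_rep i) * of_coords ?T (orb_rep i)) * K = (\<Sum>\<kappa>\<in>i. ?T \<kappa> * of_coords ?T \<kappa> * K)"
      by (simp add: sum_distrib_right[symmetric])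
  qed
  also have "\<dots> = form ?T ?T * K" unfolding pairing_def sum_over_orbits[of "\<lambda>\<kappa>. ?T \<kappa> * of_coords ?T \<kappa>"] ..
  finally show ?thesis using r_pos by (simp add: form_hat_theta)
qed

text \<open>Twice the Weyl vector pairs to 2 with each simple coroot: the simple reflection permutes
  the other positive roots and negates their pairing, so these cancel.\<close>

lemma sum_pos_coords: "(\<Sum>b\<in>pos_coords. of_coords b \<kappa>) = 2"
proof -
  note fin = finite_pos_coords
  have u: "unit \<kappa> \<in> pos_coords" using unit_in_root_coords[of \<kappa>] by (simp add: pos_coords_def fund_weight_def)
  have neg: "of_coords (coord_refl \<kappa> b) \<kappa> = - of_coords b \<kappa>" for b
    by (simp add: of_coords_coord_refl simple_refl_def simple_root_def)
  have mem: "coord_refl \<kappa> b \<in> pos_coords - {unit \<kappa>}" if "b \<in> pos_coords - {unit \<kappa>}" for b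
  proof -
    have "coord_refl \<kappa> b \<noteq> unit \<kappa>"
    proof
      assume "coord_refl \<kappa> b = unit \<kappa>"
      then have "b = - unit \<kappa>" by (metis coord_refl_invol coord_refl_unit)
      moreover have "0 \<le> b \<kappa>" using that by (simp add: pos_coords_def)
      ultimately show False by (simp add: fund_weight_def)
    qed
    then show ?thesis using coord_refl_pos[of b \<kappa>] that by simp
  qed
  have "(\<Sum>b\<in>pos_coords - {unit \<kappa>}. of_coords b \<kappa>) = (\<Sum>b\<in>pos_coords - {unit \<kappa>}. of_coords (coord_refl \<kappa> b) \<kappa>)"
    by (rule sum.reindex_bij_witness[of _ "coord_refl \<kappa>" "coord_refl \<kappa>"]) (simp_all only: coord_refl_invol mem)
  then have "(\<Sum>b\<in>pos_coords - {unit \<kappa>}. of_coords b \<kappa>) = 0" unfolding neg sum_negf by simp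
  moreover have "of_coords (unit \<kappa>) \<kappa> = 2" by (simp add: of_coords_unit simple_root_def)
  ultimately show ?thesis by (simp add: sum.remove[OF fin u])
qed

text \<open>Such a root has a positive product with some twist of \<open>theta\<close>. If it is not
  a twist the product is 1, and the difference is a root with vanishing \<open>hat\<close>, which is
  impossible.\<close>

lemma hat_eq_theta:
  assumes "b \<in> root_coords" "hat b = hat theta"
  shows "b \<in> (\<lambda>l. twist l theta) ` {..<r}"
proof (rule ccontr)
  assume ne: "b \<notin> (\<lambda>l. twist l theta) ` {..<r}"
  have le: "form b (twist l theta) \<le> 1" if "l < r" for l
    using ne that assms(1) twist_root[OF theta(1), of l] by (intro form_le_1) auto
  have "form b (hat theta) > 0"
  proof -
    have "weightn b * form b (hat theta) = 2 * int r" using weightn_form_hat[OF assms(1)] assms(2) by simp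
    then show ?thesis using weightn_pos[of b] r_pos by (metis mult_pos_pos of_nat_0_less_iff zero_less_mult_pos zero_less_numeral)
  qed
  then have "\<exists>l<r. 0 < form b (twist l theta)"
    unfolding form_hat[of _ theta] by (metis lessThan_iff not_le sum_nonpos)
  then obtain l where l: "l < r" "0 < form b (twist l theta)" by auto
  then have f1: "form b (twist l theta) = 1" using le[OF l(1)] by simp
  let ?c = "\<lambda>\<kappa>. b \<kappa> - twist l theta \<kappa>"
  have c: "?c \<in> root_coords" using root_refl[OF assms(1) twist_root[OF theta(1), of l]] by (simp add: f1)
  have "hat ?c = (\<lambda>_. 0)"
  proof
    fix \<kappa>
    have "hat ?c \<kappa> = hat b \<kappa> - hat (twist l theta) \<kappa>" by (simp add: hat_def twist_def sum_subtractf)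
    then show "hat ?c \<kappa> = 0" by (simp add: hat_twist assms(2))
  qed
  then show False using hat_root_nonzero[OF c] by simp
qed

lemma card_hat_eq_theta: "card {b \<in> pos_coords. hat b = hat theta} = r"
proof -
  have "{b \<in> pos_coords. hat b = hat theta} = (\<lambda>l. twist l theta) ` {..<r}"
  proof
    show "{b \<in> pos_coords. hat b = hat theta} \<subseteq> (\<lambda>l. twist l theta) ` {..<r}"
      using hat_eq_theta by (auto simp: pos_coords_def)
    show "(\<lambda>l. twist l theta) ` {..<r} \<subseteq> {b \<in> pos_coords. hat b = hat theta}"
    proof
      fix b assume "b \<in> (\<lambda>l. twist l theta) ` {..<r}"
      then obtain l where b: "b = twist l theta" by auto
      have h: "hat b = hat theta" unfolding b by (rule hat_twist)
      have "b \<in> root_coords" unfolding b by (rule twist_root[OF theta(1)])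
      then have "b \<in> pos_coords" using pos_hat_imp_pos[of b undefined] hat_theta_pos[of undefined] h by simp
      then show "b \<in> {b \<in> pos_coords. hat b = hat theta}" using h by simp
    qed
  qed
  moreover have "inj_on (\<lambda>l. twist l theta) {..<r}"
  proof (rule inj_onI)
    fix a b assume ab: "a \<in> {..<r}" "b \<in> {..<r}" "twist a theta = twist b theta"
    show "a = b"
    proof (rule ccontr)
      assume "a \<noteq> b"
      then have "form (twist a theta) (twist b theta) = 0" using ab(1,2) theta_orthogonal[of a b] by simp
      then show False using form_twist_theta_self[of a] ab(3) by simp
    qed
  qed
  ultimately show ?thesis by (simp add: card_image)
qed

text \<open>For a long root \<open>form b (hat theta)\<close> is 0, 1 or 2, and 2 only above the
  highest root; for a short one it is 0 or \<open>r\<close>. On these values the weighted square is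
  linear apart from the value 2, so its sum can be evaluated with the Weyl vector.\<close>

lemma theta_square:
  assumes "b \<in> pos_coords"
  shows "weightn b * (form b (hat theta))\<^sup>2 = int r * form b (hat theta) + 2 * int r * of_bool (hat b = hat theta)"
proof -
  have b: "b \<in> root_coords" "\<And>\<kappa>. 0 \<le> b \<kappa>" using assms by (auto simp: pos_coords_def)
  have a0: "0 \<le> form b (hat theta)"
    unfolding pairing_def using b(2) theta(3) by (intro sum_nonneg mult_nonneg_nonneg) (auto simp: dominant_def)
  show ?thesis
  proof (cases "weightn b = int r")
    case True
    have "form b (hat theta) \<le> 2" "form b (hat theta) = 2 \<longleftrightarrow> hat b = hat theta"
      by (rule theta_form_bound[OF b(1) True])+
    moreover have "form b (hat theta) = 0 \<or> form b (hat theta) = 1 \<or> form b (hat theta) = 2" using a0 calculation(1) by linarith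
    ultimately show ?thesis using True by auto
  next
    case False
    have f: "form b (hat theta) = int r * form b theta" "form b theta \<le> 1" by (rule fixed_form[OF b(1) False])+
    have "0 \<le> form b theta" using a0 r_pos unfolding f(1) by (simp add: zero_le_mult_iff)
    then have c: "form b theta = 0 \<or> form b theta = 1" using f(2) by linarith
    have w: "weightn b = 1" "1 < r" using weightn_cases[of b] False by auto
    have "hat b \<noteq> hat theta"
    proof
      assume "hat b = hat theta"
      then have "form b (hat theta) = 2 * int r" using weightn_form_hat[OF b(1)] w by simp
      then show False using f c r_pos by auto
    qed
    then show ?thesis using w c f(1) by (auto simp: power2_eq_square)
  qed
qed

theorem turn_eq: "turn = int r * hdual"
proof -
  obtain K where K: "\<And>\<iota>. int r * casimir \<iota> = d \<iota> * K" using casimir_const by blast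
  note fin = finite_pos_coords
  have w: "weightn (- b) = weightn b" for b
    by (auto simp: weightn_def twist_def fun_eq_iff)
  have "K = 2 * (\<Sum>b\<in>pos_coords. weightn b * (form b (hat theta))\<^sup>2)"
    unfolding casimir_theta[OF K, symmetric]
    by (rule sum_root_coords_even) (simp add: w pairing_uminus_left)
  also have "(\<Sum>b\<in>pos_coords. weightn b * (form b (hat theta))\<^sup>2)
      = (\<Sum>b\<in>pos_coords. int r * form b (hat theta) + 2 * int r * of_bool (hat b = hat theta))"
    by (intro sum.cong refl theta_square)
  \<comment> \<open>The second summand stems from the \<open>r\<close> twists of
    \<open>theta\<close> and becomes the 1 in the dual Coxeter number.\<close>
  also have "\<dots> = int r * (\<Sum>b\<in>pos_coords. form b (hat theta)) + 2 * int r * int r"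
    using fin card_hat_eq_theta by (simp add: sum.distrib sum_distrib_left[symmetric] Int_def)
  also have "(\<Sum>b\<in>pos_coords. form b (hat theta)) = (\<Sum>\<kappa>\<in>UNIV. hat theta \<kappa> * (\<Sum>b\<in>pos_coords. of_coords b \<kappa>))"
  proof -
    have "(\<Sum>b\<in>pos_coords. form b (hat theta)) = (\<Sum>b\<in>pos_coords. form (hat theta) b)"
      by (intro sum.cong refl) (rule form_sym)
    also have "\<dots> = (\<Sum>\<kappa>\<in>UNIV. \<Sum>b\<in>pos_coords. hat theta \<kappa> * of_coords b \<kappa>)"
      unfolding pairing_def by (rule sum.swap)
    finally show ?thesis by (simp only: sum_distrib_left)
  qed
  also have "\<dots> = 2 * (int r * height_of theta)"
    unfolding sum_pos_coords sum_hat[symmetric] by (simp add: sum_distrib_right[symmetric])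
  finally have K2: "K = 4 * int r * int r * hdual" by (simp add: hdual_eq algebra_simps)
  have "2 * int (card pos_roots) = turn * int (card orbits)"
    using turn_card by (metis (mono_tags, opaque_lifting) of_int_eq_iff of_int_mult of_int_numeral of_int_of_nat_eq)
  then have "4 * int r * (turn * int (card orbits)) = K * int (card orbits)"
    using casimir_trace[OF K] by simp
  moreover have "card orbits \<noteq> 0" by (simp add: orbits_def)
  ultimately show ?thesis using r_pos by (simp add: K2)
qed

end

section \<open>Coordinates on the repetition quiver\<close>

context Q_datum
begin

text \<open>By \<open>turn_eq\<close> the bound in the definition says that the vertex lies strictly
  above the half turn of \<open>\<xi>\<close>. This is where the value of the half turn
  enters.\<close>

lemma AR_vertices_eq: "AR_vertices = region \<xi> (turned \<xi>)"
proof -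
  have "(\<iota>, p) \<in> AR_vertices \<longleftrightarrow> (\<iota>, p) \<in> region \<xi> (turned \<xi>)" for \<iota> p
  proof
    assume "(\<iota>, p) \<in> AR_vertices"
    then obtain k where "p = \<xi> \<iota> - 2 * d \<iota> * k" "0 \<le> 2 * d \<iota> * k" "2 * d \<iota> * k < turn + \<xi> \<iota> - \<xi> (star \<iota>)"
      unfolding AR_vertices_def turn_eq by auto
    then show "(\<iota>, p) \<in> region \<xi> (turned \<xi>)"
      using in_row_diff[of \<iota> "\<xi> \<iota>" k] in_row_height[of \<iota>] by (simp add: region_iff turned_def)
  next
    assume a: "(\<iota>, p) \<in> region \<xi> (turned \<xi>)"
    then have "2 * d \<iota> dvd \<xi> \<iota> - p" using in_row_dvd[OF in_row_height[of \<iota>]] by (simp add: region_iff)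
    then obtain k where "\<xi> \<iota> - p = 2 * d \<iota> * k" by (rule dvdE)
    moreover have "0 \<le> \<xi> \<iota> - p" "\<xi> \<iota> - p < turn + \<xi> \<iota> - \<xi> (star \<iota>)"
      using a by (simp_all add: region_iff turned_def)
    ultimately have "p = \<xi> \<iota> - 2 * d \<iota> * k" "0 \<le> 2 * d \<iota> * k" "2 * d \<iota> * k < turn + \<xi> \<iota> - \<xi> (star \<iota>)"
      by linarith+
    then show "(\<iota>, p) \<in> AR_vertices" unfolding AR_vertices_def turn_eq by blast
  qed
  then show ?thesis by auto
qed

subsection \<open>Adapted words\<close>

lemma run_take_Suc:
  "k < length is \<Longrightarrow> run \<eta> (take (Suc k) is) \<iota> = run \<eta> (take k is) \<iota> - (if is ! k = \<iota> then 2 * d \<iota> else 0)"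
  unfolding run_def by (simp add: take_Suc_conv_app_nth algebra_simps)

lemma run_take_mono: "j \<le> k \<Longrightarrow> k \<le> length is \<Longrightarrow> run \<eta> (take k is) \<iota> \<le> run \<eta> (take j is) \<iota>"
proof (induction k rule: dec_induct)
  case (step n)
  then show ?case using run_take_Suc[of n "is" \<eta> \<iota>] d_pos[of \<iota>] by (auto split: if_splits)
qed simp

lemma run_take_const:
  "j \<le> k \<Longrightarrow> k \<le> length is \<Longrightarrow> (\<And>i. j \<le> i \<Longrightarrow> i < k \<Longrightarrow> is ! i \<noteq> \<iota>) \<Longrightarrow>
    run \<eta> (take k is) \<iota> = run \<eta> (take j is) \<iota>"
proof (induction k rule: dec_induct)
  case (step n)
  have "run \<eta> (take n is) \<iota> = run \<eta> (take j is) \<iota>" by (rule step.IH) (use step.prems in auto)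
  moreover have "is ! n \<noteq> \<iota>" using step by simp
  ultimately show ?case using run_take_Suc[of n "is" \<eta> \<iota>] step.prems(1) by simp
qed simp

lemma word_vertices_region:
  assumes "\<And>\<iota>. in_row \<iota> (\<eta> \<iota>)"
  shows "region \<eta> (run \<eta> is) \<subseteq> (\<lambda>k. (is ! k, word_height \<eta> is k)) ` {..<length is}"
  using assms
proof (induction "is" arbitrary: \<eta>)
  case Nil
  then show ?case by (auto simp: region_iff)
next
  case (Cons \<kappa> xs)
  let ?v = "\<lambda>\<eta> is k. (is ! k, word_height \<eta> is k)"
  have row: "in_row \<iota> (fire \<kappa> \<eta> \<iota>)" for \<iota> using Cons.prems by (simp add: fire_apply)
  have Suc_eq: "?v \<eta> (\<kappa> # xs) (Suc k) = ?v (fire \<kappa> \<eta>) xs k" for k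
    by (simp add: word_height_def run_Cons)
  have zero: "?v \<eta> (\<kappa> # xs) 0 = (\<kappa>, \<eta> \<kappa>)" by (simp add: word_height_def)
  show ?case
  proof
    fix x assume x: "x \<in> region \<eta> (run \<eta> (\<kappa> # xs))"
    obtain \<iota> p where xe: "x = (\<iota>, p)" by (cases x)
    have p: "in_row \<iota> p" "run (fire \<kappa> \<eta>) xs \<iota> < p" "p \<le> \<eta> \<iota>" using x by (auto simp: xe region_iff run_Cons)
    show "x \<in> ?v \<eta> (\<kappa> # xs) ` {..<length (\<kappa> # xs)}"
    proof (cases "p \<le> fire \<kappa> \<eta> \<iota>")
      case True
      then have "x \<in> region (fire \<kappa> \<eta>) (run (fire \<kappa> \<eta>) xs)" using p by (simp add: xe region_iff)
      then have "x \<in> ?v (fire \<kappa> \<eta>) xs ` {..<length xs}" using Cons.IH[OF row] by blast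
      then obtain k where k: "k < length xs" "x = ?v (fire \<kappa> \<eta>) xs k" by (elim imageE) (simp only: lessThan_iff)
      then show ?thesis unfolding k(2) Suc_eq[symmetric] by (intro imageI) simp
    next
      case False
      then have k: "\<iota> = \<kappa>" "\<eta> \<kappa> - 2 * d \<kappa> < p" using p(3) by (auto simp: fire_apply split: if_splits)
      have "p = \<eta> \<kappa>"
      proof (rule ccontr)
        assume "p \<noteq> \<eta> \<kappa>"
        then have "p + 2 * d \<kappa> \<le> \<eta> \<kappa>" using in_row_ge[OF Cons.prems, of \<kappa> p] p k(1) by simp
        then show False using k(2) by simp
      qed
      then have "x = ?v \<eta> (\<kappa> # xs) 0" by (simp add: xe k(1) word_height_def)
      then show ?thesis by (rule image_eqI) simp
    qed
  qed
qed

text \<open>If nothing is fired at the two vertices in between, the state inequality and the spacing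
  of adjacent rows bound the difference of times from both sides, and the bounds meet at
  \<open>dmin\<close> whichever \<open>d\<close> is smaller. Conversely a firing in between would
  lower a row by \<open>2 * d\<close>, more than a difference of \<open>dmin\<close> allows.\<close>

lemma arrow_iff_consecutive:
  assumes "state \<eta>" "adapted \<eta> is" "j < length is" "k < length is" "adj (is ! j) (is ! k)"
  shows "(j < k \<and> (\<forall>j'. j < j' \<and> j' < k \<longrightarrow> is ! j' \<notin> {is ! j, is ! k})) \<longleftrightarrow>
    word_height \<eta> is j = word_height \<eta> is k + dmin (is ! k) (is ! j)"
proof -
  define \<kappa> \<iota> where "\<kappa> = is ! j" and "\<iota> = is ! k"
  let ?e = "\<lambda>n. run \<eta> (take n is)"
  have a: "adj \<kappa> \<iota>" "adj \<iota> \<kappa>" "\<iota> \<noteq> \<kappa>" using assms(5) adj_sym[of "is ! j" "is ! k"] by (auto simp: \<kappa>_def \<iota>_def)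
  have st: "state (?e n)" for n by (rule state_run[OF assms(1) adapted_take[OF assms(2)]])
  have src: "source (?e n) (is ! n)" if "n < length is" for n by (rule adapted_source[OF assms(2) that])
  have s: "word_height \<eta> is j = ?e j \<kappa>" and p: "word_height \<eta> is k = ?e k \<iota>"
    by (simp_all add: word_height_def \<kappa>_def \<iota>_def)
  have row: "in_row \<mu> (?e n \<mu>)" for n \<mu> by (rule state_row[OF st])
  have dm: "dmin \<iota> \<kappa> \<le> d \<iota>" "dmin \<iota> \<kappa> \<le> d \<kappa>" "dmin \<kappa> \<iota> = dmin \<iota> \<kappa>" "dmin \<iota> \<kappa> = d \<iota> \<or> dmin \<iota> \<kappa> = d \<kappa>"
    by (auto simp: dmin_def)
  have srcj: "?e j \<iota> < ?e j \<kappa>" using source_less[OF src[OF assms(3)]] a by (simp add: \<kappa>_def)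
  have srck: "?e k \<kappa> < ?e k \<iota>" using source_less[OF src[OF assms(4)]] a by (simp add: \<iota>_def)
  show ?thesis unfolding s p \<kappa>_def[symmetric] \<iota>_def[symmetric]
  proof
    assume c: "j < k \<and> (\<forall>j'. j < j' \<and> j' < k \<longrightarrow> is ! j' \<notin> {\<kappa>, \<iota>})"
    have "?e k \<iota> = ?e j \<iota>"
    proof (rule run_take_const)
      fix i assume "j \<le> i" "i < k"
      then show "is ! i \<noteq> \<iota>" using c a(3) by (cases "i = j") (auto simp: \<kappa>_def)
    qed (use c assms(4) in auto)
    moreover have "?e k \<kappa> = ?e (Suc j) \<kappa>"
      by (rule run_take_const) (use c assms(4) in auto)
    moreover have "?e (Suc j) \<kappa> = ?e j \<kappa> - 2 * d \<kappa>" using run_take_Suc[OF assms(3)] by (simp add: \<kappa>_def)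
    moreover have "?e j \<iota> + dmin \<kappa> \<iota> \<le> ?e j \<kappa>" using adj_rows_less[OF a(1) row row] srcj by simp
    moreover have "?e k \<kappa> + dmin \<iota> \<kappa> \<le> ?e k \<iota>" using adj_rows_less[OF a(2) row row] srck by simp
    moreover have "?e j \<kappa> - ?e j \<iota> \<le> 2 * d \<iota> - dmin \<kappa> \<iota>" by (rule state_le[OF st a(1)])
    ultimately show "?e j \<kappa> = ?e k \<iota> + dmin \<iota> \<kappa>" using dm by linarith
  next
    assume e: "?e j \<kappa> = ?e k \<iota> + dmin \<iota> \<kappa>"
    note pos = dmin_pos[of \<iota> \<kappa>] d_pos[of \<iota>] d_pos[of \<kappa>]
    have jk: "j < k"
    proof (rule ccontr)
      assume "\<not> j < k"
      then have "?e j \<kappa> \<le> ?e k \<kappa>" using assms(3) by (intro run_take_mono) auto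
      then show False using srck e pos by linarith
    qed
    moreover have "is ! i \<notin> {\<kappa>, \<iota>}" if i: "j < i" "i < k" for i
    proof
      have il: "i < length is" using i assms(4) by simp
      have si: "\<And>\<mu>. adj (is ! i) \<mu> \<Longrightarrow> ?e i \<mu> < ?e i (is ! i)" using source_less[OF src[OF il]] .
      assume "is ! i \<in> {\<kappa>, \<iota>}"
      then show False
      proof
        assume k: "is ! i = \<kappa>"
        have "?e i \<kappa> \<le> ?e (Suc j) \<kappa>" using i il by (intro run_take_mono) auto
        moreover have "?e (Suc j) \<kappa> = ?e j \<kappa> - 2 * d \<kappa>" using run_take_Suc[OF assms(3)] by (simp add: \<kappa>_def)
        moreover have "?e i \<iota> < ?e i \<kappa>" using si[of \<iota>] a(1) k by simp
        moreover have "?e k \<iota> \<le> ?e i \<iota>" using i assms(4) by (intro run_take_mono) auto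
        ultimately show False using e dm pos by linarith
      next
        assume "is ! i \<in> {\<iota>}"
        then have k: "is ! i = \<iota>" by simp
        have "?e k \<iota> \<le> ?e (Suc i) \<iota>" using i assms(4) by (intro run_take_mono) auto
        moreover have "?e (Suc i) \<iota> = ?e i \<iota> - 2 * d \<iota>" using run_take_Suc[OF il] k by simp
        moreover have "?e i \<iota> \<le> ?e j \<iota>" using i il by (intro run_take_mono) auto
        ultimately show False using srcj e dm pos by linarith
      qed
    qed
    ultimately show "j < k \<and> (\<forall>j'. j < j' \<and> j' < k \<longrightarrow> is ! j' \<notin> {\<kappa>, \<iota>})" by blast
  qed
qed

text \<open>A path from \<open>\<xi>\<close> down to its half turn spells the longest element, and
  by \<open>turn_card\<close> it has the length of a reduced word.\<close>

lemma Q_class_nonempty: "\<exists>is. is \<in> Q_class"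
proof -
  obtain "is" where i: "adapted \<xi> is" "run \<xi> is = turned \<xi>"
    using ex_adapted[OF state_height state_turned[OF state_height]] turned_less[OF state_height] less_imp_le by metis
  have "word_refl is l = longest l" for l
    using place_run[OF state_height i(1), of l] unfolding i(2) place_turned by (metis place_inj[OF state_height])
  then have "word_refl is = longest" by (rule ext)
  moreover have "length is = weyl_length longest"
    using length_turned[OF i(2)] turn_card unfolding card_pos_roots by simp
  ultimately show ?thesis using i(1) by (auto simp: Q_class_def reduced_words_longest_def)
qed

section \<open>One fixed adapted reduced word of the longest element\<close>

context
  fixes "is" :: "'v list"
  assumes Q: "is \<in> Q_class"
begin

lemma Q_word: "word_refl is = longest" "length is = card pos_roots" "adapted \<xi> is"
  using Q by (auto simp: Q_class_def reduced_words_longest_def card_pos_roots)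

lemma word_root_bij: "bij_betw (word_root is) {..<length is} pos_roots"
proof -
  have sub: "pos_roots \<subseteq> word_root is ` {..<length is}" by (rule pos_roots_word_roots[OF Q_word(1)])
  have "card (word_root is ` {..<length is}) \<le> card pos_roots"
    using card_image_le[of "{..<length is}" "word_root is"] Q_word(2) by simp
  then have e: "pos_roots = word_root is ` {..<length is}" using card_seteq[OF _ sub] by simp
  have "inj_on (word_root is) {..<length is}"
    by (rule eq_card_imp_inj_on) (use e Q_word(2) in simp_all)
  then show ?thesis using e by (simp add: bij_betw_def)
qed

lemma root_at_word: "k < length is \<Longrightarrow> root_at (is ! k) (word_height \<xi> is k) = word_root is k"
  using root_at_eqI[OF place_word_root[OF state_height Q_word(3)]] by simp

text \<open>If the word went below the half turn in some row, it would contain a vertex whose root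
  is opposite to a positive one, while the roots of a reduced word are positive. So it stops above
  the half turn and can be continued to it; as the length is already that of a full path, nothing is
  left to add.\<close>

lemma run_Q_word: "run \<xi> is = turned \<xi>"
proof -
  have ge: "turned \<xi> \<iota> \<le> run \<xi> is \<iota>" for \<iota>
  proof (rule ccontr)
    assume "\<not> turned \<xi> \<iota> \<le> run \<xi> is \<iota>"
    then have "(\<iota>, turned \<xi> \<iota>) \<in> region \<xi> (run \<xi> is)"
      using state_row[OF state_turned[OF state_height]] turned_less[OF state_height, of \<iota>] by (simp add: region_iff)
    then have "(\<iota>, turned \<xi> \<iota>) \<in> (\<lambda>k. (is ! k, word_height \<xi> is k)) ` {..<length is}"
      using word_vertices_region[OF in_row_height] by blast
    then obtain k where k: "k < length is" "is ! k = \<iota>" "word_height \<xi> is k = turned \<xi> \<iota>" by auto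
    obtain b where b: "b \<in> pos_roots" "beta (star \<iota>) (\<xi> (star \<iota>)) = place \<xi> b"
      using beta_state_pos[OF state_height] by blast
    have "place \<xi> (word_root is k) = place \<xi> (- b)"
      using place_word_root[OF state_height Q_word(3) k(1)] beta_turn[of "star \<iota>" "\<xi> (star \<iota>)"]
      by (simp add: k turned_def b(2) place_uminus)
    then have "word_root is k = - b" by (rule place_inj[OF state_height])
    moreover have "word_root is k \<in> pos_roots" using word_root_bij k(1) by (auto simp: bij_betw_def)
    ultimately show False using b(1) pos_not_neg[of b] by (simp add: uminus_pos_roots)
  qed
  have "state (run \<xi> is)" by (rule state_run[OF state_height Q_word(3)])
  then obtain js where js: "adapted (run \<xi> is) js" "run (run \<xi> is) js = turned \<xi>"
    using ex_adapted[OF _ state_turned[OF state_height] ge] by blast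
  have "run \<xi> (is @ js) = turned \<xi>" using js(2) by (simp add: run_append)
  then have "length (is @ js) = card pos_roots" using length_turned turn_card by fastforce
  then have "js = []" using Q_word(2) by simp
  then show ?thesis using js(2) by simp
qed

lemma word_vertices_bij: "bij_betw (\<lambda>k. (is ! k, word_height \<xi> is k)) {..<length is} AR_vertices"
proof -
  have "(\<lambda>k. (is ! k, word_height \<xi> is k)) ` {..<length is} \<subseteq> region \<xi> (run \<xi> is)"
    using word_height_row[OF state_height Q_word(3)] by (auto simp: region_iff word_height_le word_height_gt)
  then have "(\<lambda>k. (is ! k, word_height \<xi> is k)) ` {..<length is} = AR_vertices"
    using word_vertices_region[of \<xi> "is", OF in_row_height] unfolding AR_vertices_eq run_Q_word by blast
  then show ?thesis using word_vertices_inj by (simp add: bij_betw_def)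
qed

lemma AR_word:
  assumes "(\<iota>, p) \<in> AR_vertices"
  shows "\<exists>k<length is. is ! k = \<iota> \<and> word_height \<xi> is k = p \<and> root_at \<iota> p = word_root is k"
proof -
  have "(\<iota>, p) \<in> (\<lambda>k. (is ! k, word_height \<xi> is k)) ` {..<length is}"
    using assms word_vertices_bij by (simp add: bij_betw_def)
  then obtain k where "k < length is" "is ! k = \<iota>" "word_height \<xi> is k = p" by auto
  then show ?thesis using root_at_word[of k] by auto
qed

lemma root_at_bij_word: "bij_betw (\<lambda>(\<iota>, p). root_at \<iota> p) AR_vertices pos_roots"
proof -
  have "bij_betw ((\<lambda>(\<iota>, p). root_at \<iota> p) \<circ> (\<lambda>k. (is ! k, word_height \<xi> is k))) {..<length is} pos_roots"
    by (subst bij_betw_cong[where g = "word_root is"]) (simp_all add: root_at_word word_root_bij)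
  then show ?thesis using bij_betw_comp_iff[OF word_vertices_bij] by blast
qed

lemma word_res_root_at:
  assumes "(\<iota>, p) \<in> AR_vertices"
  shows "word_res is (root_at \<iota> p) = \<iota>"
proof -
  obtain k where k: "k < length is" "is ! k = \<iota>" "root_at \<iota> p = word_root is k" using AR_word[OF assms] by blast
  have "\<kappa> = \<iota>" if "\<exists>j < length is. word_root is k = word_root is j \<and> \<kappa> = is ! j" for \<kappa>
    using that k word_root_bij unfolding bij_betw_def inj_on_def by auto
  then show ?thesis unfolding word_res_def k(3) using k(1,2) by (intro the_equality) auto
qed

lemma word_arrow_root_at:
  assumes "(\<iota>, p) \<in> AR_vertices" "(\<kappa>, s) \<in> AR_vertices"
  shows "word_arrow is (root_at \<iota> p) (root_at \<kappa> s) \<longleftrightarrow> rep_arrow (\<iota>, p) (\<kappa>, s)"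
proof -
  obtain k where k: "k < length is" "is ! k = \<iota>" "word_height \<xi> is k = p" "root_at \<iota> p = word_root is k"
    using AR_word[OF assms(1)] by blast
  obtain j where j: "j < length is" "is ! j = \<kappa>" "word_height \<xi> is j = s" "root_at \<kappa> s = word_root is j"
    using AR_word[OF assms(2)] by blast
  have inj: "word_root is a = word_root is b \<longleftrightarrow> a = b" if "a < length is" "b < length is" for a b
    using word_root_bij that unfolding bij_betw_def inj_on_def by auto
  have "word_arrow is (root_at \<iota> p) (root_at \<kappa> s) \<longleftrightarrow>
      j < k \<and> adj (is ! j) (is ! k) \<and> (\<forall>j'. j < j' \<and> j' < k \<longrightarrow> is ! j' \<notin> {is ! j, is ! k})"
  proof
    assume "word_arrow is (root_at \<iota> p) (root_at \<kappa> s)"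
    then obtain j' k' where jk: "j' < k'" "k' < length is" "word_root is k = word_root is k'" "word_root is j = word_root is j'"
      "adj (is ! j') (is ! k')" "\<forall>i. j' < i \<and> i < k' \<longrightarrow> is ! i \<notin> {is ! j', is ! k'}"
      unfolding word_arrow_def k(4) j(4) by (elim exE conjE)
    have "k' = k" "j' = j" using jk inj k(1) j(1) by auto
    then show "j < k \<and> adj (is ! j) (is ! k) \<and> (\<forall>j'. j < j' \<and> j' < k \<longrightarrow> is ! j' \<notin> {is ! j, is ! k})"
      using jk by blast
  next
    assume "j < k \<and> adj (is ! j) (is ! k) \<and> (\<forall>j'. j < j' \<and> j' < k \<longrightarrow> is ! j' \<notin> {is ! j, is ! k})"
    then show "word_arrow is (root_at \<iota> p) (root_at \<kappa> s)"
      unfolding word_arrow_def k(4) j(4) using k(1) by blast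
  qed
  also have "\<dots> \<longleftrightarrow> adj \<kappa> \<iota> \<and> s = p + dmin \<iota> \<kappa>"
    using arrow_iff_consecutive[OF state_height Q_word(3) j(1) k(1)] unfolding k(2,3) j(2,3) by blast
  also have "\<dots> \<longleftrightarrow> rep_arrow (\<iota>, p) (\<kappa>, s)"
    using assms adj_sym[of \<kappa> \<iota>] by (auto simp: rep_arrow_iff AR_vertices_eq region_iff)
  finally show ?thesis .
qed

end

subsection \<open>The isomorphism of quivers\<close>

lemma Q_class_some: "(SOME is. is \<in> Q_class) \<in> Q_class"
  by (rule someI_ex[OF Q_class_nonempty])

lemma root_at_bij: "bij_betw (\<lambda>(\<iota>, p). root_at \<iota> p) AR_vertices pos_roots"
  by (rule root_at_bij_word[OF Q_class_some])

lemma Upsilon_res_root_at: "(\<iota>, p) \<in> AR_vertices \<Longrightarrow> Upsilon_res (root_at \<iota> p) = \<iota>"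
  unfolding Upsilon_res_def by (rule word_res_root_at[OF Q_class_some])

lemma Upsilon_arrow_root_at:
  "(\<iota>, p) \<in> AR_vertices \<Longrightarrow> (\<kappa>, s) \<in> AR_vertices \<Longrightarrow>
    Upsilon_arrow (root_at \<iota> p) (root_at \<kappa> s) \<longleftrightarrow> rep_arrow (\<iota>, p) (\<kappa>, s)"
  unfolding Upsilon_arrow_def by (rule word_arrow_root_at[OF Q_class_some])

lemma finite_AR: "finite AR_vertices"
  unfolding AR_vertices_eq by (rule finite_region)

text \<open>Without neighbours the mesh relation makes the weights of the row alternate in sign, so
  consecutive roots are opposite and cannot both be positive.\<close>

lemma isolated_row:
  assumes "\<And>\<kappa>. \<not> adj \<iota> \<kappa>" "(\<iota>, p) \<in> AR_vertices" "(\<iota>, p') \<in> AR_vertices"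
  shows "\<not> p' < p"
proof
  assume less: "p' < p"
  have row: "in_row \<iota> p" "in_row \<iota> p'" using assms(2,3) by (simp_all add: AR_vertices_eq region_iff)
  have le: "p' + 2 * d \<iota> \<le> p" by (rule in_row_ge[OF row less])
  then have mem: "(\<iota>, p - 2 * d \<iota>) \<in> AR_vertices"
    using assms(2,3) row d_pos[of \<iota>] by (simp add: AR_vertices_eq region_iff)
  have row2: "in_row \<iota> (p - 2 * d \<iota>)" using row by simp
  have "lam \<iota> p \<mu> + lam \<iota> (p - 2 * d \<iota>) \<mu> = 0" for \<mu> using mesh[OF row(1), of \<mu>] assms(1) by simp
  moreover have "lam \<iota> (p - 2 * d \<iota>) \<mu> + lam \<iota> (p - 2 * d \<iota> - 2 * d \<iota>) \<mu> = 0" for \<mu> using mesh[OF row2, of \<mu>] assms(1) by simp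
  ultimately have "beta \<iota> (p - 2 * d \<iota>) = - beta \<iota> p"
    unfolding beta_def fun_eq_iff uminus_apply by smt
  then have "place \<xi> (root_at \<iota> (p - 2 * d \<iota>)) = place \<xi> (- root_at \<iota> p)"
    by (simp only: place_uminus place_root_at)
  then have "root_at \<iota> (p - 2 * d \<iota>) = - root_at \<iota> p" by (rule place_inj[OF state_height])
  moreover have "root_at \<iota> p \<in> pos_roots" "root_at \<iota> (p - 2 * d \<iota>) \<in> pos_roots"
    using root_at_bij assms(2) mem unfolding bij_betw_def by auto
  ultimately show False using pos_not_neg[of "root_at \<iota> p"] by (simp add: uminus_pos_roots)
qed

text \<open>Look at the highest vertex moved by an automorphism of \<open>\<Gamma>\<^sub>Q\<close> over \<open>\<Delta>\<^sub>0\<close>: its image lies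
  strictly below it, and an arrow out of the image comes from an arrow to a fixed vertex.\<close>

lemma AR_automorphism:
  assumes g: "bij_betw g AR_vertices AR_vertices"
    and res: "\<And>x. x \<in> AR_vertices \<Longrightarrow> fst (g x) = fst x"
    and arr: "\<And>x y. x \<in> AR_vertices \<Longrightarrow> y \<in> AR_vertices \<Longrightarrow> rep_arrow (g x) (g y) \<Longrightarrow> rep_arrow x y"
    and x: "x \<in> AR_vertices"
  shows "g x = x"
proof (rule ccontr)
  assume ne: "g x \<noteq> x"
  define M where "M = {y \<in> AR_vertices. g y \<noteq> y}"
  have M: "finite M" "M \<noteq> {}" using finite_AR x ne unfolding M_def by (simp, blast)
  have "Max (snd ` M) \<in> snd ` M" using M by (intro Max_in) auto
  then obtain y where y: "y \<in> M" "snd y = Max (snd ` M)" by auto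
  have fixed: "g z = z" if "z \<in> AR_vertices" "snd y < snd z" for z
  proof (rule ccontr)
    assume "g z \<noteq> z"
    then have "z \<in> M" using that by (simp add: M_def)
    then have "snd z \<le> snd y" using y(2) M(1) by simp
    then show False using that by simp
  qed
  obtain \<iota> p where yp: "y = (\<iota>, p)" by (cases y)
  have yA: "(\<iota>, p) \<in> AR_vertices" "g (\<iota>, p) \<noteq> (\<iota>, p)" using y(1) by (auto simp: M_def yp)
  obtain p' where p': "g (\<iota>, p) = (\<iota>, p')" using res[OF yA(1)] by (metis fst_conv prod.collapse)
  have gA: "(\<iota>, p') \<in> AR_vertices" using g yA(1) p' unfolding bij_betw_def by (metis image_eqI)
  have "p' < p"
  proof (rule ccontr)
    assume "\<not> p' < p"
    then have "p < p'" using yA(2) p' by auto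
    then have "g (\<iota>, p') = (\<iota>, p')" using fixed[OF gA] yp by simp
    then have "g (\<iota>, p') = g (\<iota>, p)" using p' by simp
    then have "(\<iota>, p') = (\<iota>, p)" using g gA yA(1) unfolding bij_betw_def inj_on_def by blast
    then show False using \<open>p < p'\<close> by simp
  qed
  then have "\<exists>\<kappa>. adj \<iota> \<kappa>" using isolated_row[OF _ yA(1) gA] by blast
  then obtain \<kappa> where "adj \<iota> \<kappa>" by blast
  moreover have "p' < \<xi> \<iota>" using \<open>p' < p\<close> yA(1) by (simp add: AR_vertices_eq region_iff)
  ultimately obtain z where z: "z \<in> AR_vertices" "rep_arrow (\<iota>, p') z"
    using region_out_arrow[OF state_height state_turned[OF state_height]] gA unfolding AR_vertices_eq by blast
  obtain z' where z': "z' \<in> AR_vertices" "z = g z'" using g z(1) unfolding bij_betw_def by (metis imageE)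
  have "rep_arrow (\<iota>, p) z'" using arr[OF yA(1) z'(1)] z z' p' by simp
  moreover have "fst z' = fst z" using res[OF z'(1)] z' by simp
  ultimately have s: "snd z' - p = snd z - p'" and gt: "p < snd z'"
    using z(2) d_pos[of \<iota>] d_pos[of "fst z"] by (auto simp: rep_arrow_def)
  have "z = z'" using fixed[OF z'(1)] gt z' yp by simp
  then show False using s \<open>p' < p\<close> by simp
qed

text \<open>Two isomorphisms compatible with residues differ by an automorphism of the twisted AR
  quiver over the diagram, which \<open>AR_automorphism\<close> shows to be the identity; so the
  definite description is justified.\<close>

lemma phi0_eq:
  assumes "(\<iota>, p) \<in> AR_vertices"
  shows "phi0 (\<iota>, p) = root_at \<iota> p"
proof -
  let ?R = "\<lambda>(\<iota>, p). root_at \<iota> p"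
  define P where "P = (\<lambda>f. f \<in> extensional AR_vertices \<and> bij_betw f AR_vertices pos_roots \<and>
     (\<forall>x\<in>AR_vertices. \<forall>y\<in>AR_vertices. rep_arrow x y \<longleftrightarrow> Upsilon_arrow (f x) (f y)) \<and>
     (\<forall>x\<in>AR_vertices. Upsilon_res (f x) = fst x))"
  define f0 where "f0 = restrict ?R AR_vertices"
  have f0: "P f0"
  proof -
    have "bij_betw f0 AR_vertices pos_roots"
      using root_at_bij by (subst bij_betw_cong[where g = ?R]) (auto simp: f0_def)
    then show ?thesis unfolding P_def
      by (auto simp: f0_def Upsilon_res_root_at Upsilon_arrow_root_at)
  qed
  have "f = f0" if f: "P f" for f
  proof (rule extensionalityI[of _ AR_vertices])
    show "f \<in> extensional AR_vertices" "f0 \<in> extensional AR_vertices" using f f0 by (auto simp: P_def)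
    fix x assume x: "x \<in> AR_vertices"
    have bf: "bij_betw f AR_vertices pos_roots" using f by (simp add: P_def)
    have bR: "bij_betw ?R AR_vertices pos_roots" by (rule root_at_bij)
    define g where "g = inv_into AR_vertices ?R \<circ> f"
    have bg: "bij_betw g AR_vertices AR_vertices"
      unfolding g_def by (rule bij_betw_trans[OF bf bij_betw_inv_into[OF bR]])
    have Rg: "?R (g y) = f y" if "y \<in> AR_vertices" for y
      unfolding g_def comp_def by (rule bij_betw_inv_into_right[OF bR bij_betwE[OF bf, rule_format, OF that]])
    have gA: "g y \<in> AR_vertices" if "y \<in> AR_vertices" for y
      by (rule bij_betwE[OF bg, rule_format, OF that])
    have "g x = x"
    proof (rule AR_automorphism[OF bg _ _ x])
      fix y assume y: "y \<in> AR_vertices"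
      have "Upsilon_res (?R (g y)) = fst (g y)" using gA[OF y] Upsilon_res_root_at by (cases "g y") simp
      then show "fst (g y) = fst y" using f y by (simp add: Rg[OF y] P_def)
    next
      fix y z assume yz: "y \<in> AR_vertices" "z \<in> AR_vertices" "rep_arrow (g y) (g z)"
      have "Upsilon_arrow (?R (g y)) (?R (g z))"
        using gA[OF yz(1)] gA[OF yz(2)] yz(3) Upsilon_arrow_root_at by (cases "g y"; cases "g z") simp
      then show "rep_arrow y z" using f yz(1,2) by (simp only: Rg[OF yz(1)] Rg[OF yz(2)] P_def)
    qed
    then show "f x = f0 x" using Rg[OF x] x by (simp add: f0_def)
  qed
  with f0 have "(THE f. P f) = f0" by (rule the_equality)
  then have "phi0 = f0" by (simp add: phi0_def P_def)
  then show ?thesis using assms by (simp add: f0_def)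
qed

subsection \<open>Translates of \<open>\<Gamma>\<^sub>Q\<close>\<close>

text \<open>The sheet \<open>n\<close> is the preimage of \<open>R\<^sup>+ \<times> {- n}\<close> under \<open>\<phi>\<^sub>Q\<close>.\<close>

definition sheet_top :: "int \<Rightarrow> 'v \<Rightarrow> int" where
  "sheet_top n \<iota> = (if even n then \<xi> \<iota> else \<xi> (star \<iota>)) - n * turn"

definition sheet :: "int \<Rightarrow> ('v \<times> int) set" where
  "sheet n = {(\<iota>, p). in_row \<iota> p \<and> sheet_top (n + 1) \<iota> < p \<and> p \<le> sheet_top n \<iota>}"

text \<open>A half turn changes the sign of \<open>root_at\<close>; the alternating sign undoes this
  and keeps the values positive.\<close>

definition sheet_root :: "int \<Rightarrow> 'v \<times> int \<Rightarrow> 'v \<Rightarrow> int" where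
  "sheet_root n = (\<lambda>(\<iota>, p). if even n then root_at \<iota> p else - root_at \<iota> p)"

lemma sheet_top_Suc: "sheet_top (n + 1) \<iota> = sheet_top n (star \<iota>) - turn"
  by (simp add: sheet_top_def algebra_simps)

lemma sheet_top_less: "sheet_top (n + 1) \<iota> < sheet_top n \<iota>"
  using turned_less[OF state_height, of \<iota>] turned_less[OF state_height, of "star \<iota>"]
  by (simp add: sheet_top_def turned_def algebra_simps)

lemma sheet_0: "sheet 0 = AR_vertices"
  by (auto simp: sheet_def AR_vertices_eq region_def sheet_top_def turned_def)

lemma sheet_Suc: "(star \<iota>, p - turn) \<in> sheet (n + 1) \<longleftrightarrow> (\<iota>, p) \<in> sheet n"
  using sheet_top_Suc[of n "star \<iota>"] sheet_top_Suc[of "n + 1" "star \<iota>"]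
  by (auto simp: sheet_def in_row_turn)

text \<open>The half turn maps each sheet onto the next one compatibly with
  \<open>sheet_root\<close>, so induction in both directions reduces everything to the sheet 0, the
  twisted AR quiver.\<close>

lemma sheet_root_bij: "bij_betw (sheet_root n) (sheet n) pos_roots"
proof -
  define h where "h = (\<lambda>(\<iota>, p). (star \<iota>, p - turn))"
  have step: "bij_betw (sheet_root (m + 1)) (sheet (m + 1)) pos_roots \<longleftrightarrow> bij_betw (sheet_root m) (sheet m) pos_roots" for m
  proof -
    have "bij_betw h (sheet m) (sheet (m + 1))"
    proof (rule bij_betw_byWitness[where f' = "\<lambda>(\<iota>, p). (star \<iota>, p + turn)"])
      show "h ` sheet m \<subseteq> sheet (m + 1)" by (auto simp: h_def sheet_Suc)
      show "(\<lambda>(\<iota>, p). (star \<iota>, p + turn)) ` sheet (m + 1) \<subseteq> sheet m"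
      proof clarify
        fix \<iota> p assume "(\<iota>, p) \<in> sheet (m + 1)"
        then show "(star \<iota>, p + turn) \<in> sheet m" using sheet_Suc[of "star \<iota>" "p + turn" m] by simp
      qed
    qed (auto simp: h_def)
    then have "bij_betw (sheet_root (m + 1)) (sheet (m + 1)) pos_roots \<longleftrightarrow>
        bij_betw (sheet_root (m + 1) \<circ> h) (sheet m) pos_roots"
      by (rule bij_betw_comp_iff)
    also have "sheet_root (m + 1) \<circ> h = sheet_root m"
      by (auto simp: fun_eq_iff sheet_root_def h_def root_at_turn)
    finally show ?thesis .
  qed
  show ?thesis
  proof (induction n rule: int_induct[where k = 0])
    case base
    have "sheet_root 0 = (\<lambda>(\<iota>, p). root_at \<iota> p)" by (simp add: sheet_root_def)
    then show ?case using root_at_bij by (simp add: sheet_0)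
  next
    case (step1 i)
    then show ?case by (simp add: step)
  next
    case (step2 i)
    then show ?case using step[of "i - 1"] by simp
  qed
qed

lemma sheet_root_pos: "x \<in> sheet n \<Longrightarrow> sheet_root n x \<in> pos_roots"
  using bij_betwE[OF sheet_root_bij] by blast

lemma in_row_sheet_top: "in_row \<iota> (sheet_top n \<iota>)"
proof -
  have step: "in_row \<iota> (sheet_top (m + 1) \<iota>) \<longleftrightarrow> in_row (star \<iota>) (sheet_top m (star \<iota>))" for m \<iota>
    unfolding sheet_top_Suc using in_row_turn[of "star \<iota>"] by simp
  have "\<forall>\<iota>. in_row \<iota> (sheet_top n \<iota>)"
  proof (induction n rule: int_induct[where k = 0])
    case base
    then show ?case by (simp add: sheet_top_def in_row_height)
  next
    case (step1 i)
    then show ?case by (simp add: step)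
  next
    case (step2 i)
    show ?case
    proof
      fix \<iota>
      have "in_row (star \<iota>) (sheet_top ((i - 1) + 1) (star \<iota>))" using step2 by simp
      then show "in_row \<iota> (sheet_top (i - 1) \<iota>)" unfolding step by simp
    qed
  qed
  then show ?thesis by blast
qed

lemma sheet_up:
  assumes "(\<iota>, p) \<in> sheet n"
  shows "(\<iota>, p + 2 * d \<iota>) \<in> sheet n \<or> (\<iota>, p + 2 * d \<iota>) \<in> sheet (n - 1)"
proof -
  have p: "in_row \<iota> p" "sheet_top (n + 1) \<iota> < p" "p \<le> sheet_top n \<iota>" using assms by (auto simp: sheet_def)
  have "p < sheet_top (n - 1) \<iota>" using p(3) sheet_top_less[of "n - 1" \<iota>] by simp
  then have "p + 2 * d \<iota> \<le> sheet_top (n - 1) \<iota>" by (rule in_row_ge[OF in_row_sheet_top p(1)])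
  then show ?thesis using p d_pos[of \<iota>] by (auto simp: sheet_def)
qed

lemma sheet_down:
  assumes "(\<iota>, p) \<in> sheet n"
  shows "(\<iota>, p - 2 * d \<iota>) \<in> sheet n \<or> (\<iota>, p - 2 * d \<iota>) \<in> sheet (n + 1)"
proof -
  have p: "in_row \<iota> p" "sheet_top (n + 1) \<iota> < p" "p \<le> sheet_top n \<iota>" using assms by (auto simp: sheet_def)
  have "sheet_top (n + 1 + 1) \<iota> < sheet_top (n + 1) \<iota>" by (rule sheet_top_less)
  moreover have "sheet_top (n + 1) \<iota> + 2 * d \<iota> \<le> p" by (rule in_row_ge[OF p(1) in_row_sheet_top p(2)])
  ultimately show ?thesis using p d_pos[of \<iota>] by (auto simp: sheet_def)
qed

lemma sheet_top_mono: "m \<le> n \<Longrightarrow> sheet_top n \<iota> \<le> sheet_top m \<iota>"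
proof (induction n rule: int_ge_induct)
  case (step i)
  then show ?case using sheet_top_less[of i \<iota>] by simp
qed simp

lemma sheet_unique:
  assumes "x \<in> sheet m" "x \<in> sheet n"
  shows "m = n"
proof -
  obtain \<iota> p where x: "x = (\<iota>, p)" by (cases x)
  have "\<not> a < b" if "x \<in> sheet a" "x \<in> sheet b" for a b
  proof
    assume "a < b"
    then have "sheet_top b \<iota> \<le> sheet_top (a + 1) \<iota>" by (intro sheet_top_mono) simp
    then show False using that by (auto simp: x sheet_def)
  qed
  then show ?thesis using assms by (meson linorder_cases)
qed

subsection \<open>The map \<open>\<phi>\<close>\<close>

lemma fun_powi_tau_sheet_root:
  "fun_powi tau (d \<iota>) (sheet_root n (\<iota>, p)) = sheet_root n (\<iota>, p - 2 * d \<iota>)"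
  "fun_powi tau (- d \<iota>) (sheet_root n (\<iota>, p)) = sheet_root n (\<iota>, p + 2 * d \<iota>)"
proof -
  have neg: "- root_at \<iota> q = root_at (star \<iota>) (q - turn)" for q by (simp add: root_at_turn)
  have "fun_powi tau (d \<iota> * j) (sheet_root n (\<iota>, p)) = sheet_root n (\<iota>, p - 2 * d \<iota> * j)" for j
    using fun_powi_tau_root_at[of \<iota> j p] fun_powi_tau_root_at[of "star \<iota>" j "p - turn"]
    by (simp add: sheet_root_def neg algebra_simps)
  from this[of 1] this[of "- 1"]
  show "fun_powi tau (d \<iota>) (sheet_root n (\<iota>, p)) = sheet_root n (\<iota>, p - 2 * d \<iota>)"
    "fun_powi tau (- d \<iota>) (sheet_root n (\<iota>, p)) = sheet_root n (\<iota>, p + 2 * d \<iota>)" by simp_all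
qed

lemma sheet_root_odd:
  "sheet_root (n + 1) x = - sheet_root n x" "sheet_root (n - 1) x = - sheet_root n x"
  by (cases x; simp add: sheet_root_def)+

text \<open>The invariant of the recursion. The next vertex of a row lies in the same sheet or in an
  adjacent one, and the sign of the transported root tells which, in step with the change of
  \<open>k\<close>.\<close>

lemma phi_graph_sheet:
  "phi_graph (\<iota>, p) (b, k) \<Longrightarrow> (\<iota>, p) \<in> sheet (- k) \<and> b = sheet_root (- k) (\<iota>, p)"
proof (induction "(\<iota>, p)" "(b, k)" arbitrary: \<iota> p b k rule: phi_graph.induct)
  case (base \<iota>)
  have "(\<iota>, \<xi> \<iota>) \<in> sheet 0"
    using turned_less[OF state_height, of \<iota>] by (simp add: sheet_0 AR_vertices_eq region_iff in_row_height)
  then show ?case by (simp add: gamma_eq sheet_root_def)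
next
  case (up_pos \<iota> p b k)
  then have IH: "(\<iota>, p) \<in> sheet (- k)" "b = sheet_root (- k) (\<iota>, p)" by auto
  have b: "fun_powi tau (- d \<iota>) b = sheet_root (- k) (\<iota>, p + 2 * d \<iota>)"
    unfolding IH(2) by (rule fun_powi_tau_sheet_root)
  have "(\<iota>, p + 2 * d \<iota>) \<notin> sheet (- k - 1)"
  proof
    assume "(\<iota>, p + 2 * d \<iota>) \<in> sheet (- k - 1)"
    then have "- sheet_root (- k) (\<iota>, p + 2 * d \<iota>) \<in> pos_roots"
      using sheet_root_pos by (metis sheet_root_odd(2))
    then show False using up_pos.hyps(3) pos_not_neg unfolding b by (simp add: uminus_pos_roots)
  qed
  then show ?case using sheet_up[OF IH(1)] b by blast
next
  case (up_neg \<iota> p b k)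
  then have IH: "(\<iota>, p) \<in> sheet (- k)" "b = sheet_root (- k) (\<iota>, p)" by auto
  have b: "fun_powi tau (- d \<iota>) b = sheet_root (- k) (\<iota>, p + 2 * d \<iota>)"
    unfolding IH(2) by (rule fun_powi_tau_sheet_root)
  have "(\<iota>, p + 2 * d \<iota>) \<notin> sheet (- k)"
    using up_neg.hyps(3) sheet_root_pos pos_not_neg unfolding b by blast
  then have "(\<iota>, p + 2 * d \<iota>) \<in> sheet (- k - 1)" using sheet_up[OF IH(1)] by blast
  moreover have "- (k + 1) = - k - 1" by simp
  ultimately show ?case unfolding b using sheet_root_odd(2) by metis
next
  case (down_pos \<iota> p b k)
  then have IH: "(\<iota>, p) \<in> sheet (- k)" "b = sheet_root (- k) (\<iota>, p)" by auto
  have b: "fun_powi tau (d \<iota>) b = sheet_root (- k) (\<iota>, p - 2 * d \<iota>)"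
    unfolding IH(2) by (rule fun_powi_tau_sheet_root)
  have "(\<iota>, p - 2 * d \<iota>) \<notin> sheet (- k + 1)"
  proof
    assume "(\<iota>, p - 2 * d \<iota>) \<in> sheet (- k + 1)"
    then have "- sheet_root (- k) (\<iota>, p - 2 * d \<iota>) \<in> pos_roots"
      using sheet_root_pos by (metis sheet_root_odd(1))
    then show False using down_pos.hyps(3) pos_not_neg unfolding b by (simp add: uminus_pos_roots)
  qed
  then show ?case using sheet_down[OF IH(1)] b by blast
next
  case (down_neg \<iota> p b k)
  then have IH: "(\<iota>, p) \<in> sheet (- k)" "b = sheet_root (- k) (\<iota>, p)" by auto
  have b: "fun_powi tau (d \<iota>) b = sheet_root (- k) (\<iota>, p - 2 * d \<iota>)"
    unfolding IH(2) by (rule fun_powi_tau_sheet_root)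
  have "(\<iota>, p - 2 * d \<iota>) \<notin> sheet (- k)"
    using down_neg.hyps(3) sheet_root_pos pos_not_neg unfolding b by blast
  then have "(\<iota>, p - 2 * d \<iota>) \<in> sheet (- k + 1)" using sheet_down[OF IH(1)] by blast
  moreover have "- (k - 1) = - k + 1" by simp
  ultimately show ?case unfolding b using sheet_root_odd(1) by metis
qed

lemma phi_graph_total:
  assumes "in_row \<iota> p"
  shows "\<exists>y. phi_graph (\<iota>, p) y"
proof -
  have "2 * d \<iota> dvd \<xi> \<iota> - p" using in_row_dvd[OF in_row_height[of \<iota>]] assms by simp
  then obtain m where m: "\<xi> \<iota> - p = 2 * d \<iota> * m" by (rule dvdE)
  have "\<exists>b k. phi_graph (\<iota>, \<xi> \<iota> - 2 * d \<iota> * m) (b, k)"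
  proof (induction m rule: int_induct[where k = 0])
    case base
    then show ?case using phi_graph.base[of \<iota>] by auto
  next
    case (step1 i)
    then obtain b k where bk: "phi_graph (\<iota>, \<xi> \<iota> - 2 * d \<iota> * i) (b, k)" by blast
    let ?q = "\<xi> \<iota> - 2 * d \<iota> * i"
    have s: "(\<iota>, ?q) \<in> sheet (- k)" "b = sheet_root (- k) (\<iota>, ?q)" using phi_graph_sheet[OF bk] by auto
    have e: "\<xi> \<iota> - 2 * d \<iota> * (i + 1) = ?q - 2 * d \<iota>" by (simp add: algebra_simps)
    have "fun_powi tau (d \<iota>) b \<in> pos_roots \<or> fun_powi tau (d \<iota>) b \<in> neg_roots"
      unfolding s(2) fun_powi_tau_sheet_root using sheet_down[OF s(1)] sheet_root_pos
      by (metis sheet_root_odd(1) uminus_pos_roots)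
    then show ?case unfolding e using phi_graph.down_pos[OF bk] phi_graph.down_neg[OF bk] by blast
  next
    case (step2 i)
    then obtain b k where bk: "phi_graph (\<iota>, \<xi> \<iota> - 2 * d \<iota> * i) (b, k)" by blast
    let ?q = "\<xi> \<iota> - 2 * d \<iota> * i"
    have s: "(\<iota>, ?q) \<in> sheet (- k)" "b = sheet_root (- k) (\<iota>, ?q)" using phi_graph_sheet[OF bk] by auto
    have e: "\<xi> \<iota> - 2 * d \<iota> * (i - 1) = ?q + 2 * d \<iota>" by (simp add: algebra_simps)
    have "fun_powi tau (- d \<iota>) b \<in> pos_roots \<or> fun_powi tau (- d \<iota>) b \<in> neg_roots"
      unfolding s(2) fun_powi_tau_sheet_root using sheet_up[OF s(1)] sheet_root_pos
      by (metis sheet_root_odd(2) uminus_pos_roots)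
    then show ?case unfolding e using phi_graph.up_pos[OF bk] phi_graph.up_neg[OF bk] by blast
  qed
  moreover have "\<xi> \<iota> - 2 * d \<iota> * m = p" using m by simp
  ultimately show ?thesis by auto
qed

text \<open>Sheets are disjoint, so the sheet of a vertex determines \<open>k\<close> and then the
  root; the graph is therefore single-valued.\<close>

lemma phi_sheet:
  assumes "x \<in> rep_vertices"
  shows "\<exists>n. x \<in> sheet n \<and> phi x = (sheet_root n x, - n)"
proof -
  obtain \<iota> p where x: "x = (\<iota>, p)" by (cases x)
  then have "in_row \<iota> p" using assms by (simp add: rep_vertices_iff)
  then obtain b k where bk: "phi_graph (\<iota>, p) (b, k)" using phi_graph_total by (metis prod.exhaust)
  have s: "(\<iota>, p) \<in> sheet (- k)" "b = sheet_root (- k) (\<iota>, p)" using phi_graph_sheet[OF bk] by auto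
  have "phi (\<iota>, p) = (b, k)" unfolding phi_def
  proof (rule the_equality)
    show "phi_graph (\<iota>, p) (b, k)" by (rule bk)
  next
    fix y assume y: "phi_graph (\<iota>, p) y"
    obtain b' k' where yy: "y = (b', k')" by (cases y)
    have "(\<iota>, p) \<in> sheet (- k')" "b' = sheet_root (- k') (\<iota>, p)" using phi_graph_sheet y yy by auto
    moreover from this(1) s(1) have "- k' = - k" by (rule sheet_unique)
    ultimately show "y = (b, k)" using s(2) yy by simp
  qed
  then show ?thesis using s x by (intro exI[of _ "- k"]) simp
qed

lemma sheet_subset: "x \<in> sheet n \<Longrightarrow> x \<in> rep_vertices"
  by (cases x) (auto simp: sheet_def rep_vertices_iff)

lemma phi_on_sheet:
  assumes "x \<in> sheet n"
  shows "phi x = (sheet_root n x, - n)"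
  using phi_sheet[OF sheet_subset[OF assms]] sheet_unique[OF assms] by blast

lemma phi_bij: "bij_betw phi rep_vertices (pos_roots \<times> UNIV)"
proof (rule bij_betw_imageI)
  show "inj_on phi rep_vertices"
  proof (rule inj_onI)
    fix x y assume "x \<in> rep_vertices" "y \<in> rep_vertices" and e: "phi x = phi y"
    then obtain m n where mn: "x \<in> sheet m" "y \<in> sheet n" "phi x = (sheet_root m x, - m)" "phi y = (sheet_root n y, - n)"
      using phi_sheet by metis
    then have "m = n" "sheet_root n x = sheet_root n y" using e by auto
    then show "x = y" using mn(1,2) sheet_root_bij[of n] by (auto simp: bij_betw_def dest: inj_onD)
  qed
  show "phi ` rep_vertices = pos_roots \<times> UNIV"
  proof
    show "phi ` rep_vertices \<subseteq> pos_roots \<times> UNIV"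
    proof
      fix y assume "y \<in> phi ` rep_vertices"
      then obtain x n where "x \<in> sheet n" "y = (sheet_root n x, - n)" using phi_sheet by (metis imageE)
      then show "y \<in> pos_roots \<times> UNIV" using sheet_root_pos by simp
    qed
    show "pos_roots \<times> UNIV \<subseteq> phi ` rep_vertices"
    proof clarify
      fix b and k :: int assume b: "b \<in> pos_roots"
      then obtain x where x: "x \<in> sheet (- k)" "b = sheet_root (- k) x"
        using sheet_root_bij[of "- k"] unfolding bij_betw_def by (metis imageE)
      then have "(b, k) = phi x" using phi_on_sheet[OF x(1)] by simp
      then show "(b, k) \<in> phi ` rep_vertices" using sheet_subset[OF x(1)] by (rule image_eqI)
    qed
  qed
qed

lemma phi_zero: "{x \<in> rep_vertices. phi x \<in> pos_roots \<times> {0}} = AR_vertices"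
proof
  show "{x \<in> rep_vertices. phi x \<in> pos_roots \<times> {0}} \<subseteq> AR_vertices"
  proof
    fix x assume x: "x \<in> {x \<in> rep_vertices. phi x \<in> pos_roots \<times> {0}}"
    then obtain n where n: "x \<in> sheet n" "phi x = (sheet_root n x, - n)" using phi_sheet by blast
    then have "n = 0" using x by simp
    then show "x \<in> AR_vertices" using n(1) sheet_0 by simp
  qed
  show "AR_vertices \<subseteq> {x \<in> rep_vertices. phi x \<in> pos_roots \<times> {0}}"
  proof
    fix x assume "x \<in> AR_vertices"
    then have x: "x \<in> sheet 0" by (simp add: sheet_0)
    then show "x \<in> {x \<in> rep_vertices. phi x \<in> pos_roots \<times> {0}}"
      using phi_on_sheet[OF x] sheet_subset[OF x] sheet_root_pos[OF x] by simp
  qed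
qed

lemma phi_AR:
  assumes "(\<iota>, p) \<in> AR_vertices"
  shows "phi (\<iota>, p) = (phi0 (\<iota>, p), 0)" "phi0 (\<iota>, p) = fun_powi tau ((\<xi> \<iota> - p) div 2) (gamma \<iota>)"
proof -
  have "(\<iota>, p) \<in> sheet 0" using assms by (simp add: sheet_0)
  then show "phi (\<iota>, p) = (phi0 (\<iota>, p), 0)"
    using phi_on_sheet by (simp add: phi0_eq[OF assms] sheet_root_def)
  have "in_row \<iota> p" using assms by (simp add: AR_vertices_eq region_iff)
  then show "phi0 (\<iota>, p) = fun_powi tau ((\<xi> \<iota> - p) div 2) (gamma \<iota>)"
    by (simp add: phi0_eq[OF assms] root_at_gamma)
qed

end

theorem theorem2p35:
  fixes adj :: "'v::finite \<Rightarrow> 'v \<Rightarrow> bool"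
    and \<sigma> :: "'v \<Rightarrow> 'v"
    and \<epsilon> \<xi> :: "'v \<Rightarrow> int"
  assumes "Q_datum adj \<sigma> \<epsilon> \<xi>"
  shows
    "bij_betw (Q_datum.phi adj \<sigma> \<epsilon> \<xi>) (Q_datum.rep_vertices \<sigma> \<epsilon>)
       (ADE_diagram.pos_roots adj \<times> (UNIV :: int set))
   \<and> {x \<in> Q_datum.rep_vertices \<sigma> \<epsilon>. Q_datum.phi adj \<sigma> \<epsilon> \<xi> x \<in> ADE_diagram.pos_roots adj \<times> {0}}
       = Q_datum.AR_vertices adj \<sigma> \<xi>
   \<and> (\<forall>\<iota> p. (\<iota>, p) \<in> Q_datum.AR_vertices adj \<sigma> \<xi> \<longrightarrow>
        Q_datum.phi adj \<sigma> \<epsilon> \<xi> (\<iota>, p) = (Q_datum.phi0 adj \<sigma> \<epsilon> \<xi> (\<iota>, p), 0)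
      \<and> Q_datum.phi0 adj \<sigma> \<epsilon> \<xi> (\<iota>, p)
          = fun_powi (Q_datum.tau adj \<sigma> \<epsilon> \<xi>) ((\<xi> \<iota> - p) div 2) (Q_datum.gamma adj \<sigma> \<epsilon> \<xi> \<iota>))"
proof -
  interpret Q_datum adj \<sigma> \<epsilon> \<xi> by (rule assms)
  show ?thesis using phi_bij phi_zero phi_AR by blast
qed

end
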